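(* If $(\mathbb{D},\boxtimes)$ is a closed monoidal derivator, then so is $(\mathbb{A}^1_{\mathbb{D}},\boxtimes_{\mathbb{A}^1_{\mathbb{D}}})$.
   Context: Derivators. A prederivator is a strict 2-functor $\mathbb{D}\colon\mathrm{Cat}^{op}\to\mathrm{CAT}$ from small categories to categories (reversing functors, preserving the direction of natural transformations); for a functor $u$ write $u^*=\mathbb{D}(u)$. Let $e$ be the terminal category. A derivator is a prederivator with: (Der1) $\mathbb{D}$ takes finite coproducts to products; (Der2) a morphism $f$ of $\mathbb{D}(A)$ is an isomorphism iff $a^*f$ is an isomorphism in $\mathbb{D}(e)$ for all objects $a\colon e\to A$; (Der3) every $u^*$ has a left adjoint $u_!$ and a right adjoint $u_*$; (Der4) for $u\colon A\to B$ and $b\in B$ the canonical maps $\pi_!\,\mathrm{pr}^*\to b^*u_!$ (over the slice category $(u/b)$) and $b^*u_*\to\pi_*\,\mathrm{pr}^*$ (over $(b/u)$) are isomorphisms, where $\mathrm{pr}$ is the forgetful functor to $A$ and $\pi$ the projection to $e$. For a small category $L$, $\mathbb{D}^L(I)=\mathbb{D}(L\times I)$ is a derivator. Monoidal derivators. A monoidal prederivator is a pseudomonoid in prederivators: each $\mathbb{D}(A)$ is monoidal with product $\otimes_A$, compatibly with the $u^*$, which are strong monoidal. The external product of $X\in\mathbb{D}(A)$, $Y\in\mathbb{D}(B)$ is $X\boxtimes Y=\pi_B^*X\otimes_{A\times B}\pi_A^*Y\in\mathbb{D}(A\times B)$, with $\pi_B\colon A\times B\to A$, $\pi_A\colon A\times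 B\to B$ the projections; conversely $\otimes_A=\Delta_A^*\circ\boxtimes$ for the diagonal $\Delta_A\colon A\to A\times A$. A monoidal derivator is a derivator that is a monoidal prederivator whose product is cocontinuous in each variable: $(u\times1)_!(X\boxtimes Y)\cong u_!X\boxtimes Y$ and $(1\times v)_!(X\boxtimes Y)\cong X\boxtimes v_!Y$ canonically. $\mathbf{1}_{\mathbb{D}}\in\mathbb{D}(e)$ is the unit. Closedness. A monoidal derivator is closed if $\otimes\colon\mathbb{D}\times\mathbb{D}\to\mathbb{D}$ is a two-variable left adjoint, i.e.: for all small $A,B$ there are functors $\rhd_{[B]}\colon\mathbb{D}(B)^{op}\times\mathbb{D}(A\times B)\to\mathbb{D}(A)$ and $\lhd_{[A]}\colon\mathbb{D}(A\times B)\times\mathbb{D}(A)^{op}\to\mathbb{D}(B)$ with isomorphisms, natural in $X\in\mathbb{D}(A)$, $Y\in\mathbb{D}(B)$, $Z\in\mathbb{D}(A\times B)$, $$\mathbb{D}(A\times B)(X\boxtimes Y,Z)\cong\mathbb{D}(A)(X,Y\rhd_{[B]}Z)\cong\mathbb{D}(B)(Y,Z\lhd_{[A]}X),$$ and for all functors $u\colon A'\to A$, $v\colon B'\to B$ the canonical mates $u^*(Y\rhd_{[B]}Z)\to Y\rhd_{[B]}(u\times1)^*Z$ and $v^*(Z\lhd_{[A]}X)\to(1\times v)^*Z\lhd_{[A]}X$ are isomorphisms. Affine line. $\underline{\mathbb{N}}$ is the category with one object and endomorphism monoid $(\mathbb{N},+)$, $\mathbb N=\{0,1,2,\dots\}$;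 $i\colon e\to\underline{\mathbb{N}}$ is the unique functor; $+\colon\underline{\mathbb{N}}\times\underline{\mathbb{N}}\to\underline{\mathbb{N}}$ sends $(a,b)$ to $a+b$. $\mathbb{A}^1_{\mathbb{D}}:=\mathbb{D}^{\underline{\mathbb{N}}}$. For $\mathbb{D}$ monoidal, $\mathbb{A}^1_{\mathbb{D}}$ is the monoidal derivator with external product $X\boxtimes_{\mathbb{A}^1_{\mathbb{D}}}Y:=(+\times1_{I\times J})_!(X\boxtimes Y)\in\mathbb{D}(\underline{\mathbb{N}}\times I\times J)$ for $X\in\mathbb{D}(\underline{\mathbb{N}}\times I)$, $Y\in\mathbb{D}(\underline{\mathbb{N}}\times J)$ (after the evident reordering of factors), and unit $i_!\mathbf{1}_{\mathbb{D}}$. *)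

theory Defs
  imports "HOL-Library.Equipollence" "HOL-Library.FuncSet" "HOL-Library.Countable_Set"
begin

section \<open>Small sets\<close>

text \<open>
  A type of class \<open>universe\<close> plays the role of the class of all sets: a subset of it is small if
  its cardinality is less than that of the whole type.  The codings of pairs and of natural
  numbers make products, slices and finite coproducts of small categories, and the category
  \<open>\<nat>\<close>, available inside the type.  A Grothendieck universe \<open>U\<close> containing the set of natural
  numbers is an instance, since a subset \<open>S\<close> of \<open>U\<close> is an element of \<open>U\<close> iff \<open>|S| < |U|\<close>; but no
  inaccessible cardinal is needed, see \<open>universe_nat_set\<close> below.
\<close>

class universe =
  fixes upair :: "'a \<Rightarrow> 'a \<Rightarrow> 'a" and ufst :: "'a \<Rightarrow> 'a" and usnd :: "'a \<Rightarrow> 'a" and unat :: "nat \<Rightarrow> 'a"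
  assumes ufst_upair [simp]: "ufst (upair x y) = x"
    and usnd_upair [simp]: "usnd (upair x y) = y"
    and inj_unat: "inj unat"
    and uncountable_UNIV: "uncountable (UNIV :: 'a set)"

definition small :: "'u::universe set \<Rightarrow> bool" where
  "small S \<longleftrightarrow> S \<prec> (UNIV :: 'u set)"

lemma universe_nat_set:
  "class.universe (\<lambda>X Y :: nat set. (\<lambda>n. 2 * n) ` X \<union> (\<lambda>n. 2 * n + 1) ` Y)
     (\<lambda>Z. {n. 2 * n \<in> Z}) (\<lambda>Z. {n. 2 * n + 1 \<in> Z}) (\<lambda>n. {n})"
proof
  have *: "2 * (m::nat) \<noteq> Suc (2 * n)" for m n by presburger
  show "{n. 2 * n \<in> (\<lambda>n. 2 * n) ` X \<union> (\<lambda>n. 2 * n + 1) ` Y} = X" for X Y :: "nat set"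
    using * by auto
  show "{n. 2 * n + 1 \<in> (\<lambda>n. 2 * n) ` X \<union> (\<lambda>n. 2 * n + 1) ` Y} = Y" for X Y :: "nat set"
    using * by (auto simp: eq_commute)
  show "inj (\<lambda>n::nat. {n})" by (simp add: inj_def)
  show "uncountable (UNIV :: nat set set)"
  proof
    assume "countable (UNIV :: nat set set)"
    then obtain f :: "nat \<Rightarrow> nat set" where "range f = UNIV"
      using uncountable_def[of "UNIV :: nat set set"] by auto
    then show False using Cantors_theorem[of "UNIV :: nat set"] by auto
  qed
qed


section \<open>Categories, functors, natural transformations\<close>

text \<open>
  All operations are required to be undefined outside their domain, so that two categories,
  functors or transformations are equal as records iff they are equal in the mathematical sense.
  The constructors \<open>mk_cat\<close>, \<open>mk_fun\<close> and \<open>mk_nt\<close> take care of this.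
\<close>

record ('o, 'a) cat =
  Ob :: "'o set"
  Ar :: "'a set"
  Dom :: "'a \<Rightarrow> 'o"
  Cod :: "'a \<Rightarrow> 'o"
  Id :: "'o \<Rightarrow> 'a"
  Cmp :: "'a \<Rightarrow> 'a \<Rightarrow> 'a"

abbreviation cmp :: "'a \<Rightarrow> ('o, 'a) cat \<Rightarrow> 'a \<Rightarrow> 'a" ("(_ \<cdot>\<^bsub>_\<^esub>/ _)" [56, 0, 55] 55) where
  "g \<cdot>\<^bsub>C\<^esub> f \<equiv> Cmp C g f"

definition hom :: "('o, 'a) cat \<Rightarrow> 'o \<Rightarrow> 'o \<Rightarrow> 'a set" where
  "hom C x y = {f \<in> Ar C. Dom C f = x \<and> Cod C f = y}"

locale category =
  fixes C :: "('o, 'a) cat"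
  assumes Dom_in: "f \<in> Ar C \<Longrightarrow> Dom C f \<in> Ob C"
    and Cod_in: "f \<in> Ar C \<Longrightarrow> Cod C f \<in> Ob C"
    and Id_hom: "x \<in> Ob C \<Longrightarrow> Id C x \<in> hom C x x"
    and Cmp_hom: "\<lbrakk>f \<in> hom C x y; g \<in> hom C y z\<rbrakk> \<Longrightarrow> g \<cdot>\<^bsub>C\<^esub> f \<in> hom C x z"
    and Id_left: "f \<in> hom C x y \<Longrightarrow> Id C y \<cdot>\<^bsub>C\<^esub> f = f"
    and Id_right: "f \<in> hom C x y \<Longrightarrow> f \<cdot>\<^bsub>C\<^esub> Id C x = f"
    and Cmp_assoc: "\<lbrakk>f \<in> hom C w x; g \<in> hom C x y; h \<in> hom C y z\<rbrakk>
          \<Longrightarrow> h \<cdot>\<^bsub>C\<^esub> (g \<cdot>\<^bsub>C\<^esub> f) = (h \<cdot>\<^bsub>C\<^esub> g) \<cdot>\<^bsub>C\<^esub> f"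
    and Dom_ext: "Dom C \<in> extensional (Ar C)"
    and Cod_ext: "Cod C \<in> extensional (Ar C)"
    and Id_ext: "Id C \<in> extensional (Ob C)"
    and Cmp_ext: "\<not> (f \<in> Ar C \<and> g \<in> Ar C \<and> Dom C g = Cod C f) \<Longrightarrow> g \<cdot>\<^bsub>C\<^esub> f = undefined"

definition mk_cat :: "'o set \<Rightarrow> 'a set \<Rightarrow> ('a \<Rightarrow> 'o) \<Rightarrow> ('a \<Rightarrow> 'o) \<Rightarrow> ('o \<Rightarrow> 'a) \<Rightarrow> ('a \<Rightarrow> 'a \<Rightarrow> 'a)
    \<Rightarrow> ('o, 'a) cat" where
  "mk_cat X F d c i m = \<lparr>Ob = X, Ar = F, Dom = restrict d F, Cod = restrict c F, Id = restrict i X,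
     Cmp = (\<lambda>g f. if f \<in> F \<and> g \<in> F \<and> d g = c f then m g f else undefined)\<rparr>"

definition iso :: "('o, 'a) cat \<Rightarrow> 'a \<Rightarrow> bool" where
  "iso C f \<longleftrightarrow> f \<in> Ar C \<and> (\<exists>g \<in> hom C (Cod C f) (Dom C f).
     g \<cdot>\<^bsub>C\<^esub> f = Id C (Dom C f) \<and> f \<cdot>\<^bsub>C\<^esub> g = Id C (Cod C f))"

record ('o, 'a, 'p, 'b) ftor =
  Src :: "('o, 'a) cat"
  Tgt :: "('p, 'b) cat"
  FO :: "'o \<Rightarrow> 'p"
  FA :: "'a \<Rightarrow> 'b"

locale cfunctor =
  fixes F :: "('o, 'a, 'p, 'b) ftor"
  assumes Src_category: "category (Src F)"
    and Tgt_category: "category (Tgt F)"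
    and FO_in: "x \<in> Ob (Src F) \<Longrightarrow> FO F x \<in> Ob (Tgt F)"
    and FA_hom: "f \<in> hom (Src F) x y \<Longrightarrow> FA F f \<in> hom (Tgt F) (FO F x) (FO F y)"
    and FA_Id: "x \<in> Ob (Src F) \<Longrightarrow> FA F (Id (Src F) x) = Id (Tgt F) (FO F x)"
    and FA_Cmp: "\<lbrakk>f \<in> hom (Src F) x y; g \<in> hom (Src F) y z\<rbrakk>
          \<Longrightarrow> FA F (g \<cdot>\<^bsub>Src F\<^esub> f) = FA F g \<cdot>\<^bsub>Tgt F\<^esub> FA F f"
    and FO_ext: "FO F \<in> extensional (Ob (Src F))"
    and FA_ext: "FA F \<in> extensional (Ar (Src F))"

definition mk_fun :: "('o, 'a) cat \<Rightarrow> ('p, 'b) cat \<Rightarrow> ('o \<Rightarrow> 'p) \<Rightarrow> ('a \<Rightarrow> 'b) \<Rightarrow> ('o, 'a, 'p, 'b) ftor" where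
  "mk_fun C D fo fa = \<lparr>Src = C, Tgt = D, FO = restrict fo (Ob C), FA = restrict fa (Ar C)\<rparr>"

definition idF :: "('o, 'a) cat \<Rightarrow> ('o, 'a, 'o, 'a) ftor" where
  "idF C = mk_fun C C (\<lambda>x. x) (\<lambda>f. f)"

definition fcomp :: "('p, 'b, 'q, 'c) ftor \<Rightarrow> ('o, 'a, 'p, 'b) ftor \<Rightarrow> ('o, 'a, 'q, 'c) ftor"
    (infixr "\<odot>" 60) where
  "G \<odot> F = mk_fun (Src F) (Tgt G) (\<lambda>x. FO G (FO F x)) (\<lambda>f. FA G (FA F f))"

record ('o, 'a, 'p, 'b) ntrans =
  NS :: "('o, 'a, 'p, 'b) ftor"
  NT :: "('o, 'a, 'p, 'b) ftor"
  NC :: "'o \<Rightarrow> 'b"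

locale nat_trans =
  fixes \<alpha> :: "('o, 'a, 'p, 'b) ntrans"
  assumes NS_functor: "cfunctor (NS \<alpha>)"
    and NT_functor: "cfunctor (NT \<alpha>)"
    and Src_eq: "Src (NT \<alpha>) = Src (NS \<alpha>)"
    and Tgt_eq: "Tgt (NT \<alpha>) = Tgt (NS \<alpha>)"
    and NC_hom: "x \<in> Ob (Src (NS \<alpha>)) \<Longrightarrow> NC \<alpha> x \<in> hom (Tgt (NS \<alpha>)) (FO (NS \<alpha>) x) (FO (NT \<alpha>) x)"
    and NC_natural: "f \<in> hom (Src (NS \<alpha>)) x y
          \<Longrightarrow> NC \<alpha> y \<cdot>\<^bsub>Tgt (NS \<alpha>)\<^esub> FA (NS \<alpha>) f = FA (NT \<alpha>) f \<cdot>\<^bsub>Tgt (NS \<alpha>)\<^esub> NC \<alpha> x"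
    and NC_ext: "NC \<alpha> \<in> extensional (Ob (Src (NS \<alpha>)))"

definition mk_nt :: "('o, 'a, 'p, 'b) ftor \<Rightarrow> ('o, 'a, 'p, 'b) ftor \<Rightarrow> ('o \<Rightarrow> 'b)
    \<Rightarrow> ('o, 'a, 'p, 'b) ntrans" where
  "mk_nt F G c = \<lparr>NS = F, NT = G, NC = restrict c (Ob (Src F))\<rparr>"

definition idN :: "('o, 'a, 'p, 'b) ftor \<Rightarrow> ('o, 'a, 'p, 'b) ntrans" where
  "idN F = mk_nt F F (\<lambda>x. Id (Tgt F) (FO F x))"

definition vcomp :: "('o, 'a, 'p, 'b) ntrans \<Rightarrow> ('o, 'a, 'p, 'b) ntrans \<Rightarrow> ('o, 'a, 'p, 'b) ntrans" where
  "vcomp \<beta> \<alpha> = mk_nt (NS \<alpha>) (NT \<beta>) (\<lambda>x. NC \<beta> x \<cdot>\<^bsub>Tgt (NS \<alpha>)\<^esub> NC \<alpha> x)"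

definition hcomp :: "('p, 'b, 'q, 'c) ntrans \<Rightarrow> ('o, 'a, 'p, 'b) ntrans \<Rightarrow> ('o, 'a, 'q, 'c) ntrans" where
  "hcomp \<beta> \<alpha> = mk_nt (NS \<beta> \<odot> NS \<alpha>) (NT \<beta> \<odot> NT \<alpha>)
     (\<lambda>x. NC \<beta> (FO (NT \<alpha>) x) \<cdot>\<^bsub>Tgt (NS \<beta>)\<^esub> FA (NS \<beta>) (NC \<alpha> x))"

definition nat_isomorphic :: "('o, 'a, 'p, 'b) ftor \<Rightarrow> ('o, 'a, 'p, 'b) ftor \<Rightarrow> bool" where
  "nat_isomorphic F G \<longleftrightarrow> (\<exists>\<alpha>. nat_trans \<alpha> \<and> NS \<alpha> = F \<and> NT \<alpha> = G \<and>
     (\<forall>x \<in> Ob (Src F). iso (Tgt F) (NC \<alpha> x)))"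

definition equivalence :: "('o, 'a, 'p, 'b) ftor \<Rightarrow> bool" where
  "equivalence F \<longleftrightarrow> cfunctor F \<and> (\<exists>G. cfunctor G \<and> Src G = Tgt F \<and> Tgt G = Src F \<and>
     nat_isomorphic (idF (Src F)) (G \<odot> F) \<and> nat_isomorphic (F \<odot> G) (idF (Tgt F)))"

definition op_cat :: "('o, 'a) cat \<Rightarrow> ('o, 'a) cat" where
  "op_cat C = \<lparr>Ob = Ob C, Ar = Ar C, Dom = Cod C, Cod = Dom C, Id = Id C, Cmp = (\<lambda>g f. Cmp C f g)\<rparr>"

definition prod_cat :: "('o, 'a) cat \<Rightarrow> ('p, 'b) cat \<Rightarrow> ('o \<times> 'p, 'a \<times> 'b) cat" where
  "prod_cat C D = mk_cat (Ob C \<times> Ob D) (Ar C \<times> Ar D)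
     (\<lambda>(f, g). (Dom C f, Dom D g)) (\<lambda>(f, g). (Cod C f, Cod D g))
     (\<lambda>(x, y). (Id C x, Id D y)) (\<lambda>(f', g') (f, g). (f' \<cdot>\<^bsub>C\<^esub> f, g' \<cdot>\<^bsub>D\<^esub> g))"

definition prod_fam :: "nat \<Rightarrow> (nat \<Rightarrow> ('o, 'a) cat) \<Rightarrow> (nat \<Rightarrow> 'o, nat \<Rightarrow> 'a) cat" where
  "prod_fam n C = mk_cat (\<Pi>\<^sub>E i\<in>{..<n}. Ob (C i)) (\<Pi>\<^sub>E i\<in>{..<n}. Ar (C i))
     (\<lambda>f. \<lambda>i\<in>{..<n}. Dom (C i) (f i)) (\<lambda>f. \<lambda>i\<in>{..<n}. Cod (C i) (f i))
     (\<lambda>x. \<lambda>i\<in>{..<n}. Id (C i) (x i)) (\<lambda>g f. \<lambda>i\<in>{..<n}. g i \<cdot>\<^bsub>C i\<^esub> f i)"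


section \<open>Adjunctions\<close>

locale adjunction =
  fixes L :: "('o, 'a, 'p, 'b) ftor" and R :: "('p, 'b, 'o, 'a) ftor"
    and \<eta> :: "('o, 'a, 'o, 'a) ntrans" and \<epsilon> :: "('p, 'b, 'p, 'b) ntrans"
  assumes L_functor: "cfunctor L"
    and R_functor: "cfunctor R"
    and Src_R: "Src R = Tgt L"
    and Tgt_R: "Tgt R = Src L"
    and unit_nt: "nat_trans \<eta>" "NS \<eta> = idF (Src L)" "NT \<eta> = R \<odot> L"
    and counit_nt: "nat_trans \<epsilon>" "NS \<epsilon> = L \<odot> R" "NT \<epsilon> = idF (Tgt L)"
    and triangle_L: "x \<in> Ob (Src L) \<Longrightarrow> NC \<epsilon> (FO L x) \<cdot>\<^bsub>Tgt L\<^esub> FA L (NC \<eta> x) = Id (Tgt L) (FO L x)"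
    and triangle_R: "y \<in> Ob (Tgt L) \<Longrightarrow> FA R (NC \<epsilon> y) \<cdot>\<^bsub>Src L\<^esub> NC \<eta> (FO R y) = Id (Src L) (FO R y)"

definition has_left_adjoint :: "('p, 'b, 'o, 'a) ftor \<Rightarrow> bool" where
  "has_left_adjoint R \<longleftrightarrow> (\<exists>L \<eta> \<epsilon>. adjunction L R \<eta> \<epsilon>)"

definition has_right_adjoint :: "('o, 'a, 'p, 'b) ftor \<Rightarrow> bool" where
  "has_right_adjoint L \<longleftrightarrow> (\<exists>R \<eta> \<epsilon>. adjunction L R \<eta> \<epsilon>)"

text \<open>A left adjoint of \<open>R\<close> with its unit and counit, and a right adjoint of \<open>L\<close> with its unit and
  counit, are fixed by choice whenever they exist.\<close>

definition left_adj :: "('p, 'b, 'o, 'a) ftor \<Rightarrow>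
    ('o, 'a, 'p, 'b) ftor \<times> ('o, 'a, 'o, 'a) ntrans \<times> ('p, 'b, 'p, 'b) ntrans" where
  "left_adj R = (SOME (L, \<eta>, \<epsilon>). adjunction L R \<eta> \<epsilon>)"

definition right_adj :: "('o, 'a, 'p, 'b) ftor \<Rightarrow>
    ('p, 'b, 'o, 'a) ftor \<times> ('o, 'a, 'o, 'a) ntrans \<times> ('p, 'b, 'p, 'b) ntrans" where
  "right_adj L = (SOME (R, \<eta>, \<epsilon>). adjunction L R \<eta> \<epsilon>)"

definition ladj :: "('p, 'b, 'o, 'a) ftor \<Rightarrow> ('o, 'a, 'p, 'b) ftor" where
  "ladj R = fst (left_adj R)"

definition ladj_unit :: "('p, 'b, 'o, 'a) ftor \<Rightarrow> 'o \<Rightarrow> 'a" where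
  "ladj_unit R = NC (fst (snd (left_adj R)))"

definition ladj_counit :: "('p, 'b, 'o, 'a) ftor \<Rightarrow> 'p \<Rightarrow> 'b" where
  "ladj_counit R = NC (snd (snd (left_adj R)))"

definition radj :: "('o, 'a, 'p, 'b) ftor \<Rightarrow> ('p, 'b, 'o, 'a) ftor" where
  "radj L = fst (right_adj L)"

definition radj_unit :: "('o, 'a, 'p, 'b) ftor \<Rightarrow> 'o \<Rightarrow> 'a" where
  "radj_unit L = NC (fst (snd (right_adj L)))"

definition radj_counit :: "('o, 'a, 'p, 'b) ftor \<Rightarrow> 'p \<Rightarrow> 'b" where
  "radj_counit L = NC (snd (snd (right_adj L)))"

text \<open>Transposition: \<open>f : x \<rightarrow> R y\<close> yields \<open>L x \<rightarrow> y\<close>, and \<open>f : L x \<rightarrow> y\<close> yields \<open>x \<rightarrow> R y\<close>.\<close>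

definition ltransp :: "('p, 'b, 'o, 'a) ftor \<Rightarrow> 'p \<Rightarrow> 'a \<Rightarrow> 'b" where
  "ltransp R y f = ladj_counit R y \<cdot>\<^bsub>Src R\<^esub> FA (ladj R) f"

definition rtransp :: "('o, 'a, 'p, 'b) ftor \<Rightarrow> 'o \<Rightarrow> 'b \<Rightarrow> 'a" where
  "rtransp L x f = FA (radj L) f \<cdot>\<^bsub>Src L\<^esub> radj_unit L x"


section \<open>Small categories\<close>

type_synonym 'u scat = "('u, 'u) cat"
type_synonym 'u sfun = "('u, 'u, 'u, 'u) ftor"
type_synonym 'u snt = "('u, 'u, 'u, 'u) ntrans"

definition small_cat :: "'u::universe scat \<Rightarrow> bool" where
  "small_cat A \<longleftrightarrow> category A \<and> small (Ob A) \<and> small (Ar A)"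

definition small_fun :: "'u::universe sfun \<Rightarrow> bool" where
  "small_fun u \<longleftrightarrow> cfunctor u \<and> small_cat (Src u) \<and> small_cat (Tgt u)"

definition small_nt :: "'u::universe snt \<Rightarrow> bool" where
  "small_nt \<alpha> \<longleftrightarrow> nat_trans \<alpha> \<and> small_fun (NS \<alpha>) \<and> small_fun (NT \<alpha>)"

definition terminal :: "'u::universe scat" ("\<e>") where
  "\<e> = mk_cat {unat 0} {unat 0} (\<lambda>_. unat 0) (\<lambda>_. unat 0) (\<lambda>_. unat 0) (\<lambda>_ _. unat 0)"

definition bang :: "'u::universe scat \<Rightarrow> 'u sfun" where
  "bang A = mk_fun A \<e> (\<lambda>_. unat 0) (\<lambda>_. unat 0)"

definition point :: "'u::universe scat \<Rightarrow> 'u \<Rightarrow> 'u sfun" where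
  "point A a = mk_fun \<e> A (\<lambda>_. a) (\<lambda>_. Id A a)"

definition times :: "'u::universe scat \<Rightarrow> 'u scat \<Rightarrow> 'u scat" (infixr "\<otimes>" 70) where
  "A \<otimes> B = mk_cat {upair a b |a b. a \<in> Ob A \<and> b \<in> Ob B} {upair f g |f g. f \<in> Ar A \<and> g \<in> Ar B}
     (\<lambda>f. upair (Dom A (ufst f)) (Dom B (usnd f))) (\<lambda>f. upair (Cod A (ufst f)) (Cod B (usnd f)))
     (\<lambda>x. upair (Id A (ufst x)) (Id B (usnd x)))
     (\<lambda>g f. upair (ufst g \<cdot>\<^bsub>A\<^esub> ufst f) (usnd g \<cdot>\<^bsub>B\<^esub> usnd f))"

definition pr1 :: "'u::universe scat \<Rightarrow> 'u scat \<Rightarrow> 'u sfun" where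
  "pr1 A B = mk_fun (A \<otimes> B) A ufst ufst"

definition pr2 :: "'u::universe scat \<Rightarrow> 'u scat \<Rightarrow> 'u sfun" where
  "pr2 A B = mk_fun (A \<otimes> B) B usnd usnd"

definition pairF :: "'u::universe sfun \<Rightarrow> 'u sfun \<Rightarrow> 'u sfun" ("\<langle>_,/ _\<rangle>") where
  "\<langle>u, v\<rangle> = mk_fun (Src u) (Tgt u \<otimes> Tgt v)
     (\<lambda>x. upair (FO u x) (FO v x)) (\<lambda>f. upair (FA u f) (FA v f))"

definition timesF :: "'u::universe sfun \<Rightarrow> 'u sfun \<Rightarrow> 'u sfun" (infixr "\<otimes>\<^sub>F" 70) where
  "u \<otimes>\<^sub>F v = \<langle>u \<odot> pr1 (Src u) (Src v), v \<odot> pr2 (Src u) (Src v)\<rangle>"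

definition diag :: "'u::universe scat \<Rightarrow> 'u sfun" where
  "diag A = \<langle>idF A, idF A\<rangle>"

text \<open>The whiskering of a transformation \<open>\<alpha> : u \<Rightarrow> v\<close> to \<open>L \<times> u \<Rightarrow> L \<times> v\<close>.\<close>

definition timesN :: "'u::universe scat \<Rightarrow> 'u snt \<Rightarrow> 'u snt" where
  "timesN L \<alpha> = mk_nt (idF L \<otimes>\<^sub>F NS \<alpha>) (idF L \<otimes>\<^sub>F NT \<alpha>)
     (\<lambda>x. upair (Id L (ufst x)) (NC \<alpha> (usnd x)))"

definition coprod :: "nat \<Rightarrow> (nat \<Rightarrow> 'u::universe scat) \<Rightarrow> 'u scat" where
  "coprod n A = mk_cat {upair (unat i) x |i x. i < n \<and> x \<in> Ob (A i)}
     {upair (unat i) f |i f. i < n \<and> f \<in> Ar (A i)}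
     (\<lambda>f. upair (ufst f) (Dom (A (inv unat (ufst f))) (usnd f)))
     (\<lambda>f. upair (ufst f) (Cod (A (inv unat (ufst f))) (usnd f)))
     (\<lambda>x. upair (ufst x) (Id (A (inv unat (ufst x))) (usnd x)))
     (\<lambda>g f. upair (ufst f) (usnd g \<cdot>\<^bsub>A (inv unat (ufst f))\<^esub> usnd f))"

definition coproj :: "nat \<Rightarrow> (nat \<Rightarrow> 'u::universe scat) \<Rightarrow> nat \<Rightarrow> 'u sfun" where
  "coproj n A i = mk_fun (A i) (coprod n A) (upair (unat i)) (upair (unat i))"

text \<open>
  For \<open>u : A \<rightarrow> B\<close> and \<open>b \<in> B\<close>, the slice \<open>(u/b)\<close> has objects \<open>(a, f : u a \<rightarrow> b)\<close>.  A morphism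
  \<open>h : (a, f) \<rightarrow> (a', f')\<close> is coded as the triple \<open>(h, f, f')\<close>, which determines its domain and
  codomain.  Dually, \<open>(b/u)\<close> has objects \<open>(a, f : b \<rightarrow> u a)\<close>.
\<close>

definition slice :: "'u::universe sfun \<Rightarrow> 'u \<Rightarrow> 'u scat" where
  "slice u b = (let A = Src u; B = Tgt u in
     mk_cat {upair a f |a f. a \<in> Ob A \<and> f \<in> hom B (FO u a) b}
       {upair h (upair f f') |h f f'. h \<in> Ar A \<and> f \<in> hom B (FO u (Dom A h)) b \<and>
          f' \<in> hom B (FO u (Cod A h)) b \<and> f' \<cdot>\<^bsub>B\<^esub> FA u h = f}
       (\<lambda>h. upair (Dom A (ufst h)) (ufst (usnd h))) (\<lambda>h. upair (Cod A (ufst h)) (usnd (usnd h)))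
       (\<lambda>x. upair (Id A (ufst x)) (upair (usnd x) (usnd x)))
       (\<lambda>k h. upair (ufst k \<cdot>\<^bsub>A\<^esub> ufst h) (upair (ufst (usnd h)) (usnd (usnd k)))))"

definition coslice :: "'u::universe sfun \<Rightarrow> 'u \<Rightarrow> 'u scat" where
  "coslice u b = (let A = Src u; B = Tgt u in
     mk_cat {upair a f |a f. a \<in> Ob A \<and> f \<in> hom B b (FO u a)}
       {upair h (upair f f') |h f f'. h \<in> Ar A \<and> f \<in> hom B b (FO u (Dom A h)) \<and>
          f' \<in> hom B b (FO u (Cod A h)) \<and> FA u h \<cdot>\<^bsub>B\<^esub> f = f'}
       (\<lambda>h. upair (Dom A (ufst h)) (ufst (usnd h))) (\<lambda>h. upair (Cod A (ufst h)) (usnd (usnd h)))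
       (\<lambda>x. upair (Id A (ufst x)) (upair (usnd x) (usnd x)))
       (\<lambda>k h. upair (ufst k \<cdot>\<^bsub>A\<^esub> ufst h) (upair (ufst (usnd h)) (usnd (usnd k)))))"

definition slice_pr :: "'u::universe sfun \<Rightarrow> 'u \<Rightarrow> 'u sfun" where
  "slice_pr u b = mk_fun (slice u b) (Src u) ufst ufst"

definition coslice_pr :: "'u::universe sfun \<Rightarrow> 'u \<Rightarrow> 'u sfun" where
  "coslice_pr u b = mk_fun (coslice u b) (Src u) ufst ufst"

text \<open>The tautological transformations \<open>u pr \<Rightarrow> b \<pi>\<close> and \<open>b \<pi> \<Rightarrow> u pr\<close>.\<close>

definition slice_nt :: "'u::universe sfun \<Rightarrow> 'u \<Rightarrow> 'u snt" where
  "slice_nt u b = mk_nt (u \<odot> slice_pr u b) (point (Tgt u) b \<odot> bang (slice u b)) usnd"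

definition coslice_nt :: "'u::universe sfun \<Rightarrow> 'u \<Rightarrow> 'u snt" where
  "coslice_nt u b = mk_nt (point (Tgt u) b \<odot> bang (coslice u b)) (u \<odot> coslice_pr u b) usnd"


section \<open>Derivators\<close>

record ('u, 'o, 'a) pder =
  Val :: "'u scat \<Rightarrow> ('o, 'a) cat"
  Res :: "'u sfun \<Rightarrow> ('o, 'a, 'o, 'a) ftor"
  Cell :: "'u snt \<Rightarrow> ('o, 'a, 'o, 'a) ntrans"

text \<open>Action of \<open>u\<^sup>*\<close> on objects and on morphisms.\<close>

abbreviation rs :: "('u, 'o, 'a) pder \<Rightarrow> 'u sfun \<Rightarrow> 'o \<Rightarrow> 'o" where
  "rs D u \<equiv> FO (Res D u)"

abbreviation rsA :: "('u, 'o, 'a) pder \<Rightarrow> 'u sfun \<Rightarrow> 'a \<Rightarrow> 'a" where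
  "rsA D u \<equiv> FA (Res D u)"

text \<open>Action of \<open>u\<^sub>!\<close> and \<open>u\<^sub>*\<close> on objects.\<close>

abbreviation lan :: "('u, 'o, 'a) pder \<Rightarrow> 'u sfun \<Rightarrow> 'o \<Rightarrow> 'o" where
  "lan D u \<equiv> FO (ladj (Res D u))"

abbreviation ran :: "('u, 'o, 'a) pder \<Rightarrow> 'u sfun \<Rightarrow> 'o \<Rightarrow> 'o" where
  "ran D u \<equiv> FO (radj (Res D u))"

locale prederivator =
  fixes D :: "('u::universe, 'o, 'a) pder"
  assumes Val_category: "small_cat A \<Longrightarrow> category (Val D A)"
    and Res_functor: "small_fun u \<Longrightarrow> cfunctor (Res D u)"
    and Res_Src: "small_fun u \<Longrightarrow> Src (Res D u) = Val D (Tgt u)"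
    and Res_Tgt: "small_fun u \<Longrightarrow> Tgt (Res D u) = Val D (Src u)"
    and Res_id: "small_cat A \<Longrightarrow> Res D (idF A) = idF (Val D A)"
    and Res_comp: "\<lbrakk>small_fun u; small_fun v; Src v = Tgt u\<rbrakk> \<Longrightarrow> Res D (v \<odot> u) = Res D u \<odot> Res D v"
    and Cell_nt: "small_nt \<alpha> \<Longrightarrow> nat_trans (Cell D \<alpha>)"
    and Cell_NS: "small_nt \<alpha> \<Longrightarrow> NS (Cell D \<alpha>) = Res D (NS \<alpha>)"
    and Cell_NT: "small_nt \<alpha> \<Longrightarrow> NT (Cell D \<alpha>) = Res D (NT \<alpha>)"
    and Cell_id: "small_fun u \<Longrightarrow> Cell D (idN u) = idN (Res D u)"
    and Cell_vcomp: "\<lbrakk>small_nt \<alpha>; small_nt \<beta>; NS \<beta> = NT \<alpha>\<rbrakk>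
          \<Longrightarrow> Cell D (vcomp \<beta> \<alpha>) = vcomp (Cell D \<beta>) (Cell D \<alpha>)"
    and Cell_hcomp: "\<lbrakk>small_nt \<alpha>; small_nt \<beta>; Src (NS \<beta>) = Tgt (NS \<alpha>)\<rbrakk>
          \<Longrightarrow> Cell D (hcomp \<beta> \<alpha>) = hcomp (Cell D \<alpha>) (Cell D \<beta>)"

definition coprod_comparison :: "('u::universe, 'o, 'a) pder \<Rightarrow> nat \<Rightarrow> (nat \<Rightarrow> 'u scat)
    \<Rightarrow> ('o, 'a, nat \<Rightarrow> 'o, nat \<Rightarrow> 'a) ftor" where
  "coprod_comparison D n A = mk_fun (Val D (coprod n A)) (prod_fam n (\<lambda>i. Val D (A i)))
     (\<lambda>X. \<lambda>i\<in>{..<n}. rs D (coproj n A i) X) (\<lambda>f. \<lambda>i\<in>{..<n}. rsA D (coproj n A i) f)"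

text \<open>The components at \<open>X\<close> of the canonical maps \<open>\<pi>\<^sub>! pr\<^sup>* \<rightarrow> b\<^sup>* u\<^sub>!\<close> and \<open>b\<^sup>* u\<^sub>* \<rightarrow> \<pi>\<^sub>* pr\<^sup>*\<close>: transposes of
  \<open>pr\<^sup>*X \<rightarrow> pr\<^sup>*u\<^sup>*u\<^sub>!X \<rightarrow> \<pi>\<^sup>*b\<^sup>*u\<^sub>!X\<close> and of \<open>\<pi>\<^sup>*b\<^sup>*u\<^sub>*X \<rightarrow> pr\<^sup>*u\<^sup>*u\<^sub>*X \<rightarrow> pr\<^sup>*X\<close>.\<close>

definition lan_comparison :: "('u::universe, 'o, 'a) pder \<Rightarrow> 'u sfun \<Rightarrow> 'u \<Rightarrow> 'o \<Rightarrow> 'a" where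
  "lan_comparison D u b X =
     ltransp (Res D (bang (slice u b))) (rs D (point (Tgt u) b) (lan D u X))
       (NC (Cell D (slice_nt u b)) (lan D u X) \<cdot>\<^bsub>Val D (slice u b)\<^esub>
          rsA D (slice_pr u b) (ladj_unit (Res D u) X))"

definition ran_comparison :: "('u::universe, 'o, 'a) pder \<Rightarrow> 'u sfun \<Rightarrow> 'u \<Rightarrow> 'o \<Rightarrow> 'a" where
  "ran_comparison D u b X =
     rtransp (Res D (bang (coslice u b))) (rs D (point (Tgt u) b) (ran D u X))
       (rsA D (coslice_pr u b) (radj_counit (Res D u) X) \<cdot>\<^bsub>Val D (coslice u b)\<^esub>
          NC (Cell D (coslice_nt u b)) (ran D u X))"

locale derivator = prederivator D for D :: "('u::universe, 'o, 'a) pder" +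
  assumes Der1: "(\<And>i. i < n \<Longrightarrow> small_cat (C i)) \<Longrightarrow> equivalence (coprod_comparison D n C)"
    and Der2: "\<lbrakk>small_cat A; f \<in> Ar (Val D A)\<rbrakk>
          \<Longrightarrow> iso (Val D A) f \<longleftrightarrow> (\<forall>a \<in> Ob A. iso (Val D \<e>) (rsA D (point A a) f))"
    and Der3_left: "small_fun u \<Longrightarrow> has_left_adjoint (Res D u)"
    and Der3_right: "small_fun u \<Longrightarrow> has_right_adjoint (Res D u)"
    and Der4_left: "\<lbrakk>small_fun u; b \<in> Ob (Tgt u); X \<in> Ob (Val D (Src u))\<rbrakk>
          \<Longrightarrow> iso (Val D \<e>) (lan_comparison D u b X)"
    and Der4_right: "\<lbrakk>small_fun u; b \<in> Ob (Tgt u); X \<in> Ob (Val D (Src u))\<rbrakk>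
          \<Longrightarrow> iso (Val D \<e>) (ran_comparison D u b X)"

definition shift :: "('u::universe, 'o, 'a) pder \<Rightarrow> 'u scat \<Rightarrow> ('u, 'o, 'a) pder" where
  "shift D L = \<lparr>Val = (\<lambda>A. Val D (L \<otimes> A)), Res = (\<lambda>u. Res D (idF L \<otimes>\<^sub>F u)),
     Cell = (\<lambda>\<alpha>. Cell D (timesN L \<alpha>))\<rparr>"


section \<open>Monoidal categories and strong monoidal functors\<close>

record ('o, 'a) mon =
  Ten :: "('o \<times> 'o, 'a \<times> 'a, 'o, 'a) ftor"
  Unt :: "'o"
  Asc :: "'o \<Rightarrow> 'o \<Rightarrow> 'o \<Rightarrow> 'a"
  Lun :: "'o \<Rightarrow> 'a"
  Run :: "'o \<Rightarrow> 'a"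

abbreviation ten :: "('o, 'a) mon \<Rightarrow> 'o \<Rightarrow> 'o \<Rightarrow> 'o" where
  "ten T x y \<equiv> FO (Ten T) (x, y)"

abbreviation tenA :: "('o, 'a) mon \<Rightarrow> 'a \<Rightarrow> 'a \<Rightarrow> 'a" where
  "tenA T f g \<equiv> FA (Ten T) (f, g)"

locale monoidal_category = category C for C :: "('o, 'a) cat" +
  fixes T :: "('o, 'a) mon"
  assumes Ten_functor: "cfunctor (Ten T)"
    and Ten_Src: "Src (Ten T) = prod_cat C C"
    and Ten_Tgt: "Tgt (Ten T) = C"
    and Unt_in: "Unt T \<in> Ob C"
    and Asc_hom: "\<lbrakk>x \<in> Ob C; y \<in> Ob C; z \<in> Ob C\<rbrakk>
          \<Longrightarrow> Asc T x y z \<in> hom C (ten T (ten T x y) z) (ten T x (ten T y z))"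
    and Asc_iso: "\<lbrakk>x \<in> Ob C; y \<in> Ob C; z \<in> Ob C\<rbrakk> \<Longrightarrow> iso C (Asc T x y z)"
    and Asc_natural: "\<lbrakk>f \<in> hom C x x'; g \<in> hom C y y'; h \<in> hom C z z'\<rbrakk>
          \<Longrightarrow> Asc T x' y' z' \<cdot>\<^bsub>C\<^esub> tenA T (tenA T f g) h = tenA T f (tenA T g h) \<cdot>\<^bsub>C\<^esub> Asc T x y z"
    and Lun_hom: "x \<in> Ob C \<Longrightarrow> Lun T x \<in> hom C (ten T (Unt T) x) x"
    and Lun_iso: "x \<in> Ob C \<Longrightarrow> iso C (Lun T x)"
    and Lun_natural: "f \<in> hom C x x' \<Longrightarrow> Lun T x' \<cdot>\<^bsub>C\<^esub> tenA T (Id C (Unt T)) f = f \<cdot>\<^bsub>C\<^esub> Lun T x"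
    and Run_hom: "x \<in> Ob C \<Longrightarrow> Run T x \<in> hom C (ten T x (Unt T)) x"
    and Run_iso: "x \<in> Ob C \<Longrightarrow> iso C (Run T x)"
    and Run_natural: "f \<in> hom C x x' \<Longrightarrow> Run T x' \<cdot>\<^bsub>C\<^esub> tenA T f (Id C (Unt T)) = f \<cdot>\<^bsub>C\<^esub> Run T x"
    and pentagon: "\<lbrakk>w \<in> Ob C; x \<in> Ob C; y \<in> Ob C; z \<in> Ob C\<rbrakk>
          \<Longrightarrow> Asc T w x (ten T y z) \<cdot>\<^bsub>C\<^esub> Asc T (ten T w x) y z
            = tenA T (Id C w) (Asc T x y z) \<cdot>\<^bsub>C\<^esub>
                (Asc T w (ten T x y) z \<cdot>\<^bsub>C\<^esub> tenA T (Asc T w x y) (Id C z))"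
    and triangle: "\<lbrakk>x \<in> Ob C; y \<in> Ob C\<rbrakk>
          \<Longrightarrow> tenA T (Id C x) (Lun T y) \<cdot>\<^bsub>C\<^esub> Asc T x (Unt T) y = tenA T (Run T x) (Id C y)"

text \<open>\<open>F : (C, T) \<rightarrow> (C', T')\<close> with structure maps \<open>\<mu> x y : F x \<otimes> F y \<rightarrow> F (x \<otimes> y)\<close> and \<open>\<iota> : 1 \<rightarrow> F 1\<close>.\<close>

locale strong_monoidal_functor = cfunctor F for F :: "('o, 'a, 'p, 'b) ftor" +
  fixes T :: "('o, 'a) mon" and T' :: "('p, 'b) mon" and \<mu> :: "'o \<Rightarrow> 'o \<Rightarrow> 'b" and \<iota> :: "'b"
  assumes mon_Src: "monoidal_category (Src F) T"
    and mon_Tgt: "monoidal_category (Tgt F) T'"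
    and mu_hom: "\<lbrakk>x \<in> Ob (Src F); y \<in> Ob (Src F)\<rbrakk>
          \<Longrightarrow> \<mu> x y \<in> hom (Tgt F) (ten T' (FO F x) (FO F y)) (FO F (ten T x y))"
    and mu_iso: "\<lbrakk>x \<in> Ob (Src F); y \<in> Ob (Src F)\<rbrakk> \<Longrightarrow> iso (Tgt F) (\<mu> x y)"
    and mu_natural: "\<lbrakk>f \<in> hom (Src F) x x'; g \<in> hom (Src F) y y'\<rbrakk>
          \<Longrightarrow> \<mu> x' y' \<cdot>\<^bsub>Tgt F\<^esub> tenA T' (FA F f) (FA F g) = FA F (tenA T f g) \<cdot>\<^bsub>Tgt F\<^esub> \<mu> x y"
    and iota_hom: "\<iota> \<in> hom (Tgt F) (Unt T') (FO F (Unt T))"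
    and iota_iso: "iso (Tgt F) \<iota>"
    and mu_assoc: "\<lbrakk>x \<in> Ob (Src F); y \<in> Ob (Src F); z \<in> Ob (Src F)\<rbrakk>
          \<Longrightarrow> FA F (Asc T x y z) \<cdot>\<^bsub>Tgt F\<^esub>
                (\<mu> (ten T x y) z \<cdot>\<^bsub>Tgt F\<^esub> tenA T' (\<mu> x y) (Id (Tgt F) (FO F z)))
            = \<mu> x (ten T y z) \<cdot>\<^bsub>Tgt F\<^esub> (tenA T' (Id (Tgt F) (FO F x)) (\<mu> y z) \<cdot>\<^bsub>Tgt F\<^esub>
                Asc T' (FO F x) (FO F y) (FO F z))"
    and mu_Lun: "x \<in> Ob (Src F)
          \<Longrightarrow> FA F (Lun T x) \<cdot>\<^bsub>Tgt F\<^esub> (\<mu> (Unt T) x \<cdot>\<^bsub>Tgt F\<^esub> tenA T' \<iota> (Id (Tgt F) (FO F x)))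
            = Lun T' (FO F x)"
    and mu_Run: "x \<in> Ob (Src F)
          \<Longrightarrow> FA F (Run T x) \<cdot>\<^bsub>Tgt F\<^esub> (\<mu> x (Unt T) \<cdot>\<^bsub>Tgt F\<^esub> tenA T' (Id (Tgt F) (FO F x)) \<iota>)
            = Run T' (FO F x)"


section \<open>Monoidal derivators\<close>

text \<open>
  A pseudomonoid in the 2-category of prederivators, pseudonatural transformations and
  modifications, written out: \<open>Mu u\<close> and \<open>Mu0 u\<close> are the pseudonaturality constraints
  \<open>u\<^sup>*X \<otimes> u\<^sup>*Y \<cong> u\<^sup>*(X \<otimes> Y)\<close> and \<open>1 \<cong> u\<^sup>*1\<close> of the product and the unit.
\<close>

record ('u, 'o, 'a) mpder =
  Mon :: "'u scat \<Rightarrow> ('o, 'a) mon"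
  Mu :: "'u sfun \<Rightarrow> 'o \<Rightarrow> 'o \<Rightarrow> 'a"
  Mu0 :: "'u sfun \<Rightarrow> 'a"

locale monoidal_prederivator = prederivator D for D :: "('u::universe, 'o, 'a) pder" +
  fixes M :: "('u, 'o, 'a) mpder"
  assumes Mon_monoidal: "small_cat A \<Longrightarrow> monoidal_category (Val D A) (Mon M A)"
    and Res_strong_monoidal: "small_fun u \<Longrightarrow>
          strong_monoidal_functor (Res D u) (Mon M (Tgt u)) (Mon M (Src u)) (Mu M u) (Mu0 M u)"
    and Mu_id: "\<lbrakk>small_cat A; X \<in> Ob (Val D A); Y \<in> Ob (Val D A)\<rbrakk>
          \<Longrightarrow> Mu M (idF A) X Y = Id (Val D A) (ten (Mon M A) X Y)"
    and Mu0_id: "small_cat A \<Longrightarrow> Mu0 M (idF A) = Id (Val D A) (Unt (Mon M A))"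
    and Mu_comp: "\<lbrakk>small_fun u; small_fun v; Src v = Tgt u;
            X \<in> Ob (Val D (Tgt v)); Y \<in> Ob (Val D (Tgt v))\<rbrakk>
          \<Longrightarrow> Mu M (v \<odot> u) X Y = rsA D u (Mu M v X Y) \<cdot>\<^bsub>Val D (Src u)\<^esub> Mu M u (rs D v X) (rs D v Y)"
    and Mu0_comp: "\<lbrakk>small_fun u; small_fun v; Src v = Tgt u\<rbrakk>
          \<Longrightarrow> Mu0 M (v \<odot> u) = rsA D u (Mu0 M v) \<cdot>\<^bsub>Val D (Src u)\<^esub> Mu0 M u"
    and Mu_Cell: "\<lbrakk>small_nt \<alpha>; X \<in> Ob (Val D (Tgt (NS \<alpha>))); Y \<in> Ob (Val D (Tgt (NS \<alpha>)))\<rbrakk>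
          \<Longrightarrow> NC (Cell D \<alpha>) (ten (Mon M (Tgt (NS \<alpha>))) X Y) \<cdot>\<^bsub>Val D (Src (NS \<alpha>))\<^esub> Mu M (NS \<alpha>) X Y
            = Mu M (NT \<alpha>) X Y \<cdot>\<^bsub>Val D (Src (NS \<alpha>))\<^esub>
                tenA (Mon M (Src (NS \<alpha>))) (NC (Cell D \<alpha>) X) (NC (Cell D \<alpha>) Y)"
    and Mu0_Cell: "small_nt \<alpha>
          \<Longrightarrow> NC (Cell D \<alpha>) (Unt (Mon M (Tgt (NS \<alpha>)))) \<cdot>\<^bsub>Val D (Src (NS \<alpha>))\<^esub> Mu0 M (NS \<alpha>)
            = Mu0 M (NT \<alpha>)"

text \<open>External product of \<open>X \<in> \<bbbD>(A)\<close> and \<open>Y \<in> \<bbbD>(B)\<close>, and of morphisms; written \<open>X \<star> Y\<close> in comments.\<close>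

definition ext :: "('u::universe, 'o, 'a) pder \<Rightarrow> ('u, 'o, 'a) mpder \<Rightarrow> 'u scat \<Rightarrow> 'u scat
    \<Rightarrow> 'o \<Rightarrow> 'o \<Rightarrow> 'o" where
  "ext D M A B X Y = ten (Mon M (A \<otimes> B)) (rs D (pr1 A B) X) (rs D (pr2 A B) Y)"

definition extA :: "('u::universe, 'o, 'a) pder \<Rightarrow> ('u, 'o, 'a) mpder \<Rightarrow> 'u scat \<Rightarrow> 'u scat
    \<Rightarrow> 'a \<Rightarrow> 'a \<Rightarrow> 'a" where
  "extA D M A B f g = tenA (Mon M (A \<otimes> B)) (rsA D (pr1 A B) f) (rsA D (pr2 A B) g)"

text \<open>The pseudonaturality constraint \<open>u\<^sup>*X \<star> v\<^sup>*Y \<rightarrow> (u \<times> v)\<^sup>*(X \<star> Y)\<close>.\<close>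

definition ext_mu :: "('u::universe, 'o, 'a) pder \<Rightarrow> ('u, 'o, 'a) mpder \<Rightarrow> 'u sfun \<Rightarrow> 'u sfun
    \<Rightarrow> 'o \<Rightarrow> 'o \<Rightarrow> 'a" where
  "ext_mu D M u v X Y =
     Mu M (u \<otimes>\<^sub>F v) (rs D (pr1 (Tgt u) (Tgt v)) X) (rs D (pr2 (Tgt u) (Tgt v)) Y)"

text \<open>The canonical maps \<open>(u \<times> 1)\<^sub>!(X \<star> Y) \<rightarrow> u\<^sub>!X \<star> Y\<close> for \<open>Y \<in> \<bbbD>(B)\<close>, and \<open>(1 \<times> v)\<^sub>!(X \<star> Y) \<rightarrow> X \<star> v\<^sub>!Y\<close>
  for \<open>X \<in> \<bbbD>(A)\<close>.\<close>

definition cocont_left :: "('u::universe, 'o, 'a) pder \<Rightarrow> ('u, 'o, 'a) mpder \<Rightarrow> 'u sfun \<Rightarrow> 'u scat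
    \<Rightarrow> 'o \<Rightarrow> 'o \<Rightarrow> 'a" where
  "cocont_left D M u B X Y =
     ltransp (Res D (u \<otimes>\<^sub>F idF B)) (ext D M (Tgt u) B (lan D u X) Y)
       (ext_mu D M u (idF B) (lan D u X) Y \<cdot>\<^bsub>Val D (Src u \<otimes> B)\<^esub>
          extA D M (Src u) B (ladj_unit (Res D u) X) (Id (Val D B) Y))"

definition cocont_right :: "('u::universe, 'o, 'a) pder \<Rightarrow> ('u, 'o, 'a) mpder \<Rightarrow> 'u scat \<Rightarrow> 'u sfun
    \<Rightarrow> 'o \<Rightarrow> 'o \<Rightarrow> 'a" where
  "cocont_right D M A v X Y =
     ltransp (Res D (idF A \<otimes>\<^sub>F v)) (ext D M A (Tgt v) X (lan D v Y))
       (ext_mu D M (idF A) v X (lan D v Y) \<cdot>\<^bsub>Val D (A \<otimes> Src v)\<^esub>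
          extA D M A (Src v) (Id (Val D A) X) (ladj_unit (Res D v) Y))"

locale monoidal_derivator = derivator D + monoidal_prederivator D M
  for D :: "('u::universe, 'o, 'a) pder" and M :: "('u, 'o, 'a) mpder" +
  assumes cocontinuous_left: "\<lbrakk>small_fun u; small_cat B; X \<in> Ob (Val D (Src u)); Y \<in> Ob (Val D B)\<rbrakk>
          \<Longrightarrow> iso (Val D (Tgt u \<otimes> B)) (cocont_left D M u B X Y)"
    and cocontinuous_right: "\<lbrakk>small_cat A; small_fun v; X \<in> Ob (Val D A); Y \<in> Ob (Val D (Src v))\<rbrakk>
          \<Longrightarrow> iso (Val D (A \<otimes> Tgt v)) (cocont_right D M A v X Y)"


section \<open>Closedness\<close>

text \<open>
  Data exhibiting \<open>\<otimes>\<close> as a two-variable left adjoint: \<open>rhd A B\<close> is the functor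
  \<open>(Y, Z) \<mapsto> Y \<rhd> Z : \<bbbD>(B)\<^sup>o\<^sup>p \<times> \<bbbD>(A \<times> B) \<rightarrow> \<bbbD>(A)\<close>, \<open>lhd A B\<close> the functor
  \<open>(Z, X) \<mapsto> Z \<lhd> X : \<bbbD>(A \<times> B) \<times> \<bbbD>(A)\<^sup>o\<^sup>p \<rightarrow> \<bbbD>(B)\<close>, and \<open>\<phi> A B X Y Z\<close>, \<open>\<psi> A B X Y Z\<close> are the bijections
  from \<open>\<bbbD>(A \<times> B)(X \<star> Y, Z)\<close> to \<open>\<bbbD>(A)(X, Y \<rhd> Z)\<close> and to \<open>\<bbbD>(B)(Y, Z \<lhd> X)\<close>.
\<close>

locale two_variable_adjunction =
  fixes D :: "('u::universe, 'o, 'a) pder" and M :: "('u, 'o, 'a) mpder"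
    and rhd :: "'u scat \<Rightarrow> 'u scat \<Rightarrow> ('o \<times> 'o, 'a \<times> 'a, 'o, 'a) ftor"
    and lhd :: "'u scat \<Rightarrow> 'u scat \<Rightarrow> ('o \<times> 'o, 'a \<times> 'a, 'o, 'a) ftor"
    and \<phi> :: "'u scat \<Rightarrow> 'u scat \<Rightarrow> 'o \<Rightarrow> 'o \<Rightarrow> 'o \<Rightarrow> 'a \<Rightarrow> 'a"
    and \<psi> :: "'u scat \<Rightarrow> 'u scat \<Rightarrow> 'o \<Rightarrow> 'o \<Rightarrow> 'o \<Rightarrow> 'a \<Rightarrow> 'a"
  assumes rhd_functor: "\<lbrakk>small_cat A; small_cat B\<rbrakk> \<Longrightarrow> cfunctor (rhd A B)"
    and rhd_Src: "\<lbrakk>small_cat A; small_cat B\<rbrakk>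
          \<Longrightarrow> Src (rhd A B) = prod_cat (op_cat (Val D B)) (Val D (A \<otimes> B))"
    and rhd_Tgt: "\<lbrakk>small_cat A; small_cat B\<rbrakk> \<Longrightarrow> Tgt (rhd A B) = Val D A"
    and lhd_functor: "\<lbrakk>small_cat A; small_cat B\<rbrakk> \<Longrightarrow> cfunctor (lhd A B)"
    and lhd_Src: "\<lbrakk>small_cat A; small_cat B\<rbrakk>
          \<Longrightarrow> Src (lhd A B) = prod_cat (Val D (A \<otimes> B)) (op_cat (Val D A))"
    and lhd_Tgt: "\<lbrakk>small_cat A; small_cat B\<rbrakk> \<Longrightarrow> Tgt (lhd A B) = Val D B"
    and phi_bij: "\<lbrakk>small_cat A; small_cat B;
            X \<in> Ob (Val D A); Y \<in> Ob (Val D B); Z \<in> Ob (Val D (A \<otimes> B))\<rbrakk>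
          \<Longrightarrow> bij_betw (\<phi> A B X Y Z) (hom (Val D (A \<otimes> B)) (ext D M A B X Y) Z)
                (hom (Val D A) X (FO (rhd A B) (Y, Z)))"
    and phi_natural: "\<lbrakk>small_cat A; small_cat B;
            x \<in> hom (Val D A) X' X; y \<in> hom (Val D B) Y' Y; z \<in> hom (Val D (A \<otimes> B)) Z Z';
            h \<in> hom (Val D (A \<otimes> B)) (ext D M A B X Y) Z\<rbrakk>
          \<Longrightarrow> \<phi> A B X' Y' Z' (z \<cdot>\<^bsub>Val D (A \<otimes> B)\<^esub> (h \<cdot>\<^bsub>Val D (A \<otimes> B)\<^esub> extA D M A B x y))
            = FA (rhd A B) (y, z) \<cdot>\<^bsub>Val D A\<^esub> (\<phi> A B X Y Z h \<cdot>\<^bsub>Val D A\<^esub> x)"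
    and psi_bij: "\<lbrakk>small_cat A; small_cat B;
            X \<in> Ob (Val D A); Y \<in> Ob (Val D B); Z \<in> Ob (Val D (A \<otimes> B))\<rbrakk>
          \<Longrightarrow> bij_betw (\<psi> A B X Y Z) (hom (Val D (A \<otimes> B)) (ext D M A B X Y) Z)
                (hom (Val D B) Y (FO (lhd A B) (Z, X)))"
    and psi_natural: "\<lbrakk>small_cat A; small_cat B;
            x \<in> hom (Val D A) X' X; y \<in> hom (Val D B) Y' Y; z \<in> hom (Val D (A \<otimes> B)) Z Z';
            h \<in> hom (Val D (A \<otimes> B)) (ext D M A B X Y) Z\<rbrakk>
          \<Longrightarrow> \<psi> A B X' Y' Z' (z \<cdot>\<^bsub>Val D (A \<otimes> B)\<^esub> (h \<cdot>\<^bsub>Val D (A \<otimes> B)\<^esub> extA D M A B x y))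
            = FA (lhd A B) (z, x) \<cdot>\<^bsub>Val D B\<^esub> (\<psi> A B X Y Z h \<cdot>\<^bsub>Val D B\<^esub> y)"
begin

definition ev_rhd :: "'u scat \<Rightarrow> 'u scat \<Rightarrow> 'o \<Rightarrow> 'o \<Rightarrow> 'a" where
  "ev_rhd A B Y Z = (let W = FO (rhd A B) (Y, Z) in
     inv_into (hom (Val D (A \<otimes> B)) (ext D M A B W Y) Z) (\<phi> A B W Y Z) (Id (Val D A) W))"

definition ev_lhd :: "'u scat \<Rightarrow> 'u scat \<Rightarrow> 'o \<Rightarrow> 'o \<Rightarrow> 'a" where
  "ev_lhd A B Z X = (let W = FO (lhd A B) (Z, X) in
     inv_into (hom (Val D (A \<otimes> B)) (ext D M A B X W) Z) (\<psi> A B X W Z) (Id (Val D B) W))"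

text \<open>The canonical mates \<open>u\<^sup>*(Y \<rhd> Z) \<rightarrow> Y \<rhd> (u \<times> 1)\<^sup>*Z\<close> for \<open>Y \<in> \<bbbD>(B)\<close>, and \<open>v\<^sup>*(Z \<lhd> X) \<rightarrow> (1 \<times> v)\<^sup>*Z \<lhd> X\<close>
  for \<open>X \<in> \<bbbD>(A)\<close>, the first being the transpose of
  \<open>u\<^sup>*(Y \<rhd> Z) \<star> Y \<rightarrow> (u \<times> 1)\<^sup>*((Y \<rhd> Z) \<star> Y) \<rightarrow> (u \<times> 1)\<^sup>*Z\<close>.\<close>

definition mate_rhd :: "'u sfun \<Rightarrow> 'u scat \<Rightarrow> 'o \<Rightarrow> 'o \<Rightarrow> 'a" where
  "mate_rhd u B Y Z = (let W = FO (rhd (Tgt u) B) (Y, Z) in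
     \<phi> (Src u) B (rs D u W) Y (rs D (u \<otimes>\<^sub>F idF B) Z)
       (rsA D (u \<otimes>\<^sub>F idF B) (ev_rhd (Tgt u) B Y Z) \<cdot>\<^bsub>Val D (Src u \<otimes> B)\<^esub>
          ext_mu D M u (idF B) W Y))"

definition mate_lhd :: "'u scat \<Rightarrow> 'u sfun \<Rightarrow> 'o \<Rightarrow> 'o \<Rightarrow> 'a" where
  "mate_lhd A v Z X = (let W = FO (lhd A (Tgt v)) (Z, X) in
     \<psi> A (Src v) X (rs D v W) (rs D (idF A \<otimes>\<^sub>F v) Z)
       (rsA D (idF A \<otimes>\<^sub>F v) (ev_lhd A (Tgt v) Z X) \<cdot>\<^bsub>Val D (A \<otimes> Src v)\<^esub>
          ext_mu D M (idF A) v X W))"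

end

locale closed_two_variable_adjunction = two_variable_adjunction D M rhd lhd \<phi> \<psi>
  for D :: "('u::universe, 'o, 'a) pder" and M and rhd and lhd and \<phi> and \<psi> +
  assumes mate_rhd_iso: "\<lbrakk>small_fun u; small_cat B; Y \<in> Ob (Val D B); Z \<in> Ob (Val D (Tgt u \<otimes> B))\<rbrakk>
          \<Longrightarrow> iso (Val D (Src u)) (mate_rhd u B Y Z)"
    and mate_lhd_iso: "\<lbrakk>small_cat A; small_fun v; X \<in> Ob (Val D A); Z \<in> Ob (Val D (A \<otimes> Tgt v))\<rbrakk>
          \<Longrightarrow> iso (Val D (Src v)) (mate_lhd A v Z X)"

locale closed_monoidal_derivator = monoidal_derivator D M
  for D :: "('u::universe, 'o, 'a) pder" and M :: "('u, 'o, 'a) mpder" +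
  assumes closed: "\<exists>rhd lhd \<phi> \<psi>. closed_two_variable_adjunction D M rhd lhd \<phi> \<psi>"


section \<open>The affine line\<close>

definition natcat :: "'u::universe scat" ("\<N>") where
  "\<N> = mk_cat {unat 0} (range unat) (\<lambda>_. unat 0) (\<lambda>_. unat 0) (\<lambda>_. unat 0)
     (\<lambda>g f. unat (inv unat g + inv unat f))"

definition incl :: "'u::universe sfun" where
  "incl = point \<N> (unat 0)"

definition plus :: "'u::universe sfun" where
  "plus = mk_fun (\<N> \<otimes> \<N>) \<N> (\<lambda>_. unat 0) (\<lambda>f. unat (inv unat (ufst f) + inv unat (usnd f)))"

definition affine_line :: "('u::universe, 'o, 'a) pder \<Rightarrow> ('u, 'o, 'a) pder" where
  "affine_line D = shift D \<N>"

text \<open>The reordering \<open>(\<nat> \<times> \<nat>) \<times> (I \<times> J) \<rightarrow> (\<nat> \<times> I) \<times> (\<nat> \<times> J)\<close>.\<close>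

definition reorder :: "'u::universe scat \<Rightarrow> 'u scat \<Rightarrow> 'u sfun" where
  "reorder I J = \<langle>pr1 \<N> \<N> \<otimes>\<^sub>F pr1 I J, pr2 \<N> \<N> \<otimes>\<^sub>F pr2 I J\<rangle>"

abbreviation plus_times :: "'u::universe scat \<Rightarrow> 'u sfun" where
  "plus_times K \<equiv> plus \<otimes>\<^sub>F idF K"

context
  fixes D :: "('u::universe, 'o, 'a) pder" and M :: "('u, 'o, 'a) mpder"
begin

text \<open>\<open>aext_pre I J X Y\<close> is \<open>X \<star> Y\<close> reordered to an object of \<open>\<bbbD>((\<nat> \<times> \<nat>) \<times> (I \<times> J))\<close>, and \<open>aext I J X Y\<close>
  the external product of the affine line.\<close>

definition aext_pre :: "'u scat \<Rightarrow> 'u scat \<Rightarrow> 'o \<Rightarrow> 'o \<Rightarrow> 'o" where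
  "aext_pre I J X Y = rs D (reorder I J) (ext D M (\<N> \<otimes> I) (\<N> \<otimes> J) X Y)"

definition aext :: "'u scat \<Rightarrow> 'u scat \<Rightarrow> 'o \<Rightarrow> 'o \<Rightarrow> 'o" where
  "aext I J X Y = lan D (plus_times (I \<otimes> J)) (aext_pre I J X Y)"

definition aextA :: "'u scat \<Rightarrow> 'u scat \<Rightarrow> 'a \<Rightarrow> 'a \<Rightarrow> 'a" where
  "aextA I J f g = FA (ladj (Res D (plus_times (I \<otimes> J))))
     (rsA D (reorder I J) (extA D M (\<N> \<otimes> I) (\<N> \<otimes> J) f g))"

text \<open>
  Its pseudonaturality constraint
  \<open>(1 \<times> u)\<^sup>*X \<star> (1 \<times> v)\<^sup>*Y \<rightarrow> (1 \<times> u \<times> v)\<^sup>*(X \<star> Y)\<close> (with the external products of the affine line):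
  the constraint of \<open>\<star>\<close> on \<open>\<bbbD>\<close>, followed by the Beck--Chevalley map
  \<open>(+ \<times> 1)\<^sub>! (1 \<times> u \<times> v)\<^sup>* \<rightarrow> (1 \<times> u \<times> v)\<^sup>* (+ \<times> 1)\<^sub>!\<close>.
\<close>

definition aext_mu :: "'u sfun \<Rightarrow> 'u sfun \<Rightarrow> 'o \<Rightarrow> 'o \<Rightarrow> 'a" where
  "aext_mu u v X Y =
     (let I = Src u; J = Src v; I' = Tgt u; J' = Tgt v;
          w = idF (\<N> \<otimes> \<N>) \<otimes>\<^sub>F (u \<otimes>\<^sub>F v); w' = idF \<N> \<otimes>\<^sub>F (u \<otimes>\<^sub>F v)
      in ltransp (Res D (plus_times (I \<otimes> J))) (rs D w' (aext I' J' X Y))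
           (rsA D w (ladj_unit (Res D (plus_times (I' \<otimes> J'))) (aext_pre I' J' X Y))
              \<cdot>\<^bsub>Val D ((\<N> \<otimes> \<N>) \<otimes> (I \<otimes> J))\<^esub>
            rsA D (reorder I J) (ext_mu D M (idF \<N> \<otimes>\<^sub>F u) (idF \<N> \<otimes>\<^sub>F v) X Y)))"

text \<open>The internal product \<open>\<otimes>\<^sub>A = \<Delta>\<^sub>A\<^sup>* \<star>\<close> on \<open>\<bbbD>(\<nat> \<times> A)\<close>, as a functor and on objects.\<close>

definition aTen :: "'u scat \<Rightarrow> ('o \<times> 'o, 'a \<times> 'a, 'o, 'a) ftor" where
  "aTen A = mk_fun (prod_cat (Val D (\<N> \<otimes> A)) (Val D (\<N> \<otimes> A))) (Val D (\<N> \<otimes> A))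
     (\<lambda>(X, Y). rs D (idF \<N> \<otimes>\<^sub>F diag A) (aext A A X Y))
     (\<lambda>(f, g). rsA D (idF \<N> \<otimes>\<^sub>F diag A) (aextA A A f g))"

abbreviation aten :: "'u scat \<Rightarrow> 'o \<Rightarrow> 'o \<Rightarrow> 'o" where
  "aten A X Y \<equiv> FO (aTen A) (X, Y)"

definition aUnt :: "'u scat \<Rightarrow> 'o" where
  "aUnt A = rs D (pr1 \<N> A) (lan D incl (Unt (Mon M \<e>)))"

text \<open>
  The associator and the unitors of the affine line are the unique maps compatible with those of
  \<open>\<bbbD>\<close> via the universal maps \<open>bil A X Y : p\<^sub>1\<^sup>*X \<otimes> p\<^sub>2\<^sup>*Y \<rightarrow> (+ \<times> 1\<^sub>A)\<^sup>*(X \<otimes>\<^sub>A Y)\<close> in \<open>\<bbbD>((\<nat> \<times> \<nat>) \<times> A)\<close>, where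
  \<open>p\<^sub>1, p\<^sub>2 : (\<nat> \<times> \<nat>) \<times> A \<rightarrow> \<nat> \<times> A\<close> are the projections and the product on the right is that of the
  affine line.  The map \<open>bil A X Y\<close> is \<open>d\<^sup>*\<pi>\<^sub>1\<^sup>*X \<otimes> d\<^sup>*\<pi>\<^sub>2\<^sup>*Y \<rightarrow> d\<^sup>*(X \<star> Y)\<close> for the functor
  \<open>d : (\<nat> \<times> \<nat>) \<times> A \<rightarrow> (\<nat> \<times> A) \<times> (\<nat> \<times> A)\<close> that duplicates \<open>A\<close>, followed by the restriction along
  \<open>1 \<times> \<Delta>\<^sub>A\<close> of the unit of \<open>(+ \<times> 1)\<^sub>!\<close>.
\<close>

abbreviation p1 :: "'u scat \<Rightarrow> 'u sfun" where
  "p1 A \<equiv> pr1 \<N> \<N> \<otimes>\<^sub>F idF A"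

abbreviation p2 :: "'u scat \<Rightarrow> 'u sfun" where
  "p2 A \<equiv> pr2 \<N> \<N> \<otimes>\<^sub>F idF A"

definition bil :: "'u scat \<Rightarrow> 'o \<Rightarrow> 'o \<Rightarrow> 'a" where
  "bil A X Y =
     (let \<delta> = idF (\<N> \<otimes> \<N>) \<otimes>\<^sub>F diag A
      in rsA D \<delta> (ladj_unit (Res D (plus_times (A \<otimes> A))) (aext_pre A A X Y))
           \<cdot>\<^bsub>Val D ((\<N> \<otimes> \<N>) \<otimes> A)\<^esub>
         Mu M (reorder A A \<odot> \<delta>)
           (rs D (pr1 (\<N> \<otimes> A) (\<N> \<otimes> A)) X) (rs D (pr2 (\<N> \<otimes> A) (\<N> \<otimes> A)) Y))"

text \<open>
  In \<open>((\<nat> \<times> \<nat>) \<times> \<nat>) \<times> A\<close>, with objects and morphisms written \<open>(((k, m), n), x)\<close>: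
  \<open>q12\<close> and \<open>q23\<close> are the projections to \<open>((k, m), x)\<close> and \<open>((m, n), x)\<close>, \<open>q1\<close>, \<open>q2\<close>, \<open>q3\<close> those to
  \<open>(k, x)\<close>, \<open>(m, x)\<close> and \<open>(n, x)\<close>, and \<open>r1\<close>, \<open>r2\<close> are the functors to \<open>((k + m, n), x)\<close> and \<open>((k, m + n), x)\<close>.
\<close>

abbreviation q12 :: "'u scat \<Rightarrow> 'u sfun" where
  "q12 A \<equiv> pr1 (\<N> \<otimes> \<N>) \<N> \<otimes>\<^sub>F idF A"

abbreviation q23 :: "'u scat \<Rightarrow> 'u sfun" where
  "q23 A \<equiv> (pr2 \<N> \<N> \<otimes>\<^sub>F idF \<N>) \<otimes>\<^sub>F idF A"

abbreviation q1 :: "'u scat \<Rightarrow> 'u sfun" where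
  "q1 A \<equiv> p1 A \<odot> q12 A"

abbreviation q2 :: "'u scat \<Rightarrow> 'u sfun" where
  "q2 A \<equiv> p2 A \<odot> q12 A"

abbreviation q3 :: "'u scat \<Rightarrow> 'u sfun" where
  "q3 A \<equiv> p2 A \<odot> q23 A"

abbreviation r1 :: "'u scat \<Rightarrow> 'u sfun" where
  "r1 A \<equiv> (plus \<otimes>\<^sub>F idF \<N>) \<otimes>\<^sub>F idF A"

abbreviation r2 :: "'u scat \<Rightarrow> 'u sfun" where
  "r2 A \<equiv> \<langle>pr1 \<N> \<N> \<odot> pr1 (\<N> \<otimes> \<N>) \<N>, plus \<odot> (pr2 \<N> \<N> \<otimes>\<^sub>F idF \<N>)\<rangle> \<otimes>\<^sub>F idF A"

text \<open>The maps \<open>(q\<^sub>1\<^sup>*X \<otimes> q\<^sub>2\<^sup>*Y) \<otimes> q\<^sub>3\<^sup>*Z \<rightarrow> s\<^sup>*((X \<otimes> Y) \<otimes> Z)\<close> and \<open>q\<^sub>1\<^sup>*X \<otimes> (q\<^sub>2\<^sup>*Y \<otimes> q\<^sub>3\<^sup>*Z) \<rightarrow> s\<^sup>*(X \<otimes> (Y \<otimes> Z))\<close>,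
  with \<open>s\<close> the sum \<open>(((k, m), n), x) \<mapsto> (k + m + n, x)\<close> and the products on the right those of the
  affine line.\<close>

definition tri_left :: "'u scat \<Rightarrow> 'o \<Rightarrow> 'o \<Rightarrow> 'o \<Rightarrow> 'a" where
  "tri_left A X Y Z =
     (let K = ((\<N> \<otimes> \<N>) \<otimes> \<N>) \<otimes> A
      in rsA D (r1 A) (bil A (aten A X Y) Z)
           \<cdot>\<^bsub>Val D K\<^esub>
         (Mu M (r1 A) (rs D (p1 A) (aten A X Y)) (rs D (p2 A) Z)
           \<cdot>\<^bsub>Val D K\<^esub>
          tenA (Mon M K)
            (rsA D (q12 A) (bil A X Y) \<cdot>\<^bsub>Val D K\<^esub> Mu M (q12 A) (rs D (p1 A) X) (rs D (p2 A) Y))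
            (Id (Val D K) (rs D (q3 A) Z))))"

definition tri_right :: "'u scat \<Rightarrow> 'o \<Rightarrow> 'o \<Rightarrow> 'o \<Rightarrow> 'a" where
  "tri_right A X Y Z =
     (let K = ((\<N> \<otimes> \<N>) \<otimes> \<N>) \<otimes> A
      in rsA D (r2 A) (bil A X (aten A Y Z))
           \<cdot>\<^bsub>Val D K\<^esub>
         (Mu M (r2 A) (rs D (p1 A) X) (rs D (p2 A) (aten A Y Z))
           \<cdot>\<^bsub>Val D K\<^esub>
          tenA (Mon M K)
            (Id (Val D K) (rs D (q1 A) X))
            (rsA D (q23 A) (bil A Y Z) \<cdot>\<^bsub>Val D K\<^esub> Mu M (q23 A) (rs D (p1 A) Y) (rs D (p2 A) Z))))"

definition aAsc :: "'u scat \<Rightarrow> 'o \<Rightarrow> 'o \<Rightarrow> 'o \<Rightarrow> 'a" where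
  "aAsc A X Y Z = (THE a.
     a \<in> hom (Val D (\<N> \<otimes> A)) (aten A (aten A X Y) Z) (aten A X (aten A Y Z)) \<and>
     rsA D (plus_times A \<odot> r1 A) a \<cdot>\<^bsub>Val D (((\<N> \<otimes> \<N>) \<otimes> \<N>) \<otimes> A)\<^esub> tri_left A X Y Z
       = tri_right A X Y Z \<cdot>\<^bsub>Val D (((\<N> \<otimes> \<N>) \<otimes> \<N>) \<otimes> A)\<^esub>
           Asc (Mon M (((\<N> \<otimes> \<N>) \<otimes> \<N>) \<otimes> A)) (rs D (q1 A) X) (rs D (q2 A) Y) (rs D (q3 A) Z))"

text \<open>
  The functors \<open>(n, x) \<mapsto> ((0, n), x)\<close> and \<open>(n, x) \<mapsto> ((n, 0), x)\<close> from \<open>\<nat> \<times> A\<close> to \<open>(\<nat> \<times> \<nat>) \<times> A\<close>, and the map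
  \<open>1 \<rightarrow> \<pi>\<^sup>*i\<^sup>*i\<^sub>!1\<close> in \<open>\<bbbD>(\<nat> \<times> A)\<close>.
\<close>

abbreviation zero_left :: "'u scat \<Rightarrow> 'u sfun" where
  "zero_left A \<equiv> \<langle>incl \<odot> bang \<N>, idF \<N>\<rangle> \<otimes>\<^sub>F idF A"

abbreviation zero_right :: "'u scat \<Rightarrow> 'u sfun" where
  "zero_right A \<equiv> \<langle>idF \<N>, incl \<odot> bang \<N>\<rangle> \<otimes>\<^sub>F idF A"

definition unit_map :: "'u scat \<Rightarrow> 'a" where
  "unit_map A = rsA D (bang (\<N> \<otimes> A)) (ladj_unit (Res D incl) (Unt (Mon M \<e>)))
     \<cdot>\<^bsub>Val D (\<N> \<otimes> A)\<^esub> Mu0 M (bang (\<N> \<otimes> A))"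

definition aLun :: "'u scat \<Rightarrow> 'o \<Rightarrow> 'a" where
  "aLun A X = (let C = Val D (\<N> \<otimes> A) in THE l.
     l \<in> hom C (aten A (aUnt A) X) X \<and>
     l \<cdot>\<^bsub>C\<^esub> (rsA D (zero_left A) (bil A (aUnt A) X) \<cdot>\<^bsub>C\<^esub>
       (Mu M (zero_left A) (rs D (p1 A) (aUnt A)) (rs D (p2 A) X) \<cdot>\<^bsub>C\<^esub>
        tenA (Mon M (\<N> \<otimes> A)) (unit_map A) (Id C X)))
       = Lun (Mon M (\<N> \<otimes> A)) X)"

definition aRun :: "'u scat \<Rightarrow> 'o \<Rightarrow> 'a" where
  "aRun A X = (let C = Val D (\<N> \<otimes> A) in THE r.
     r \<in> hom C (aten A X (aUnt A)) X \<and>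
     r \<cdot>\<^bsub>C\<^esub> (rsA D (zero_right A) (bil A X (aUnt A)) \<cdot>\<^bsub>C\<^esub>
       (Mu M (zero_right A) (rs D (p1 A) X) (rs D (p2 A) (aUnt A)) \<cdot>\<^bsub>C\<^esub>
        tenA (Mon M (\<N> \<otimes> A)) (Id C X) (unit_map A)))
       = Run (Mon M (\<N> \<otimes> A)) X)"

text \<open>The unit constraint is an identity, because \<open>(1 \<times> u)\<^sup>* pr\<^sup>* = pr\<^sup>*\<close>.\<close>

definition affine_line_monoidal :: "('u, 'o, 'a) mpder" where
  "affine_line_monoidal =
     \<lparr>Mon = (\<lambda>A. \<lparr>Ten = aTen A, Unt = aUnt A, Asc = aAsc A, Lun = aLun A, Run = aRun A\<rparr>),
      Mu = (\<lambda>u X Y. rsA D (idF \<N> \<otimes>\<^sub>F diag (Src u)) (aext_mu u u X Y)),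
      Mu0 = (\<lambda>u. Id (Val D (\<N> \<otimes> Src u)) (aUnt (Src u)))\<rparr>"

end

end

theory Submission
  imports Defs
begin

text \<open>
  Everything is reduced to universal arrows: \<open>\<eta> : X \<rightarrow> u\<^sup>*Y\<close> is universal along \<open>u\<close> if it exhibits \<open>Y\<close> as
  \<open>u\<^sub>!X\<close>.  By (Der2) and (Der4), universality along \<open>u \<times> 1\<^sub>K\<close> is detected at the objects of \<open>K\<close>, hence it is
  stable under base change in \<open>K\<close>; by cocontinuity of the product, an external product of a universal
  arrow with an identity is universal.

  The product of the affine line comes with a universal arrow \<open>p\<^sub>1\<^sup>*X \<otimes> p\<^sub>2\<^sup>*Y \<rightarrow> (+ \<times> 1)\<^sup>*(X \<otimes> Y)\<close>.  Restricting it
  along \<open>k, m : K \<rightarrow> \<nat>\<close> and \<open>t : K \<rightarrow> A\<close> yields multiplications \<open>X\<^sub>k \<otimes> Y\<^sub>m \<rightarrow> (X \<otimes> Y)\<^bsub>k + m\<^esub>\<close> inside the one monoidal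
  category \<open>\<bbbD>(K)\<close>, like those of a graded algebra.  Their iterates in three and four variables are again
  universal for generic \<open>k, m, \<dots>\<close>, and inserting units gives isomorphisms.  So every coherence law of the
  affine line may be tested after composition with such an iterate, where it becomes the corresponding
  law of \<open>\<bbbD>(K)\<close>.

  The external product of the affine line is \<open>\<sigma>\<^sub>!(X \<star> Y)\<close> for the functor
  \<open>\<sigma> : (\<nat> \<times> A) \<times> (\<nat> \<times> B) \<rightarrow> \<nat> \<times> (A \<times> B)\<close> that adds the first components.  Cocontinuity follows from that of
  \<open>\<bbbD>\<close> by cancelling universal arrows, and \<open>Y \<rhd> \<sigma>\<^sup>*Z\<close>, \<open>\<sigma>\<^sup>*Z \<lhd> X\<close> are the internal homs; their mates are
  literally mates of \<open>\<bbbD>\<close>, because \<open>\<sigma>\<close> is strictly natural in \<open>A\<close> and \<open>B\<close>.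
\<close>

section \<open>Small sets\<close>

text \<open>Two obstacles shape the argument. Left adjoints are picked by choice, so no identity
  between composites of them holds on the nose; being universal is a property of a single arrow,
  stable under composition, cancellation and isomorphism, and it replaces every comparison of chosen
  adjoints. Moreover, iterated products live over differently bracketed powers of
  \<open>\<N>\<close>. Pulling everything back along functors
  \<open>k, l, m : K \<rightarrow> \<N>\<close> removes this: rebracketing becomes a change of
  \<open>K\<close>, while addition of functors into \<open>\<N>\<close> is strictly associative and
  unital, so the arrows to be compared lie in one category. Base change has a geometric source: the
  slice of \<open>1 \<times> u\<close> over \<open>(l, b)\<close> is the product of
  \<open>L/l\<close> with \<open>u/b\<close>, and \<open>L/l\<close> has a terminal object, so
  \<open>u/b\<close> is a reflective, hence final, subcategory. The dual statement for right Kan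
  extensions takes no second slice argument: it follows from base change for \<open>ins L l\<close>
  by passing to right adjoints.\<close>

lemma upair_eq [simp]: "upair a b = upair c d \<longleftrightarrow> a = c \<and> b = d"
  by (metis ufst_upair usnd_upair)

lemma unat_eq [simp]: "unat m = unat n \<longleftrightarrow> m = n"
  by (simp add: inj_eq[OF inj_unat])

lemma inv_unat [simp]: "inv unat (unat n) = n"
  by (rule inv_f_f[OF inj_unat])

section \<open>Cardinal arithmetic of small sets\<close>

lemma small_subset: "small T \<Longrightarrow> S \<subseteq> T \<Longrightarrow> small S"
  unfolding small_def by (meson lesspoll_trans1 subset_imp_lepoll)

lemma infinite_UNIV_universe: "infinite (UNIV :: 'u::universe set)"
  by (rule uncountable_infinite[OF uncountable_UNIV])

text \<open>A countable set embeds into the universe through \<open>unat\<close>; equipollence with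
  the universe would make the universe countable, against \<open>uncountable_UNIV\<close>.\<close>

lemma small_countable: "countable S \<Longrightarrow> small (S :: 'u::universe set)"
  unfolding small_def lesspoll_def
proof
  assume S: "countable S"
  have f: "inj (unat :: nat \<Rightarrow> 'u)" by (rule inj_unat)
  obtain g :: "'u \<Rightarrow> nat" where "inj_on g S" using S unfolding countable_def by blast
  then have "inj_on (unat \<circ> g :: 'u \<Rightarrow> 'u) S" using f by (meson comp_inj_on inj_on_subset subset_UNIV)
  then show "S \<lesssim> (UNIV :: 'u set)" unfolding lepoll_def by blast
  show "\<not> S \<approx> (UNIV :: 'u set)"
    using S uncountable_UNIV countable_eqpoll eqpoll_sym by blast
qed

lemma small_image: "small S \<Longrightarrow> small (f ` S)"
  for f :: "'u::universe \<Rightarrow> 'u"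
  unfolding small_def by (rule lesspoll_trans1[OF image_lepoll])

lemma lepoll_iff_ordLeq: "S \<lesssim> T \<longleftrightarrow> (card_of S, card_of T) \<in> ordLeq"
  unfolding lepoll_def by (rule card_of_ordLeq)

text \<open>Absorption in cardinal arithmetic: a product with an infinite factor has the size of its
  larger factor. The empty \<open>S\<close> is split off because
  \<open>card_of_Times_infinite\<close> asks for a nonempty one.\<close>

lemma infinite_Times_lepoll:
  fixes S :: "'a set" and T :: "'b set"
  assumes "infinite T" "S \<lesssim> T"
  shows "S \<times> T \<lesssim> T"
proof (cases "S = {}")
  case False
  have "(card_of (T \<times> S), card_of T) \<in> ordIso"
    using card_of_Times_infinite[OF assms(1) False] assms(2) by (simp add: lepoll_iff_ordLeq)
  then have "T \<times> S \<lesssim> T" by (simp add: lepoll_iff_ordLeq ordIso_iff_ordLeq)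
  then show ?thesis using lepoll_trans1 times_commute_eqpoll by blast
qed simp

lemma lepoll_finite: "S \<lesssim> T \<Longrightarrow> finite T \<Longrightarrow> finite S"
  unfolding lepoll_def by (meson finite_imageD finite_subset)

text \<open>The universe may have any uncountable cardinality, so the bound comes from absorption
  alone: either both factors are finite, or the larger one is infinite and already bounds the
  product.\<close>

lemma small_Times:
  fixes S T :: "'u::universe set"
  assumes S: "small S" and T: "small T"
  shows "S \<times> T \<prec> (UNIV :: 'u set)"
proof (cases "finite S \<and> finite T")
  case True
  then have "finite (S \<times> T)" by blast
  then have "S \<times> T \<lesssim> (UNIV :: 'u set)" "\<not> S \<times> T \<approx> (UNIV :: 'u set)"
    using finite_lepoll_infinite[OF infinite_UNIV_universe] eqpoll_finite_iff infinite_UNIV_universe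
    by auto
  then show ?thesis by (simp add: lesspoll_def)
next
  case False
  have tot: "S \<lesssim> T \<or> T \<lesssim> S"
    unfolding lepoll_iff_ordLeq by (rule ordLeq_total[OF card_of_Well_order card_of_Well_order])
  show ?thesis
  proof (cases "infinite T \<and> S \<lesssim> T")
    case True
    then have "S \<times> T \<lesssim> T" by (simp add: infinite_Times_lepoll)
    then show ?thesis by (rule lesspoll_trans1[OF _ T[unfolded small_def]])
  next
    case F: False
    have S': "infinite S" using F False tot lepoll_finite[of T S] by metis
    then have S'': "T \<lesssim> S" using F tot lepoll_finite[of S T] by metis
    have "S \<times> T \<lesssim> S"
      by (rule lepoll_trans1[OF times_commute_eqpoll infinite_Times_lepoll[OF S' S'']])
    then show ?thesis by (rule lesspoll_trans1[OF _ S[unfolded small_def]])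
  qed
qed

lemma small_image2: "small S \<Longrightarrow> small T \<Longrightarrow> small {f x y |x y. x \<in> S \<and> y \<in> T}"
  for f :: "'u::universe \<Rightarrow> 'u \<Rightarrow> 'u"
proof -
  assume "small S" "small T"
  then have "(\<lambda>(x, y). f x y) ` (S \<times> T) \<prec> (UNIV :: 'u set)"
    by (intro lesspoll_trans1[OF image_lepoll] small_Times)
  moreover have "(\<lambda>(x, y). f x y) ` (S \<times> T) = {f x y |x y. x \<in> S \<and> y \<in> T}" by auto
  ultimately show ?thesis by (simp add: small_def)
qed

text \<open>If both sets are inhabited, their union is an image of
  \<open>{0, 1} \<times> S \<times> T\<close>: the tag selects which coordinate to read. Thus
  products already give unions.\<close>

lemma small_Un:
  assumes "small S" "small (T :: 'u::universe set)"
  shows "small (S \<union> T)"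
proof (cases "S = {} \<or> T = {}")
  case False
  then obtain s t where st: "s \<in> S" "t \<in> T" by blast
  define P where "P = {upair x y |x y. x \<in> S \<and> y \<in> T}"
  define Q where "Q = {upair i p |i p. i \<in> {unat 0, unat 1} \<and> p \<in> P}"
  have "small Q"
    unfolding Q_def P_def by (intro small_image2 assms small_countable) auto
  moreover have "unat 0 \<noteq> (unat 1 :: 'u)" by simp
  then have "S \<union> T \<subseteq> (\<lambda>q. if ufst q = unat 0 then ufst (usnd q) else usnd (usnd q)) ` Q"
  proof (intro subsetI)
    fix x assume ne: "unat 0 \<noteq> (unat 1 :: 'u)" and "x \<in> S \<union> T"
    then consider "x \<in> S" | "x \<in> T" by blast
    then show "x \<in> (\<lambda>q. if ufst q = unat 0 then ufst (usnd q) else usnd (usnd q)) ` Q"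
    proof cases
      case 1
      then have "upair (unat 0) (upair x t) \<in> Q" using st by (auto simp: Q_def P_def)
      then show ?thesis by (rule rev_image_eqI) simp
    next
      case 2
      then have "upair (unat 1) (upair s x) \<in> Q" using st by (auto simp: Q_def P_def)
      then show ?thesis by (rule rev_image_eqI) (use ne in simp)
    qed
  qed
  ultimately show ?thesis using small_image small_subset by blast
qed (use assms in auto)

text \<open>Only finite unions can be expected, since the cardinality of the universe may be
  singular.\<close>

lemma small_UN: "(\<And>i. i < (n::nat) \<Longrightarrow> small (S i)) \<Longrightarrow> small (\<Union>i<n. S i)"
proof (induction n)
  case (Suc n)
  then have "small (S n \<union> (\<Union>i<n. S i))" by (intro small_Un) auto
  then show ?case by (simp add: lessThan_Suc)
qed (simp add: small_countable)

section \<open>Categories and functors\<close>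

lemma hom_iff: "f \<in> hom C x y \<longleftrightarrow> f \<in> Ar C \<and> Dom C f = x \<and> Cod C f = y"
  by (auto simp: hom_def)

context category
begin

lemma Ar_hom: "f \<in> Ar C \<Longrightarrow> f \<in> hom C (Dom C f) (Cod C f)"
  by (simp add: hom_iff)

lemma comp_arr:
  assumes "f \<in> Ar C" "g \<in> Ar C" "Dom C g = Cod C f"
  shows "g \<cdot>\<^bsub>C\<^esub> f \<in> Ar C" "Dom C (g \<cdot>\<^bsub>C\<^esub> f) = Dom C f" "Cod C (g \<cdot>\<^bsub>C\<^esub> f) = Cod C g"
  using Cmp_hom[of f "Dom C f" "Cod C f" g "Cod C g"] assms by (auto simp: hom_iff)

lemma Id_arr:
  assumes "x \<in> Ob C"
  shows "Id C x \<in> Ar C" "Dom C (Id C x) = x" "Cod C (Id C x) = x"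
  using Id_hom[OF assms] by (auto simp: hom_iff)

lemma comp_Id: "f \<in> Ar C \<Longrightarrow> Dom C f = x \<Longrightarrow> f \<cdot>\<^bsub>C\<^esub> Id C x = f"
  using Id_right Ar_hom by blast

lemma Id_comp: "f \<in> Ar C \<Longrightarrow> Cod C f = x \<Longrightarrow> Id C x \<cdot>\<^bsub>C\<^esub> f = f"
  using Id_left Ar_hom by blast

lemma comp_assoc:
  "\<lbrakk>f \<in> Ar C; g \<in> Ar C; h \<in> Ar C; Dom C g = Cod C f; Dom C h = Cod C g\<rbrakk>
    \<Longrightarrow> (h \<cdot>\<^bsub>C\<^esub> g) \<cdot>\<^bsub>C\<^esub> f = h \<cdot>\<^bsub>C\<^esub> (g \<cdot>\<^bsub>C\<^esub> f)"
  using Cmp_assoc[of f "Dom C f" "Cod C f" g "Cod C g" h "Cod C h"] by (simp add: hom_iff)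

lemma iso_arr: "iso C f \<Longrightarrow> f \<in> Ar C"
  by (simp add: iso_def)

lemma iso_Id: "x \<in> Ob C \<Longrightarrow> iso C (Id C x)"
  unfolding iso_def by (auto simp: Id_arr comp_Id hom_iff)

lemma isoE:
  assumes "iso C f"
  obtains g where "g \<in> Ar C" "Dom C g = Cod C f" "Cod C g = Dom C f"
    "g \<cdot>\<^bsub>C\<^esub> f = Id C (Dom C f)" "f \<cdot>\<^bsub>C\<^esub> g = Id C (Cod C f)"
  using assms by (auto simp: iso_def hom_iff)

lemma isoI:
  assumes "f \<in> Ar C" "g \<in> Ar C" "Dom C g = Cod C f" "Cod C g = Dom C f"
    "g \<cdot>\<^bsub>C\<^esub> f = Id C (Dom C f)" "f \<cdot>\<^bsub>C\<^esub> g = Id C (Cod C f)"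
  shows "iso C f"
  using assms by (auto simp: iso_def hom_iff)

lemma iso_comp:
  assumes "iso C f" "iso C g" "Dom C g = Cod C f"
  shows "iso C (g \<cdot>\<^bsub>C\<^esub> f)"
proof -
  obtain f' where f': "f' \<in> Ar C" "Dom C f' = Cod C f" "Cod C f' = Dom C f"
    "f' \<cdot>\<^bsub>C\<^esub> f = Id C (Dom C f)" "f \<cdot>\<^bsub>C\<^esub> f' = Id C (Cod C f)" using assms(1) isoE by blast
  obtain g' where g': "g' \<in> Ar C" "Dom C g' = Cod C g" "Cod C g' = Dom C g"
    "g' \<cdot>\<^bsub>C\<^esub> g = Id C (Dom C g)" "g \<cdot>\<^bsub>C\<^esub> g' = Id C (Cod C g)" using assms(2) isoE by blast
  note ar = iso_arr[OF assms(1)] iso_arr[OF assms(2)]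
  have "(f' \<cdot>\<^bsub>C\<^esub> g') \<cdot>\<^bsub>C\<^esub> (g \<cdot>\<^bsub>C\<^esub> f) = f' \<cdot>\<^bsub>C\<^esub> ((g' \<cdot>\<^bsub>C\<^esub> g) \<cdot>\<^bsub>C\<^esub> f)"
    using ar f'(1-3) g'(1-3) assms(3) by (simp add: comp_arr comp_assoc)
  moreover have "(g \<cdot>\<^bsub>C\<^esub> f) \<cdot>\<^bsub>C\<^esub> (f' \<cdot>\<^bsub>C\<^esub> g') = g \<cdot>\<^bsub>C\<^esub> ((f \<cdot>\<^bsub>C\<^esub> f') \<cdot>\<^bsub>C\<^esub> g')"
    using ar f'(1-3) g'(1-3) assms(3) by (simp add: comp_arr comp_assoc)
  ultimately show ?thesis
    by (intro isoI[of _ "f' \<cdot>\<^bsub>C\<^esub> g'"]) (use ar f' g' assms(3) in \<open>simp_all add: comp_arr Id_comp\<close>)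
qed

lemma iso_cancel_left:
  assumes g: "iso C g" and f: "f \<in> Ar C" "f' \<in> Ar C" "Cod C f = Dom C g" "Cod C f' = Dom C g"
    and eq: "g \<cdot>\<^bsub>C\<^esub> f = g \<cdot>\<^bsub>C\<^esub> f'"
  shows "f = f'"
proof -
  obtain h where h: "h \<in> Ar C" "Dom C h = Cod C g" "Cod C h = Dom C g"
    "h \<cdot>\<^bsub>C\<^esub> g = Id C (Dom C g)" using g isoE by blast
  have "h \<cdot>\<^bsub>C\<^esub> (g \<cdot>\<^bsub>C\<^esub> f) = f" "h \<cdot>\<^bsub>C\<^esub> (g \<cdot>\<^bsub>C\<^esub> f') = f'"
    using h f iso_arr[OF g] by (simp_all add: comp_assoc[symmetric] Id_comp)
  then show ?thesis using eq by metis
qed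

lemma iso_cancel_right:
  assumes g: "iso C g" and f: "f \<in> Ar C" "f' \<in> Ar C" "Dom C f = Cod C g" "Dom C f' = Cod C g"
    and eq: "f \<cdot>\<^bsub>C\<^esub> g = f' \<cdot>\<^bsub>C\<^esub> g"
  shows "f = f'"
proof -
  obtain h where h: "h \<in> Ar C" "Dom C h = Cod C g" "Cod C h = Dom C g"
    "g \<cdot>\<^bsub>C\<^esub> h = Id C (Cod C g)" using g isoE by blast
  have "(f \<cdot>\<^bsub>C\<^esub> g) \<cdot>\<^bsub>C\<^esub> h = f" "(f' \<cdot>\<^bsub>C\<^esub> g) \<cdot>\<^bsub>C\<^esub> h = f'"
    using h f iso_arr[OF g] by (simp_all add: comp_assoc comp_Id)
  then show ?thesis using eq by metis
qed

text \<open>\<open>g\<close> is the composite of \<open>g f\<close> with the inverse of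
  \<open>f\<close>.\<close>

lemma iso_cancel_comp_left:
  assumes "iso C (g \<cdot>\<^bsub>C\<^esub> f)" "iso C f" "g \<in> Ar C" "Dom C g = Cod C f"
  shows "iso C g"
proof -
  obtain h where h: "h \<in> Ar C" "Dom C h = Cod C f" "Cod C h = Dom C f"
    "f \<cdot>\<^bsub>C\<^esub> h = Id C (Cod C f)" "h \<cdot>\<^bsub>C\<^esub> f = Id C (Dom C f)" using assms(2) isoE by blast
  have "iso C h" using h iso_arr[OF assms(2)] by (intro isoI[of h f]) auto
  then have "iso C ((g \<cdot>\<^bsub>C\<^esub> f) \<cdot>\<^bsub>C\<^esub> h)"
    using assms iso_arr[OF assms(2)] h by (intro iso_comp[of h]) (simp_all add: comp_arr)
  moreover have "(g \<cdot>\<^bsub>C\<^esub> f) \<cdot>\<^bsub>C\<^esub> h = g"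
    using assms iso_arr[OF assms(2)] h by (simp add: comp_assoc comp_Id)
  ultimately show ?thesis by simp
qed

end

lemmas category_simps = category.comp_arr category.Id_arr category.comp_Id category.Id_comp
  category.Dom_in category.Cod_in

context cfunctor
begin

lemma FA_arr:
  assumes "f \<in> Ar (Src F)"
  shows "FA F f \<in> Ar (Tgt F)" "Dom (Tgt F) (FA F f) = FO F (Dom (Src F) f)"
    "Cod (Tgt F) (FA F f) = FO F (Cod (Src F) f)"
  using FA_hom[of f "Dom (Src F) f" "Cod (Src F) f"] assms by (auto simp: hom_iff)

lemma FA_comp:
  "\<lbrakk>f \<in> Ar (Src F); g \<in> Ar (Src F); Dom (Src F) g = Cod (Src F) f\<rbrakk>
    \<Longrightarrow> FA F (g \<cdot>\<^bsub>Src F\<^esub> f) = FA F g \<cdot>\<^bsub>Tgt F\<^esub> FA F f"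
  using FA_Cmp[of f "Dom (Src F) f" "Cod (Src F) f" g "Cod (Src F) g"] by (simp add: hom_iff)

lemma FA_iso:
  assumes "iso (Src F) f"
  shows "iso (Tgt F) (FA F f)"
proof -
  interpret S: category "Src F" by (rule Src_category)
  interpret T: category "Tgt F" by (rule Tgt_category)
  obtain g where "g \<in> Ar (Src F)" "Dom (Src F) g = Cod (Src F) f" "Cod (Src F) g = Dom (Src F) f"
    "g \<cdot>\<^bsub>Src F\<^esub> f = Id (Src F) (Dom (Src F) f)" "f \<cdot>\<^bsub>Src F\<^esub> g = Id (Src F) (Cod (Src F) f)"
    using assms S.isoE by blast
  then show ?thesis
    using S.iso_arr[OF assms]
    by (intro T.isoI[of _ "FA F g"])
       (simp_all add: FA_arr FA_comp[symmetric] S.Dom_in S.Cod_in FA_Id)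
qed

end

lemma cfunctor_arr:
  assumes "cfunctor F" "f \<in> Ar (Src F)"
  shows "Tgt F = D \<Longrightarrow> FA F f \<in> Ar D" "Tgt F = D \<Longrightarrow> Dom D (FA F f) = FO F (Dom (Src F) f)"
    "Tgt F = D \<Longrightarrow> Cod D (FA F f) = FO F (Cod (Src F) f)"
  using cfunctor.FA_arr[OF assms] by auto

lemma cfunctor_ob: "cfunctor F \<Longrightarrow> Tgt F = D \<Longrightarrow> x \<in> Ob (Src F) \<Longrightarrow> FO F x \<in> Ob D"
  by (auto simp: cfunctor.FO_in)

lemma cfunctor_Id: "cfunctor F \<Longrightarrow> Src F = C \<Longrightarrow> x \<in> Ob C \<Longrightarrow> FA F (Id C x) = Id (Tgt F) (FO F x)"
  by (auto simp: cfunctor.FA_Id)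

lemma cfunctor_comp:
  "\<lbrakk>cfunctor F; Src F = C; f \<in> Ar C; g \<in> Ar C; Dom C g = Cod C f\<rbrakk>
    \<Longrightarrow> FA F (g \<cdot>\<^bsub>C\<^esub> f) = FA F g \<cdot>\<^bsub>Tgt F\<^esub> FA F f"
  by (auto simp: cfunctor.FA_comp)

lemmas cfunctor_simps = cfunctor_ob cfunctor_arr cfunctor_Id cfunctor_comp
  cfunctor.Src_category cfunctor.Tgt_category

text \<open>Extensionality outside the source makes pointwise equal functors equal as records. The
  strict identities between functors rest on it.\<close>

lemma ftor_eqI:
  assumes F: "cfunctor F" and G: "cfunctor G" and "Src F = Src G" "Tgt F = Tgt G"
    and "\<And>x. x \<in> Ob (Src F) \<Longrightarrow> FO F x = FO G x" "\<And>f. f \<in> Ar (Src F) \<Longrightarrow> FA F f = FA G f"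
  shows "F = G"
proof -
  have "FO F = FO G" using cfunctor.FO_ext[OF F] cfunctor.FO_ext[OF G] assms
    by (intro extensionalityI) auto
  moreover have "FA F = FA G" using cfunctor.FA_ext[OF F] cfunctor.FA_ext[OF G] assms
    by (intro extensionalityI) auto
  ultimately show ?thesis using assms by (cases F; cases G) simp
qed

lemma mk_cat_simps [simp]:
  "Ob (mk_cat X F d c i m) = X" "Ar (mk_cat X F d c i m) = F"
  "f \<in> F \<Longrightarrow> Dom (mk_cat X F d c i m) f = d f" "f \<in> F \<Longrightarrow> Cod (mk_cat X F d c i m) f = c f"
  "x \<in> X \<Longrightarrow> Id (mk_cat X F d c i m) x = i x"
  "f \<in> F \<Longrightarrow> g \<in> F \<Longrightarrow> d g = c f \<Longrightarrow> g \<cdot>\<^bsub>mk_cat X F d c i m\<^esub> f = m g f"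
  by (auto simp: mk_cat_def)

lemma category_mk_cat:
  assumes "\<And>f. f \<in> F \<Longrightarrow> d f \<in> X" "\<And>f. f \<in> F \<Longrightarrow> c f \<in> X"
    and "\<And>x. x \<in> X \<Longrightarrow> i x \<in> F \<and> d (i x) = x \<and> c (i x) = x"
    and "\<And>f g. \<lbrakk>f \<in> F; g \<in> F; d g = c f\<rbrakk> \<Longrightarrow> m g f \<in> F \<and> d (m g f) = d f \<and> c (m g f) = c g"
    and "\<And>f. f \<in> F \<Longrightarrow> m (i (c f)) f = f" "\<And>f. f \<in> F \<Longrightarrow> m f (i (d f)) = f"
    and "\<And>f g h. \<lbrakk>f \<in> F; g \<in> F; h \<in> F; d g = c f; d h = c g\<rbrakk> \<Longrightarrow> m h (m g f) = m (m h g) f"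
  shows "category (mk_cat X F d c i m)"
proof (unfold_locales, goal_cases)
  case (4 f x y g z) then show ?case using assms(4)[of f g] by (auto simp: hom_iff)
next
  case (7 f w x g y h z)
  then have *: "f \<in> F" "g \<in> F" "h \<in> F" "d g = c f" "d h = c g" by (auto simp: hom_iff)
  then show ?case using assms(4)[of f g] assms(4)[of g h] assms(7)[of f g h] by simp
qed (auto simp: assms hom_iff mk_cat_def)

lemma mk_fun_simps [simp]:
  "Src (mk_fun C D fo fa) = C" "Tgt (mk_fun C D fo fa) = D"
  "x \<in> Ob C \<Longrightarrow> FO (mk_fun C D fo fa) x = fo x" "f \<in> Ar C \<Longrightarrow> FA (mk_fun C D fo fa) f = fa f"
  by (auto simp: mk_fun_def)

lemma cfunctor_mk_fun:
  assumes C: "category C" and D: "category D"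
    and "\<And>x. x \<in> Ob C \<Longrightarrow> fo x \<in> Ob D"
    and fa: "\<And>f. f \<in> Ar C \<Longrightarrow> fa f \<in> Ar D \<and> Dom D (fa f) = fo (Dom C f) \<and> Cod D (fa f) = fo (Cod C f)"
    and "\<And>x. x \<in> Ob C \<Longrightarrow> fa (Id C x) = Id D (fo x)"
    and cmp: "\<And>f g. \<lbrakk>f \<in> Ar C; g \<in> Ar C; Dom C g = Cod C f\<rbrakk> \<Longrightarrow> fa (g \<cdot>\<^bsub>C\<^esub> f) = fa g \<cdot>\<^bsub>D\<^esub> fa f"
  shows "cfunctor (mk_fun C D fo fa)"
proof (rule cfunctor.intro, goal_cases)
  case (6 f x y g z)
  then show ?case using category.comp_arr[OF C, of f g] cmp[of f g] by (auto simp: hom_iff)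
qed (use assms in \<open>auto simp: hom_iff category.Id_arr category.Dom_in category.Cod_in mk_fun_def\<close>)

lemma mk_nt_simps [simp]:
  "NS (mk_nt F G c) = F" "NT (mk_nt F G c) = G" "x \<in> Ob (Src F) \<Longrightarrow> NC (mk_nt F G c) x = c x"
  by (auto simp: mk_nt_def)

lemma nat_trans_mk_nt:
  assumes "cfunctor F" "cfunctor G" "Src G = Src F" "Tgt G = Tgt F"
    and "\<And>x. x \<in> Ob (Src F) \<Longrightarrow>
      c x \<in> Ar (Tgt F) \<and> Dom (Tgt F) (c x) = FO F x \<and> Cod (Tgt F) (c x) = FO G x"
    and "\<And>f. f \<in> Ar (Src F) \<Longrightarrow>
      c (Cod (Src F) f) \<cdot>\<^bsub>Tgt F\<^esub> FA F f = FA G f \<cdot>\<^bsub>Tgt F\<^esub> c (Dom (Src F) f)"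
  shows "nat_trans (mk_nt F G c)"
proof -
  have *: "category (Src F)" using assms(1) cfunctor.Src_category by blast
  show ?thesis
    using assms category.Dom_in[OF *] category.Cod_in[OF *]
    by (intro nat_trans.intro) (auto simp: hom_iff mk_nt_def)
qed

lemma idF_simps [simp]:
  "Src (idF C) = C" "Tgt (idF C) = C"
  "x \<in> Ob C \<Longrightarrow> FO (idF C) x = x" "f \<in> Ar C \<Longrightarrow> FA (idF C) f = f"
  by (simp_all add: idF_def)

lemma fcomp_simps [simp]:
  "Src (G \<odot> F) = Src F" "Tgt (G \<odot> F) = Tgt G"
  "x \<in> Ob (Src F) \<Longrightarrow> FO (G \<odot> F) x = FO G (FO F x)"
  "f \<in> Ar (Src F) \<Longrightarrow> FA (G \<odot> F) f = FA G (FA F f)"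
  by (simp_all add: fcomp_def)

lemma cfunctor_idF: "category C \<Longrightarrow> cfunctor (idF C)"
  unfolding idF_def by (rule cfunctor_mk_fun) auto

lemma cfunctor_fcomp: "cfunctor F \<Longrightarrow> cfunctor G \<Longrightarrow> Src G = Tgt F \<Longrightarrow> cfunctor (G \<odot> F)"
  unfolding fcomp_def
  by (rule cfunctor_mk_fun)
     (simp_all add: cfunctor_simps)

lemma fcomp_idF: "cfunctor F \<Longrightarrow> Src F = C \<Longrightarrow> F \<odot> idF C = F"
  by (rule ftor_eqI) (auto simp: cfunctor_fcomp cfunctor_idF cfunctor.Src_category)

lemma idF_fcomp: "cfunctor F \<Longrightarrow> Tgt F = C \<Longrightarrow> idF C \<odot> F = F"
  by (rule ftor_eqI) (auto simp: cfunctor_fcomp cfunctor_idF cfunctor.Tgt_category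
      cfunctor.FO_in cfunctor.FA_arr)

lemma fcomp_assoc:
  assumes "cfunctor F" "cfunctor G" "cfunctor H" "Src G = Tgt F" "Src H = Tgt G"
  shows "(H \<odot> G) \<odot> F = H \<odot> (G \<odot> F)"
  using assms by (intro ftor_eqI) (simp_all add: cfunctor_fcomp cfunctor_simps)

section \<open>Small categories\<close>

lemma small_fun_cfunctor: "small_fun u \<Longrightarrow> cfunctor u"
  and small_funI: "cfunctor u \<Longrightarrow> small_cat (Src u) \<Longrightarrow> small_cat (Tgt u) \<Longrightarrow> small_fun u"
  and small_fun_cat [simp]: "small_fun u \<Longrightarrow> small_cat (Src u)" "small_fun u \<Longrightarrow> small_cat (Tgt u)"
  by (simp_all add: small_fun_def)

lemma small_cat_category: "small_cat A \<Longrightarrow> category A"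
  by (simp add: small_cat_def)

text \<open>A typing judgement \<open>u : A \<rightarrow> B\<close> in one formula; with
  \<open>fn_iff\<close> it hands the simplifier source, target and all smallness conditions at
  once.\<close>

definition fn :: "'u::universe scat \<Rightarrow> 'u scat \<Rightarrow> 'u sfun set" where
  "fn A B = {u. small_fun u \<and> Src u = A \<and> Tgt u = B}"

lemma fn_iff: "u \<in> fn A B \<longleftrightarrow> small_fun u \<and> Src u = A \<and> Tgt u = B \<and> small_cat A \<and> small_cat B"
  by (auto simp: fn_def)

section \<open>Products, points and pairings of small categories\<close>

lemma Ob_times [simp]: "Ob (A \<otimes> B) = {upair a b |a b. a \<in> Ob A \<and> b \<in> Ob B}"
  and Ar_times [simp]: "Ar (A \<otimes> B) = {upair f g |f g. f \<in> Ar A \<and> g \<in> Ar B}"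
  by (simp_all add: times_def)

lemma times_simps [simp]:
  "f \<in> Ar A \<Longrightarrow> g \<in> Ar B \<Longrightarrow> Dom (A \<otimes> B) (upair f g) = upair (Dom A f) (Dom B g)"
  "f \<in> Ar A \<Longrightarrow> g \<in> Ar B \<Longrightarrow> Cod (A \<otimes> B) (upair f g) = upair (Cod A f) (Cod B g)"
  "a \<in> Ob A \<Longrightarrow> b \<in> Ob B \<Longrightarrow> Id (A \<otimes> B) (upair a b) = upair (Id A a) (Id B b)"
  "\<lbrakk>f \<in> Ar A; g \<in> Ar B; f' \<in> Ar A; g' \<in> Ar B; Dom A f' = Cod A f; Dom B g' = Cod B g\<rbrakk>
    \<Longrightarrow> upair f' g' \<cdot>\<^bsub>A \<otimes> B\<^esub> upair f g = upair (f' \<cdot>\<^bsub>A\<^esub> f) (g' \<cdot>\<^bsub>B\<^esub> g)"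
  by (simp_all add: times_def)

lemma category_times: "category A \<Longrightarrow> category B \<Longrightarrow> category (A \<otimes> B)"
  unfolding times_def
  by (rule category_mk_cat) (auto simp: category_simps category.comp_assoc)

lemma small_cat_times [simp]: "small_cat A \<Longrightarrow> small_cat B \<Longrightarrow> small_cat (A \<otimes> B)"
  by (simp add: small_cat_def category_times small_image2)

lemma small_cat_terminal [simp]: "small_cat \<e>"
  unfolding small_cat_def terminal_def
  by (intro conjI category_mk_cat) (simp_all add: small_countable)

lemma terminal_simps [simp]: "Ob \<e> = {unat 0}" "Ar \<e> = {unat 0}"
  "Dom \<e> (unat 0) = unat 0" "Cod \<e> (unat 0) = unat 0" "Id \<e> (unat 0) = unat 0"
  "unat 0 \<cdot>\<^bsub>\<e>\<^esub> unat 0 = unat 0"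
  by (simp_all add: terminal_def)

lemma small_fun_idF [simp]: "small_cat A \<Longrightarrow> small_fun (idF A)"
  by (rule small_funI) (simp_all add: cfunctor_idF small_cat_category)

lemma small_fun_fcomp [simp]:
  "small_fun u \<Longrightarrow> small_fun v \<Longrightarrow> Src v = Tgt u \<Longrightarrow> small_fun (v \<odot> u)"
  by (rule small_funI) (simp_all add: cfunctor_fcomp small_fun_cfunctor)

lemma sfun_eqI:
  assumes "small_fun u" "small_fun v" "Src u = Src v" "Tgt u = Tgt v"
    and "\<And>x. x \<in> Ob (Src u) \<Longrightarrow> FO u x = FO v x" "\<And>f. f \<in> Ar (Src u) \<Longrightarrow> FA u f = FA v f"
  shows "u = v"
  using assms by (intro ftor_eqI) (simp_all add: small_fun_cfunctor)

lemma sfcomp_idF [simp]: "small_fun u \<Longrightarrow> Src u = A \<Longrightarrow> u \<odot> idF A = u"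
  by (simp add: fcomp_idF small_fun_cfunctor)

lemma idF_sfcomp [simp]: "small_fun u \<Longrightarrow> Tgt u = A \<Longrightarrow> idF A \<odot> u = u"
  by (simp add: idF_fcomp small_fun_cfunctor)

text \<open>Right-nested composites are the normal form; with the rules for pairings and projections
  below, equations between structural functors become a matter of rewriting.\<close>

lemma sfcomp_assoc [simp]:
  "\<lbrakk>small_fun u; small_fun v; small_fun w; Src v = Tgt u; Src w = Tgt v\<rbrakk>
    \<Longrightarrow> (w \<odot> v) \<odot> u = w \<odot> (v \<odot> u)"
  by (simp add: fcomp_assoc small_fun_cfunctor)

lemma sfun_ob: "small_fun u \<Longrightarrow> Tgt u = B \<Longrightarrow> x \<in> Ob (Src u) \<Longrightarrow> FO u x \<in> Ob B"
  by (simp add: cfunctor_simps small_fun_cfunctor)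

lemma sfun_arr:
  assumes "small_fun u" "Tgt u = B" "f \<in> Ar (Src u)"
  shows "FA u f \<in> Ar B" "Dom B (FA u f) = FO u (Dom (Src u) f)" "Cod B (FA u f) = FO u (Cod (Src u) f)"
  using assms by (simp_all add: cfunctor_simps small_fun_cfunctor)

lemmas sfun_simps = sfun_ob sfun_arr cfunctor_Id[OF small_fun_cfunctor]
  cfunctor_comp[OF small_fun_cfunctor] small_cat_category

lemma pr_simps [simp]:
  "Src (pr1 A B) = A \<otimes> B" "Tgt (pr1 A B) = A" "Src (pr2 A B) = A \<otimes> B" "Tgt (pr2 A B) = B"
  "a \<in> Ob A \<Longrightarrow> b \<in> Ob B \<Longrightarrow> FO (pr1 A B) (upair a b) = a"
  "a \<in> Ob A \<Longrightarrow> b \<in> Ob B \<Longrightarrow> FO (pr2 A B) (upair a b) = b"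
  "f \<in> Ar A \<Longrightarrow> g \<in> Ar B \<Longrightarrow> FA (pr1 A B) (upair f g) = f"
  "f \<in> Ar A \<Longrightarrow> g \<in> Ar B \<Longrightarrow> FA (pr2 A B) (upair f g) = g"
  by (simp_all add: pr1_def pr2_def)

lemma small_fun_pr [simp]:
  assumes "small_cat A" "small_cat B"
  shows "small_fun (pr1 A B)" "small_fun (pr2 A B)"
  using assms unfolding pr1_def pr2_def
  by (auto intro!: small_funI cfunctor_mk_fun simp: small_cat_category category_times category_simps)

lemma pairF_simps [simp]:
  "Src \<langle>u, v\<rangle> = Src u" "Tgt \<langle>u, v\<rangle> = Tgt u \<otimes> Tgt v"
  "x \<in> Ob (Src u) \<Longrightarrow> FO \<langle>u, v\<rangle> x = upair (FO u x) (FO v x)"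
  "f \<in> Ar (Src u) \<Longrightarrow> FA \<langle>u, v\<rangle> f = upair (FA u f) (FA v f)"
  by (simp_all add: pairF_def)

lemma small_fun_pairF [simp]:
  assumes "small_fun u" "small_fun v" "Src u = Src v"
  shows "small_fun \<langle>u, v\<rangle>"
proof -
  have "cfunctor \<langle>u, v\<rangle>"
    unfolding pairF_def using assms
    by (intro cfunctor_mk_fun) (auto simp: category_times sfun_simps category_simps)
  then show ?thesis using assms by (intro small_funI) simp_all
qed

lemma bang_simps [simp]: "Src (bang A) = A" "Tgt (bang A) = \<e>"
  "x \<in> Ob A \<Longrightarrow> FO (bang A) x = unat 0" "f \<in> Ar A \<Longrightarrow> FA (bang A) f = unat 0"
  by (simp_all add: bang_def)

lemma small_fun_bang [simp]: "small_cat A \<Longrightarrow> small_fun (bang A)"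
  unfolding bang_def by (auto intro!: small_funI cfunctor_mk_fun simp: small_cat_category)

lemma point_simps [simp]: "Src (point A a) = \<e>" "Tgt (point A a) = A"
  "FO (point A a) (unat 0) = a" "FA (point A a) (unat 0) = Id A a"
  by (simp_all add: point_def)

lemma small_fun_point [simp]: "small_cat A \<Longrightarrow> a \<in> Ob A \<Longrightarrow> small_fun (point A a)"
  unfolding point_def
  by (auto intro!: small_funI cfunctor_mk_fun simp: small_cat_category category_simps)

lemma pr_pairF [simp]:
  assumes "small_fun u" "small_fun v" "Src u = Src v" "Tgt u = A" "Tgt v = B"
  shows "pr1 A B \<odot> \<langle>u, v\<rangle> = u" "pr2 A B \<odot> \<langle>u, v\<rangle> = v"
  using assms by (auto intro!: sfun_eqI simp: sfun_simps)

lemma pairF_fcomp [simp]: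
  assumes "small_fun u" "small_fun v" "Src u = Src v" "small_fun w" "Tgt w = Src u"
  shows "\<langle>u, v\<rangle> \<odot> w = \<langle>u \<odot> w, v \<odot> w\<rangle>"
  using assms by (auto intro!: sfun_eqI simp: sfun_simps)

lemma pairF_pr [simp]: "small_cat A \<Longrightarrow> small_cat B \<Longrightarrow> \<langle>pr1 A B, pr2 A B\<rangle> = idF (A \<otimes> B)"
  by (auto intro!: sfun_eqI)

lemma pairF_pr_fcomp [simp]:
  assumes "small_fun h" "Tgt h = A \<otimes> B" "small_cat A" "small_cat B"
  shows "\<langle>pr1 A B \<odot> h, pr2 A B \<odot> h\<rangle> = h"
  using assms by (simp flip: pairF_fcomp)

lemma bang_fcomp [simp]: "small_fun u \<Longrightarrow> Tgt u = A \<Longrightarrow> bang A \<odot> u = bang (Src u)"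
  by (auto intro!: sfun_eqI simp: sfun_simps)

lemma fcomp_point [simp]: "small_fun u \<Longrightarrow> a \<in> Ob (Src u) \<Longrightarrow> Src u = A \<Longrightarrow> u \<odot> point A a = point (Tgt u) (FO u a)"
  by (auto intro!: sfun_eqI simp: sfun_simps)

lemma bang_terminal [simp]: "bang \<e> = idF \<e>"
  by (auto intro!: sfun_eqI)

lemma timesF_simps [simp]: "Src (u \<otimes>\<^sub>F v) = Src u \<otimes> Src v" "Tgt (u \<otimes>\<^sub>F v) = Tgt u \<otimes> Tgt v"
  by (simp_all add: timesF_def)

lemma timesF_elem [simp]:
  "a \<in> Ob (Src u) \<Longrightarrow> b \<in> Ob (Src v) \<Longrightarrow> FO (u \<otimes>\<^sub>F v) (upair a b) = upair (FO u a) (FO v b)"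
  "f \<in> Ar (Src u) \<Longrightarrow> g \<in> Ar (Src v) \<Longrightarrow> FA (u \<otimes>\<^sub>F v) (upair f g) = upair (FA u f) (FA v g)"
  by (simp_all add: timesF_def)

lemma small_fun_timesF [simp]: "small_fun u \<Longrightarrow> small_fun v \<Longrightarrow> small_fun (u \<otimes>\<^sub>F v)"
  by (simp add: timesF_def)

lemma diag_simps [simp]: "Src (diag A) = A" "Tgt (diag A) = A \<otimes> A"
  "small_cat A \<Longrightarrow> small_fun (diag A)"
  by (simp_all add: diag_def)

section \<open>The monoid of natural numbers as a one-object category\<close>

lemma Ob_natcat [simp]: "Ob \<N> = {unat 0}" and Ar_natcat: "Ar \<N> = range unat"
  by (simp_all add: natcat_def)

lemma natcat_simps [simp]: "unat n \<in> Ar \<N>" "Dom \<N> (unat n) = unat 0" "Cod \<N> (unat n) = unat 0"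
  "Id \<N> (unat 0) = unat 0" "unat m \<cdot>\<^bsub>\<N>\<^esub> unat n = unat (m + n)"
  by (simp_all add: natcat_def)

lemma small_cat_natcat [simp]: "small_cat \<N>"
  unfolding small_cat_def natcat_def
  by (intro conjI category_mk_cat) (auto simp: small_countable)

lemma plus_simps [simp]: "Src plus = \<N> \<otimes> \<N>" "Tgt plus = \<N>"
  "x \<in> Ob (\<N> \<otimes> \<N>) \<Longrightarrow> FO plus x = unat 0"
  "FA plus (upair (unat m) (unat n)) = unat (m + n)"
  by (simp_all add: plus_def)

lemma small_fun_plus [simp]: "small_fun plus"
  unfolding plus_def
  by (auto intro!: small_funI cfunctor_mk_fun simp: small_cat_category category_times Ar_natcat)

lemma incl_simps [simp]: "Src incl = \<e>" "Tgt incl = \<N>" "small_fun incl"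
  "FO incl (unat 0) = unat 0" "FA incl (unat 0) = unat 0"
  by (simp_all add: incl_def)

text \<open>\<open>\<N>\<close> has a single object, so a functor into it is known once the number
  attached to each arrow is; sums of such functors are computed arrowwise.\<close>

lemma sfun_natcat:
  assumes "small_fun k" "Tgt k = \<N>"
  shows "x \<in> Ob (Src k) \<Longrightarrow> FO k x = unat 0" "f \<in> Ar (Src k) \<Longrightarrow> \<exists>n. FA k f = unat n"
  using sfun_ob[OF assms] sfun_arr(1)[OF assms] by (auto simp: Ar_natcat)

text \<open>Associativity of addition gives an equality of functors, not just an isomorphism. As a
  rewrite rule it makes both bracketings of a threefold product restrict along the very same functor
  \<open>k \<oplus> l \<oplus> m\<close>.\<close>

lemma plus_assoc [simp]:
  assumes k: "small_fun k" "Tgt k = \<N>" "small_fun l" "Tgt l = \<N>" "small_fun m" "Tgt m = \<N>"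
    "Src k = Src l" "Src m = Src l"
  shows "plus \<odot> \<langle>plus \<odot> \<langle>k, l\<rangle>, m\<rangle> = plus \<odot> \<langle>k, plus \<odot> \<langle>l, m\<rangle>\<rangle>"
proof (rule sfun_eqI)
  fix f assume f: "f \<in> Ar (Src (plus \<odot> \<langle>plus \<odot> \<langle>k, l\<rangle>, m\<rangle>))"
  then obtain a b c where "FA k f = unat a" "FA l f = unat b" "FA m f = unat c"
    using sfun_natcat k by (metis fcomp_simps(1) pairF_simps(1))
  then show "FA (plus \<odot> \<langle>plus \<odot> \<langle>k, l\<rangle>, m\<rangle>) f = FA (plus \<odot> \<langle>k, plus \<odot> \<langle>l, m\<rangle>\<rangle>) f"
    using f k by simp
qed (use k in \<open>simp_all add: sfun_natcat\<close>)

text \<open>\<open>incl \<odot> bang K\<close> is the constant zero over \<open>K\<close>, and zero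
  is a strict unit for addition of functors; unit laws therefore need no correction of the index
  functors.\<close>

lemma plus_incl [simp]:
  assumes k: "small_fun k" "Tgt k = \<N>" "Src k = K"
  shows "plus \<odot> \<langle>incl \<odot> bang K, k\<rangle> = k" "plus \<odot> \<langle>k, incl \<odot> bang K\<rangle> = k"
proof -
  note small_fun_cat(1)[OF k(1), unfolded k(3), simp]
  show "plus \<odot> \<langle>incl \<odot> bang K, k\<rangle> = k"
  proof (rule sfun_eqI)
    fix f assume f: "f \<in> Ar (Src (plus \<odot> \<langle>incl \<odot> bang K, k\<rangle>))"
    then obtain a where "FA k f = unat a" using sfun_natcat k by (metis fcomp_simps(1) pairF_simps(1) bang_simps(1))
    then show "FA (plus \<odot> \<langle>incl \<odot> bang K, k\<rangle>) f = FA k f" using f k by simp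
  qed (use k in \<open>simp_all add: sfun_natcat\<close>)
  show "plus \<odot> \<langle>k, incl \<odot> bang K\<rangle> = k"
  proof (rule sfun_eqI)
    fix f assume f: "f \<in> Ar (Src (plus \<odot> \<langle>k, incl \<odot> bang K\<rangle>))"
    then obtain a where "FA k f = unat a" using sfun_natcat k by (metis fcomp_simps(1) pairF_simps(1))
    then show "FA (plus \<odot> \<langle>k, incl \<odot> bang K\<rangle>) f = FA k f" using f k by simp
  qed (use k in \<open>simp_all add: sfun_natcat\<close>)
qed

section \<open>Prederivators and universal arrows\<close>

declare category_simps [simp] category.comp_assoc [simp]

section \<open>Transposition across an adjunction\<close>

context adjunction
begin

lemma unit_arr:
  assumes "x \<in> Ob (Src L)"
  shows "NC \<eta> x \<in> Ar (Src L)" "Dom (Src L) (NC \<eta> x) = x" "Cod (Src L) (NC \<eta> x) = FO R (FO L x)"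
  using nat_trans.NC_hom[OF unit_nt(1), of x] assms
  by (auto simp: unit_nt hom_iff)

lemma counit_arr:
  assumes "y \<in> Ob (Tgt L)"
  shows "NC \<epsilon> y \<in> Ar (Tgt L)" "Dom (Tgt L) (NC \<epsilon> y) = FO L (FO R y)" "Cod (Tgt L) (NC \<epsilon> y) = y"
  using nat_trans.NC_hom[OF counit_nt(1), of y] assms
  by (auto simp: counit_nt hom_iff Src_R)

lemma unit_natural:
  assumes "f \<in> Ar (Src L)"
  shows "NC \<eta> (Cod (Src L) f) \<cdot>\<^bsub>Src L\<^esub> f = FA R (FA L f) \<cdot>\<^bsub>Src L\<^esub> NC \<eta> (Dom (Src L) f)"
  using nat_trans.NC_natural[OF unit_nt(1), of f "Dom (Src L) f" "Cod (Src L) f"] assms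
  by (simp add: unit_nt hom_iff)

lemma counit_natural:
  assumes "f \<in> Ar (Tgt L)"
  shows "NC \<epsilon> (Cod (Tgt L) f) \<cdot>\<^bsub>Tgt L\<^esub> FA L (FA R f) = f \<cdot>\<^bsub>Tgt L\<^esub> NC \<epsilon> (Dom (Tgt L) f)"
  using nat_trans.NC_natural[OF counit_nt(1), of f "Dom (Tgt L) f" "Cod (Tgt L) f"] assms
  by (simp add: counit_nt hom_iff Src_R)

lemma cats [simp]: "category (Src L)" "category (Tgt L)"
  using L_functor cfunctor.Src_category cfunctor.Tgt_category by blast+

lemmas LR_simps = cfunctor_simps[OF L_functor] cfunctor_simps[OF R_functor]

lemma left_transpose:
  assumes f: "f \<in> Ar (Src L)" "Cod (Src L) f = FO R y" and y: "y \<in> Ob (Tgt L)"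
  shows "NC \<epsilon> y \<cdot>\<^bsub>Tgt L\<^esub> FA L f \<in> Ar (Tgt L)"
    "Dom (Tgt L) (NC \<epsilon> y \<cdot>\<^bsub>Tgt L\<^esub> FA L f) = FO L (Dom (Src L) f)"
    "Cod (Tgt L) (NC \<epsilon> y \<cdot>\<^bsub>Tgt L\<^esub> FA L f) = y"
    "FA R (NC \<epsilon> y \<cdot>\<^bsub>Tgt L\<^esub> FA L f) \<cdot>\<^bsub>Src L\<^esub> NC \<eta> (Dom (Src L) f) = f"
proof -
  note [simp] = counit_arr unit_arr LR_simps Src_R Tgt_R
  show "NC \<epsilon> y \<cdot>\<^bsub>Tgt L\<^esub> FA L f \<in> Ar (Tgt L)"
    "Dom (Tgt L) (NC \<epsilon> y \<cdot>\<^bsub>Tgt L\<^esub> FA L f) = FO L (Dom (Src L) f)"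
    "Cod (Tgt L) (NC \<epsilon> y \<cdot>\<^bsub>Tgt L\<^esub> FA L f) = y" using assms by simp_all
  have "FA R (NC \<epsilon> y \<cdot>\<^bsub>Tgt L\<^esub> FA L f) \<cdot>\<^bsub>Src L\<^esub> NC \<eta> (Dom (Src L) f)
    = FA R (NC \<epsilon> y) \<cdot>\<^bsub>Src L\<^esub> (FA R (FA L f) \<cdot>\<^bsub>Src L\<^esub> NC \<eta> (Dom (Src L) f))"
    using assms by simp
  also have "\<dots> = (FA R (NC \<epsilon> y) \<cdot>\<^bsub>Src L\<^esub> NC \<eta> (FO R y)) \<cdot>\<^bsub>Src L\<^esub> f"
    using assms unit_natural[OF f(1)] by simp
  also have "\<dots> = f" using assms by (simp only: triangle_R[OF y]) simp
  finally show "FA R (NC \<epsilon> y \<cdot>\<^bsub>Tgt L\<^esub> FA L f) \<cdot>\<^bsub>Src L\<^esub> NC \<eta> (Dom (Src L) f) = f" .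
qed

lemma left_transpose_unique:
  assumes g: "g \<in> Ar (Tgt L)" "Dom (Tgt L) g = FO L x" "Cod (Tgt L) g = y" and x: "x \<in> Ob (Src L)"
    and f: "f = FA R g \<cdot>\<^bsub>Src L\<^esub> NC \<eta> x"
  shows "NC \<epsilon> y \<cdot>\<^bsub>Tgt L\<^esub> FA L f = g"
proof -
  note [simp] = counit_arr unit_arr LR_simps Src_R Tgt_R
  have y: "y \<in> Ob (Tgt L)" using g by (metis cats(2) category.Cod_in)
  have "NC \<epsilon> y \<cdot>\<^bsub>Tgt L\<^esub> FA L f = (NC \<epsilon> y \<cdot>\<^bsub>Tgt L\<^esub> FA L (FA R g)) \<cdot>\<^bsub>Tgt L\<^esub> FA L (NC \<eta> x)"
    using assms y by simp
  also have "\<dots> = g \<cdot>\<^bsub>Tgt L\<^esub> (NC \<epsilon> (FO L x) \<cdot>\<^bsub>Tgt L\<^esub> FA L (NC \<eta> x))"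
    using counit_natural[OF g(1)] g x y by simp
  finally show ?thesis using triangle_L[OF x] g by simp
qed

lemma right_transpose:
  assumes f: "f \<in> Ar (Tgt L)" "Dom (Tgt L) f = FO L x" and x: "x \<in> Ob (Src L)"
  shows "FA R f \<cdot>\<^bsub>Src L\<^esub> NC \<eta> x \<in> Ar (Src L)"
    "Dom (Src L) (FA R f \<cdot>\<^bsub>Src L\<^esub> NC \<eta> x) = x"
    "Cod (Src L) (FA R f \<cdot>\<^bsub>Src L\<^esub> NC \<eta> x) = FO R (Cod (Tgt L) f)"
    "NC \<epsilon> (Cod (Tgt L) f) \<cdot>\<^bsub>Tgt L\<^esub> FA L (FA R f \<cdot>\<^bsub>Src L\<^esub> NC \<eta> x) = f"
  using assms left_transpose_unique[OF f(1,2) refl x refl]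
  by (simp_all add: unit_arr LR_simps Src_R Tgt_R)

lemma right_transpose_unique:
  assumes g: "g \<in> Ar (Src L)" "Dom (Src L) g = x" "Cod (Src L) g = FO R y" and y: "y \<in> Ob (Tgt L)"
    and f: "f = NC \<epsilon> y \<cdot>\<^bsub>Tgt L\<^esub> FA L g"
  shows "FA R f \<cdot>\<^bsub>Src L\<^esub> NC \<eta> x = g"
  using left_transpose(4)[OF g(1,3) y] f g by simp

end

section \<open>Restriction functors of a prederivator\<close>

context prederivator
begin

lemma cat_Val [simp]: "small_cat A \<Longrightarrow> category (Val D A)"
  by (rule Val_category)

lemma rs_ob [simp]: "small_fun u \<Longrightarrow> Src u = K \<Longrightarrow> X \<in> Ob (Val D (Tgt u)) \<Longrightarrow> rs D u X \<in> Ob (Val D K)"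
  using cfunctor_ob[OF Res_functor] by (simp add: Res_Src Res_Tgt)

lemma rsA_arr [simp]:
  assumes "small_fun u" "Src u = K" "f \<in> Ar (Val D (Tgt u))"
  shows "rsA D u f \<in> Ar (Val D K)" "Dom (Val D K) (rsA D u f) = rs D u (Dom (Val D (Tgt u)) f)"
    "Cod (Val D K) (rsA D u f) = rs D u (Cod (Val D (Tgt u)) f)"
  using cfunctor_arr[OF Res_functor] assms by (simp_all add: Res_Src Res_Tgt)

lemma rsA_Id [simp]: "small_fun u \<Longrightarrow> Tgt u = B \<Longrightarrow> X \<in> Ob (Val D B)
    \<Longrightarrow> rsA D u (Id (Val D B) X) = Id (Val D (Src u)) (rs D u X)"
  using cfunctor_Id[OF Res_functor] by (simp add: Res_Src Res_Tgt)

lemma rsA_comp [simp]: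
  "\<lbrakk>small_fun u; Tgt u = B; f \<in> Ar (Val D B); g \<in> Ar (Val D B); Dom (Val D B) g = Cod (Val D B) f\<rbrakk>
    \<Longrightarrow> rsA D u (g \<cdot>\<^bsub>Val D B\<^esub> f) = rsA D u g \<cdot>\<^bsub>Val D (Src u)\<^esub> rsA D u f"
  using cfunctor_comp[OF Res_functor] by (simp add: Res_Src Res_Tgt)

lemma rsA_iso:
  assumes "small_fun u" "iso (Val D B) f" "Tgt u = B" "Src u = K"
  shows "iso (Val D K) (rsA D u f)"
  using cfunctor.FA_iso[OF Res_functor] assms by (auto simp: Res_Src Res_Tgt)

lemma rs_rs [simp]:
  "\<lbrakk>small_fun u; small_fun v; Src v = Tgt u; X \<in> Ob (Val D (Tgt v))\<rbrakk>
    \<Longrightarrow> rs D u (rs D v X) = rs D (v \<odot> u) X"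
  by (simp add: Res_comp Res_Src)

lemma rsA_rsA [simp]:
  "\<lbrakk>small_fun u; small_fun v; Src v = Tgt u; f \<in> Ar (Val D (Tgt v))\<rbrakk>
    \<Longrightarrow> rsA D u (rsA D v f) = rsA D (v \<odot> u) f"
  by (simp add: Res_comp Res_Src)

lemma rs_idF [simp]: "small_cat A \<Longrightarrow> X \<in> Ob (Val D A) \<Longrightarrow> rs D (idF A) X = X"
  by (simp add: Res_id)

lemma rsA_idF [simp]: "small_cat A \<Longrightarrow> f \<in> Ar (Val D A) \<Longrightarrow> rsA D (idF A) f = f"
  by (simp add: Res_id)

end

text \<open>Initiality of \<open>\<eta> : X \<rightarrow> u\<^sup>*Y\<close> among the arrows from
  \<open>X\<close> to restrictions along \<open>u\<close>; \<open>X\<close> is not an argument,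
  being the domain of \<open>\<eta>\<close>. No adjoint is chosen, so composites and isomorphic
  copies can be compared.\<close>

definition univ :: "('u::universe, 'o, 'a) pder \<Rightarrow> 'u sfun \<Rightarrow> 'o \<Rightarrow> 'a \<Rightarrow> bool" where
  "univ D u Y \<eta> \<longleftrightarrow> small_fun u \<and> Y \<in> Ob (Val D (Tgt u)) \<and>
     \<eta> \<in> Ar (Val D (Src u)) \<and> Cod (Val D (Src u)) \<eta> = rs D u Y \<and>
     (\<forall>f \<in> Ar (Val D (Src u)). \<forall>Z \<in> Ob (Val D (Tgt u)).
        Dom (Val D (Src u)) f = Dom (Val D (Src u)) \<eta> \<longrightarrow> Cod (Val D (Src u)) f = rs D u Z \<longrightarrow>
        (\<exists>!g. g \<in> hom (Val D (Tgt u)) Y Z \<and> rsA D u g \<cdot>\<^bsub>Val D (Src u)\<^esub> \<eta> = f))"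

text \<open>The dual notion: \<open>\<epsilon> : u\<^sup>*Y \<rightarrow> X\<close> exhibits
  \<open>Y\<close> as the right Kan extension of \<open>X\<close>.\<close>

definition couniv :: "('u::universe, 'o, 'a) pder \<Rightarrow> 'u sfun \<Rightarrow> 'o \<Rightarrow> 'a \<Rightarrow> bool" where
  "couniv D u Y \<epsilon> \<longleftrightarrow> small_fun u \<and> Y \<in> Ob (Val D (Tgt u)) \<and>
     \<epsilon> \<in> Ar (Val D (Src u)) \<and> Dom (Val D (Src u)) \<epsilon> = rs D u Y \<and>
     (\<forall>f \<in> Ar (Val D (Src u)). \<forall>Z \<in> Ob (Val D (Tgt u)).
        Cod (Val D (Src u)) f = Cod (Val D (Src u)) \<epsilon> \<longrightarrow> Dom (Val D (Src u)) f = rs D u Z \<longrightarrow>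
        (\<exists>!g. g \<in> hom (Val D (Tgt u)) Z Y \<and> \<epsilon> \<cdot>\<^bsub>Val D (Src u)\<^esub> rsA D u g = f))"

lemma univD:
  assumes "univ D u Y \<eta>"
  shows "small_fun u" "Y \<in> Ob (Val D (Tgt u))" "\<eta> \<in> Ar (Val D (Src u))" "Cod (Val D (Src u)) \<eta> = rs D u Y"
  using assms by (auto simp: univ_def)

lemma univ_ex:
  assumes "univ D u Y \<eta>" "f \<in> Ar (Val D (Src u))" "Z \<in> Ob (Val D (Tgt u))"
    "Dom (Val D (Src u)) f = Dom (Val D (Src u)) \<eta>" "Cod (Val D (Src u)) f = rs D u Z"
  obtains g where "g \<in> Ar (Val D (Tgt u))" "Dom (Val D (Tgt u)) g = Y" "Cod (Val D (Tgt u)) g = Z"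
    "rsA D u g \<cdot>\<^bsub>Val D (Src u)\<^esub> \<eta> = f"
proof -
  have "\<exists>!g. g \<in> hom (Val D (Tgt u)) Y Z \<and> rsA D u g \<cdot>\<^bsub>Val D (Src u)\<^esub> \<eta> = f"
    using assms by (simp add: univ_def)
  then show ?thesis using that by (auto simp: hom_iff)
qed

lemma couniv_ex:
  assumes "couniv D u Y \<epsilon>" "f \<in> Ar (Val D (Src u))" "Z \<in> Ob (Val D (Tgt u))"
    "Cod (Val D (Src u)) f = Cod (Val D (Src u)) \<epsilon>" "Dom (Val D (Src u)) f = rs D u Z"
  obtains g where "g \<in> Ar (Val D (Tgt u))" "Cod (Val D (Tgt u)) g = Y" "Dom (Val D (Tgt u)) g = Z"
    "\<epsilon> \<cdot>\<^bsub>Val D (Src u)\<^esub> rsA D u g = f"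
proof -
  have "\<exists>!g. g \<in> hom (Val D (Tgt u)) Z Y \<and> \<epsilon> \<cdot>\<^bsub>Val D (Src u)\<^esub> rsA D u g = f"
    using assms by (simp add: couniv_def)
  then show ?thesis using that by (auto simp: hom_iff)
qed

lemma couniv_unique:
  assumes "prederivator D" "couniv D u Y \<epsilon>" "g \<in> Ar (Val D (Tgt u))" "g' \<in> Ar (Val D (Tgt u))"
    "Cod (Val D (Tgt u)) g = Y" "Cod (Val D (Tgt u)) g' = Y" "Dom (Val D (Tgt u)) g = Dom (Val D (Tgt u)) g'"
    "\<epsilon> \<cdot>\<^bsub>Val D (Src u)\<^esub> rsA D u g = \<epsilon> \<cdot>\<^bsub>Val D (Src u)\<^esub> rsA D u g'"
  shows "g = g'"
proof -
  interpret prederivator D by fact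
  have u: "small_fun u" "\<epsilon> \<in> Ar (Val D (Src u))" "Dom (Val D (Src u)) \<epsilon> = rs D u Y" using assms(2) by (auto simp: couniv_def)
  then have "\<exists>!h. h \<in> hom (Val D (Tgt u)) (Dom (Val D (Tgt u)) g) Y \<and>
      \<epsilon> \<cdot>\<^bsub>Val D (Src u)\<^esub> rsA D u h = \<epsilon> \<cdot>\<^bsub>Val D (Src u)\<^esub> rsA D u g"
    using assms(2)[unfolded couniv_def] assms(3-8) by simp
  then show ?thesis using assms by (auto simp: hom_iff)
qed

section \<open>Composition and cancellation of universal arrows\<close>

context prederivator
begin

lemma univ_unique:
  assumes "univ D u Y \<eta>" "g \<in> Ar (Val D (Tgt u))" "g' \<in> Ar (Val D (Tgt u))"
    "Dom (Val D (Tgt u)) g = Y" "Dom (Val D (Tgt u)) g' = Y" "Cod (Val D (Tgt u)) g = Cod (Val D (Tgt u)) g'"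
    "rsA D u g \<cdot>\<^bsub>Val D (Src u)\<^esub> \<eta> = rsA D u g' \<cdot>\<^bsub>Val D (Src u)\<^esub> \<eta>"
  shows "g = g'"
proof -
  have "\<exists>!h. h \<in> hom (Val D (Tgt u)) Y (Cod (Val D (Tgt u)) g) \<and>
      rsA D u h \<cdot>\<^bsub>Val D (Src u)\<^esub> \<eta> = rsA D u g \<cdot>\<^bsub>Val D (Src u)\<^esub> \<eta>"
    using assms(1)[unfolded univ_def] assms(2-7) by simp
  then show ?thesis using assms by (auto simp: hom_iff)
qed

lemma univI:
  assumes "small_fun u" "Y \<in> Ob (Val D (Tgt u))" "\<eta> \<in> Ar (Val D (Src u))"
    "Cod (Val D (Src u)) \<eta> = rs D u Y"
    and ex: "\<And>f Z. \<lbrakk>f \<in> Ar (Val D (Src u)); Z \<in> Ob (Val D (Tgt u));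
        Dom (Val D (Src u)) f = Dom (Val D (Src u)) \<eta>; Cod (Val D (Src u)) f = rs D u Z\<rbrakk>
        \<Longrightarrow> \<exists>g. g \<in> Ar (Val D (Tgt u)) \<and> Dom (Val D (Tgt u)) g = Y \<and> Cod (Val D (Tgt u)) g = Z \<and>
          rsA D u g \<cdot>\<^bsub>Val D (Src u)\<^esub> \<eta> = f"
    and un: "\<And>g g'. \<lbrakk>g \<in> Ar (Val D (Tgt u)); g' \<in> Ar (Val D (Tgt u)); Dom (Val D (Tgt u)) g = Y;
        Dom (Val D (Tgt u)) g' = Y; Cod (Val D (Tgt u)) g = Cod (Val D (Tgt u)) g';
        rsA D u g \<cdot>\<^bsub>Val D (Src u)\<^esub> \<eta> = rsA D u g' \<cdot>\<^bsub>Val D (Src u)\<^esub> \<eta>\<rbrakk> \<Longrightarrow> g = g'"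
  shows "univ D u Y \<eta>"
  unfolding univ_def
proof (intro conjI ballI impI)
  fix f Z
  assume "f \<in> Ar (Val D (Src u))" "Z \<in> Ob (Val D (Tgt u))"
    "Dom (Val D (Src u)) f = Dom (Val D (Src u)) \<eta>" "Cod (Val D (Src u)) f = rs D u Z"
  from ex[OF this] obtain g where g: "g \<in> Ar (Val D (Tgt u))" "Dom (Val D (Tgt u)) g = Y"
    "Cod (Val D (Tgt u)) g = Z" "rsA D u g \<cdot>\<^bsub>Val D (Src u)\<^esub> \<eta> = f" by blast
  show "\<exists>!g. g \<in> hom (Val D (Tgt u)) Y Z \<and> rsA D u g \<cdot>\<^bsub>Val D (Src u)\<^esub> \<eta> = f"
    using g un by (intro ex1I[of _ g]) (auto simp: hom_iff)
qed (use assms in auto)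

text \<open>The universal property in two stages: this is
  \<open>(v u)\<^sub>! = v\<^sub>! u\<^sub>!\<close> without a choice of adjoints.\<close>

lemma univ_comp:
  assumes \<eta>: "univ D u Y \<eta>" and \<theta>: "univ D v Z \<theta>" and uv: "Src v = Tgt u"
    and Y: "Dom (Val D (Tgt u)) \<theta> = Y"
  shows "univ D (v \<odot> u) Z (rsA D u \<theta> \<cdot>\<^bsub>Val D (Src u)\<^esub> \<eta>)"
proof -
  note a = univD[OF \<eta>] univD[OF \<theta>] Y uv
  show ?thesis
  proof (rule univI, goal_cases)
    case (5 f W)
    obtain g where g: "g \<in> Ar (Val D (Tgt u))" "Dom (Val D (Tgt u)) g = Y"
      "Cod (Val D (Tgt u)) g = rs D v W" "rsA D u g \<cdot>\<^bsub>Val D (Src u)\<^esub> \<eta> = f"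
      using univ_ex[OF \<eta>, of f "rs D v W"] 5 a by auto
    obtain h where h: "h \<in> Ar (Val D (Tgt v))" "Dom (Val D (Tgt v)) h = Z"
      "Cod (Val D (Tgt v)) h = W" "rsA D v h \<cdot>\<^bsub>Val D (Src v)\<^esub> \<theta> = g"
      using univ_ex[OF \<theta>, of g W] 5 a g by auto
    have "rsA D u (rsA D v h \<cdot>\<^bsub>Val D (Src v)\<^esub> \<theta>) = rsA D (v \<odot> u) h \<cdot>\<^bsub>Val D (Src u)\<^esub> rsA D u \<theta>"
      using a h(1-3) by simp
    then show ?case using g h a by (intro exI[of _ h]) simp
  next
    case (6 g g')
    have "rsA D v g \<cdot>\<^bsub>Val D (Src v)\<^esub> \<theta> = rsA D v g' \<cdot>\<^bsub>Val D (Src v)\<^esub> \<theta>"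
      by (rule univ_unique[OF \<eta>]) (use 6 a in simp_all)
    then show ?case using univ_unique[OF \<theta>, of g g'] 6 by simp
  qed (use a in simp_all)
qed

text \<open>A competitor for \<open>\<theta>\<close> becomes one for the composite after restriction
  and composition with \<open>\<eta>\<close>, and universality of \<open>\<eta>\<close> brings the
  factorisation back. The cocontinuity of the affine product is obtained through this rule.\<close>

lemma univ_cancel:
  assumes \<eta>: "univ D u Y \<eta>" and \<theta>: "univ D (v \<odot> u) Z (rsA D u \<theta> \<cdot>\<^bsub>Val D (Src u)\<^esub> \<eta>)"
    and v: "small_fun v" "Src v = Tgt u" and Y: "\<theta> \<in> Ar (Val D (Tgt u))" "Dom (Val D (Tgt u)) \<theta> = Y"
    and Z: "Cod (Val D (Tgt u)) \<theta> = rs D v Z"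
  shows "univ D v Z \<theta>"
proof -
  note a = univD[OF \<eta>] v Y Z univD(2)[OF \<theta>]
  show ?thesis
  proof (rule univI, goal_cases)
    case (5 f W)
    obtain h where h: "h \<in> Ar (Val D (Tgt v))" "Dom (Val D (Tgt v)) h = Z"
      "Cod (Val D (Tgt v)) h = W" "rsA D (v \<odot> u) h \<cdot>\<^bsub>Val D (Src u)\<^esub> (rsA D u \<theta> \<cdot>\<^bsub>Val D (Src u)\<^esub> \<eta>) = rsA D u f \<cdot>\<^bsub>Val D (Src u)\<^esub> \<eta>"
      using univ_ex[OF \<theta>, of "rsA D u f \<cdot>\<^bsub>Val D (Src u)\<^esub> \<eta>" W] 5 a by auto
    have "rsA D v h \<cdot>\<^bsub>Val D (Src v)\<^esub> \<theta> = f"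
      by (rule univ_unique[OF \<eta>]) (use h a 5 in simp_all)
    then show ?case using h by blast
  next
    case (6 g g')
    have "rsA D u (rsA D v g \<cdot>\<^bsub>Val D (Src v)\<^esub> \<theta>) \<cdot>\<^bsub>Val D (Src u)\<^esub> \<eta>
      = rsA D u (rsA D v g' \<cdot>\<^bsub>Val D (Src v)\<^esub> \<theta>) \<cdot>\<^bsub>Val D (Src u)\<^esub> \<eta>" by (simp only: 6(6))
    then have "rsA D (v \<odot> u) g \<cdot>\<^bsub>Val D (Src u)\<^esub> (rsA D u \<theta> \<cdot>\<^bsub>Val D (Src u)\<^esub> \<eta>)
      = rsA D (v \<odot> u) g' \<cdot>\<^bsub>Val D (Src u)\<^esub> (rsA D u \<theta> \<cdot>\<^bsub>Val D (Src u)\<^esub> \<eta>)"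
      using 6(1-5) a by simp
    then show ?case using univ_unique[OF \<theta>, of g g'] 6(1-5) by simp
  qed (use a in simp_all)
qed

text \<open>Factoring the identity of the domain through \<open>\<eta>\<close> produces the inverse.
  Composing a universal arrow with an isomorphism on either side thereby becomes a special case of
  \<open>univ_comp\<close>.\<close>

lemma univ_idF_iff:
  assumes A: "small_cat A"
  shows "univ D (idF A) Y \<eta> \<longleftrightarrow> iso (Val D A) \<eta> \<and> Cod (Val D A) \<eta> = Y"
proof
  assume u: "univ D (idF A) Y \<eta>"
  note a = univD[OF u]
  obtain g where g: "g \<in> Ar (Val D A)" "Dom (Val D A) g = Y" "Cod (Val D A) g = Dom (Val D A) \<eta>"
    "g \<cdot>\<^bsub>Val D A\<^esub> \<eta> = Id (Val D A) (Dom (Val D A) \<eta>)"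
    using univ_ex[OF u, of "Id (Val D A) (Dom (Val D A) \<eta>)" "Dom (Val D A) \<eta>"] a A by auto
  have "\<eta> \<cdot>\<^bsub>Val D A\<^esub> g = Id (Val D A) Y"
    by (rule univ_unique[OF u]) (use a A g in simp_all)
  then show "iso (Val D A) \<eta> \<and> Cod (Val D A) \<eta> = Y"
    using g a A by (auto intro!: category.isoI[of _ _ g])
next
  assume "iso (Val D A) \<eta> \<and> Cod (Val D A) \<eta> = Y"
  then have i: "iso (Val D A) \<eta>" and Y: "Cod (Val D A) \<eta> = Y" by auto
  have \<eta>: "\<eta> \<in> Ar (Val D A)" using i by (simp add: iso_def)
  then have Y': "Y \<in> Ob (Val D A)" using Y A by auto
  obtain h where h: "h \<in> Ar (Val D A)" "Dom (Val D A) h = Y" "Cod (Val D A) h = Dom (Val D A) \<eta>"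
    "h \<cdot>\<^bsub>Val D A\<^esub> \<eta> = Id (Val D A) (Dom (Val D A) \<eta>)"
    using category.isoE[OF _ i] A Y by auto
  show "univ D (idF A) Y \<eta>"
  proof (rule univI, goal_cases)
    case (5 f Z)
    then show ?case using h \<eta> Y A by (intro exI[of _ "f \<cdot>\<^bsub>Val D A\<^esub> h"]) simp
  next
    case (6 g g')
    then show ?case using \<eta> Y A i by (auto intro: category.iso_cancel_right[of "Val D A"])
  qed (use \<eta> Y A Y' in simp_all)
qed

lemma univ_pre:
  assumes \<eta>: "univ D u Y \<eta>" and i: "iso (Val D A) i" "Cod (Val D A) i = Dom (Val D A) \<eta>" "Src u = A"
  shows "univ D u Y (\<eta> \<cdot>\<^bsub>Val D A\<^esub> i)"
proof -
  have A: "small_cat A" using univD(1)[OF \<eta>] i by auto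
  have "univ D (u \<odot> idF A) Y (rsA D (idF A) \<eta> \<cdot>\<^bsub>Val D (Src (idF A))\<^esub> i)"
    by (rule univ_comp[OF _ \<eta>]) (use i A in \<open>auto simp: univ_idF_iff\<close>)
  then show ?thesis using univD[OF \<eta>] i A by simp
qed

lemma univ_post:
  assumes \<eta>: "univ D u Y \<eta>" and g: "iso (Val D (Tgt u)) g" "Dom (Val D (Tgt u)) g = Y"
  shows "univ D u (Cod (Val D (Tgt u)) g) (rsA D u g \<cdot>\<^bsub>Val D (Src u)\<^esub> \<eta>)"
proof -
  have "univ D (idF (Tgt u) \<odot> u) (Cod (Val D (Tgt u)) g) (rsA D u g \<cdot>\<^bsub>Val D (Src u)\<^esub> \<eta>)"
    by (rule univ_comp[OF \<eta>]) (use g univD[OF \<eta>] in \<open>auto simp: univ_idF_iff\<close>)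
  then show ?thesis using univD[OF \<eta>] by simp
qed

text \<open>The translation between two languages: a comparison map out of a Kan extension is
  invertible exactly when the arrow it classifies is universal.\<close>

lemma univ_post_iff:
  assumes \<eta>: "univ D u Y \<eta>" and g: "g \<in> Ar (Val D (Tgt u))" "Dom (Val D (Tgt u)) g = Y" "Cod (Val D (Tgt u)) g = Z"
  shows "univ D u Z (rsA D u g \<cdot>\<^bsub>Val D (Src u)\<^esub> \<eta>) \<longleftrightarrow> iso (Val D (Tgt u)) g"
proof
  note a = univD[OF \<eta>]
  assume as: "univ D u Z (rsA D u g \<cdot>\<^bsub>Val D (Src u)\<^esub> \<eta>)"
  have "univ D (idF (Tgt u)) Z g"
    by (rule univ_cancel[OF \<eta>]) (use as a g univD(2)[OF as] in simp_all)
  then show "iso (Val D (Tgt u)) g" using a by (simp add: univ_idF_iff)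
qed (use univ_post assms in auto)

text \<open>For an isomorphism of categories, \<open>b\<^sup>*\<close> is a two-sided inverse of
  \<open>a\<^sup>*\<close>, so the identity is universal. This serves to replace an index category
  by a differently bracketed one.\<close>

lemma univ_isoF:
  assumes "small_fun a" "small_fun b" "b \<odot> a = idF A" "a \<odot> b = idF B" "Src a = A" "Tgt a = B"
    "Src b = B" "Tgt b = A" "X \<in> Ob (Val D B)"
  shows "univ D a X (Id (Val D A) (rs D a X))"
proof -
  note [simp] = assms
  have AB: "small_cat A" "small_cat B" using small_fun_cat[OF assms(1)] assms(5,6) by simp_all
  note [simp] = AB
  show ?thesis
  proof (rule univI, goal_cases)
    case (5 f Z)
    then show ?case by (intro exI[of _ "rsA D b f"]) simp
  next
    case (6 g g')
    then have "rsA D a g = rsA D a g'" by simp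
    moreover have "rsA D b (rsA D a g) = g" "rsA D b (rsA D a g') = g'" using 6(1,2) by simp_all
    ultimately show ?case by metis
  qed simp_all
qed

text \<open>Composes \<open>\<eta>\<close> on either side with the trivial universal arrows of the
  isomorphisms \<open>a\<close> and \<open>b'\<close>.\<close>

lemma univ_iso_square:
  assumes \<eta>: "univ D u Y \<eta>"
    and a: "small_fun a" "small_fun a'" "a' \<odot> a = idF (Src a)" "a \<odot> a' = idF (Tgt a)" "Src a' = Tgt a" "Tgt a' = Src a"
    and b: "small_fun b" "small_fun b'" "b' \<odot> b = idF (Src b)" "b \<odot> b' = idF (Tgt b)" "Src b' = Tgt b" "Tgt b' = Src b"
    and v: "small_fun v" "u \<odot> a = b \<odot> v" "Src v = Src a" "Tgt v = Src b" "Src u = Tgt a" "Tgt u = Tgt b"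
  shows "univ D v (rs D b Y) (rsA D a \<eta>)"
proof -
  note [simp] = a b v univD[OF \<eta>]
  have Yob: "Y \<in> Ob (Val D (Tgt b))" "\<eta> \<in> Ar (Val D (Tgt a))"
    "Cod (Val D (Tgt a)) \<eta> = rs D u Y" using univD[OF \<eta>] by simp_all
  note [simp] = Yob
  have [simp]: "Dom (Val D (Tgt a)) \<eta> \<in> Ob (Val D (Tgt a))"
    by (rule category.Dom_in[OF cat_Val]) simp_all
  have "univ D a (Dom (Val D (Tgt a)) \<eta>) (Id (Val D (Src a)) (rs D a (Dom (Val D (Tgt a)) \<eta>)))"
    by (rule univ_isoF[OF a(1) a(2) a(3) a(4) refl refl a(5) a(6)]) simp
  from univ_comp[OF this \<eta>]
  have 1: "univ D (b \<odot> v) Y (rsA D a \<eta>)" by simp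
  have "univ D b' (rs D b Y) (Id (Val D (Tgt b)) (rs D b' (rs D b Y)))"
    by (rule univ_isoF[of b' b "Tgt b" "Src b"]) simp_all
  from univ_comp[OF 1 this]
  have "univ D (b' \<odot> (b \<odot> v)) (rs D b Y) (rsA D a \<eta>)" by simp
  moreover have "b' \<odot> (b \<odot> v) = (b' \<odot> b) \<odot> v" by (simp del: b(3))
  ultimately show ?thesis by simp
qed

end

section \<open>Left Kan extensions as universal arrows\<close>

context derivator
begin

lemma left_adj_adjunction:
  assumes "small_fun u"
  shows "adjunction (ladj (Res D u)) (Res D u) (fst (snd (left_adj (Res D u)))) (snd (snd (left_adj (Res D u))))"
proof -
  have "\<exists>p. case p of (L, \<eta>, \<epsilon>) \<Rightarrow> adjunction L (Res D u) \<eta> \<epsilon>"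
    using Der3_left[OF assms] by (auto simp: has_left_adjoint_def)
  from someI_ex[OF this] show ?thesis by (simp add: ladj_def left_adj_def case_prod_unfold)
qed

lemma right_adj_adjunction:
  assumes "small_fun u"
  shows "adjunction (Res D u) (radj (Res D u)) (fst (snd (right_adj (Res D u)))) (snd (snd (right_adj (Res D u))))"
proof -
  have "\<exists>p. case p of (R, \<eta>, \<epsilon>) \<Rightarrow> adjunction (Res D u) R \<eta> \<epsilon>"
    using Der3_right[OF assms] by (auto simp: has_right_adjoint_def)
  from someI_ex[OF this] show ?thesis by (simp add: radj_def right_adj_def case_prod_unfold)
qed

lemma ladj_src_tgt:
  assumes "small_fun u"
  shows "Src (ladj (Res D u)) = Val D (Src u)" "Tgt (ladj (Res D u)) = Val D (Tgt u)"
  using adjunction.Src_R[OF left_adj_adjunction] adjunction.Tgt_R[OF left_adj_adjunction] assms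
  by (simp_all add: Res_Src Res_Tgt)

lemma univ_lan:
  assumes u: "small_fun u" and X: "X \<in> Ob (Val D (Src u))"
  shows "univ D u (lan D u X) (ladj_unit (Res D u) X)"
    "Dom (Val D (Src u)) (ladj_unit (Res D u) X) = X" "lan D u X \<in> Ob (Val D (Tgt u))"
proof -
  interpret A: adjunction "ladj (Res D u)" "Res D u" "fst (snd (left_adj (Res D u)))" "snd (snd (left_adj (Res D u)))"
    by (rule left_adj_adjunction[OF u])
  note s = ladj_src_tgt[OF u] Res_Src[OF u] Res_Tgt[OF u]
  have un: "ladj_unit (Res D u) = NC (fst (snd (left_adj (Res D u))))" by (simp add: ladj_unit_def)
  note [simp] = A.unit_arr[unfolded s, folded un]
  show L: "lan D u X \<in> Ob (Val D (Tgt u))" using X cfunctor_ob[OF A.L_functor] by (simp add: s)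
  show "Dom (Val D (Src u)) (ladj_unit (Res D u) X) = X" using X by simp
  show "univ D u (lan D u X) (ladj_unit (Res D u) X)"
  proof (rule univI, goal_cases)
    case (5 f Z)
    then show ?case using A.left_transpose[of f Z, unfolded s, folded un] X by auto
  next
    case (6 g g')
    from A.left_transpose_unique[of _ X, OF _ _ refl _ refl, unfolded s, folded un] 6 X
    have "NC (snd (snd (left_adj (Res D u)))) (Cod (Val D (Tgt u)) h) \<cdot>\<^bsub>Val D (Tgt u)\<^esub>
        FA (ladj (Res D u)) (rsA D u h \<cdot>\<^bsub>Val D (Src u)\<^esub> ladj_unit (Res D u) X) = h" if "h \<in> {g, g'}" for h
      using that by blast
    from this[of g] this[of g'] show ?case unfolding 6(5,6) by simp
  qed (use u X L in simp_all)
qed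

lemma ltransp:
  assumes u: "small_fun u" and f: "f \<in> Ar (Val D (Src u))" "Cod (Val D (Src u)) f = rs D u Y"
    "Dom (Val D (Src u)) f = X" and Y: "Y \<in> Ob (Val D (Tgt u))"
  shows "ltransp (Res D u) Y f \<in> Ar (Val D (Tgt u))" "Dom (Val D (Tgt u)) (ltransp (Res D u) Y f) = lan D u X"
    "Cod (Val D (Tgt u)) (ltransp (Res D u) Y f) = Y"
    "rsA D u (ltransp (Res D u) Y f) \<cdot>\<^bsub>Val D (Src u)\<^esub> ladj_unit (Res D u) X = f"
proof -
  interpret A: adjunction "ladj (Res D u)" "Res D u" "fst (snd (left_adj (Res D u)))" "snd (snd (left_adj (Res D u)))"
    by (rule left_adj_adjunction[OF u])
  note s = ladj_src_tgt[OF u] Res_Src[OF u] Res_Tgt[OF u]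
  show "ltransp (Res D u) Y f \<in> Ar (Val D (Tgt u))" "Dom (Val D (Tgt u)) (ltransp (Res D u) Y f) = lan D u X"
    "Cod (Val D (Tgt u)) (ltransp (Res D u) Y f) = Y"
    "rsA D u (ltransp (Res D u) Y f) \<cdot>\<^bsub>Val D (Src u)\<^esub> ladj_unit (Res D u) X = f"
    using A.left_transpose[unfolded s, OF f(1,2) Y] f(3)
    by (simp_all add: ltransp_def ladj_counit_def ladj_unit_def s)
qed

text \<open>The transpose is the arrow induced from the chosen Kan extension, so
  \<open>univ_post_iff\<close> applies. Both (Der4) and cocontinuity assert that some transpose is
  invertible, and are read as universality through this equivalence.\<close>

lemma ltransp_iso_iff:
  assumes u: "small_fun u" and f: "f \<in> Ar (Val D (Src u))" "Cod (Val D (Src u)) f = rs D u Y"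
    and Y: "Y \<in> Ob (Val D (Tgt u))"
  shows "iso (Val D (Tgt u)) (ltransp (Res D u) Y f) \<longleftrightarrow> univ D u Y f"
proof -
  have X: "Dom (Val D (Src u)) f \<in> Ob (Val D (Src u))" using f u by simp
  note l = ltransp[OF u f refl Y]
  from univ_post_iff[OF univ_lan(1)[OF u X] l(1-3)] l(4) show ?thesis by simp
qed

lemma ladj_arr:
  assumes u: "small_fun u" and f: "f \<in> Ar (Val D (Src u))"
  shows "FA (ladj (Res D u)) f \<in> Ar (Val D (Tgt u))"
    "Dom (Val D (Tgt u)) (FA (ladj (Res D u)) f) = lan D u (Dom (Val D (Src u)) f)"
    "Cod (Val D (Tgt u)) (FA (ladj (Res D u)) f) = lan D u (Cod (Val D (Src u)) f)"
    "rsA D u (FA (ladj (Res D u)) f) \<cdot>\<^bsub>Val D (Src u)\<^esub> ladj_unit (Res D u) (Dom (Val D (Src u)) f)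
       = ladj_unit (Res D u) (Cod (Val D (Src u)) f) \<cdot>\<^bsub>Val D (Src u)\<^esub> f"
proof -
  interpret A: adjunction "ladj (Res D u)" "Res D u" "fst (snd (left_adj (Res D u)))" "snd (snd (left_adj (Res D u)))"
    by (rule left_adj_adjunction[OF u])
  note s = ladj_src_tgt[OF u] Res_Src[OF u] Res_Tgt[OF u]
  show "FA (ladj (Res D u)) f \<in> Ar (Val D (Tgt u))"
    "Dom (Val D (Tgt u)) (FA (ladj (Res D u)) f) = lan D u (Dom (Val D (Src u)) f)"
    "Cod (Val D (Tgt u)) (FA (ladj (Res D u)) f) = lan D u (Cod (Val D (Src u)) f)"
    using cfunctor_arr[OF A.L_functor] f by (simp_all add: s)
  show "rsA D u (FA (ladj (Res D u)) f) \<cdot>\<^bsub>Val D (Src u)\<^esub> ladj_unit (Res D u) (Dom (Val D (Src u)) f)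
       = ladj_unit (Res D u) (Cod (Val D (Src u)) f) \<cdot>\<^bsub>Val D (Src u)\<^esub> f"
    using A.unit_natural[unfolded s, OF f] by (simp add: ladj_unit_def)
qed

lemma univ_exists:
  assumes "small_fun u" "X \<in> Ob (Val D (Src u))"
  obtains Y \<eta> where "univ D u Y \<eta>" "Dom (Val D (Src u)) \<eta> = X"
  using univ_lan[OF assms] by blast

end

section \<open>Transformations and slices\<close>

lemma small_nt_mk_nt:
  assumes "small_fun F" "small_fun G" "Src G = Src F" "Tgt G = Tgt F"
    and "\<And>x. x \<in> Ob (Src F) \<Longrightarrow>
      c x \<in> Ar (Tgt F) \<and> Dom (Tgt F) (c x) = FO F x \<and> Cod (Tgt F) (c x) = FO G x"
    and "\<And>f. f \<in> Ar (Src F) \<Longrightarrow>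
      c (Cod (Src F) f) \<cdot>\<^bsub>Tgt F\<^esub> FA F f = FA G f \<cdot>\<^bsub>Tgt F\<^esub> c (Dom (Src F) f)"
  shows "small_nt (mk_nt F G c)"
  unfolding small_nt_def using assms by (auto intro!: nat_trans_mk_nt simp: small_fun_cfunctor)

lemma small_nt_fun:
  assumes "small_nt \<alpha>"
  shows "small_fun (NS \<alpha>)" "small_fun (NT \<alpha>)" "Src (NT \<alpha>) = Src (NS \<alpha>)" "Tgt (NT \<alpha>) = Tgt (NS \<alpha>)"
  using assms nat_trans.Src_eq nat_trans.Tgt_eq by (auto simp: small_nt_def)

lemma small_nt_arr:
  assumes "small_nt \<alpha>" "x \<in> Ob (Src (NS \<alpha>))" "Tgt (NS \<alpha>) = B"
  shows "NC \<alpha> x \<in> Ar B" "Dom B (NC \<alpha> x) = FO (NS \<alpha>) x" "Cod B (NC \<alpha> x) = FO (NT \<alpha>) x"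
  using assms nat_trans.NC_hom[of \<alpha> x] by (auto simp: small_nt_def hom_iff)

lemma small_nt_natural:
  assumes "small_nt \<alpha>" "f \<in> Ar (Src (NS \<alpha>))"
  shows "NC \<alpha> (Cod (Src (NS \<alpha>)) f) \<cdot>\<^bsub>Tgt (NS \<alpha>)\<^esub> FA (NS \<alpha>) f
    = FA (NT \<alpha>) f \<cdot>\<^bsub>Tgt (NS \<alpha>)\<^esub> NC \<alpha> (Dom (Src (NS \<alpha>)) f)"
  using assms nat_trans.NC_natural[of \<alpha> f] by (auto simp: small_nt_def hom_iff)

lemma mk_nt_eqI: "F = F' \<Longrightarrow> G = G' \<Longrightarrow> (\<And>x. x \<in> Ob (Src F) \<Longrightarrow> c x = c' x) \<Longrightarrow> mk_nt F G c = mk_nt F' G' c'"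
  by (auto simp: mk_nt_def)

lemma idN_simps [simp]: "NS (idN u) = u" "NT (idN u) = u"
  "x \<in> Ob (Src u) \<Longrightarrow> NC (idN u) x = Id (Tgt u) (FO u x)"
  by (simp_all add: idN_def)

lemma small_nt_idN [simp]: "small_fun u \<Longrightarrow> small_nt (idN u)"
  unfolding idN_def by (rule small_nt_mk_nt) (simp_all add: sfun_simps)

lemma hcomp_idN_right:
  assumes "small_nt \<alpha>" "small_fun j" "Tgt j = Src (NS \<alpha>)"
  shows "hcomp \<alpha> (idN j) = mk_nt (NS \<alpha> \<odot> j) (NT \<alpha> \<odot> j) (\<lambda>x. NC \<alpha> (FO j x))"
  unfolding hcomp_def using assms small_nt_fun[OF assms(1)]
  by (intro mk_nt_eqI) (simp_all add: sfun_simps small_nt_arr)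

lemma hcomp_idN_left:
  assumes "small_nt \<alpha>" "small_fun w" "Src w = Tgt (NS \<alpha>)"
  shows "hcomp (idN w) \<alpha> = mk_nt (w \<odot> NS \<alpha>) (w \<odot> NT \<alpha>) (\<lambda>x. FA w (NC \<alpha> x))"
  unfolding hcomp_def using assms small_nt_fun[OF assms(1)]
  by (intro mk_nt_eqI) (simp_all add: sfun_simps small_nt_arr)

section \<open>Cells and whiskering\<close>

context prederivator
begin

lemma cell_arr:
  assumes "small_nt \<alpha>" "X \<in> Ob (Val D (Tgt (NS \<alpha>)))" "Src (NS \<alpha>) = K"
  shows "NC (Cell D \<alpha>) X \<in> Ar (Val D K)"
    "Dom (Val D K) (NC (Cell D \<alpha>) X) = rs D (NS \<alpha>) X"
    "Cod (Val D K) (NC (Cell D \<alpha>) X) = rs D (NT \<alpha>) X"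
  using nat_trans.NC_hom[OF Cell_nt[OF assms(1)], of X] assms small_nt_fun[OF assms(1)]
  by (auto simp: Cell_NS Cell_NT Res_Src Res_Tgt hom_iff)

lemma cell_natural:
  assumes "small_nt \<alpha>" "f \<in> Ar (Val D (Tgt (NS \<alpha>)))" "Src (NS \<alpha>) = K"
    "Dom (Val D (Tgt (NS \<alpha>))) f = X" "Cod (Val D (Tgt (NS \<alpha>))) f = Y"
  shows "NC (Cell D \<alpha>) Y \<cdot>\<^bsub>Val D K\<^esub> rsA D (NS \<alpha>) f = rsA D (NT \<alpha>) f \<cdot>\<^bsub>Val D K\<^esub> NC (Cell D \<alpha>) X"
  using nat_trans.NC_natural[OF Cell_nt[OF assms(1)], of f] assms small_nt_fun[OF assms(1)]
  by (auto simp: Cell_NS Cell_NT Res_Src Res_Tgt hom_iff)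

lemma cell_idN: "small_fun u \<Longrightarrow> X \<in> Ob (Val D (Tgt u)) \<Longrightarrow> NC (Cell D (idN u)) X = Id (Val D (Src u)) (rs D u X)"
  by (simp add: Cell_id Res_Src Res_Tgt)

text \<open>\<open>Cell\<close> reverses horizontal composition, so precomposing
  \<open>\<alpha>\<close> with \<open>j\<close> becomes applying \<open>j\<^sup>*\<close> to the
  components of the cell.\<close>

lemma cell_whisker_right:
  assumes "small_nt \<alpha>" "small_fun j" "Tgt j = Src (NS \<alpha>)" "X \<in> Ob (Val D (Tgt (NS \<alpha>)))"
  shows "rsA D j (NC (Cell D \<alpha>) X) = NC (Cell D (mk_nt (NS \<alpha> \<odot> j) (NT \<alpha> \<odot> j) (\<lambda>x. NC \<alpha> (FO j x)))) X"
proof -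
  note [simp] = assms small_nt_fun[OF assms(1)]
  have "Cell D (hcomp \<alpha> (idN j)) = hcomp (Cell D (idN j)) (Cell D \<alpha>)"
    by (rule Cell_hcomp) simp_all
  then have "NC (Cell D (hcomp \<alpha> (idN j))) X = NC (hcomp (idN (Res D j)) (Cell D \<alpha>)) X"
    by (simp add: Cell_id)
  also have "\<dots> = rsA D j (NC (Cell D \<alpha>) X)"
    by (simp add: hcomp_def Cell_NS Cell_NT Res_Src Res_Tgt cell_arr)
  finally show ?thesis by (simp add: hcomp_idN_right)
qed

text \<open>By the same reversal, postcomposing \<open>\<alpha>\<close> with \<open>w\<close>
  becomes evaluating the cell at an object restricted along \<open>w\<close>.\<close>

lemma cell_whisker_left:
  assumes "small_nt \<alpha>" "small_fun w" "Src w = Tgt (NS \<alpha>)" "X \<in> Ob (Val D (Tgt w))"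
  shows "NC (Cell D \<alpha>) (rs D w X) = NC (Cell D (mk_nt (w \<odot> NS \<alpha>) (w \<odot> NT \<alpha>) (\<lambda>x. FA w (NC \<alpha> x)))) X"
proof -
  note [simp] = assms small_nt_fun[OF assms(1)]
  have "Cell D (hcomp (idN w) \<alpha>) = hcomp (Cell D \<alpha>) (Cell D (idN w))"
    by (rule Cell_hcomp) simp_all
  then have "NC (Cell D (hcomp (idN w) \<alpha>)) X = NC (hcomp (Cell D \<alpha>) (idN (Res D w))) X"
    by (simp add: Cell_id)
  also have "\<dots> = NC (Cell D \<alpha>) (rs D w X)"
    using cell_arr[of \<alpha> "rs D w X"]
    by (simp add: hcomp_def Cell_NS Cell_NT Res_Src Res_Tgt)
  finally show ?thesis by (simp add: hcomp_idN_left)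
qed

lemma cell_eq_Id:
  assumes "small_fun F" "\<And>x. x \<in> Ob (Src F) \<Longrightarrow> c x = Id (Tgt F) (FO F x)" "X \<in> Ob (Val D (Tgt F))"
  shows "NC (Cell D (mk_nt F F c)) X = Id (Val D (Src F)) (rs D F X)"
proof -
  have "mk_nt F F c = idN F" unfolding idN_def using assms by (intro mk_nt_eqI) auto
  then show ?thesis using assms by (simp add: cell_idN)
qed

end

section \<open>Slices and coslices\<close>

lemma slice_simps:
  "Ob (slice u b) = {upair a f |a f. a \<in> Ob (Src u) \<and> f \<in> hom (Tgt u) (FO u a) b}"
  "Ar (slice u b) = {upair h (upair f f') |h f f'. h \<in> Ar (Src u) \<and> f \<in> hom (Tgt u) (FO u (Dom (Src u) h)) b \<and>
      f' \<in> hom (Tgt u) (FO u (Cod (Src u) h)) b \<and> f' \<cdot>\<^bsub>Tgt u\<^esub> FA u h = f}"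
  "upair h (upair f f') \<in> Ar (slice u b) \<Longrightarrow> Dom (slice u b) (upair h (upair f f')) = upair (Dom (Src u) h) f"
  "upair h (upair f f') \<in> Ar (slice u b) \<Longrightarrow> Cod (slice u b) (upair h (upair f f')) = upair (Cod (Src u) h) f'"
  "upair a f \<in> Ob (slice u b) \<Longrightarrow> Id (slice u b) (upair a f) = upair (Id (Src u) a) (upair f f)"
  "\<lbrakk>upair h (upair f f') \<in> Ar (slice u b); upair k (upair g g') \<in> Ar (slice u b); Dom (Src u) k = Cod (Src u) h; g = f'\<rbrakk>
   \<Longrightarrow> upair k (upair g g') \<cdot>\<^bsub>slice u b\<^esub> upair h (upair f f') = upair (k \<cdot>\<^bsub>Src u\<^esub> h) (upair f g')"
  by (simp_all add: slice_def Let_def)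

lemma sliceE:
  shows "x \<in> Ob (slice u b) \<Longrightarrow>
      (\<And>a f. \<lbrakk>x = upair a f; a \<in> Ob (Src u); f \<in> hom (Tgt u) (FO u a) b\<rbrakk> \<Longrightarrow> P) \<Longrightarrow> P"
    and "y \<in> Ar (slice u b) \<Longrightarrow>
      (\<And>h f f'. \<lbrakk>y = upair h (upair f f'); h \<in> Ar (Src u); f \<in> hom (Tgt u) (FO u (Dom (Src u) h)) b; f' \<in> hom (Tgt u) (FO u (Cod (Src u) h)) b; f' \<cdot>\<^bsub>Tgt u\<^esub> FA u h = f\<rbrakk> \<Longrightarrow> P) \<Longrightarrow> P"
  unfolding slice_simps by blast+

lemma small_cat_slice [simp]:
  assumes "small_fun u" "b \<in> Ob (Tgt u)"
  shows "small_cat (slice u b)"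
proof -
  note [simp] = assms(1) small_cat_category[OF small_fun_cat(1)[OF assms(1)]]
    small_cat_category[OF small_fun_cat(2)[OF assms(1)]]
  have "category (slice u b)"
    unfolding slice_def Let_def
    by (rule category_mk_cat; (elim CollectE exE conjE)?;
        simp add: hom_iff sfun_simps flip: category.comp_assoc)
  moreover have s: "small (Ar (Src u))" "small (Ar (Tgt u))" "small (Ob (Src u))"
    using small_fun_cat[OF assms(1)] by (simp_all add: small_cat_def)
  have "small (Ob (slice u b))"
    by (rule small_subset[OF small_image2[of "Ob (Src u)" "Ar (Tgt u)" upair]])
       (auto simp: slice_simps hom_iff s)
  moreover have "small (Ar (slice u b))"
    by (rule small_subset[OF small_image2[of "Ar (Src u)" "{upair f f' |f f'. f \<in> Ar (Tgt u) \<and> f' \<in> Ar (Tgt u)}" upair]])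
       (auto simp: slice_simps hom_iff s intro!: small_image2)
  ultimately show ?thesis by (simp add: small_cat_def)
qed

lemma coslice_simps:
  "Ob (coslice u b) = {upair a f |a f. a \<in> Ob (Src u) \<and> f \<in> hom (Tgt u) b (FO u a)}"
  "Ar (coslice u b) = {upair h (upair f f') |h f f'. h \<in> Ar (Src u) \<and> f \<in> hom (Tgt u) b (FO u (Dom (Src u) h)) \<and>
      f' \<in> hom (Tgt u) b (FO u (Cod (Src u) h)) \<and> FA u h \<cdot>\<^bsub>Tgt u\<^esub> f = f'}"
  "upair h (upair f f') \<in> Ar (coslice u b) \<Longrightarrow> Dom (coslice u b) (upair h (upair f f')) = upair (Dom (Src u) h) f"
  "upair h (upair f f') \<in> Ar (coslice u b) \<Longrightarrow> Cod (coslice u b) (upair h (upair f f')) = upair (Cod (Src u) h) f'"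
  "upair a f \<in> Ob (coslice u b) \<Longrightarrow> Id (coslice u b) (upair a f) = upair (Id (Src u) a) (upair f f)"
  "\<lbrakk>upair h (upair f f') \<in> Ar (coslice u b); upair k (upair g g') \<in> Ar (coslice u b); Dom (Src u) k = Cod (Src u) h; g = f'\<rbrakk>
   \<Longrightarrow> upair k (upair g g') \<cdot>\<^bsub>coslice u b\<^esub> upair h (upair f f') = upair (k \<cdot>\<^bsub>Src u\<^esub> h) (upair f g')"
  by (simp_all add: coslice_def Let_def)

lemma cosliceE:
  shows "x \<in> Ob (coslice u b) \<Longrightarrow>
      (\<And>a f. \<lbrakk>x = upair a f; a \<in> Ob (Src u); f \<in> hom (Tgt u) b (FO u a)\<rbrakk> \<Longrightarrow> P) \<Longrightarrow> P"
    and "y \<in> Ar (coslice u b) \<Longrightarrow>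
      (\<And>h f f'. \<lbrakk>y = upair h (upair f f'); h \<in> Ar (Src u); f \<in> hom (Tgt u) b (FO u (Dom (Src u) h)); f' \<in> hom (Tgt u) b (FO u (Cod (Src u) h)); FA u h \<cdot>\<^bsub>Tgt u\<^esub> f = f'\<rbrakk> \<Longrightarrow> P) \<Longrightarrow> P"
  unfolding coslice_simps by blast+

lemma small_cat_coslice [simp]:
  assumes "small_fun u" "b \<in> Ob (Tgt u)"
  shows "small_cat (coslice u b)"
proof -
  note [simp] = assms(1) small_cat_category[OF small_fun_cat(1)[OF assms(1)]]
    small_cat_category[OF small_fun_cat(2)[OF assms(1)]]
  have "category (coslice u b)"
    unfolding coslice_def Let_def
    by (rule category_mk_cat; (elim CollectE exE conjE)?; simp add: hom_iff sfun_simps)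
  moreover have s: "small (Ar (Src u))" "small (Ar (Tgt u))" "small (Ob (Src u))"
    using small_fun_cat[OF assms(1)] by (simp_all add: small_cat_def)
  have "small (Ob (coslice u b))"
    by (rule small_subset[OF small_image2[of "Ob (Src u)" "Ar (Tgt u)" upair]])
       (auto simp: coslice_simps hom_iff s)
  moreover have "small (Ar (coslice u b))"
    by (rule small_subset[OF small_image2[of "Ar (Src u)" "{upair f f' |f f'. f \<in> Ar (Tgt u) \<and> f' \<in> Ar (Tgt u)}" upair]])
       (auto simp: coslice_simps hom_iff s intro!: small_image2)
  ultimately show ?thesis by (simp add: small_cat_def)
qed

lemma slice_pr [simp]:
  "Src (slice_pr u b) = slice u b" "Tgt (slice_pr u b) = Src u"
  "upair a f \<in> Ob (slice u b) \<Longrightarrow> FO (slice_pr u b) (upair a f) = a"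
  "upair h p \<in> Ar (slice u b) \<Longrightarrow> FA (slice_pr u b) (upair h p) = h"
  "Src (coslice_pr u b) = coslice u b" "Tgt (coslice_pr u b) = Src u"
  "upair a f \<in> Ob (coslice u b) \<Longrightarrow> FO (coslice_pr u b) (upair a f) = a"
  "upair h p \<in> Ar (coslice u b) \<Longrightarrow> FA (coslice_pr u b) (upair h p) = h"
  by (simp_all add: slice_pr_def coslice_pr_def)

lemma small_fun_slice_pr [simp]:
  assumes u: "small_fun u" "b \<in> Ob (Tgt u)"
  shows "small_fun (slice_pr u b)"
proof -
  note c = small_cat_category[OF small_cat_slice[OF u]]
  show ?thesis using u unfolding slice_pr_def
    by (intro small_funI cfunctor_mk_fun; simp?; (elim sliceE)?; 
       simp add: c slice_simps hom_iff sfun_simps)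
qed

lemma small_fun_coslice_pr [simp]:
  assumes u: "small_fun u" "b \<in> Ob (Tgt u)"
  shows "small_fun (coslice_pr u b)"
proof -
  note c = small_cat_category[OF small_cat_coslice[OF u]]
  show ?thesis using u unfolding coslice_pr_def
    by (intro small_funI cfunctor_mk_fun; simp?; (elim cosliceE)?; 
       simp add: c coslice_simps hom_iff sfun_simps)
qed

lemma slice_nt [simp]:
  "NS (slice_nt u b) = u \<odot> slice_pr u b" "NT (slice_nt u b) = point (Tgt u) b \<odot> bang (slice u b)"
  "upair a f \<in> Ob (slice u b) \<Longrightarrow> NC (slice_nt u b) (upair a f) = f"
  "NT (coslice_nt u b) = u \<odot> coslice_pr u b" "NS (coslice_nt u b) = point (Tgt u) b \<odot> bang (coslice u b)"
  "upair a f \<in> Ob (coslice u b) \<Longrightarrow> NC (coslice_nt u b) (upair a f) = f"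
  by (simp_all add: slice_nt_def coslice_nt_def)

lemma small_nt_slice_nt [simp]:
  assumes u: "small_fun u" "b \<in> Ob (Tgt u)"
  shows "small_nt (slice_nt u b)"
  unfolding slice_nt_def
  using assms by (intro small_nt_mk_nt; simp; (elim sliceE)?; simp add: slice_simps hom_iff sfun_simps)

lemma small_nt_coslice_nt [simp]:
  assumes u: "small_fun u" "b \<in> Ob (Tgt u)"
  shows "small_nt (coslice_nt u b)"
  unfolding coslice_nt_def
  using assms by (intro small_nt_mk_nt; simp; (elim cosliceE)?; simp add: coslice_simps hom_iff sfun_simps)

section \<open>Pointwise criteria and base change\<close>

text \<open>The arrow \<open>pr\<^sup>*X \<rightarrow> pr\<^sup>*u\<^sup>*Y \<rightarrow>
  \<pi>\<^sup>*b\<^sup>*Y\<close>; for the chosen unit in place of \<open>\<eta>\<close> its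
  transpose is the map of (Der4).\<close>

definition at_slice :: "('u::universe, 'o, 'a) pder \<Rightarrow> 'u sfun \<Rightarrow> 'u \<Rightarrow> 'o \<Rightarrow> 'a \<Rightarrow> 'a" where
  "at_slice D u b Y \<eta> = NC (Cell D (slice_nt u b)) Y \<cdot>\<^bsub>Val D (slice u b)\<^esub> rsA D (slice_pr u b) \<eta>"

context derivator
begin

lemma at_slice_arr:
  assumes "small_fun u" "b \<in> Ob (Tgt u)" "Y \<in> Ob (Val D (Tgt u))" "\<eta> \<in> Ar (Val D (Src u))"
    "Cod (Val D (Src u)) \<eta> = rs D u Y"
  shows "at_slice D u b Y \<eta> \<in> Ar (Val D (slice u b))"
    "Dom (Val D (slice u b)) (at_slice D u b Y \<eta>) = rs D (slice_pr u b) (Dom (Val D (Src u)) \<eta>)"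
    "Cod (Val D (slice u b)) (at_slice D u b Y \<eta>) = rs D (bang (slice u b)) (rs D (point (Tgt u) b) Y)"
  using assms by (simp_all add: at_slice_def cell_arr)

text \<open>Naturality of the tautological cell at \<open>g\<close>.\<close>

lemma at_slice_post:
  assumes u: "small_fun u" "b \<in> Ob (Tgt u)" and \<eta>: "\<eta> \<in> Ar (Val D (Src u))"
    "Cod (Val D (Src u)) \<eta> = rs D u Y" and g: "g \<in> Ar (Val D (Tgt u))" "Dom (Val D (Tgt u)) g = Y"
    "Cod (Val D (Tgt u)) g = Z"
  shows "at_slice D u b Z (rsA D u g \<cdot>\<^bsub>Val D (Src u)\<^esub> \<eta>)
    = rsA D (bang (slice u b)) (rsA D (point (Tgt u) b) g) \<cdot>\<^bsub>Val D (slice u b)\<^esub> at_slice D u b Y \<eta>"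
proof -
  have [simp]: "Y \<in> Ob (Val D (Tgt u))" "Z \<in> Ob (Val D (Tgt u))" using g u by auto
  note [simp] = u \<eta> g cell_arr
  have "at_slice D u b Z (rsA D u g \<cdot>\<^bsub>Val D (Src u)\<^esub> \<eta>)
    = (NC (Cell D (slice_nt u b)) Z \<cdot>\<^bsub>Val D (slice u b)\<^esub> rsA D (u \<odot> slice_pr u b) g)
        \<cdot>\<^bsub>Val D (slice u b)\<^esub> rsA D (slice_pr u b) \<eta>"
    by (simp add: at_slice_def)
  also have "NC (Cell D (slice_nt u b)) Z \<cdot>\<^bsub>Val D (slice u b)\<^esub> rsA D (u \<odot> slice_pr u b) g
    = rsA D (point (Tgt u) b \<odot> bang (slice u b)) g \<cdot>\<^bsub>Val D (slice u b)\<^esub> NC (Cell D (slice_nt u b)) Y"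
    using cell_natural[of "slice_nt u b" g "slice u b" Y Z] by simp
  finally show ?thesis by (simp add: at_slice_def)
qed

text \<open>(Der4) gives this for the chosen unit; an arbitrary universal \<open>\<eta>\<close>
  differs from it by an isomorphism \<open>g\<close>, which \<open>at_slice_post\<close> carries to
  an isomorphism at \<open>b\<close>.\<close>

lemma univ_at_slice:
  assumes \<eta>: "univ D u Y \<eta>" and b: "b \<in> Ob (Tgt u)"
  shows "univ D (bang (slice u b)) (rs D (point (Tgt u) b) Y) (at_slice D u b Y \<eta>)"
proof -
  note a = univD[OF \<eta>]
  define X where "X = Dom (Val D (Src u)) \<eta>"
  have X: "X \<in> Ob (Val D (Src u))" using a by (simp add: X_def)
  note l = univ_lan[OF a(1) X]
  note l' = l univD[OF l(1)]
  let ?L = "lan D u X" and ?U = "ladj_unit (Res D u) X"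
  obtain g where g: "g \<in> Ar (Val D (Tgt u))" "Dom (Val D (Tgt u)) g = ?L" "Cod (Val D (Tgt u)) g = Y"
    "rsA D u g \<cdot>\<^bsub>Val D (Src u)\<^esub> ?U = \<eta>"
    using univ_ex[OF l(1) a(3) a(2)] l' a X_def by auto
  have i: "iso (Val D (Tgt u)) g" using univ_post_iff[OF l(1) g(1,2,3)] \<eta> g(4) by simp
  have "lan_comparison D u b X = ltransp (Res D (bang (slice u b))) (rs D (point (Tgt u) b) ?L) (at_slice D u b ?L ?U)"
    by (simp add: lan_comparison_def at_slice_def)
  then have 0: "univ D (bang (slice u b)) (rs D (point (Tgt u) b) ?L) (at_slice D u b ?L ?U)"
    using Der4_left[OF a(1) b X] a(1) b l' at_slice_arr[OF a(1) b, of ?L ?U]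
    by (simp add: ltransp_iso_iff[of "bang (slice u b)", simplified])
  have gi: "iso (Val D \<e>) (rsA D (point (Tgt u) b) g)"
    by (rule rsA_iso[OF _ i]) (use a b in simp_all)
  have "univ D (bang (slice u b)) (Cod (Val D \<e>) (rsA D (point (Tgt u) b) g))
    (rsA D (bang (slice u b)) (rsA D (point (Tgt u) b) g) \<cdot>\<^bsub>Val D (slice u b)\<^esub> at_slice D u b ?L ?U)"
    using univ_post[OF 0, of "rsA D (point (Tgt u) b) g"] gi a b g by simp
  then show ?thesis
    using at_slice_post[OF a(1) b l'(6,7) g(1-3)] g a b by simp
qed

text \<open>Factor \<open>\<eta>\<close> through the chosen unit by some \<open>g\<close>. At each
  \<open>b\<close> the map \<open>b\<^sup>*g\<close> compares two universal arrows, so it is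
  invertible, and (Der2) makes \<open>g\<close> invertible.\<close>

lemma univI_at_slice:
  assumes u: "small_fun u" and \<eta>: "\<eta> \<in> Ar (Val D (Src u))" "Cod (Val D (Src u)) \<eta> = rs D u Y"
    and Y: "Y \<in> Ob (Val D (Tgt u))"
    and pt: "\<And>b. b \<in> Ob (Tgt u) \<Longrightarrow>
      univ D (bang (slice u b)) (rs D (point (Tgt u) b) Y) (at_slice D u b Y \<eta>)"
  shows "univ D u Y \<eta>"
proof -
  define X where "X = Dom (Val D (Src u)) \<eta>"
  have X: "X \<in> Ob (Val D (Src u))" using \<eta> u by (simp add: X_def)
  note l = univ_lan[OF u X]
  note l' = l univD[OF l(1)]
  let ?L = "lan D u X" and ?U = "ladj_unit (Res D u) X"
  obtain g where g: "g \<in> Ar (Val D (Tgt u))" "Dom (Val D (Tgt u)) g = ?L" "Cod (Val D (Tgt u)) g = Y"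
    "rsA D u g \<cdot>\<^bsub>Val D (Src u)\<^esub> ?U = \<eta>"
    using univ_ex[OF l(1) \<eta>(1) Y] l' \<eta> X_def by auto
  have "iso (Val D \<e>) (rsA D (point (Tgt u) b) g)" if b: "b \<in> Ob (Tgt u)" for b
  proof -
    have "univ D (bang (slice u b)) (rs D (point (Tgt u) b) Y)
      (rsA D (bang (slice u b)) (rsA D (point (Tgt u) b) g) \<cdot>\<^bsub>Val D (slice u b)\<^esub> at_slice D u b ?L ?U)"
      using pt[OF b] at_slice_post[OF u b l'(6,7) g(1-3)] g(4) by simp
    then show ?thesis
      using univ_post_iff[OF univ_at_slice[OF l(1) b], of "rsA D (point (Tgt u) b) g" "rs D (point (Tgt u) b) Y"]
        g(1-3) u b by simp
  qed
  then have "iso (Val D (Tgt u)) g" using Der2[of "Tgt u" g] u g by simp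
  then show ?thesis using univ_post_iff[OF l(1) g(1-3)] g(4) by simp
qed

text \<open>A reflective inclusion \<open>j\<close> with reflector \<open>l\<close> is final.\<close>

lemma univ_reflective:
  assumes j: "j \<in> fn T S" and l: "l \<in> fn S T" and lj: "l \<odot> j = idF T"
    and \<rho>: "small_nt \<rho>" "NS \<rho> = idF S" "NT \<rho> = j \<odot> l"
    and \<rho>j: "\<And>x. x \<in> Ob T \<Longrightarrow> NC \<rho> (FO j x) = Id S (FO j x)"
    and l\<rho>: "\<And>x. x \<in> Ob S \<Longrightarrow> FA l (NC \<rho> x) = Id T (FO l x)"
    and Y: "Y \<in> Ob (Val D \<e>)" and \<theta>: "\<theta> \<in> Ar (Val D S)" "Cod (Val D S) \<theta> = rs D (bang S) Y"
  shows "univ D (bang S) Y \<theta> \<longleftrightarrow> univ D (bang T) Y (rsA D j \<theta>)"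
proof -
  note [simp] = j[unfolded fn_iff] l[unfolded fn_iff] lj \<rho> Y \<theta>
  define X where "X = Dom (Val D S) \<theta>"
  have X [simp]: "X \<in> Ob (Val D S)" by (simp add: X_def)
  have "l \<odot> (j \<odot> l) = (l \<odot> j) \<odot> l" by (simp del: lj)
  then have ljl [simp]: "l \<odot> (j \<odot> l) = l" by simp
  define R where "R Z = NC (Cell D \<rho>) Z" for Z
  have R [simp]: "R Z \<in> Ar (Val D S)" "Dom (Val D S) (R Z) = Z" "Cod (Val D S) (R Z) = rs D (j \<odot> l) Z"
    if "Z \<in> Ob (Val D S)" for Z
    using cell_arr[of \<rho> Z S] that by (simp_all add: R_def)
  \<comment> \<open>The triangle identities of the reflection hold strictly, because
    \<open>\<rho>\<close> becomes an identity after \<open>l\<close> and on the image of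
    \<open>j\<close>.\<close>
  have Rl: "R (rs D l Z) = Id (Val D S) (rs D l Z)" if "Z \<in> Ob (Val D T)" for Z
    using cell_whisker_left[of \<rho> l Z] cell_eq_Id[of l "\<lambda>x. FA l (NC \<rho> x)" Z] that l\<rho>
    by (simp add: R_def)
  have Rj: "rsA D j (R Z) = Id (Val D T) (rs D j Z)" if "Z \<in> Ob (Val D S)" for Z
  proof -
    have "(j \<odot> l) \<odot> j = j" by (simp add: sfcomp_assoc)
    then show ?thesis
      using cell_whisker_right[of \<rho> j Z] cell_eq_Id[of j "\<lambda>x. NC \<rho> (FO j x)" Z] that \<rho>j
      by (simp add: R_def)
  qed
  have nat: "R (Cod (Val D S) f) \<cdot>\<^bsub>Val D S\<^esub> f = rsA D (j \<odot> l) f \<cdot>\<^bsub>Val D S\<^esub> R (Dom (Val D S) f)"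
    if "f \<in> Ar (Val D S)" for f
    using cell_natural[of \<rho> f S] that by (simp add: R_def)
  \<comment> \<open>A prederivator keeps the direction of 2-cells, so the reflection makes
    \<open>j\<^sup>*\<close> left adjoint to \<open>l\<^sup>*\<close>, with unit
    \<open>R\<close>.\<close>
  have 1: "univ D l (rs D j X) (R X)"
  proof (rule univI, goal_cases)
    case (5 f Z)
    have "rsA D l (rsA D j f) \<cdot>\<^bsub>Val D S\<^esub> R X = f"
      using nat[of f] 5 Rl[of Z] by simp
    then show ?case using 5 by (intro exI[of _ "rsA D j f"]) simp
  next
    case (6 g g')
    have "rsA D j (rsA D l h \<cdot>\<^bsub>Val D S\<^esub> R X) = h" if "h \<in> {g, g'}" for h
      using that 6(1-5) by (auto simp: Rj)
    moreover have "rsA D l g \<cdot>\<^bsub>Val D S\<^esub> R X = rsA D l g' \<cdot>\<^bsub>Val D S\<^esub> R X" using 6(6) by simp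
    ultimately show ?case by (metis insertI1 insertI2)
  qed simp_all
  \<comment> \<open>Projecting to the point trivialises \<open>\<rho>\<close>, so \<open>R\<close>
    is an identity at constant objects, and \<theta> factors through the unit as
    \<open>j\<^sup>*\<theta>\<close>.\<close>
  have "R (rs D (bang S) Y) = Id (Val D S) (rs D (bang S) Y)"
    using cell_whisker_left[of \<rho> "bang S" Y] small_nt_arr[OF \<rho>(1), of _ S]
      cell_eq_Id[of "bang S" "\<lambda>x. FA (bang S) (NC \<rho> x)" Y]
    by (simp add: R_def)
  then have eq: "rsA D l (rsA D j \<theta>) \<cdot>\<^bsub>Val D S\<^esub> R X = \<theta>"
    using nat[of \<theta>] by (simp add: X_def)
  show ?thesis
  proof
    assume a: "univ D (bang S) Y \<theta>"
    show "univ D (bang T) Y (rsA D j \<theta>)"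
      by (rule univ_cancel[OF 1]) (use a eq in \<open>simp_all add: X_def\<close>)
  next
    assume "univ D (bang T) Y (rsA D j \<theta>)"
    from univ_comp[OF 1 this] show "univ D (bang S) Y \<theta>" using eq by (simp add: X_def)
  qed
qed

end

section \<open>Slices of a product and fibrewise universality\<close>

definition ins :: "'u::universe scat \<Rightarrow> 'u \<Rightarrow> 'u scat \<Rightarrow> 'u sfun" where
  "ins L l A = \<langle>point L l \<odot> bang A, idF A\<rangle>"

definition insr :: "'u::universe scat \<Rightarrow> 'u \<Rightarrow> 'u scat \<Rightarrow> 'u sfun" where
  "insr L l A = \<langle>idF A, point L l \<odot> bang A\<rangle>"

lemma ins_simps [simp]: "Src (ins L l A) = A" "Tgt (ins L l A) = L \<otimes> A"
  "l \<in> Ob L \<Longrightarrow> small_cat L \<Longrightarrow> small_cat A \<Longrightarrow> small_fun (ins L l A)"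
  "x \<in> Ob A \<Longrightarrow> FO (ins L l A) x = upair l x"
  "f \<in> Ar A \<Longrightarrow> FA (ins L l A) f = upair (Id L l) f"
  by (simp_all add: ins_def)

lemma insr_simps [simp]: "Src (insr L l A) = A" "Tgt (insr L l A) = A \<otimes> L"
  "l \<in> Ob L \<Longrightarrow> small_cat L \<Longrightarrow> small_cat A \<Longrightarrow> small_fun (insr L l A)"
  by (simp_all add: insr_def)

text \<open>The slice of \<open>1 \<times> u\<close> over \<open>(l, b)\<close> is
  \<open>L/l \<times> u/b\<close>. The identity of \<open>l\<close> is terminal in
  \<open>L/l\<close>, which makes \<open>T\<close> the reflective subcategory of objects whose
  \<open>L\<close>-part is that identity; the last two clauses record how the projection and the
  tautological transformation restrict to it.\<close>

lemma slice_times: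
  fixes L :: "'u::universe scat" and u :: "'u sfun"
  assumes L: "small_cat L" and u: "small_fun u" and l: "l \<in> Ob L" and b: "b \<in> Ob (Tgt u)"
  defines "S \<equiv> slice (idF L \<otimes>\<^sub>F u) (upair l b)" and "T \<equiv> slice u b"
  obtains j r \<rho> where "j \<in> fn T S" "r \<in> fn S T" "r \<odot> j = idF T"
    "small_nt \<rho>" "NS \<rho> = idF S" "NT \<rho> = j \<odot> r"
    "\<And>x. x \<in> Ob T \<Longrightarrow> NC \<rho> (FO j x) = Id S (FO j x)"
    "\<And>x. x \<in> Ob S \<Longrightarrow> FA r (NC \<rho> x) = Id T (FO r x)"
    "slice_pr (idF L \<otimes>\<^sub>F u) (upair l b) \<odot> j = ins L l (Src u) \<odot> slice_pr u b"
    "\<And>x. x \<in> Ob T \<Longrightarrow> NC (slice_nt (idF L \<otimes>\<^sub>F u) (upair l b)) (FO j x) = upair (Id L l) (NC (slice_nt u b) x)"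
proof -
  note [simp] = L u l b small_cat_category sfun_simps
  have S [simp]: "small_cat S" unfolding S_def by (rule small_cat_slice) (use l b in auto)
  have T [simp]: "small_cat T" unfolding T_def by simp
  \<comment> \<open>Coordinates on objects and arrows of \<open>S\<close>; the \<open>L\<close>-part
    of an object is an arrow \<open>m : l0 \<rightarrow> l\<close>.\<close>
  have ObS: "\<exists>l0 a m f. x = upair (upair l0 a) (upair m f) \<and> l0 \<in> Ob L \<and> a \<in> Ob (Src u) \<and> m \<in> Ar L \<and> Dom L m = l0
      \<and> Cod L m = l \<and> f \<in> Ar (Tgt u) \<and> Dom (Tgt u) f = FO u a \<and> Cod (Tgt u) f = b" if "x \<in> Ob S" for x
  proof -
    from that[unfolded S_def] obtain p q where x: "x = upair p q" "p \<in> Ob (L \<otimes> Src u)"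
      "q \<in> hom (L \<otimes> Tgt u) (FO (idF L \<otimes>\<^sub>F u) p) (upair l b)" by (elim sliceE) (simp only: timesF_simps idF_simps)
    from x(2) obtain l0 a where p: "p = upair l0 a" "l0 \<in> Ob L" "a \<in> Ob (Src u)" by auto
    obtain m f where q: "q = upair m f" "m \<in> Ar L" "f \<in> Ar (Tgt u)" using x(3)[THEN hom_iff[THEN iffD1], THEN conjunct1] by auto
    show ?thesis
      by (intro exI[of _ l0] exI[of _ a] exI[of _ m] exI[of _ f]) (use x p q in \<open>simp add: hom_iff\<close>)
  qed
  have ArS: "\<exists>n h m f m' f'. x = upair (upair n h) (upair (upair m f) (upair m' f')) \<and> n \<in> Ar L \<and> h \<in> Ar (Src u)
      \<and> m \<in> Ar L \<and> Dom L m = Dom L n \<and> Cod L m = l \<and> m' \<in> Ar L \<and> Dom L m' = Cod L n \<and> Cod L m' = l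
      \<and> f \<in> Ar (Tgt u) \<and> Dom (Tgt u) f = FO u (Dom (Src u) h) \<and> Cod (Tgt u) f = b
      \<and> f' \<in> Ar (Tgt u) \<and> Dom (Tgt u) f' = FO u (Cod (Src u) h) \<and> Cod (Tgt u) f' = b
      \<and> m' \<cdot>\<^bsub>L\<^esub> n = m \<and> f' \<cdot>\<^bsub>Tgt u\<^esub> FA u h = f" if "x \<in> Ar S" for x
  proof -
    from that[unfolded S_def] obtain nh p p' where x: "x = upair nh (upair p p')" "nh \<in> Ar (L \<otimes> Src u)"
      "p \<in> hom (L \<otimes> Tgt u) (FO (idF L \<otimes>\<^sub>F u) (Dom (L \<otimes> Src u) nh)) (upair l b)"
      "p' \<in> hom (L \<otimes> Tgt u) (FO (idF L \<otimes>\<^sub>F u) (Cod (L \<otimes> Src u) nh)) (upair l b)"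
      "p' \<cdot>\<^bsub>L \<otimes> Tgt u\<^esub> FA (idF L \<otimes>\<^sub>F u) nh = p" by (elim sliceE) (simp only: timesF_simps idF_simps)
    from x(2) obtain n h where nh: "nh = upair n h" "n \<in> Ar L" "h \<in> Ar (Src u)" by auto
    obtain m f where p: "p = upair m f" "m \<in> Ar L" "f \<in> Ar (Tgt u)" using x(3)[THEN hom_iff[THEN iffD1], THEN conjunct1] by auto
    obtain m' f' where p': "p' = upair m' f'" "m' \<in> Ar L" "f' \<in> Ar (Tgt u)" using x(4)[THEN hom_iff[THEN iffD1], THEN conjunct1] by auto
    have "Dom L m = Dom L n \<and> Cod L m = l \<and> Dom (Tgt u) f = FO u (Dom (Src u) h) \<and> Cod (Tgt u) f = b"
      using x(3) unfolding nh(1) p(1) using nh p by (simp add: hom_iff)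
    moreover have q': "Dom L m' = Cod L n \<and> Cod L m' = l \<and> Dom (Tgt u) f' = FO u (Cod (Src u) h) \<and> Cod (Tgt u) f' = b"
      using x(4) unfolding nh(1) p'(1) using nh p' by (simp add: hom_iff)
    moreover have "m' \<cdot>\<^bsub>L\<^esub> n = m \<and> f' \<cdot>\<^bsub>Tgt u\<^esub> FA u h = f"
      using x(5) unfolding nh(1) p(1) p'(1) using nh p' q' by simp
    ultimately show ?thesis
      using x(1) unfolding nh(1) p(1) p'(1) using nh p p' by blast
  qed
  define j where "j = mk_fun T S (\<lambda>x. upair (upair l (ufst x)) (upair (Id L l) (usnd x)))
    (\<lambda>h. upair (upair (Id L l) (ufst h)) (upair (upair (Id L l) (ufst (usnd h))) (upair (Id L l) (usnd (usnd h)))))"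
  define r where "r = mk_fun S T (\<lambda>x. upair (usnd (ufst x)) (usnd (usnd x)))
    (\<lambda>h. upair (usnd (ufst h)) (upair (usnd (ufst (usnd h))) (usnd (usnd (usnd h)))))"
  \<comment> \<open>The unit of the reflection at \<open>((l0, a), (m, f))\<close> is
    \<open>(m, 1) : (l0, a) \<rightarrow> (l, a)\<close>: in the \<open>L\<close>-direction, the
    unique map to the terminal object.\<close>
  define \<rho> where "\<rho> = mk_nt (idF S) (j \<odot> r) (\<lambda>x. upair (upair (ufst (usnd x)) (Id (Src u) (usnd (ufst x))))
    (upair (usnd x) (upair (Id L l) (usnd (usnd x)))))"
  note sl = slice_simps[where u = "idF L \<otimes>\<^sub>F u" and b = "upair l b"] slice_simps[where u = u and b = b]
  note [simp] = hom_iff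
  have jS [simp]: "Src j = T" "Tgt j = S" by (simp_all add: j_def)
  have j [simp]: "small_fun j"
    unfolding j_def
    by (intro small_funI cfunctor_mk_fun; simp?; (unfold T_def, elim sliceE)?; simp add: S_def sl)
  have rS [simp]: "Src r = S" "Tgt r = T" by (simp_all add: r_def)
  have r [simp]: "small_fun r"
    unfolding r_def
    by (intro small_funI cfunctor_mk_fun; simp?; ((drule ObS)+ | (drule ArS)+)?; (elim exE conjE)?; simp add: S_def T_def sl)
  have jx [simp]: "FO j x = upair (upair l (ufst x)) (upair (Id L l) (usnd x))" if "x \<in> Ob T" for x
    using that by (simp add: j_def)
  have jf [simp]: "FA j x = upair (upair (Id L l) (ufst x)) (upair (upair (Id L l) (ufst (usnd x))) (upair (Id L l) (usnd (usnd x))))"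
    if "x \<in> Ar T" for x
    using that by (simp add: j_def)
  have rx [simp]: "FO r x = upair (usnd (ufst x)) (usnd (usnd x))" if "x \<in> Ob S" for x
    using that by (simp add: r_def)
  have rf [simp]: "FA r h = upair (usnd (ufst h)) (upair (usnd (ufst (usnd h))) (usnd (usnd (usnd h))))" if "h \<in> Ar S" for h
    using that by (simp add: r_def)
  show thesis
  proof
    show "j \<in> fn T S" "r \<in> fn S T" by (simp_all add: fn_iff)
    show "r \<odot> j = idF T"
      by (rule sfun_eqI; simp?; (unfold T_def, elim sliceE)?; simp add: S_def T_def sl)
    show \<rho>: "small_nt \<rho>"
      unfolding \<rho>_def
      by (intro small_nt_mk_nt; simp?; ((drule ObS)+ | (drule ArS)+)?; (elim exE conjE)?; simp add: S_def T_def sl)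
    show "NS \<rho> = idF S" "NT \<rho> = j \<odot> r" by (simp_all add: \<rho>_def)
    show "NC \<rho> (FO j x) = Id S (FO j x)" if "x \<in> Ob T" for x
      using that unfolding T_def
      by (elim sliceE; simp add: S_def T_def sl \<rho>_def)
    show "FA r (NC \<rho> x) = Id T (FO r x)" if "x \<in> Ob S" for x
      using ObS[OF that]
      by (elim exE conjE; simp add: S_def T_def sl \<rho>_def)
    show "slice_pr (idF L \<otimes>\<^sub>F u) (upair l b) \<odot> j = ins L l (Src u) \<odot> slice_pr u b"
      by (rule sfun_eqI; simp?; (unfold T_def, elim sliceE)?; simp add: S_def T_def sl)
    show "NC (slice_nt (idF L \<otimes>\<^sub>F u) (upair l b)) (FO j x) = upair (Id L l) (NC (slice_nt u b) x)" if "x \<in> Ob T" for x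
      using that unfolding T_def
      by (elim sliceE; simp add: S_def T_def sl)
  qed
qed

lemma timesF_pairF [simp]:
  assumes "small_fun u" "small_fun v" "small_fun a" "small_fun b" "Src a = Src b" "Tgt a = Src u" "Tgt b = Src v"
  shows "(u \<otimes>\<^sub>F v) \<odot> \<langle>a, b\<rangle> = \<langle>u \<odot> a, v \<odot> b\<rangle>"
  using assms by (simp add: timesF_def)

lemma timesF_ins [simp]:
  assumes "small_cat L" "small_fun u" "l \<in> Ob L" "Src u = A"
  shows "(idF L \<otimes>\<^sub>F u) \<odot> ins L l A = ins L l (Tgt u) \<odot> u"
  using assms small_fun_cat[OF assms(2)] by (simp add: ins_def)

definition swap :: "'u::universe scat \<Rightarrow> 'u scat \<Rightarrow> 'u sfun" where
  "swap A B = \<langle>pr2 A B, pr1 A B\<rangle>"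

lemma swap_simps [simp]: "Src (swap A B) = A \<otimes> B" "Tgt (swap A B) = B \<otimes> A"
  "small_cat A \<Longrightarrow> small_cat B \<Longrightarrow> small_fun (swap A B)"
  "small_cat A \<Longrightarrow> small_cat B \<Longrightarrow> swap A B \<odot> swap B A = idF (B \<otimes> A)"
  "small_cat L \<Longrightarrow> small_cat A \<Longrightarrow> l \<in> Ob L \<Longrightarrow> swap L A \<odot> ins L l A = insr L l A"
  by (simp_all add: swap_def ins_def insr_def)

lemma swap_natural:
  "small_fun u \<Longrightarrow> small_fun v \<Longrightarrow> Src u = A \<Longrightarrow> Src v = B \<Longrightarrow>
    (v \<otimes>\<^sub>F u) \<odot> swap A B = swap (Tgt u) (Tgt v) \<odot> (u \<otimes>\<^sub>F v)"
  by (auto simp: swap_def timesF_def)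

context derivator
begin

text \<open>By \<open>slice_times\<close> and finality of a reflective subcategory, universality at
  \<open>(l, b)\<close> depends only on the restriction to \<open>u/b\<close>, and there the two
  arrows agree.\<close>

lemma at_slice_ins:
  assumes L: "small_cat L" and u: "small_fun u" and l: "l \<in> Ob L" and b: "b \<in> Ob (Tgt u)"
    and Y: "Y \<in> Ob (Val D (L \<otimes> Tgt u))"
    and \<eta>: "\<eta> \<in> Ar (Val D (L \<otimes> Src u))" "Cod (Val D (L \<otimes> Src u)) \<eta> = rs D (idF L \<otimes>\<^sub>F u) Y"
  shows "univ D (bang (slice (idF L \<otimes>\<^sub>F u) (upair l b))) (rs D (point (L \<otimes> Tgt u) (upair l b)) Y)
      (at_slice D (idF L \<otimes>\<^sub>F u) (upair l b) Y \<eta>) \<longleftrightarrow>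
    univ D (bang (slice u b)) (rs D (point (Tgt u) b) (rs D (ins L l (Tgt u)) Y))
      (at_slice D u b (rs D (ins L l (Tgt u)) Y) (rsA D (ins L l (Src u)) \<eta>))"
proof -
  let ?v = "idF L \<otimes>\<^sub>F u" and ?c = "upair l b"
  let ?S = "slice ?v ?c" and ?T = "slice u b"
  obtain j r \<rho> where j: "j \<in> fn ?T ?S" and r: "r \<in> fn ?S ?T" and rj: "r \<odot> j = idF ?T"
    and \<rho>: "small_nt \<rho>" "NS \<rho> = idF ?S" "NT \<rho> = j \<odot> r"
    "\<And>x. x \<in> Ob ?T \<Longrightarrow> NC \<rho> (FO j x) = Id ?S (FO j x)"
    "\<And>x. x \<in> Ob ?S \<Longrightarrow> FA r (NC \<rho> x) = Id ?T (FO r x)"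
    and pr: "slice_pr ?v ?c \<odot> j = ins L l (Src u) \<odot> slice_pr u b"
    and nc: "\<And>x. x \<in> Ob ?T \<Longrightarrow> NC (slice_nt ?v ?c) (FO j x) = upair (Id L l) (NC (slice_nt u b) x)"
    using slice_times[OF L u l b] by blast
  have c: "?c \<in> Ob (Tgt ?v)" using l b by simp
  have [simp]: "small_cat ?S" "small_fun (slice_pr ?v ?c)" "small_nt (slice_nt ?v ?c)"
    "small_fun (point (L \<otimes> Tgt u) ?c)"
    using c L u l b by simp_all
  note [simp] = L u l b Y \<eta> j[unfolded fn_iff] pr
  have v: "?v \<odot> (ins L l (Src u) \<odot> slice_pr u b) = ins L l (Tgt u) \<odot> (u \<odot> slice_pr u b)"
    by (simp flip: sfcomp_assoc)
  note at = at_slice_arr[OF _ c, of Y \<eta>]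
  have "univ D (bang ?S) (rs D (point (L \<otimes> Tgt u) ?c) Y) (at_slice D ?v ?c Y \<eta>) \<longleftrightarrow>
    univ D (bang ?T) (rs D (point (L \<otimes> Tgt u) ?c) Y) (rsA D j (at_slice D ?v ?c Y \<eta>))"
    by (rule univ_reflective[OF j r rj \<rho>]) (use at in simp_all)
  also have "rsA D j (at_slice D ?v ?c Y \<eta>) = at_slice D u b (rs D (ins L l (Tgt u)) Y) (rsA D (ins L l (Src u)) \<eta>)"
  proof -
    have "rsA D j (NC (Cell D (slice_nt ?v ?c)) Y) = NC (Cell D (slice_nt u b)) (rs D (ins L l (Tgt u)) Y)"
    proof -
      \<comment> \<open>On \<open>u/b\<close> the tautological transformation of the large slice is
        \<open>(1, f)\<close>, the image under \<open>ins L l\<close> of that of the small slice;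
        the two whiskering rules turn this into an equality of cells.\<close>
      have "mk_nt (NS (slice_nt ?v ?c) \<odot> j) (NT (slice_nt ?v ?c) \<odot> j) (\<lambda>x. NC (slice_nt ?v ?c) (FO j x))
        = mk_nt (ins L l (Tgt u) \<odot> NS (slice_nt u b)) (ins L l (Tgt u) \<odot> NT (slice_nt u b))
            (\<lambda>x. FA (ins L l (Tgt u)) (NC (slice_nt u b) x))"
      proof (rule mk_nt_eqI)
        show "NS (slice_nt ?v ?c) \<odot> j = ins L l (Tgt u) \<odot> NS (slice_nt u b)" by (simp add: v)
        have "ins L l (Tgt u) \<odot> (point (Tgt u) b \<odot> bang ?T) = point (L \<otimes> Tgt u) ?c \<odot> bang ?T"
          by (subst sfcomp_assoc[symmetric]) simp_all
        then show "NT (slice_nt ?v ?c) \<odot> j = ins L l (Tgt u) \<odot> NT (slice_nt u b)" by simp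
      qed (simp add: nc small_nt_arr)
      then show ?thesis
        using cell_whisker_right[of "slice_nt ?v ?c" j Y] cell_whisker_left[of "slice_nt u b" "ins L l (Tgt u)" Y]
        by simp
    qed
    then show ?thesis unfolding at_slice_def by (simp add: cell_arr)
  qed
  finally show ?thesis by simp
qed

text \<open>Both sides split into conditions at the points \<open>(l, b)\<close>, matched by
  \<open>at_slice_ins\<close>.\<close>

lemma univ_times_left_iff:
  assumes L: "small_cat L" and u: "small_fun u"
    and Y: "Y \<in> Ob (Val D (L \<otimes> Tgt u))"
    and \<eta>: "\<eta> \<in> Ar (Val D (L \<otimes> Src u))" "Cod (Val D (L \<otimes> Src u)) \<eta> = rs D (idF L \<otimes>\<^sub>F u) Y"
  shows "univ D (idF L \<otimes>\<^sub>F u) Y \<eta> \<longleftrightarrow>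
    (\<forall>l \<in> Ob L. univ D u (rs D (ins L l (Tgt u)) Y) (rsA D (ins L l (Src u)) \<eta>))"
proof (intro iffI ballI)
  fix l assume l: "l \<in> Ob L" and un: "univ D (idF L \<otimes>\<^sub>F u) Y \<eta>"
  show "univ D u (rs D (ins L l (Tgt u)) Y) (rsA D (ins L l (Src u)) \<eta>)"
  proof (rule univI_at_slice)
    fix b assume b: "b \<in> Ob (Tgt u)"
    then show "univ D (bang (slice u b)) (rs D (point (Tgt u) b) (rs D (ins L l (Tgt u)) Y))
      (at_slice D u b (rs D (ins L l (Tgt u)) Y) (rsA D (ins L l (Src u)) \<eta>))"
      using at_slice_ins[OF L u l b Y \<eta>] univ_at_slice[OF un, of "upair l b"] l by simp
  qed (use L u l Y \<eta> in simp_all)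
next
  assume pt: "\<forall>l \<in> Ob L. univ D u (rs D (ins L l (Tgt u)) Y) (rsA D (ins L l (Src u)) \<eta>)"
  show "univ D (idF L \<otimes>\<^sub>F u) Y \<eta>"
  proof (rule univI_at_slice)
    fix c assume "c \<in> Ob (Tgt (idF L \<otimes>\<^sub>F u))"
    then obtain l b where c: "c = upair l b" and l: "l \<in> Ob L" and b: "b \<in> Ob (Tgt u)" by auto
    have "univ D u (rs D (ins L l (Tgt u)) Y) (rsA D (ins L l (Src u)) \<eta>)" using pt l by blast
    from univ_at_slice[OF this b]
    show "univ D (bang (slice (idF L \<otimes>\<^sub>F u) c)) (rs D (point (Tgt (idF L \<otimes>\<^sub>F u)) c) Y)
      (at_slice D (idF L \<otimes>\<^sub>F u) c Y \<eta>)"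
      using at_slice_ins[OF L u l b Y \<eta>] by (simp add: c)
  qed (use L u Y \<eta> in simp_all)
qed

text \<open>\<open>fam f I v\<close>: up to isomorphism of functors, \<open>v\<close> is \<open>f\<close> times an identity, and \<open>I\<close> is the family of
  copies of \<open>f\<close> inside \<open>v\<close>.\<close>

definition fam :: "'u sfun \<Rightarrow> ('u sfun \<times> 'u sfun) set \<Rightarrow> 'u sfun \<Rightarrow> bool" where
  "fam f I v \<longleftrightarrow> small_fun f \<and> small_fun v \<and>
     (\<forall>(c, d) \<in> I. c \<in> fn (Src f) (Src v) \<and> d \<in> fn (Tgt f) (Tgt v) \<and> v \<odot> c = d \<odot> f) \<and>
     (\<forall>\<eta> \<in> Ar (Val D (Src v)). \<forall>Y \<in> Ob (Val D (Tgt v)). Cod (Val D (Src v)) \<eta> = rs D v Y \<longrightarrow>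
        (univ D v Y \<eta> \<longleftrightarrow> (\<forall>(c, d) \<in> I. univ D f (rs D d Y) (rsA D c \<eta>))))"

lemma famD:
  assumes "fam f I v"
  shows "small_fun f" "small_fun v"
    and "(c, d) \<in> I \<Longrightarrow> c \<in> fn (Src f) (Src v) \<and> d \<in> fn (Tgt f) (Tgt v) \<and> v \<odot> c = d \<odot> f"
    and "\<lbrakk>\<eta> \<in> Ar (Val D (Src v)); Y \<in> Ob (Val D (Tgt v)); Cod (Val D (Src v)) \<eta> = rs D v Y\<rbrakk> \<Longrightarrow>
      univ D v Y \<eta> \<longleftrightarrow> (\<forall>(c, d) \<in> I. univ D f (rs D d Y) (rsA D c \<eta>))"
  using assms unfolding fam_def by auto

lemma fam_self: "small_fun f \<Longrightarrow> fam f {(idF (Src f), idF (Tgt f))} f"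
  by (simp add: fam_def fn_iff)

text \<open>Universality for \<open>1 \<times> v\<close> is tested in each fibre over
  \<open>l\<close>, and in the fibre on the copies of \<open>f\<close> inside \<open>v\<close>; the
  new family combines the two tests.\<close>

lemma fam_times_left:
  assumes L: "small_cat L" and v: "fam f I v"
  shows "fam f {(ins L l (Src v) \<odot> c, ins L l (Tgt v) \<odot> d) |l c d. l \<in> Ob L \<and> (c, d) \<in> I} (idF L \<otimes>\<^sub>F v)"
    (is "fam f ?J ?v")
  unfolding fam_def
proof (intro conjI ballI impI)
  note [simp] = L famD(1,2)[OF v]
  show "small_fun f" "small_fun ?v" by simp_all
  fix p assume "p \<in> ?J"
  then obtain l c d where p: "p = (ins L l (Src v) \<odot> c, ins L l (Tgt v) \<odot> d)" "l \<in> Ob L" and cd: "(c, d) \<in> I" by blast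
  note cd' = famD(3)[OF v cd, unfolded fn_iff]
  have "?v \<odot> (ins L l (Src v) \<odot> c) = (?v \<odot> ins L l (Src v)) \<odot> c"
    using cd' p by (subst sfcomp_assoc) simp_all
  then show "case p of (c, d) \<Rightarrow> c \<in> fn (Src f) (Src ?v) \<and> d \<in> fn (Tgt f) (Tgt ?v) \<and> ?v \<odot> c = d \<odot> f"
    using cd' p by (simp add: fn_iff)
next
  note [simp] = L famD(1,2)[OF v]
  fix \<eta> Y
  assume a: "\<eta> \<in> Ar (Val D (Src ?v))" "Y \<in> Ob (Val D (Tgt ?v))" "Cod (Val D (Src ?v)) \<eta> = rs D ?v Y"
  have "univ D v (rs D (ins L l (Tgt v)) Y) (rsA D (ins L l (Src v)) \<eta>) \<longleftrightarrow>
      (\<forall>(c, d) \<in> I. univ D f (rs D (ins L l (Tgt v) \<odot> d) Y) (rsA D (ins L l (Src v) \<odot> c) \<eta>))"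
    if l: "l \<in> Ob L" for l
  proof -
    have "rs D d (rs D (ins L l (Tgt v)) Y) = rs D (ins L l (Tgt v) \<odot> d) Y"
      "rsA D c (rsA D (ins L l (Src v)) \<eta>) = rsA D (ins L l (Src v) \<odot> c) \<eta>" if "(c, d) \<in> I" for c d
      using famD(3)[OF v that, unfolded fn_iff] a l by simp_all
    moreover have "univ D v (rs D (ins L l (Tgt v)) Y) (rsA D (ins L l (Src v)) \<eta>) \<longleftrightarrow>
      (\<forall>(c, d) \<in> I. univ D f (rs D d (rs D (ins L l (Tgt v)) Y)) (rsA D c (rsA D (ins L l (Src v)) \<eta>)))"
      by (rule famD(4)[OF v]) (use a l in simp_all)
    ultimately show ?thesis by auto
  qed
  then have "(\<forall>l \<in> Ob L. univ D v (rs D (ins L l (Tgt v)) Y) (rsA D (ins L l (Src v)) \<eta>)) \<longleftrightarrow>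
    (\<forall>(c, d) \<in> ?J. univ D f (rs D d Y) (rsA D c \<eta>))" by fast
  then show "univ D ?v Y \<eta> \<longleftrightarrow> (\<forall>(c, d) \<in> ?J. univ D f (rs D d Y) (rsA D c \<eta>))"
    using univ_times_left_iff[of L v Y \<eta>] a by simp
qed

text \<open>Conjugation by isomorphisms of categories neither creates nor destroys universal arrows,
  so the family is carried along by the inverses \<open>a'\<close> and \<open>b'\<close>.\<close>

lemma fam_iso:
  assumes u: "fam f I u"
    and a: "small_fun a" "small_fun a'" "a' \<odot> a = idF (Src a)" "a \<odot> a' = idF (Tgt a)" "Src a' = Tgt a" "Tgt a' = Src a"
    and b: "small_fun b" "small_fun b'" "b' \<odot> b = idF (Src b)" "b \<odot> b' = idF (Tgt b)" "Src b' = Tgt b" "Tgt b' = Src b"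
    and v: "small_fun v" "u \<odot> a = b \<odot> v" "Src v = Src a" "Tgt v = Src b" "Src u = Tgt a" "Tgt u = Tgt b"
  shows "fam f {(a' \<odot> c, b' \<odot> d) |c d. (c, d) \<in> I} v" (is "fam f ?J v")
proof -
  note [simp] = famD(1,2)[OF u] a b v
  have "v \<odot> a' = ((b' \<odot> b) \<odot> v) \<odot> a'" by simp
  also have "\<dots> = b' \<odot> ((b \<odot> v) \<odot> a')" by (simp del: b(3) v(2))
  also have "\<dots> = b' \<odot> (u \<odot> (a \<odot> a'))" unfolding v(2)[symmetric] by (simp del: a(4) v(2))
  finally have va: "v \<odot> a' = b' \<odot> u" by simp
  have [simp]: "small_cat (Src b)" "small_cat (Src a)" using small_fun_cat[OF a(1)] small_fun_cat[OF b(1)] by simp_all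
  show ?thesis
    unfolding fam_def
  proof (intro conjI ballI impI)
    show "small_fun f" "small_fun v" by simp_all
    fix p assume "p \<in> ?J"
    then obtain c d where p: "p = (a' \<odot> c, b' \<odot> d)" and cd: "(c, d) \<in> I" by blast
    note cd' = famD(3)[OF u cd, unfolded fn_iff]
    have "v \<odot> (a' \<odot> c) = (v \<odot> a') \<odot> c" using cd' by (subst sfcomp_assoc) simp_all
    also have "\<dots> = b' \<odot> (d \<odot> f)" unfolding va using cd' by simp
    finally show "case p of (c, d) \<Rightarrow> c \<in> fn (Src f) (Src v) \<and> d \<in> fn (Tgt f) (Tgt v) \<and> v \<odot> c = d \<odot> f"
      using cd' by (simp add: p fn_iff)
  next
    fix \<eta> Y assume h: "\<eta> \<in> Ar (Val D (Src v))" "Y \<in> Ob (Val D (Tgt v))" "Cod (Val D (Src v)) \<eta> = rs D v Y"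
    let ?\<eta> = "rsA D a' \<eta>" and ?Y = "rs D b' Y"
    have "univ D v Y \<eta> \<longleftrightarrow> univ D u ?Y ?\<eta>"
    proof
      assume "univ D v Y \<eta>"
      then show "univ D u ?Y ?\<eta>"
        by (rule univ_iso_square[where a' = a and b' = b]) (simp_all add: va)
    next
      assume "univ D u ?Y ?\<eta>"
      then have "univ D v (rs D b ?Y) (rsA D a ?\<eta>)"
        by (rule univ_iso_square[where a' = a' and b' = b']) simp_all
      then show "univ D v Y \<eta>" using h by simp
    qed
    also have "\<dots> \<longleftrightarrow> (\<forall>(c, d) \<in> I. univ D f (rs D d ?Y) (rsA D c ?\<eta>))"
      by (rule famD(4)[OF u]) (use h va in simp_all)
    also have "\<dots> \<longleftrightarrow> (\<forall>(c, d) \<in> ?J. univ D f (rs D d Y) (rsA D c \<eta>))"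
    proof -
      have "rs D d ?Y = rs D (b' \<odot> d) Y" "rsA D c ?\<eta> = rsA D (a' \<odot> c) \<eta>" if "(c, d) \<in> I" for c d
        using famD(3)[OF u that, unfolded fn_iff] h by simp_all
      then have "(\<forall>(c, d) \<in> I. univ D f (rs D d ?Y) (rsA D c ?\<eta>)) \<longleftrightarrow>
          (\<forall>(c, d) \<in> I. univ D f (rs D (b' \<odot> d) Y) (rsA D (a' \<odot> c) \<eta>))" by auto
      then show ?thesis by fast
    qed
    finally show "univ D v Y \<eta> \<longleftrightarrow> (\<forall>(c, d) \<in> ?J. univ D f (rs D d Y) (rsA D c \<eta>))" .
  qed
qed

text \<open>Deduced from the left version by conjugating with the swap of factors.\<close>

lemma fam_times_right:
  assumes L: "small_cat L" and v: "fam f I v"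
  shows "fam f {(insr L l (Src v) \<odot> c, insr L l (Tgt v) \<odot> d) |l c d. l \<in> Ob L \<and> (c, d) \<in> I} (v \<otimes>\<^sub>F idF L)"
proof -
  note [simp] = L famD(1,2)[OF v] swap_natural
  have "fam f {(swap L (Src v) \<odot> c, swap L (Tgt v) \<odot> d) |c d.
      (c, d) \<in> {(ins L l (Src v) \<odot> c, ins L l (Tgt v) \<odot> d) |l c d. l \<in> Ob L \<and> (c, d) \<in> I}} (v \<otimes>\<^sub>F idF L)"
    by (rule fam_iso[OF fam_times_left[OF L v], where a = "swap (Src v) L" and b = "swap (Tgt v) L"]) simp_all
  also have "{(swap L (Src v) \<odot> c, swap L (Tgt v) \<odot> d) |c d.
      (c, d) \<in> {(ins L l (Src v) \<odot> c, ins L l (Tgt v) \<odot> d) |l c d. l \<in> Ob L \<and> (c, d) \<in> I}}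
    = {(insr L l (Src v) \<odot> c, insr L l (Tgt v) \<odot> d) |l c d. l \<in> Ob L \<and> (c, d) \<in> I}" (is "?P = ?Q")
  proof -
    have *: "swap L (Src v) \<odot> (ins L l (Src v) \<odot> c) = insr L l (Src v) \<odot> c"
      "swap L (Tgt v) \<odot> (ins L l (Tgt v) \<odot> d) = insr L l (Tgt v) \<odot> d" if "l \<in> Ob L" "(c, d) \<in> I" for l c d
    proof -
      note cd = famD(3)[OF v that(2), unfolded fn_iff]
      show "swap L (Src v) \<odot> (ins L l (Src v) \<odot> c) = insr L l (Src v) \<odot> c"
        "swap L (Tgt v) \<odot> (ins L l (Tgt v) \<odot> d) = insr L l (Tgt v) \<odot> d"
        using cd that by (subst sfcomp_assoc[symmetric]; simp)+
    qed
    show ?thesis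
    proof (intro equalityI subsetI)
      fix p assume "p \<in> ?P"
      then obtain l c d where "p = (swap L (Src v) \<odot> (ins L l (Src v) \<odot> c), swap L (Tgt v) \<odot> (ins L l (Tgt v) \<odot> d))"
        "l \<in> Ob L" "(c, d) \<in> I" by blast
      then show "p \<in> ?Q" using * by blast
    next
      fix p assume "p \<in> ?Q"
      then obtain l c d where "p = (insr L l (Src v) \<odot> c, insr L l (Tgt v) \<odot> d)" and i: "l \<in> Ob L" "(c, d) \<in> I" by blast
      then have "p = (swap L (Src v) \<odot> (ins L l (Src v) \<odot> c), swap L (Tgt v) \<odot> (ins L l (Tgt v) \<odot> d))" by (simp only: *[OF i])
      then show "p \<in> ?P" using i by blast
    qed
  qed
  finally show ?thesis .
qed

text \<open>A Beck--Chevalley statement: universality over \<open>v\<close> is tested on its copies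
  of \<open>f\<close>, and \<open>(s, t)\<close> sends each of them to a copy of \<open>f\<close> in
  \<open>u\<close>, where the test succeeds. Only a combinatorial condition on functors is left to
  check.\<close>

lemma univ_base_change:
  assumes u: "fam f I u" and v: "fam f J v" and s: "s \<in> fn (Src v) (Src u)" and t: "t \<in> fn (Tgt v) (Tgt u)"
    and sq: "u \<odot> s = t \<odot> v" and J: "\<And>c d. (c, d) \<in> J \<Longrightarrow> (s \<odot> c, t \<odot> d) \<in> I"
    and \<eta>: "univ D u Y \<eta>"
  shows "univ D v (rs D t Y) (rsA D s \<eta>)"
proof -
  note [simp] = famD(1,2)[OF u] famD(1,2)[OF v] s[unfolded fn_iff] t[unfolded fn_iff] univD[OF \<eta>] sq
  have "univ D f (rs D d (rs D t Y)) (rsA D c (rsA D s \<eta>))" if cd: "(c, d) \<in> J" for c d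
  proof -
    have "univ D f (rs D (t \<odot> d) Y) (rsA D (s \<odot> c) \<eta>)"
      using famD(4)[OF u, of \<eta> Y] J[OF cd] \<eta> by auto
    then show ?thesis using famD(3)[OF v cd, unfolded fn_iff] by simp
  qed
  then show ?thesis using famD(4)[OF v, of "rsA D s \<eta>" "rs D t Y"] by auto
qed

end

section \<open>The shifted derivator\<close>

lemma couniv_conds:
  assumes "couniv D u Y \<epsilon>"
  shows "small_fun u" "Y \<in> Ob (Val D (Tgt u))" "\<epsilon> \<in> Ar (Val D (Src u))" "Dom (Val D (Src u)) \<epsilon> = rs D u Y"
  using assms by (auto simp: couniv_def)

lemma counivI:
  assumes "small_fun u" "Y \<in> Ob (Val D (Tgt u))" "\<epsilon> \<in> Ar (Val D (Src u))"
    "Dom (Val D (Src u)) \<epsilon> = rs D u Y"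
    and ex: "\<And>f Z. \<lbrakk>f \<in> Ar (Val D (Src u)); Z \<in> Ob (Val D (Tgt u));
        Cod (Val D (Src u)) f = Cod (Val D (Src u)) \<epsilon>; Dom (Val D (Src u)) f = rs D u Z\<rbrakk>
        \<Longrightarrow> \<exists>g. g \<in> Ar (Val D (Tgt u)) \<and> Cod (Val D (Tgt u)) g = Y \<and> Dom (Val D (Tgt u)) g = Z \<and>
          \<epsilon> \<cdot>\<^bsub>Val D (Src u)\<^esub> rsA D u g = f"
    and un: "\<And>g g'. \<lbrakk>g \<in> Ar (Val D (Tgt u)); g' \<in> Ar (Val D (Tgt u)); Cod (Val D (Tgt u)) g = Y;
        Cod (Val D (Tgt u)) g' = Y; Dom (Val D (Tgt u)) g = Dom (Val D (Tgt u)) g';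
        \<epsilon> \<cdot>\<^bsub>Val D (Src u)\<^esub> rsA D u g = \<epsilon> \<cdot>\<^bsub>Val D (Src u)\<^esub> rsA D u g'\<rbrakk> \<Longrightarrow> g = g'"
  shows "couniv D u Y \<epsilon>"
  unfolding couniv_def
proof (intro conjI ballI impI)
  fix f Z
  assume "f \<in> Ar (Val D (Src u))" "Z \<in> Ob (Val D (Tgt u))"
    "Cod (Val D (Src u)) f = Cod (Val D (Src u)) \<epsilon>" "Dom (Val D (Src u)) f = rs D u Z"
  from ex[OF this] obtain g where g: "g \<in> Ar (Val D (Tgt u))" "Cod (Val D (Tgt u)) g = Y"
    "Dom (Val D (Tgt u)) g = Z" "\<epsilon> \<cdot>\<^bsub>Val D (Src u)\<^esub> rsA D u g = f" by blast
  show "\<exists>!g. g \<in> hom (Val D (Tgt u)) Z Y \<and> \<epsilon> \<cdot>\<^bsub>Val D (Src u)\<^esub> rsA D u g = f"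
    using g un by (intro ex1I[of _ g]) (auto simp: hom_iff)
qed (use assms in auto)

context prederivator
begin

text \<open>Dual to \<open>univ_post_iff\<close>, for comparison maps into a right Kan
  extension.\<close>

lemma couniv_pre_iff:
  assumes \<epsilon>: "couniv D u Y \<epsilon>" and g: "g \<in> Ar (Val D (Tgt u))" "Cod (Val D (Tgt u)) g = Y" "Dom (Val D (Tgt u)) g = Z"
  shows "couniv D u Z (\<epsilon> \<cdot>\<^bsub>Val D (Src u)\<^esub> rsA D u g) \<longleftrightarrow> iso (Val D (Tgt u)) g"
proof
  note a = couniv_conds[OF \<epsilon>] g
  have Z: "Z \<in> Ob (Val D (Tgt u))" using a by auto
  note unique = couniv_unique[OF prederivator_axioms]
  {
    assume c: "couniv D u Z (\<epsilon> \<cdot>\<^bsub>Val D (Src u)\<^esub> rsA D u g)"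
    obtain h where h: "h \<in> Ar (Val D (Tgt u))" "Cod (Val D (Tgt u)) h = Z" "Dom (Val D (Tgt u)) h = Y"
      "(\<epsilon> \<cdot>\<^bsub>Val D (Src u)\<^esub> rsA D u g) \<cdot>\<^bsub>Val D (Src u)\<^esub> rsA D u h = \<epsilon>"
      using couniv_ex[OF c, of \<epsilon> Y] a by auto
    have h4: "\<epsilon> \<cdot>\<^bsub>Val D (Src u)\<^esub> (rsA D u g \<cdot>\<^bsub>Val D (Src u)\<^esub> rsA D u h) = \<epsilon>" using h a by simp
    have gh: "g \<cdot>\<^bsub>Val D (Tgt u)\<^esub> h = Id (Val D (Tgt u)) Y"
      by (rule unique[OF \<epsilon>]) (use a h(1-3) h4 in simp_all)
    have e1: "rsA D u g \<cdot>\<^bsub>Val D (Src u)\<^esub> rsA D u h = Id (Val D (Src u)) (rs D u Y)"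
      using arg_cong[OF gh, of "rsA D u"] a h by simp
    have e2: "\<epsilon> \<cdot>\<^bsub>Val D (Src u)\<^esub> (rsA D u g \<cdot>\<^bsub>Val D (Src u)\<^esub> (rsA D u h \<cdot>\<^bsub>Val D (Src u)\<^esub> rsA D u g))
      = \<epsilon> \<cdot>\<^bsub>Val D (Src u)\<^esub> ((rsA D u g \<cdot>\<^bsub>Val D (Src u)\<^esub> rsA D u h) \<cdot>\<^bsub>Val D (Src u)\<^esub> rsA D u g)"
      using a h(1-3) by simp
    have "h \<cdot>\<^bsub>Val D (Tgt u)\<^esub> g = Id (Val D (Tgt u)) Z"
      by (rule unique[OF c]) (use a h(1-3) Z e2[unfolded e1] in simp_all)
    then show "iso (Val D (Tgt u)) g"
      by (intro category.isoI[of _ g h]) (use a h gh in simp_all)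
  next
    assume i: "iso (Val D (Tgt u)) g"
    then obtain h where h: "h \<in> Ar (Val D (Tgt u))" "Dom (Val D (Tgt u)) h = Y" "Cod (Val D (Tgt u)) h = Z"
      "h \<cdot>\<^bsub>Val D (Tgt u)\<^esub> g = Id (Val D (Tgt u)) Z" "g \<cdot>\<^bsub>Val D (Tgt u)\<^esub> h = Id (Val D (Tgt u)) Y"
      using category.isoE[of "Val D (Tgt u)" g] a by auto
    show "couniv D u Z (\<epsilon> \<cdot>\<^bsub>Val D (Src u)\<^esub> rsA D u g)"
    proof (rule counivI, goal_cases)
      case (5 f W)
      obtain k where k: "k \<in> Ar (Val D (Tgt u))" "Cod (Val D (Tgt u)) k = Y" "Dom (Val D (Tgt u)) k = W"
        "\<epsilon> \<cdot>\<^bsub>Val D (Src u)\<^esub> rsA D u k = f"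
        using couniv_ex[OF \<epsilon>, of f W] 5 a by auto
      have "g \<cdot>\<^bsub>Val D (Tgt u)\<^esub> (h \<cdot>\<^bsub>Val D (Tgt u)\<^esub> k) = (g \<cdot>\<^bsub>Val D (Tgt u)\<^esub> h) \<cdot>\<^bsub>Val D (Tgt u)\<^esub> k"
        using a h(1-3) k(1-3) by simp
      then have "g \<cdot>\<^bsub>Val D (Tgt u)\<^esub> (h \<cdot>\<^bsub>Val D (Tgt u)\<^esub> k) = k" using h k a by simp
      then have "rsA D u g \<cdot>\<^bsub>Val D (Src u)\<^esub> rsA D u (h \<cdot>\<^bsub>Val D (Tgt u)\<^esub> k) = rsA D u k"
        using rsA_comp[of u "Tgt u" "h \<cdot>\<^bsub>Val D (Tgt u)\<^esub> k" g] a h(1-3) k(1-3) by simp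
      then show ?case using a h(1-3) k
        by (intro exI[of _ "h \<cdot>\<^bsub>Val D (Tgt u)\<^esub> k"]) simp
    next
      case (6 k k')
      have "g \<cdot>\<^bsub>Val D (Tgt u)\<^esub> k = g \<cdot>\<^bsub>Val D (Tgt u)\<^esub> k'"
        by (rule unique[OF \<epsilon>]) (use a 6 in simp_all)
      then show ?case using category.iso_cancel_left[OF _ i, of k k'] 6 a by simp
    qed (use a Z in simp_all)
  }
qed

end

context derivator
begin

lemma radj_src_tgt:
  assumes "small_fun u"
  shows "Src (radj (Res D u)) = Val D (Src u)" "Tgt (radj (Res D u)) = Val D (Tgt u)"
  using adjunction.Src_R[OF right_adj_adjunction] adjunction.Tgt_R[OF right_adj_adjunction] assms
  by (simp_all add: Res_Src Res_Tgt)

lemma couniv_ran: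
  assumes u: "small_fun u" and X: "X \<in> Ob (Val D (Src u))"
  shows "couniv D u (ran D u X) (radj_counit (Res D u) X)"
    "Cod (Val D (Src u)) (radj_counit (Res D u) X) = X" "ran D u X \<in> Ob (Val D (Tgt u))"
proof -
  interpret A: adjunction "Res D u" "radj (Res D u)" "fst (snd (right_adj (Res D u)))" "snd (snd (right_adj (Res D u)))"
    by (rule right_adj_adjunction[OF u])
  note s = radj_src_tgt[OF u] Res_Src[OF u] Res_Tgt[OF u]
  have un: "radj_counit (Res D u) = NC (snd (snd (right_adj (Res D u))))" by (simp add: radj_counit_def)
  note [simp] = A.counit_arr[unfolded s, folded un]
  show L: "ran D u X \<in> Ob (Val D (Tgt u))" using X cfunctor_ob[OF A.R_functor] by (simp add: s)
  show "Cod (Val D (Src u)) (radj_counit (Res D u) X) = X" using X by simp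
  show "couniv D u (ran D u X) (radj_counit (Res D u) X)"
  proof (rule counivI, goal_cases)
    case (5 f Z)
    then show ?case using A.right_transpose[of f Z, unfolded s, folded un] X by auto
  next
    case (6 g g')
    from A.right_transpose_unique[of _ _ X, OF _ refl _ _ refl, unfolded s, folded un] 6 X
    have "FA (radj (Res D u)) (radj_counit (Res D u) X \<cdot>\<^bsub>Val D (Src u)\<^esub> rsA D u h) \<cdot>\<^bsub>Val D (Tgt u)\<^esub>
        NC (fst (snd (right_adj (Res D u)))) (Dom (Val D (Tgt u)) h) = h" if "h \<in> {g, g'}" for h
      using that by blast
    from this[of g] this[of g'] show ?case unfolding 6(5,6) by simp
  qed (use u X L in simp_all)
qed

lemma rtransp:
  assumes u: "small_fun u" and f: "f \<in> Ar (Val D (Src u))" "Dom (Val D (Src u)) f = rs D u Z"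
    "Cod (Val D (Src u)) f = X" and Z: "Z \<in> Ob (Val D (Tgt u))"
  shows "rtransp (Res D u) Z f \<in> Ar (Val D (Tgt u))" "Dom (Val D (Tgt u)) (rtransp (Res D u) Z f) = Z"
    "Cod (Val D (Tgt u)) (rtransp (Res D u) Z f) = ran D u X"
    "radj_counit (Res D u) X \<cdot>\<^bsub>Val D (Src u)\<^esub> rsA D u (rtransp (Res D u) Z f) = f"
proof -
  interpret A: adjunction "Res D u" "radj (Res D u)" "fst (snd (right_adj (Res D u)))" "snd (snd (right_adj (Res D u)))"
    by (rule right_adj_adjunction[OF u])
  note s = radj_src_tgt[OF u] Res_Src[OF u] Res_Tgt[OF u]
  show "rtransp (Res D u) Z f \<in> Ar (Val D (Tgt u))" "Dom (Val D (Tgt u)) (rtransp (Res D u) Z f) = Z"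
    "Cod (Val D (Tgt u)) (rtransp (Res D u) Z f) = ran D u X"
    "radj_counit (Res D u) X \<cdot>\<^bsub>Val D (Src u)\<^esub> rsA D u (rtransp (Res D u) Z f) = f"
    using A.right_transpose[unfolded s, OF f(1,2) Z] f(3)
    by (simp_all add: rtransp_def radj_counit_def radj_unit_def s)
qed

lemma rtransp_iso_iff:
  assumes u: "small_fun u" and f: "f \<in> Ar (Val D (Src u))" "Dom (Val D (Src u)) f = rs D u Z"
    and Z: "Z \<in> Ob (Val D (Tgt u))"
  shows "iso (Val D (Tgt u)) (rtransp (Res D u) Z f) \<longleftrightarrow> couniv D u Z f"
proof -
  have X: "Cod (Val D (Src u)) f \<in> Ob (Val D (Src u))" using f u by simp
  note l = rtransp[OF u f refl Z]
  from couniv_pre_iff[OF couniv_ran(1)[OF u X] l(1,3,2)] l(4) show ?thesis by simp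
qed

text \<open>\<open>ins L l A\<close> is the product of \<open>point L l\<close> with
  \<open>A\<close> after identifying \<open>\<e> \<times> A\<close> with \<open>A\<close>, so its
  copies of the point sit over the objects of \<open>A\<close>.\<close>

lemma fam_ins:
  assumes L: "small_cat L" and A: "small_cat A" and l: "l \<in> Ob L"
  shows "fam (point L l) {(point A a, insr A a L) |a. a \<in> Ob A} (ins L l A)"
proof -
  note [simp] = assms
  have "\<langle>bang (\<e> \<otimes> A), pr2 \<e> A\<rangle> = idF (\<e> \<otimes> A)"
    by (rule sfun_eqI) auto
  note [simp] = this
  have "fam (point L l) {(idF \<e>, idF L)} (point L l)"
    using fam_self[of "point L l"] by simp
  from fam_times_right[OF A this]
  have f: "fam (point L l) {(insr A a \<e> \<odot> c, insr A a L \<odot> d) |a c d. a \<in> Ob A \<and> (c, d) \<in> {(idF \<e>, idF L)}}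
      (point L l \<otimes>\<^sub>F idF A)" by (simp only: point_simps)
  have "fam (point L l) {(pr2 \<e> A \<odot> c, idF (L \<otimes> A) \<odot> d) |c d. (c, d) \<in>
     {(insr A a \<e> \<odot> c, insr A a L \<odot> d) |a c d. a \<in> Ob A \<and> (c, d) \<in> {(idF \<e>, idF L)}}} (ins L l A)"
    by (rule fam_iso[OF f, where a = "\<langle>bang A, idF A\<rangle>" and b = "idF (L \<otimes> A)"]) (simp_all add: ins_def)
  moreover have "{(pr2 \<e> A \<odot> c, idF (L \<otimes> A) \<odot> d) |c d. (c, d) \<in>
     {(insr A a \<e> \<odot> c, insr A a L \<odot> d) |a c d. a \<in> Ob A \<and> (c, d) \<in> {(idF \<e>, idF L)}}}
    = {(pr2 \<e> A \<odot> (insr A a \<e> \<odot> idF \<e>), idF (L \<otimes> A) \<odot> (insr A a L \<odot> idF L)) |a. a \<in> Ob A}" by auto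
  moreover have "pr2 \<e> A \<odot> (insr A a \<e> \<odot> idF \<e>) = point A a" "idF (L \<otimes> A) \<odot> (insr A a L \<odot> idF L) = insr A a L"
    if "a \<in> Ob A" for a
    using that by (simp_all add: insr_def)
  then have "{(pr2 \<e> A \<odot> (insr A a \<e> \<odot> idF \<e>), idF (L \<otimes> A) \<odot> (insr A a L \<odot> idF L)) |a. a \<in> Ob A}
    = {(point A a, insr A a L) |a. a \<in> Ob A}" by force
  ultimately show ?thesis by simp
qed

text \<open>Up to isomorphism, base change gives
  \<open>(1 \<times> u)\<^sup>* ins\<^sub>! = ins\<^sub>! u\<^sup>*\<close>; passing to right
  adjoints yields \<open>ins\<^sup>* (1 \<times> u)\<^sub>* = u\<^sub>* ins\<^sup>*\<close>, which
  is the claim.\<close>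

lemma couniv_ins:
  assumes L: "small_cat L" and l: "l \<in> Ob L" and u: "small_fun u" and \<epsilon>: "couniv D (idF L \<otimes>\<^sub>F u) Y \<epsilon>"
  shows "couniv D u (rs D (ins L l (Tgt u)) Y) (rsA D (ins L l (Src u)) \<epsilon>)"
proof -
  define A where "A = Src u"
  define B where "B = Tgt u"
  note [simp] = L l u A_def[symmetric] B_def[symmetric]
  have AB [simp]: "small_cat A" "small_cat B" using small_fun_cat[OF u] by simp_all
  have e [simp]: "\<epsilon> \<in> Ar (Val D (L \<otimes> A))" "Dom (Val D (L \<otimes> A)) \<epsilon> = rs D (idF L \<otimes>\<^sub>F u) Y"
    "Y \<in> Ob (Val D (L \<otimes> B))"
    using couniv_conds[OF \<epsilon>] by simp_all
  \<comment> \<open>A universal arrow along \<open>ins L l B\<close> stays universal after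
    restriction along \<open>u\<close>, because \<open>1 \<times> u\<close> maps the copy of the
    point over \<open>a\<close> to the one over \<open>u a\<close>.\<close>
  have bc: "univ D (ins L l A) (rs D (idF L \<otimes>\<^sub>F u) W) (rsA D u \<zeta>)" if "univ D (ins L l B) W \<zeta>" for W \<zeta>
  proof (rule univ_base_change[OF fam_ins[of L B l] fam_ins[of L A l]])
    show "(u \<odot> c, (idF L \<otimes>\<^sub>F u) \<odot> d) \<in> {(point B b, insr B b L) |b. b \<in> Ob B}"
      if cd: "(c, d) \<in> {(point A a, insr A a L) |a. a \<in> Ob A}" for c d
    proof -
      obtain a where a: "c = point A a" "d = insr A a L" "a \<in> Ob A" using cd by blast
      have "(idF L \<otimes>\<^sub>F u) \<odot> insr A a L = insr B (FO u a) L"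
        using a by (auto intro!: sfun_eqI simp: insr_def sfun_simps)
      moreover have "FO u a \<in> Ob B" using a by (simp add: sfun_simps)
      ultimately show ?thesis using a by auto
    qed
  qed (use that in \<open>simp_all add: fn_iff\<close>)
  show ?thesis
    unfolding A_def[symmetric] B_def[symmetric]
  proof (rule counivI, goal_cases)
    case (5 f Z)
    \<comment> \<open>Existence: move \<open>Z\<close> from \<open>B\<close> to
      \<open>L \<otimes> B\<close> by left Kan extension along \<open>ins L l B\<close>, use
      couniversality of \<open>\<epsilon>\<close> there, and come back by composing with
      \<open>\<zeta>\<close>.\<close>
    obtain W \<zeta> where \<zeta>: "univ D (ins L l B) W \<zeta>" "Dom (Val D B) \<zeta> = Z"
      using univ_exists[of "ins L l B" Z] 5 by auto
    note z = univD[OF \<zeta>(1)]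
    obtain f' where f': "f' \<in> Ar (Val D (L \<otimes> A))" "Dom (Val D (L \<otimes> A)) f' = rs D (idF L \<otimes>\<^sub>F u) W"
      "Cod (Val D (L \<otimes> A)) f' = Cod (Val D (L \<otimes> A)) \<epsilon>" "rsA D (ins L l A) f' \<cdot>\<^bsub>Val D A\<^esub> rsA D u \<zeta> = f"
      using univ_ex[OF bc[OF \<zeta>(1)], of f "Cod (Val D (L \<otimes> A)) \<epsilon>"] 5 z \<zeta> by auto
    obtain g where g: "g \<in> Ar (Val D (L \<otimes> B))" "Cod (Val D (L \<otimes> B)) g = Y" "Dom (Val D (L \<otimes> B)) g = W"
      "\<epsilon> \<cdot>\<^bsub>Val D (L \<otimes> A)\<^esub> rsA D (idF L \<otimes>\<^sub>F u) g = f'"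
      using couniv_ex[OF \<epsilon>, of f' W] f' z by auto
    have "rsA D (ins L l A) (\<epsilon> \<cdot>\<^bsub>Val D (L \<otimes> A)\<^esub> rsA D (idF L \<otimes>\<^sub>F u) g)
      = rsA D (ins L l A) \<epsilon> \<cdot>\<^bsub>Val D A\<^esub> rsA D (ins L l B \<odot> u) g" using g(1-3) by simp
    then show ?case using g(1-3) z \<zeta> f'(4) unfolding g(4)
      by (intro exI[of _ "rsA D (ins L l B) g \<cdot>\<^bsub>Val D B\<^esub> \<zeta>"]) simp
  next
    case (6 g g')
    define Z where "Z = Dom (Val D B) g"
    obtain W \<zeta> where \<zeta>: "univ D (ins L l B) W \<zeta>" "Dom (Val D B) \<zeta> = Z"
      using univ_exists[of "ins L l B" Z] 6 by (auto simp: Z_def)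
    note z = univD[OF \<zeta>(1)]
    obtain h where h: "h \<in> Ar (Val D (L \<otimes> B))" "Dom (Val D (L \<otimes> B)) h = W" "Cod (Val D (L \<otimes> B)) h = Y"
      "rsA D (ins L l B) h \<cdot>\<^bsub>Val D B\<^esub> \<zeta> = g"
      using univ_ex[OF \<zeta>(1), of g Y] 6 z \<zeta> Z_def by auto
    obtain h' where h': "h' \<in> Ar (Val D (L \<otimes> B))" "Dom (Val D (L \<otimes> B)) h' = W" "Cod (Val D (L \<otimes> B)) h' = Y"
      "rsA D (ins L l B) h' \<cdot>\<^bsub>Val D B\<^esub> \<zeta> = g'"
      using univ_ex[OF \<zeta>(1), of g' Y] 6 z \<zeta> Z_def by auto
    have eq: "rsA D (ins L l A) (\<epsilon> \<cdot>\<^bsub>Val D (L \<otimes> A)\<^esub> rsA D (idF L \<otimes>\<^sub>F u) k) \<cdot>\<^bsub>Val D A\<^esub> rsA D u \<zeta>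
       = rsA D (ins L l A) \<epsilon> \<cdot>\<^bsub>Val D A\<^esub> rsA D u (rsA D (ins L l B) k \<cdot>\<^bsub>Val D B\<^esub> \<zeta>)"
      if "k \<in> Ar (Val D (L \<otimes> B))" "Dom (Val D (L \<otimes> B)) k = W" "Cod (Val D (L \<otimes> B)) k = Y" for k
      using that z by simp
    have "\<epsilon> \<cdot>\<^bsub>Val D (L \<otimes> A)\<^esub> rsA D (idF L \<otimes>\<^sub>F u) h = \<epsilon> \<cdot>\<^bsub>Val D (L \<otimes> A)\<^esub> rsA D (idF L \<otimes>\<^sub>F u) h'"
      by (rule univ_unique[OF bc[OF \<zeta>(1)]])
         (use h(1-3) h'(1-3) z 6(6) eq[OF h(1-3)] eq[OF h'(1-3)] h(4) h'(4) in simp_all)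
    then have "h = h'" using couniv_unique[OF prederivator_axioms \<epsilon>, of h h'] h(1-3) h'(1-3) by simp
    then show ?case using h h' by simp
  qed simp_all
qed

text \<open>Compare with the chosen right Kan extension; by \<open>couniv_ins\<close> the comparison
  \<open>g\<close> is invertible in each fibre over \<open>L\<close>, hence at every object, and
  (Der2) applies.\<close>

lemma couniv_timesI:
  assumes L: "small_cat L" and u: "small_fun u"
    and Y: "Y \<in> Ob (Val D (L \<otimes> Tgt u))"
    and \<epsilon>: "\<epsilon> \<in> Ar (Val D (L \<otimes> Src u))" "Dom (Val D (L \<otimes> Src u)) \<epsilon> = rs D (idF L \<otimes>\<^sub>F u) Y"
    and pt: "\<And>l. l \<in> Ob L \<Longrightarrow> couniv D u (rs D (ins L l (Tgt u)) Y) (rsA D (ins L l (Src u)) \<epsilon>)"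
  shows "couniv D (idF L \<otimes>\<^sub>F u) Y \<epsilon>"
proof -
  note [simp] = L u Y \<epsilon>
  let ?v = "idF L \<otimes>\<^sub>F u"
  define X where "X = Cod (Val D (L \<otimes> Src u)) \<epsilon>"
  have X: "X \<in> Ob (Val D (Src ?v))" by (simp add: X_def)
  note r = couniv_ran[OF _ X, simplified]
  note r' = couniv_conds[OF r(1), simplified]
  let ?R = "ran D ?v X" and ?E = "radj_counit (Res D ?v) X"
  obtain g where g: "g \<in> Ar (Val D (L \<otimes> Tgt u))" "Cod (Val D (L \<otimes> Tgt u)) g = ?R" "Dom (Val D (L \<otimes> Tgt u)) g = Y"
    "?E \<cdot>\<^bsub>Val D (L \<otimes> Src u)\<^esub> rsA D ?v g = \<epsilon>"
    using couniv_ex[OF r(1), of \<epsilon> Y] r X_def[symmetric] by auto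
  have i: "iso (Val D (Tgt u)) (rsA D (ins L l (Tgt u)) g)" if l: "l \<in> Ob L" for l
  proof -
    have "rsA D (ins L l (Src u)) (?E \<cdot>\<^bsub>Val D (L \<otimes> Src u)\<^esub> rsA D ?v g)
      = rsA D (ins L l (Src u)) ?E \<cdot>\<^bsub>Val D (Src u)\<^esub> rsA D u (rsA D (ins L l (Tgt u)) g)"
      using l g(1-3) r r' by simp
    then have "couniv D u (rs D (ins L l (Tgt u)) Y) (rsA D (ins L l (Src u)) ?E \<cdot>\<^bsub>Val D (Src u)\<^esub> rsA D u (rsA D (ins L l (Tgt u)) g))"
      using pt[OF l] g(4) by simp
    then show ?thesis
      using couniv_pre_iff[OF couniv_ins[OF L l u r(1)], of "rsA D (ins L l (Tgt u)) g"] g(1-3) l by simp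
  qed
  have "iso (Val D (L \<otimes> Tgt u)) g"
  proof -
    have "iso (Val D \<e>) (rsA D (point (L \<otimes> Tgt u) x) g)" if x: "x \<in> Ob (L \<otimes> Tgt u)" for x
    proof -
      obtain l b where lb: "x = upair l b" "l \<in> Ob L" "b \<in> Ob (Tgt u)" using x by auto
      have "iso (Val D \<e>) (rsA D (point (Tgt u) b) (rsA D (ins L l (Tgt u)) g))"
        by (rule rsA_iso[OF _ i]) (use lb in simp_all)
      then show ?thesis using lb g(1) by simp
    qed
    then show ?thesis using Der2[of "L \<otimes> Tgt u" g] g by simp
  qed
  then show ?thesis using couniv_pre_iff[OF r(1), of g Y] g by simp
qed

definition at_coslice :: "'u sfun \<Rightarrow> 'u \<Rightarrow> 'o \<Rightarrow> 'a \<Rightarrow> 'a" where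
  "at_coslice u b Y \<epsilon> = rsA D (coslice_pr u b) \<epsilon> \<cdot>\<^bsub>Val D (coslice u b)\<^esub> NC (Cell D (coslice_nt u b)) Y"

text \<open>(Der4) for the chosen counit, transported along the comparison isomorphism
  \<open>g\<close>.\<close>

lemma couniv_at_coslice:
  assumes \<epsilon>: "couniv D u Y \<epsilon>" and b: "b \<in> Ob (Tgt u)"
  shows "couniv D (bang (coslice u b)) (rs D (point (Tgt u) b) Y) (at_coslice u b Y \<epsilon>)"
proof -
  note a = couniv_conds[OF \<epsilon>]
  define X where "X = Cod (Val D (Src u)) \<epsilon>"
  have X: "X \<in> Ob (Val D (Src u))" using a by (simp add: X_def)
  note l = couniv_ran[OF a(1) X]
  note l' = l couniv_conds[OF l(1)]
  let ?L = "ran D u X" and ?U = "radj_counit (Res D u) X" and ?S = "coslice u b"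
  note [simp] = a b l' cell_arr
  obtain g where g: "g \<in> Ar (Val D (Tgt u))" "Cod (Val D (Tgt u)) g = ?L" "Dom (Val D (Tgt u)) g = Y"
    "?U \<cdot>\<^bsub>Val D (Src u)\<^esub> rsA D u g = \<epsilon>"
    using couniv_ex[OF l(1) a(3) a(2)] X_def[symmetric] by auto
  have i: "iso (Val D (Tgt u)) g" using couniv_pre_iff[OF l(1) g(1,2,3)] \<epsilon> g(4) by simp
  have arr: "at_coslice u b ?L ?U \<in> Ar (Val D ?S)"
    "Dom (Val D ?S) (at_coslice u b ?L ?U) = rs D (bang ?S) (rs D (point (Tgt u) b) ?L)"
    by (simp_all add: at_coslice_def)
  have "ran_comparison D u b X = rtransp (Res D (bang ?S)) (rs D (point (Tgt u) b) ?L) (at_coslice u b ?L ?U)"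
    by (simp add: ran_comparison_def at_coslice_def)
  then have 0: "couniv D (bang ?S) (rs D (point (Tgt u) b) ?L) (at_coslice u b ?L ?U)"
    using Der4_right[OF a(1) b X] arr
    by (simp add: rtransp_iso_iff[of "bang ?S", simplified])
  have gi: "iso (Val D \<e>) (rsA D (point (Tgt u) b) g)"
    by (rule rsA_iso[OF _ i]) simp_all
  have "at_coslice u b Y \<epsilon> = at_coslice u b ?L ?U \<cdot>\<^bsub>Val D ?S\<^esub> rsA D (bang ?S) (rsA D (point (Tgt u) b) g)"
    unfolding g(4)[symmetric] at_coslice_def
    using g(1-3) cell_natural[of "coslice_nt u b" g ?S Y ?L] by simp
  then show ?thesis
    using couniv_pre_iff[OF 0, of "rsA D (point (Tgt u) b) g"] gi g(1-3) by simp
qed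

end

section \<open>Product of a fixed category with functors and transformations\<close>

lemma timesF_timesF [simp]:
  assumes "small_fun u" "small_fun v" "small_fun a" "small_fun b" "Tgt a = Src u" "Tgt b = Src v"
  shows "(u \<otimes>\<^sub>F v) \<odot> (a \<otimes>\<^sub>F b) = (u \<odot> a) \<otimes>\<^sub>F (v \<odot> b)"
  using assms by (simp add: timesF_def)

lemma timesF_idF [simp]: "small_cat A \<Longrightarrow> small_cat B \<Longrightarrow> idF A \<otimes>\<^sub>F idF B = idF (A \<otimes> B)"
  by (simp add: timesF_def)

lemma timesN_simps [simp]: "NS (timesN L \<alpha>) = idF L \<otimes>\<^sub>F NS \<alpha>" "NT (timesN L \<alpha>) = idF L \<otimes>\<^sub>F NT \<alpha>"
  "l \<in> Ob L \<Longrightarrow> x \<in> Ob (Src (NS \<alpha>)) \<Longrightarrow> NC (timesN L \<alpha>) (upair l x) = upair (Id L l) (NC \<alpha> x)"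
  by (simp_all add: timesN_def)

lemma small_nt_timesN [simp]:
  assumes L: "small_cat L" and \<alpha>: "small_nt \<alpha>"
  shows "small_nt (timesN L \<alpha>)"
  unfolding timesN_def
proof (rule small_nt_mk_nt, goal_cases)
  note [simp] = L \<alpha> small_nt_fun[OF \<alpha>] small_nt_arr[OF \<alpha>] small_cat_category sfun_simps
  {
    case 5 then show ?case by auto
  next
    case (6 f)
    then show ?case using small_nt_natural[OF \<alpha>] by auto
  }
qed (use L small_nt_fun[OF \<alpha>] in simp_all)

lemma timesN_idN:
  assumes "small_cat L" "small_fun u"
  shows "timesN L (idN u) = idN (idF L \<otimes>\<^sub>F u)"
  unfolding timesN_def idN_def using assms by (intro mk_nt_eqI) (auto simp: sfun_simps)

lemma timesN_vcomp:
  assumes L: "small_cat L" and \<alpha>: "small_nt \<alpha>" and \<beta>: "small_nt \<beta>" and eq: "NS \<beta> = NT \<alpha>"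
  shows "timesN L (vcomp \<beta> \<alpha>) = vcomp (timesN L \<beta>) (timesN L \<alpha>)"
proof -
  note [simp] = L \<alpha> \<beta> eq small_nt_fun[OF \<alpha>] small_nt_fun[OF \<beta>, unfolded eq]
    small_nt_arr[OF \<alpha>] small_nt_arr[OF \<beta>, unfolded eq] small_cat_category
  show ?thesis unfolding timesN_def[of L "vcomp \<beta> \<alpha>"] vcomp_def[of "timesN L \<beta>"]
    by (intro mk_nt_eqI) (auto simp: vcomp_def)
qed

lemma timesN_hcomp:
  assumes L: "small_cat L" and \<alpha>: "small_nt \<alpha>" and \<beta>: "small_nt \<beta>" and eq: "Src (NS \<beta>) = Tgt (NS \<alpha>)"
  shows "timesN L (hcomp \<beta> \<alpha>) = hcomp (timesN L \<beta>) (timesN L \<alpha>)"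
proof -
  note [simp] = L \<alpha> \<beta> eq small_nt_fun[OF \<alpha>] small_nt_fun[OF \<beta>, unfolded eq]
    small_nt_arr[OF \<alpha>] small_nt_arr[OF \<beta>, unfolded eq] small_cat_category sfun_simps
  show ?thesis unfolding timesN_def[of L "hcomp \<beta> \<alpha>"] hcomp_def[of "timesN L \<beta>"]
    by (intro mk_nt_eqI) (auto simp: hcomp_def)
qed

lemma shift_simps [simp]: "Val (shift D L) A = Val D (L \<otimes> A)" "Res (shift D L) u = Res D (idF L \<otimes>\<^sub>F u)"
  "Cell (shift D L) \<alpha> = Cell D (timesN L \<alpha>)"
  by (simp_all add: shift_def)

text \<open>\<open>L \<otimes> -\<close> is a strict 2-functor on small categories, and the shift is
  the composite with it.\<close>

lemma prederivator_shift:
  assumes "prederivator D" and L: "small_cat L"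
  shows "prederivator (shift D L)"
proof -
  interpret prederivator D by fact
  note [simp] = L
  have comp: "Res D (idF L \<otimes>\<^sub>F (v \<odot> u)) = Res D (idF L \<otimes>\<^sub>F u) \<odot> Res D (idF L \<otimes>\<^sub>F v)"
    if "small_fun u" "small_fun v" "Src v = Tgt u" for u v
    using Res_comp[of "idF L \<otimes>\<^sub>F u" "idF L \<otimes>\<^sub>F v"] that by simp
  show ?thesis
    by (rule prederivator.intro) (simp_all add: Res_functor Res_Src Res_Tgt Res_id comp Cell_nt Cell_NS Cell_NT timesN_idN
      Cell_id timesN_vcomp timesN_hcomp Cell_vcomp Cell_hcomp small_nt_fun)
qed

section \<open>Finite coproducts and products\<close>

lemma mk_fun_eqI:
  "(\<And>x. x \<in> Ob C \<Longrightarrow> f x = f' x) \<Longrightarrow> (\<And>x. x \<in> Ar C \<Longrightarrow> g x = g' x) \<Longrightarrow> mk_fun C E f g = mk_fun C E f' g'"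
  by (auto simp: mk_fun_def)

text \<open>\<open>R' \<odot> G\<close> is a quasi-inverse of the composite. The coproduct
  comparison of the shift is of this form: that of \<open>D\<close> after an isomorphism.\<close>

lemma equivalence_fcomp_iso:
  assumes F: "equivalence F" and R: "cfunctor R" "cfunctor R'" "Tgt R = Src F" "Src R' = Src F" "Tgt R' = Src R"
    and inv: "R' \<odot> R = idF (Src R)" "R \<odot> R' = idF (Src F)"
  shows "equivalence (F \<odot> R)"
proof -
  obtain G where G: "cfunctor F" "cfunctor G" "Src G = Tgt F" "Tgt G = Src F"
    "nat_isomorphic (idF (Src F)) (G \<odot> F)" "nat_isomorphic (F \<odot> G) (idF (Tgt F))"
    using F by (auto simp: equivalence_def)
  note [simp] = R inv G(1-4) cfunctor_fcomp
  note cats [simp] = cfunctor.Src_category[OF G(1)] cfunctor.Tgt_category[OF G(1)] cfunctor.Src_category[OF R(1)]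
  obtain \<alpha> where \<alpha>: "nat_trans \<alpha>" "NS \<alpha> = idF (Src F)" "NT \<alpha> = G \<odot> F"
    "\<And>x. x \<in> Ob (Src F) \<Longrightarrow> iso (Src F) (NC \<alpha> x)"
    using G(5) by (auto simp: nat_isomorphic_def)
  have a: "NC \<alpha> x \<in> Ar (Src F)" "Dom (Src F) (NC \<alpha> x) = x" "Cod (Src F) (NC \<alpha> x) = FO G (FO F x)"
    if "x \<in> Ob (Src F)" for x
    using nat_trans.NC_hom[OF \<alpha>(1), of x] that by (auto simp: \<alpha> hom_iff)
  have nat: "NC \<alpha> (Cod (Src F) f) \<cdot>\<^bsub>Src F\<^esub> f = FA G (FA F f) \<cdot>\<^bsub>Src F\<^esub> NC \<alpha> (Dom (Src F) f)"
    if "f \<in> Ar (Src F)" for f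
    using nat_trans.NC_natural[OF \<alpha>(1), of f "Dom (Src F) f" "Cod (Src F) f"] that by (simp add: \<alpha> hom_iff)
  have RR: "FO R' (FO R x) = x" if "x \<in> Ob (Src R)" for x
    using arg_cong[OF inv(1), of "\<lambda>F. FO F x"] that by (simp del: inv)
  have RRA: "FA R' (FA R f) = f" if "f \<in> Ar (Src R)" for f
    using arg_cong[OF inv(1), of "\<lambda>F. FA F f"] that by (simp del: inv)
  have FO [simp]: "FO R x \<in> Ob (Src F)" if "x \<in> Ob (Src R)" for x using cfunctor_ob[OF R(1)] that by simp
  have FA [simp]: "FA R f \<in> Ar (Src F)" "Dom (Src F) (FA R f) = FO R (Dom (Src R) f)"
    "Cod (Src F) (FA R f) = FO R (Cod (Src R) f)" if "f \<in> Ar (Src R)" for f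
    using cfunctor_arr[OF R(1)] that by simp_all
  define \<beta> where "\<beta> = mk_nt (idF (Src R)) ((R' \<odot> G) \<odot> (F \<odot> R)) (\<lambda>x. FA R' (NC \<alpha> (FO R x)))"
  have "nat_isomorphic (idF (Src R)) ((R' \<odot> G) \<odot> (F \<odot> R))"
    unfolding nat_isomorphic_def
  proof (intro exI[of _ \<beta>] conjI ballI)
    show "nat_trans \<beta>"
      unfolding \<beta>_def
    proof (rule nat_trans_mk_nt, goal_cases)
      case (5 x)
      then show ?case using a[of "FO R x"] cfunctor_arr[OF R(2)] RR by (simp add: cfunctor_simps)
    next
      case (6 f)
      then have f: "f \<in> Ar (Src R)" by simp
      have "FA R' (NC \<alpha> (FO R (Cod (Src R) f)) \<cdot>\<^bsub>Src F\<^esub> FA R f)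
        = FA R' (FA G (FA F (FA R f)) \<cdot>\<^bsub>Src F\<^esub> NC \<alpha> (FO R (Dom (Src R) f)))"
        using nat[of "FA R f"] f by simp
      then show ?case using f a by (simp add: cfunctor_simps RRA)
    qed (simp_all add: cfunctor_idF)
    show "NS \<beta> = idF (Src R)" "NT \<beta> = (R' \<odot> G) \<odot> (F \<odot> R)" by (simp_all add: \<beta>_def)
    show "iso (Tgt (idF (Src R))) (NC \<beta> x)" if "x \<in> Ob (Src (idF (Src R)))" for x
      using cfunctor.FA_iso[OF R(2), of "NC \<alpha> (FO R x)"] \<alpha>(4) that by (simp add: \<beta>_def)
  qed
  moreover have "(F \<odot> R) \<odot> (R' \<odot> G) = F \<odot> G"
  proof -
    have "(F \<odot> R) \<odot> (R' \<odot> G) = F \<odot> ((R \<odot> R') \<odot> G)" by (simp add: fcomp_assoc del: inv)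
    then show ?thesis by (simp add: idF_fcomp)
  qed
  ultimately show ?thesis
    unfolding equivalence_def using G(6) by (intro conjI exI[of _ "R' \<odot> G"]) simp_all
qed

lemma Ob_coprod [simp]: "Ob (coprod n A) = {upair (unat i) x |i x. i < n \<and> x \<in> Ob (A i)}"
  and Ar_coprod [simp]: "Ar (coprod n A) = {upair (unat i) f |i f. i < n \<and> f \<in> Ar (A i)}"
  by (simp_all add: coprod_def)

lemma coprod_simps [simp]:
  "i < n \<Longrightarrow> f \<in> Ar (A i) \<Longrightarrow> Dom (coprod n A) (upair (unat i) f) = upair (unat i) (Dom (A i) f)"
  "i < n \<Longrightarrow> f \<in> Ar (A i) \<Longrightarrow> Cod (coprod n A) (upair (unat i) f) = upair (unat i) (Cod (A i) f)"
  "i < n \<Longrightarrow> x \<in> Ob (A i) \<Longrightarrow> Id (coprod n A) (upair (unat i) x) = upair (unat i) (Id (A i) x)"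
  "\<lbrakk>i < n; f \<in> Ar (A i); g \<in> Ar (A i); Dom (A i) g = Cod (A i) f\<rbrakk> \<Longrightarrow>
    upair (unat i) g \<cdot>\<^bsub>coprod n A\<^esub> upair (unat i) f = upair (unat i) (g \<cdot>\<^bsub>A i\<^esub> f)"
  by (simp_all add: coprod_def)

lemma small_cat_coprod [simp]:
  assumes "\<And>i. i < n \<Longrightarrow> small_cat (A i)"
  shows "small_cat (coprod n A)"
proof -
  have [simp]: "category (A i)" if "i < n" for i using assms[OF that] by (rule small_cat_category)
  have "category (coprod n A)"
    unfolding coprod_def by (rule category_mk_cat) auto
  moreover have "small (Ob (coprod n A))"
    by (rule small_subset[OF small_image2[of "range unat" "\<Union>i<n. Ob (A i)" upair]])
       (use assms small_countable[of "range unat"] in \<open>auto simp: small_cat_def intro!: small_UN\<close>)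
  moreover have "small (Ar (coprod n A))"
    by (rule small_subset[OF small_image2[of "range unat" "\<Union>i<n. Ar (A i)" upair]])
       (use assms small_countable[of "range unat"] in \<open>auto simp: small_cat_def intro!: small_UN\<close>)
  ultimately show ?thesis by (simp add: small_cat_def)
qed

lemma coproj_simps [simp]: "Src (coproj n A i) = A i" "Tgt (coproj n A i) = coprod n A"
  "x \<in> Ob (A i) \<Longrightarrow> FO (coproj n A i) x = upair (unat i) x" "f \<in> Ar (A i) \<Longrightarrow> FA (coproj n A i) f = upair (unat i) f"
  by (simp_all add: coproj_def)

lemma small_fun_coproj [simp]:
  assumes "i < n" "\<And>i. i < n \<Longrightarrow> small_cat (A i)"
  shows "small_fun (coproj n A i)"
  unfolding coproj_def using assms small_cat_category[OF small_cat_coprod[OF assms(2)]]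
  by (intro small_funI cfunctor_mk_fun) (auto simp: small_cat_category)

text \<open>Distributivity of \<open>L \<otimes> -\<close> over finite coproducts, as an isomorphism
  compatible with the injections; it brings (Der1) for the shift back to (Der1) for
  \<open>D\<close>.\<close>

lemma times_coprod_iso:
  assumes L: "small_cat L" and C: "\<And>i. i < n \<Longrightarrow> small_cat (C i)"
  obtains a b where "a \<in> fn (coprod n (\<lambda>i. L \<otimes> C i)) (L \<otimes> coprod n C)" "b \<in> fn (L \<otimes> coprod n C) (coprod n (\<lambda>i. L \<otimes> C i))"
    "a \<odot> b = idF (L \<otimes> coprod n C)" "b \<odot> a = idF (coprod n (\<lambda>i. L \<otimes> C i))"
    "\<And>i. i < n \<Longrightarrow> a \<odot> coproj n (\<lambda>i. L \<otimes> C i) i = idF L \<otimes>\<^sub>F coproj n C i"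
proof -
  have [simp]: "small_cat (coprod n C)" "small_cat (coprod n (\<lambda>i. L \<otimes> C i))" "category L"
    "category (coprod n C)" "category (coprod n (\<lambda>i. L \<otimes> C i))" "category (L \<otimes> coprod n C)"
    using C L by (auto intro: small_cat_category)
  have [simp]: "category (C i)" "small_cat (C i)" if "i < n" for i using C[OF that] small_cat_category by auto
  note [simp] = L
  \<comment> \<open>Elements are \<open>(i, (l, x))\<close> on one side and
    \<open>(l, (i, x))\<close> on the other, so a single exchange serves in both directions, on
    objects and on arrows.\<close>
  define s where "s x = upair (ufst (usnd x)) (upair (ufst x) (usnd (usnd x)))" for x :: 'a
  define a where "a = mk_fun (coprod n (\<lambda>i. L \<otimes> C i)) (L \<otimes> coprod n C) s s"
  define b where "b = mk_fun (L \<otimes> coprod n C) (coprod n (\<lambda>i. L \<otimes> C i)) s s"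
  have s [simp]: "s (upair x (upair y z)) = upair y (upair x z)" for x y z by (simp add: s_def)
  have a [simp]: "small_fun a" unfolding a_def
    by (rule small_funI, rule cfunctor_mk_fun) auto
  have b [simp]: "small_fun b" unfolding b_def
    by (rule small_funI, rule cfunctor_mk_fun) auto
  have [simp]: "Src a = coprod n (\<lambda>i. L \<otimes> C i)" "Tgt a = L \<otimes> coprod n C"
    "Src b = L \<otimes> coprod n C" "Tgt b = coprod n (\<lambda>i. L \<otimes> C i)" by (simp_all add: a_def b_def)
  have sa: "FO a x = s x" if "x \<in> Ob (coprod n (\<lambda>i. L \<otimes> C i))" for x using that unfolding a_def by (rule mk_fun_simps)
  have sa': "FA a x = s x" if "x \<in> Ar (coprod n (\<lambda>i. L \<otimes> C i))" for x using that unfolding a_def by (rule mk_fun_simps)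
  have sb: "FO b x = s x" if "x \<in> Ob (L \<otimes> coprod n C)" for x using that unfolding b_def by (rule mk_fun_simps)
  have sb': "FA b x = s x" if "x \<in> Ar (L \<otimes> coprod n C)" for x using that unfolding b_def by (rule mk_fun_simps)
  show thesis
  proof
    show "a \<in> fn (coprod n (\<lambda>i. L \<otimes> C i)) (L \<otimes> coprod n C)" "b \<in> fn (L \<otimes> coprod n C) (coprod n (\<lambda>i. L \<otimes> C i))"
      by (simp_all add: fn_iff)
    show "a \<odot> b = idF (L \<otimes> coprod n C)" by (rule sfun_eqI) (auto simp: sa sa' sb sb')
    show "b \<odot> a = idF (coprod n (\<lambda>i. L \<otimes> C i))" by (rule sfun_eqI) (auto simp: sa sa' sb sb')
    show "a \<odot> coproj n (\<lambda>i. L \<otimes> C i) i = idF L \<otimes>\<^sub>F coproj n C i" if "i < n" for i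
      using that by (intro sfun_eqI) (auto simp: sa sa')
  qed
qed

context derivator
begin

text \<open>The two ways of whiskering \<open>\<alpha>\<close> into the fibre over \<open>l\<close>
  give the same transformation.\<close>

lemma cell_timesN_ins:
  assumes L: "small_cat L" and l: "l \<in> Ob L" and \<alpha>: "small_nt \<alpha>" and Y: "Y \<in> Ob (Val D (L \<otimes> Tgt (NS \<alpha>)))"
    and A: "Src (NS \<alpha>) = A"
  shows "rsA D (ins L l A) (NC (Cell D (timesN L \<alpha>)) Y) = NC (Cell D \<alpha>) (rs D (ins L l (Tgt (NS \<alpha>))) Y)"
proof -
  note [simp] = L l \<alpha> Y A small_nt_fun[OF \<alpha>] small_nt_arr[OF \<alpha>]
  have A' [simp]: "small_cat A" using small_fun_cat[OF small_nt_fun(1)[OF \<alpha>]] by simp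
  have "mk_nt (NS (timesN L \<alpha>) \<odot> ins L l A) (NT (timesN L \<alpha>) \<odot> ins L l A) (\<lambda>x. NC (timesN L \<alpha>) (FO (ins L l A) x))
    = mk_nt (ins L l (Tgt (NS \<alpha>)) \<odot> NS \<alpha>) (ins L l (Tgt (NS \<alpha>)) \<odot> NT \<alpha>) (\<lambda>x. FA (ins L l (Tgt (NS \<alpha>))) (NC \<alpha> x))"
    by (rule mk_nt_eqI) simp_all
  then show ?thesis
    using cell_whisker_right[of "timesN L \<alpha>" "ins L l A" Y] cell_whisker_left[of \<alpha> "ins L l (Tgt (NS \<alpha>))" Y] by simp
qed

lemma derivator_shift:
  assumes L: "small_cat L"
  shows "derivator (shift D L)"
proof -
  interpret S: prederivator "shift D L" by (rule prederivator_shift[OF prederivator_axioms L])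
  note [simp] = L
  show ?thesis
  proof (unfold_locales, goal_cases)
    \<comment> \<open>(Der1): the comparison functor of the shift is that of \<open>D\<close> for
      the categories \<open>L \<otimes> C i\<close>, preceded by restriction along the
      distributivity isomorphism.\<close>
    case (1 n C)
    note [simp] = 1
    obtain a b where a: "a \<in> fn (coprod n (\<lambda>i. L \<otimes> C i)) (L \<otimes> coprod n C)" and b: "b \<in> fn (L \<otimes> coprod n C) (coprod n (\<lambda>i. L \<otimes> C i))"
      and ab: "a \<odot> b = idF (L \<otimes> coprod n C)" "b \<odot> a = idF (coprod n (\<lambda>i. L \<otimes> C i))"
      and ac: "\<And>i. i < n \<Longrightarrow> a \<odot> coproj n (\<lambda>i. L \<otimes> C i) i = idF L \<otimes>\<^sub>F coproj n C i"
      using times_coprod_iso[OF L, of n C] 1 by blast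
    note [simp] = a[unfolded fn_iff] b[unfolded fn_iff] ab ac
    let ?F = "coprod_comparison D n (\<lambda>i. L \<otimes> C i)"
    have F: "equivalence ?F" by (rule Der1) simp
    have "coprod_comparison (shift D L) n C = ?F \<odot> Res D a"
      unfolding coprod_comparison_def[of "shift D L"] fcomp_def
      by (simp add: Res_Src Res_Tgt coprod_comparison_def) (rule mk_fun_eqI; auto intro!: restrict_ext)
    moreover have "equivalence (?F \<odot> Res D a)"
      by (rule equivalence_fcomp_iso[OF F, where R' = "Res D b"])
         (simp_all add: Res_functor Res_Src Res_Tgt coprod_comparison_def flip: Res_comp Res_id)
    ultimately show ?case by simp
  next
    \<comment> \<open>(Der2): evaluation at a point of \<open>A\<close> lands over
      \<open>L \<otimes> \<e>\<close>, whose own points run over \<open>L\<close>; (Der2) of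
      \<open>D\<close> is applied over \<open>L \<otimes> \<e>\<close> and over
      \<open>L \<otimes> A\<close>.\<close>
    case (2 A f)
    note [simp] = 2(1)
    have f [simp]: "f \<in> Ar (Val D (L \<otimes> A))" using 2 by simp
    have z [simp]: "small_cat (L \<otimes> \<e>)" by simp
    have "iso (Val D (L \<otimes> \<e>)) (rsA D (idF L \<otimes>\<^sub>F point A a) f) \<longleftrightarrow>
       (\<forall>l \<in> Ob L. iso (Val D \<e>) (rsA D (point (L \<otimes> A) (upair l a)) f))" if a: "a \<in> Ob A" for a
    proof -
      have "iso (Val D (L \<otimes> \<e>)) (rsA D (idF L \<otimes>\<^sub>F point A a) f) \<longleftrightarrow>
        (\<forall>x \<in> Ob (L \<otimes> \<e>). iso (Val D \<e>) (rsA D (point (L \<otimes> \<e>) x) (rsA D (idF L \<otimes>\<^sub>F point A a) f)))"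
        by (rule Der2) (use a in simp_all)
      also have "\<dots> \<longleftrightarrow> (\<forall>l \<in> Ob L. iso (Val D \<e>) (rsA D (point (L \<otimes> \<e>) (upair l (unat 0))) (rsA D (idF L \<otimes>\<^sub>F point A a) f)))"
        by auto
      also have "\<dots> \<longleftrightarrow> (\<forall>l \<in> Ob L. iso (Val D \<e>) (rsA D (point (L \<otimes> A) (upair l a)) f))"
        using a by simp
      finally show ?thesis .
    qed
    then show ?case using Der2[of "L \<otimes> A" f] by auto
  next
    case (3 u) then show ?case by (simp add: Der3_left)
  next
    case (4 u) then show ?case by (simp add: Der3_right)
  next
    \<comment> \<open>(Der4): the map for the shift is a transpose along \<open>L\<close> times the
      projection of \<open>u/b\<close>, not along a slice of \<open>1 \<times> u\<close>. Its
      universality is tested in each fibre over \<open>L\<close>, where it is (Der4) of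
      \<open>D\<close> for \<open>u\<close> itself.\<close>
    case (5 u b X)
    note [simp] = 5(1,2) small_cat_slice[OF 5(1,2)]
    have X [simp]: "X \<in> Ob (Val D (L \<otimes> Src u))" using 5 by simp
    let ?v = "idF L \<otimes>\<^sub>F u" and ?S = "slice u b"
    let ?Y = "lan D ?v X" and ?\<eta> = "ladj_unit (Res D ?v) X"
    note l = univ_lan[of ?v X, simplified]
    note [simp] = l(2,3) univD[OF l(1), simplified] cell_arr
    let ?\<theta> = "NC (Cell D (timesN L (slice_nt u b))) ?Y \<cdot>\<^bsub>Val D (L \<otimes> ?S)\<^esub> rsA D (idF L \<otimes>\<^sub>F slice_pr u b) ?\<eta>"
    have "univ D (idF L \<otimes>\<^sub>F bang ?S) (rs D (idF L \<otimes>\<^sub>F point (Tgt u) b) ?Y) ?\<theta>"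
    proof (subst univ_times_left_iff, goal_cases)
      case 6
      show ?case
      proof
        fix l' assume l': "l' \<in> Ob L"
        have "univ D u (rs D (ins L l' (Tgt u)) ?Y) (rsA D (ins L l' (Src u)) ?\<eta>)"
          using univ_times_left_iff[of L u ?Y ?\<eta>] l l' by simp
        from univ_at_slice[OF this 5(2), simplified]
        have *: "univ D (bang ?S) (rs D (point (Tgt u) b) (rs D (ins L l' (Tgt u)) ?Y))
          (at_slice D u b (rs D (ins L l' (Tgt u)) ?Y) (rsA D (ins L l' (Src u)) ?\<eta>))" using 5(2) by simp
        have "rsA D (ins L l' ?S) ?\<theta> = at_slice D u b (rs D (ins L l' (Tgt u)) ?Y) (rsA D (ins L l' (Src u)) ?\<eta>)"
          using l' cell_timesN_ins[OF L l', of "slice_nt u b" ?Y ?S] by (simp add: at_slice_def)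
        then show "univ D (bang ?S) (rs D (ins L l' (Tgt (bang ?S))) (rs D (idF L \<otimes>\<^sub>F point (Tgt u) b) ?Y))
           (rsA D (ins L l' (Src (bang ?S))) ?\<theta>)" using * l' by simp
      qed
    qed simp_all
    then show ?case
      using ltransp_iso_iff[of "idF L \<otimes>\<^sub>F bang ?S" ?\<theta> "rs D (idF L \<otimes>\<^sub>F point (Tgt u) b) ?Y"]
      by (simp add: lan_comparison_def)
  next
    \<comment> \<open>The same reduction for right Kan extensions, with \<open>couniv_timesI\<close>
      testing in the fibres.\<close>
    case (6 u b X)
    note [simp] = 6(1,2) small_cat_coslice[OF 6(1,2)]
    have X [simp]: "X \<in> Ob (Val D (L \<otimes> Src u))" using 6 by simp
    let ?v = "idF L \<otimes>\<^sub>F u" and ?S = "coslice u b"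
    let ?Y = "ran D ?v X" and ?\<eta> = "radj_counit (Res D ?v) X"
    note l = couniv_ran[of ?v X, simplified]
    note [simp] = l(2,3) couniv_conds[OF l(1), simplified] cell_arr
    let ?\<theta> = "rsA D (idF L \<otimes>\<^sub>F coslice_pr u b) ?\<eta> \<cdot>\<^bsub>Val D (L \<otimes> ?S)\<^esub> NC (Cell D (timesN L (coslice_nt u b))) ?Y"
    have "couniv D (idF L \<otimes>\<^sub>F bang ?S) (rs D (idF L \<otimes>\<^sub>F point (Tgt u) b) ?Y) ?\<theta>"
    proof (rule couniv_timesI, goal_cases)
      case (6 l')
      then have l': "l' \<in> Ob L" by simp
      have "couniv D u (rs D (ins L l' (Tgt u)) ?Y) (rsA D (ins L l' (Src u)) ?\<eta>)"
        by (rule couniv_ins[OF L l' _ l(1)]) simp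
      from couniv_at_coslice[OF this]
      have *: "couniv D (bang ?S) (rs D (point (Tgt u) b) (rs D (ins L l' (Tgt u)) ?Y))
        (at_coslice u b (rs D (ins L l' (Tgt u)) ?Y) (rsA D (ins L l' (Src u)) ?\<eta>))" by simp
      have "rsA D (ins L l' ?S) ?\<theta> = at_coslice u b (rs D (ins L l' (Tgt u)) ?Y) (rsA D (ins L l' (Src u)) ?\<eta>)"
        using l' cell_timesN_ins[OF L l', of "coslice_nt u b" ?Y ?S] by (simp add: at_coslice_def)
      then show ?case using * l' by simp
    qed simp_all
    then show ?case
      using rtransp_iso_iff[of "idF L \<otimes>\<^sub>F bang ?S" ?\<theta> "rs D (idF L \<otimes>\<^sub>F point (Tgt u) b) ?Y"]
      by (simp add: ran_comparison_def)
  qed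
qed

end

section \<open>Monoidal derivators\<close>

lemma prod_cat_simps [simp]:
  "Ob (prod_cat C E) = Ob C \<times> Ob E" "Ar (prod_cat C E) = Ar C \<times> Ar E"
  "f \<in> Ar C \<Longrightarrow> g \<in> Ar E \<Longrightarrow> Dom (prod_cat C E) (f, g) = (Dom C f, Dom E g)"
  "f \<in> Ar C \<Longrightarrow> g \<in> Ar E \<Longrightarrow> Cod (prod_cat C E) (f, g) = (Cod C f, Cod E g)"
  "x \<in> Ob C \<Longrightarrow> y \<in> Ob E \<Longrightarrow> Id (prod_cat C E) (x, y) = (Id C x, Id E y)"
  "\<lbrakk>f \<in> Ar C; g \<in> Ar E; f' \<in> Ar C; g' \<in> Ar E; Dom C f' = Cod C f; Dom E g' = Cod E g\<rbrakk>
    \<Longrightarrow> (f', g') \<cdot>\<^bsub>prod_cat C E\<^esub> (f, g) = (f' \<cdot>\<^bsub>C\<^esub> f, g' \<cdot>\<^bsub>E\<^esub> g)"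
  by (simp_all add: prod_cat_def)

lemma category_prod_cat: "category C \<Longrightarrow> category E \<Longrightarrow> category (prod_cat C E)"
  unfolding prod_cat_def by (rule category_mk_cat) auto

lemma op_cat_simps [simp]: "Ob (op_cat C) = Ob C" "Ar (op_cat C) = Ar C" "Dom (op_cat C) = Cod C"
  "Cod (op_cat C) = Dom C" "Id (op_cat C) = Id C" "g \<cdot>\<^bsub>op_cat C\<^esub> f = f \<cdot>\<^bsub>C\<^esub> g"
  by (simp_all add: op_cat_def)

context monoidal_category
begin

lemma ten_ob: "x \<in> Ob C \<Longrightarrow> y \<in> Ob C \<Longrightarrow> ten T x y \<in> Ob C"
  using cfunctor_ob[OF Ten_functor Ten_Tgt, of "(x, y)"] by (simp add: Ten_Src)

lemma tenA_arr:
  assumes "f \<in> Ar C" "g \<in> Ar C"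
  shows "tenA T f g \<in> Ar C" "Dom C (tenA T f g) = ten T (Dom C f) (Dom C g)"
    "Cod C (tenA T f g) = ten T (Cod C f) (Cod C g)"
  using cfunctor_arr[OF Ten_functor, of "(f, g)"] assms by (simp_all add: Ten_Src Ten_Tgt)

lemma tenA_Id: "x \<in> Ob C \<Longrightarrow> y \<in> Ob C \<Longrightarrow> tenA T (Id C x) (Id C y) = Id C (ten T x y)"
  using cfunctor_Id[OF Ten_functor refl, of "(x, y)"] by (simp add: Ten_Src Ten_Tgt)

lemma tenA_comp:
  "\<lbrakk>f \<in> Ar C; g \<in> Ar C; f' \<in> Ar C; g' \<in> Ar C; Dom C f' = Cod C f; Dom C g' = Cod C g\<rbrakk>
    \<Longrightarrow> tenA T f' g' \<cdot>\<^bsub>C\<^esub> tenA T f g = tenA T (f' \<cdot>\<^bsub>C\<^esub> f) (g' \<cdot>\<^bsub>C\<^esub> g)"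
  using cfunctor_comp[OF Ten_functor refl, of "(f, g)" "(f', g')"] by (simp add: Ten_Src Ten_Tgt)

text \<open>The interchange law under a further composite, the form in which it meets right-nested
  composites.\<close>

lemma tenA_comp_left:
  "\<lbrakk>f \<in> Ar C; g \<in> Ar C; f' \<in> Ar C; g' \<in> Ar C; Dom C f' = Cod C f; Dom C g' = Cod C g;
    h \<in> Ar C; Cod C h = ten T (Dom C f) (Dom C g)\<rbrakk>
    \<Longrightarrow> tenA T f' g' \<cdot>\<^bsub>C\<^esub> (tenA T f g \<cdot>\<^bsub>C\<^esub> h) = tenA T (f' \<cdot>\<^bsub>C\<^esub> f) (g' \<cdot>\<^bsub>C\<^esub> g) \<cdot>\<^bsub>C\<^esub> h"
  by (simp add: tenA_arr comp_assoc[symmetric] tenA_comp del: comp_assoc category.comp_assoc)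

lemma iso_ten:
  assumes "iso C f" "iso C g"
  shows "iso C (tenA T f g)"
proof -
  obtain f' where f': "f' \<in> Ar C" "Dom C f' = Cod C f" "Cod C f' = Dom C f"
    "f' \<cdot>\<^bsub>C\<^esub> f = Id C (Dom C f)" "f \<cdot>\<^bsub>C\<^esub> f' = Id C (Cod C f)" using assms(1) isoE by blast
  obtain g' where g': "g' \<in> Ar C" "Dom C g' = Cod C g" "Cod C g' = Dom C g"
    "g' \<cdot>\<^bsub>C\<^esub> g = Id C (Dom C g)" "g \<cdot>\<^bsub>C\<^esub> g' = Id C (Cod C g)" using assms(2) isoE by blast
  note ar = iso_arr[OF assms(1)] iso_arr[OF assms(2)]
  show ?thesis
    by (rule isoI[of _ "tenA T f' g'"]) (use ar f' g' in \<open>simp_all add: tenA_arr tenA_comp tenA_Id Dom_in Cod_in\<close>)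
qed

lemma Asc_arr:
  assumes "x \<in> Ob C" "y \<in> Ob C" "z \<in> Ob C"
  shows "Asc T x y z \<in> Ar C" "Dom C (Asc T x y z) = ten T (ten T x y) z" "Cod C (Asc T x y z) = ten T x (ten T y z)"
  using Asc_hom[OF assms] by (auto simp: hom_iff)

lemma Lun_arr:
  assumes "x \<in> Ob C"
  shows "Lun T x \<in> Ar C" "Dom C (Lun T x) = ten T (Unt T) x" "Cod C (Lun T x) = x"
    "Run T x \<in> Ar C" "Dom C (Run T x) = ten T x (Unt T)" "Cod C (Run T x) = x"
  using Lun_hom[OF assms] Run_hom[OF assms] by (auto simp: hom_iff)

end

context monoidal_prederivator
begin

lemma ten_rules [simp]:
  assumes "small_cat K"
  shows "X \<in> Ob (Val D K) \<Longrightarrow> Y \<in> Ob (Val D K) \<Longrightarrow> ten (Mon M K) X Y \<in> Ob (Val D K)"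
    "f \<in> Ar (Val D K) \<Longrightarrow> g \<in> Ar (Val D K) \<Longrightarrow> tenA (Mon M K) f g \<in> Ar (Val D K)"
    "f \<in> Ar (Val D K) \<Longrightarrow> g \<in> Ar (Val D K) \<Longrightarrow>
      Dom (Val D K) (tenA (Mon M K) f g) = ten (Mon M K) (Dom (Val D K) f) (Dom (Val D K) g)"
    "f \<in> Ar (Val D K) \<Longrightarrow> g \<in> Ar (Val D K) \<Longrightarrow>
      Cod (Val D K) (tenA (Mon M K) f g) = ten (Mon M K) (Cod (Val D K) f) (Cod (Val D K) g)"
    "X \<in> Ob (Val D K) \<Longrightarrow> Y \<in> Ob (Val D K) \<Longrightarrow>
      tenA (Mon M K) (Id (Val D K) X) (Id (Val D K) Y) = Id (Val D K) (ten (Mon M K) X Y)"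
    "Unt (Mon M K) \<in> Ob (Val D K)"
  using monoidal_category.ten_ob[OF Mon_monoidal] monoidal_category.tenA_arr[OF Mon_monoidal]
    monoidal_category.tenA_Id[OF Mon_monoidal] monoidal_category.Unt_in[OF Mon_monoidal] assms by auto

lemma Asc_rules [simp]:
  assumes "small_cat K" "X \<in> Ob (Val D K)" "Y \<in> Ob (Val D K)" "Z \<in> Ob (Val D K)"
  shows "Asc (Mon M K) X Y Z \<in> Ar (Val D K)"
    "Dom (Val D K) (Asc (Mon M K) X Y Z) = ten (Mon M K) (ten (Mon M K) X Y) Z"
    "Cod (Val D K) (Asc (Mon M K) X Y Z) = ten (Mon M K) X (ten (Mon M K) Y Z)"
  using monoidal_category.Asc_arr[OF Mon_monoidal] assms by auto

lemma Lun_rules [simp]: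
  assumes "small_cat K" "X \<in> Ob (Val D K)"
  shows "Lun (Mon M K) X \<in> Ar (Val D K)" "Dom (Val D K) (Lun (Mon M K) X) = ten (Mon M K) (Unt (Mon M K)) X"
    "Cod (Val D K) (Lun (Mon M K) X) = X"
    "Run (Mon M K) X \<in> Ar (Val D K)" "Dom (Val D K) (Run (Mon M K) X) = ten (Mon M K) X (Unt (Mon M K))"
    "Cod (Val D K) (Run (Mon M K) X) = X"
  using monoidal_category.Lun_arr[OF Mon_monoidal] assms by auto

lemmas tenA_merge = monoidal_category.tenA_comp[OF Mon_monoidal] monoidal_category.tenA_comp_left[OF Mon_monoidal]

lemma Mu_rules [simp]:
  assumes "small_fun u" "X \<in> Ob (Val D (Tgt u))" "Y \<in> Ob (Val D (Tgt u))" "Src u = K"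
  shows "Mu M u X Y \<in> Ar (Val D K)" "Dom (Val D K) (Mu M u X Y) = ten (Mon M K) (rs D u X) (rs D u Y)"
    "Cod (Val D K) (Mu M u X Y) = rs D u (ten (Mon M (Tgt u)) X Y)"
  using strong_monoidal_functor.mu_hom[OF Res_strong_monoidal, of u X Y] assms
  by (auto simp: Res_Src Res_Tgt hom_iff)

lemma Mu_iso:
  assumes "small_fun u" "X \<in> Ob (Val D (Tgt u))" "Y \<in> Ob (Val D (Tgt u))" "Src u = K"
  shows "iso (Val D K) (Mu M u X Y)"
  using strong_monoidal_functor.mu_iso[OF Res_strong_monoidal, of u X Y] assms by (simp add: Res_Src Res_Tgt)

lemma Mu_natural:
  assumes "small_fun u" "Src u = K" "f \<in> Ar (Val D (Tgt u))" "g \<in> Ar (Val D (Tgt u))"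
    "Dom (Val D (Tgt u)) f = X" "Dom (Val D (Tgt u)) g = Y" "Cod (Val D (Tgt u)) f = X'" "Cod (Val D (Tgt u)) g = Y'"
  shows "rsA D u (tenA (Mon M (Tgt u)) f g) \<cdot>\<^bsub>Val D K\<^esub> Mu M u X Y
    = Mu M u X' Y' \<cdot>\<^bsub>Val D K\<^esub> tenA (Mon M K) (rsA D u f) (rsA D u g)"
  using strong_monoidal_functor.mu_natural[OF Res_strong_monoidal, of u f X X' g Y Y'] assms
  by (simp add: Res_Src Res_Tgt hom_iff)

end

text \<open>Post-compose with the inverse of \<open>g\<close>.\<close>

lemma (in prederivator) univ_post_cancel:
  assumes as: "univ D u Z (rsA D u g \<cdot>\<^bsub>Val D (Src u)\<^esub> \<eta>)" and gi: "iso (Val D (Tgt u)) g"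
    and \<eta>: "\<eta> \<in> Ar (Val D (Src u))" "Cod (Val D (Src u)) \<eta> = rs D u Y" "Dom (Val D (Tgt u)) g = Y"
      "Cod (Val D (Tgt u)) g = Z"
    and u: "small_fun u"
  shows "univ D u Y \<eta>"
proof -
  have g: "g \<in> Ar (Val D (Tgt u))" using gi by (simp add: iso_def)
  obtain h where h: "h \<in> Ar (Val D (Tgt u))" "Dom (Val D (Tgt u)) h = Z" "Cod (Val D (Tgt u)) h = Y"
    "h \<cdot>\<^bsub>Val D (Tgt u)\<^esub> g = Id (Val D (Tgt u)) Y" "g \<cdot>\<^bsub>Val D (Tgt u)\<^esub> h = Id (Val D (Tgt u)) Z"
    using category.isoE[OF _ gi] u \<eta>(3,4) by auto
  have hi: "iso (Val D (Tgt u)) h"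
    by (rule category.isoI[of _ h g]) (use h g u \<eta>(3,4) in simp_all)
  have Y: "Y \<in> Ob (Val D (Tgt u))" using \<eta>(3) g u by auto
  have "rsA D u h \<cdot>\<^bsub>Val D (Src u)\<^esub> (rsA D u g \<cdot>\<^bsub>Val D (Src u)\<^esub> \<eta>)
      = (rsA D u h \<cdot>\<^bsub>Val D (Src u)\<^esub> rsA D u g) \<cdot>\<^bsub>Val D (Src u)\<^esub> \<eta>"
    using h(1-3) g \<eta> u by simp
  also have "rsA D u h \<cdot>\<^bsub>Val D (Src u)\<^esub> rsA D u g = Id (Val D (Src u)) (rs D u Y)"
    using arg_cong[OF h(4), of "rsA D u"] h(1-3) g \<eta> u Y by simp
  finally show ?thesis using univ_post[OF as hi h(2)] h(3) \<eta> u Y by simp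
qed

lemma pr_timesF [simp]:
  assumes "small_fun u" "small_fun v" "Tgt u = A" "Tgt v = B"
  shows "pr1 A B \<odot> (u \<otimes>\<^sub>F v) = u \<odot> pr1 (Src u) (Src v)" "pr2 A B \<odot> (u \<otimes>\<^sub>F v) = v \<odot> pr2 (Src u) (Src v)"
  using assms by (simp_all add: timesF_def)

section \<open>Cocontinuity and the projection formula\<close>

context monoidal_derivator
begin

text \<open>With the chosen unit of \<open>u\<^sub>!\<close> for \<open>\<theta>\<close> this is the
  arrow whose transpose is the cocontinuity map; allowing any \<open>\<theta>\<close> frees the
  statement from the chosen adjoint.\<close>

definition ext_left :: "'u sfun \<Rightarrow> 'u scat \<Rightarrow> 'o \<Rightarrow> 'o \<Rightarrow> 'a \<Rightarrow> 'a" where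
  "ext_left u B W V \<theta> = Mu M (u \<otimes>\<^sub>F idF B) (rs D (pr1 (Tgt u) B) W) (rs D (pr2 (Tgt u) B) V)
     \<cdot>\<^bsub>Val D (Src u \<otimes> B)\<^esub>
     tenA (Mon M (Src u \<otimes> B)) (rsA D (pr1 (Src u) B) \<theta>) (Id (Val D (Src u \<otimes> B)) (rs D (pr2 (Src u) B) V))"

definition ext_right :: "'u scat \<Rightarrow> 'u sfun \<Rightarrow> 'o \<Rightarrow> 'o \<Rightarrow> 'a \<Rightarrow> 'a" where
  "ext_right A u V W \<theta> = Mu M (idF A \<otimes>\<^sub>F u) (rs D (pr1 A (Tgt u)) V) (rs D (pr2 A (Tgt u)) W)
     \<cdot>\<^bsub>Val D (A \<otimes> Src u)\<^esub>
     tenA (Mon M (A \<otimes> Src u)) (Id (Val D (A \<otimes> Src u)) (rs D (pr1 A (Src u)) V)) (rsA D (pr2 A (Src u)) \<theta>)"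

lemma ext_left_post:
  assumes u: "small_fun u" and B: "small_cat B" and V: "V \<in> Ob (Val D B)"
    and \<theta>: "\<theta> \<in> Ar (Val D (Src u))" "Cod (Val D (Src u)) \<theta> = rs D u W"
    and g: "g \<in> Ar (Val D (Tgt u))" "Dom (Val D (Tgt u)) g = W" "Cod (Val D (Tgt u)) g = W'"
  shows "ext_left u B W' V (rsA D u g \<cdot>\<^bsub>Val D (Src u)\<^esub> \<theta>)
    = rsA D (u \<otimes>\<^sub>F idF B) (tenA (Mon M (Tgt u \<otimes> B)) (rsA D (pr1 (Tgt u) B) g) (Id (Val D (Tgt u \<otimes> B)) (rs D (pr2 (Tgt u) B) V)))
      \<cdot>\<^bsub>Val D (Src u \<otimes> B)\<^esub> ext_left u B W V \<theta>"
proof -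
  have [simp]: "W \<in> Ob (Val D (Tgt u))" "W' \<in> Ob (Val D (Tgt u))" using g u by auto
  note [simp] = u B V \<theta> g
  have "rsA D (u \<otimes>\<^sub>F idF B) (tenA (Mon M (Tgt u \<otimes> B)) (rsA D (pr1 (Tgt u) B) g) (Id (Val D (Tgt u \<otimes> B)) (rs D (pr2 (Tgt u) B) V)))
      \<cdot>\<^bsub>Val D (Src u \<otimes> B)\<^esub> ext_left u B W V \<theta>
    = (rsA D (u \<otimes>\<^sub>F idF B) (tenA (Mon M (Tgt u \<otimes> B)) (rsA D (pr1 (Tgt u) B) g) (Id (Val D (Tgt u \<otimes> B)) (rs D (pr2 (Tgt u) B) V)))
      \<cdot>\<^bsub>Val D (Src u \<otimes> B)\<^esub> Mu M (u \<otimes>\<^sub>F idF B) (rs D (pr1 (Tgt u) B) W) (rs D (pr2 (Tgt u) B) V)) \<cdot>\<^bsub>Val D (Src u \<otimes> B)\<^esub>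
     tenA (Mon M (Src u \<otimes> B)) (rsA D (pr1 (Src u) B) \<theta>) (Id (Val D (Src u \<otimes> B)) (rs D (pr2 (Src u) B) V))"
    by (simp add: ext_left_def)
  also have "rsA D (u \<otimes>\<^sub>F idF B) (tenA (Mon M (Tgt u \<otimes> B)) (rsA D (pr1 (Tgt u) B) g) (Id (Val D (Tgt u \<otimes> B)) (rs D (pr2 (Tgt u) B) V)))
      \<cdot>\<^bsub>Val D (Src u \<otimes> B)\<^esub> Mu M (u \<otimes>\<^sub>F idF B) (rs D (pr1 (Tgt u) B) W) (rs D (pr2 (Tgt u) B) V)
     = Mu M (u \<otimes>\<^sub>F idF B) (rs D (pr1 (Tgt u) B) W') (rs D (pr2 (Tgt u) B) V) \<cdot>\<^bsub>Val D (Src u \<otimes> B)\<^esub>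
      tenA (Mon M (Src u \<otimes> B)) (rsA D (u \<odot> pr1 (Src u) B) g) (Id (Val D (Src u \<otimes> B)) (rs D (pr2 (Src u) B) V))"
    using Mu_natural[of "u \<otimes>\<^sub>F idF B" "Src u \<otimes> B" "rsA D (pr1 (Tgt u) B) g" "Id (Val D (Tgt u \<otimes> B)) (rs D (pr2 (Tgt u) B) V)"]
    by simp
  finally show ?thesis by (simp add: ext_left_def tenA_merge)
qed

lemma ext_right_post:
  assumes u: "small_fun u" and A: "small_cat A" and V: "V \<in> Ob (Val D A)"
    and \<theta>: "\<theta> \<in> Ar (Val D (Src u))" "Cod (Val D (Src u)) \<theta> = rs D u W"
    and g: "g \<in> Ar (Val D (Tgt u))" "Dom (Val D (Tgt u)) g = W" "Cod (Val D (Tgt u)) g = W'"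
  shows "ext_right A u V W' (rsA D u g \<cdot>\<^bsub>Val D (Src u)\<^esub> \<theta>)
    = rsA D (idF A \<otimes>\<^sub>F u) (tenA (Mon M (A \<otimes> Tgt u)) (Id (Val D (A \<otimes> Tgt u)) (rs D (pr1 A (Tgt u)) V)) (rsA D (pr2 A (Tgt u)) g))
      \<cdot>\<^bsub>Val D (A \<otimes> Src u)\<^esub> ext_right A u V W \<theta>"
proof -
  have [simp]: "W \<in> Ob (Val D (Tgt u))" "W' \<in> Ob (Val D (Tgt u))" using g u by auto
  note [simp] = u A V \<theta> g
  have "rsA D (idF A \<otimes>\<^sub>F u) (tenA (Mon M (A \<otimes> Tgt u)) (Id (Val D (A \<otimes> Tgt u)) (rs D (pr1 A (Tgt u)) V)) (rsA D (pr2 A (Tgt u)) g))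
      \<cdot>\<^bsub>Val D (A \<otimes> Src u)\<^esub> ext_right A u V W \<theta>
    = (rsA D (idF A \<otimes>\<^sub>F u) (tenA (Mon M (A \<otimes> Tgt u)) (Id (Val D (A \<otimes> Tgt u)) (rs D (pr1 A (Tgt u)) V)) (rsA D (pr2 A (Tgt u)) g))
      \<cdot>\<^bsub>Val D (A \<otimes> Src u)\<^esub> Mu M (idF A \<otimes>\<^sub>F u) (rs D (pr1 A (Tgt u)) V) (rs D (pr2 A (Tgt u)) W)) \<cdot>\<^bsub>Val D (A \<otimes> Src u)\<^esub>
     tenA (Mon M (A \<otimes> Src u)) (Id (Val D (A \<otimes> Src u)) (rs D (pr1 A (Src u)) V)) (rsA D (pr2 A (Src u)) \<theta>)"
    by (simp add: ext_right_def)
  also have "rsA D (idF A \<otimes>\<^sub>F u) (tenA (Mon M (A \<otimes> Tgt u)) (Id (Val D (A \<otimes> Tgt u)) (rs D (pr1 A (Tgt u)) V)) (rsA D (pr2 A (Tgt u)) g))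
      \<cdot>\<^bsub>Val D (A \<otimes> Src u)\<^esub> Mu M (idF A \<otimes>\<^sub>F u) (rs D (pr1 A (Tgt u)) V) (rs D (pr2 A (Tgt u)) W)
     = Mu M (idF A \<otimes>\<^sub>F u) (rs D (pr1 A (Tgt u)) V) (rs D (pr2 A (Tgt u)) W') \<cdot>\<^bsub>Val D (A \<otimes> Src u)\<^esub>
      tenA (Mon M (A \<otimes> Src u)) (Id (Val D (A \<otimes> Src u)) (rs D (pr1 A (Src u)) V)) (rsA D (u \<odot> pr2 A (Src u)) g)"
    using Mu_natural[of "idF A \<otimes>\<^sub>F u" "A \<otimes> Src u" "Id (Val D (A \<otimes> Tgt u)) (rs D (pr1 A (Tgt u)) V)" "rsA D (pr2 A (Tgt u)) g"]
    by simp
  finally show ?thesis by (simp add: ext_right_def tenA_merge)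
qed

lemma iso_Id_Val: "small_cat K \<Longrightarrow> X \<in> Ob (Val D K) \<Longrightarrow> iso (Val D K) (Id (Val D K) X)"
  by (rule category.iso_Id) simp_all

text \<open>Cocontinuity settles the case of the chosen unit. A general \<open>\<theta>\<close> is
  that unit followed by an isomorphism \<open>g\<close>, and tensoring with an identity keeps
  \<open>g\<close> invertible.\<close>

lemma univ_ext_left:
  assumes \<theta>: "univ D u W \<theta>" and B: "small_cat B" and V: "V \<in> Ob (Val D B)"
  shows "univ D (u \<otimes>\<^sub>F idF B) (ext D M (Tgt u) B W V) (ext_left u B W V \<theta>)"
proof -
  define X where "X = Dom (Val D (Src u)) \<theta>"
  note t = univD[OF \<theta>]
  have X: "X \<in> Ob (Val D (Src u))" using t by (simp add: X_def)
  note l = univ_lan[OF t(1) X]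
  let ?L = "lan D u X" and ?U = "ladj_unit (Res D u) X" and ?v = "u \<otimes>\<^sub>F idF B"
  note [simp] = t B V X l(2,3) univD[OF l(1)]
  have "cocont_left D M u B X V = ltransp (Res D ?v) (ext D M (Tgt u) B ?L V) (ext_left u B ?L V ?U)"
    by (simp add: cocont_left_def ext_left_def ext_mu_def extA_def)
  then have 1: "univ D ?v (ext D M (Tgt u) B ?L V) (ext_left u B ?L V ?U)"
    using cocontinuous_left[OF t(1) B X V] ltransp_iso_iff[of ?v "ext_left u B ?L V ?U" "ext D M (Tgt u) B ?L V"]
    by (simp add: ext_left_def ext_def)
  obtain g where g: "g \<in> Ar (Val D (Tgt u))" "Dom (Val D (Tgt u)) g = ?L" "Cod (Val D (Tgt u)) g = W"
    "rsA D u g \<cdot>\<^bsub>Val D (Src u)\<^esub> ?U = \<theta>"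
    using univ_ex[OF l(1), of \<theta> W] X_def[symmetric] by auto
  have i: "iso (Val D (Tgt u)) g" using univ_post_iff[OF l(1) g(1,2,3)] \<theta> g(4) by simp
  have "iso (Val D (Tgt u \<otimes> B)) (tenA (Mon M (Tgt u \<otimes> B)) (rsA D (pr1 (Tgt u) B) g) (Id (Val D (Tgt u \<otimes> B)) (rs D (pr2 (Tgt u) B) V)))"
    by (intro monoidal_category.iso_ten[OF Mon_monoidal] rsA_iso[OF _ i] iso_Id_Val) simp_all
  from univ_post[OF 1, simplified, OF this] show ?thesis
    using ext_left_post[OF t(1) B V _ _ g(1-3), of ?U] g by (simp add: ext_def)
qed

lemma univ_ext_right:
  assumes \<theta>: "univ D u W \<theta>" and A: "small_cat A" and V: "V \<in> Ob (Val D A)"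
  shows "univ D (idF A \<otimes>\<^sub>F u) (ext D M A (Tgt u) V W) (ext_right A u V W \<theta>)"
proof -
  define X where "X = Dom (Val D (Src u)) \<theta>"
  note t = univD[OF \<theta>]
  have X: "X \<in> Ob (Val D (Src u))" using t by (simp add: X_def)
  note l = univ_lan[OF t(1) X]
  let ?L = "lan D u X" and ?U = "ladj_unit (Res D u) X" and ?v = "idF A \<otimes>\<^sub>F u"
  note [simp] = t A V X l(2,3) univD[OF l(1)]
  have "cocont_right D M A u V X = ltransp (Res D ?v) (ext D M A (Tgt u) V ?L) (ext_right A u V ?L ?U)"
    by (simp add: cocont_right_def ext_right_def ext_mu_def extA_def)
  then have 1: "univ D ?v (ext D M A (Tgt u) V ?L) (ext_right A u V ?L ?U)"
    using cocontinuous_right[OF A t(1) V X] ltransp_iso_iff[of ?v "ext_right A u V ?L ?U" "ext D M A (Tgt u) V ?L"]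
    by (simp add: ext_right_def ext_def)
  obtain g where g: "g \<in> Ar (Val D (Tgt u))" "Dom (Val D (Tgt u)) g = ?L" "Cod (Val D (Tgt u)) g = W"
    "rsA D u g \<cdot>\<^bsub>Val D (Src u)\<^esub> ?U = \<theta>"
    using univ_ex[OF l(1), of \<theta> W] X_def[symmetric] by auto
  have i: "iso (Val D (Tgt u)) g" using univ_post_iff[OF l(1) g(1,2,3)] \<theta> g(4) by simp
  have "iso (Val D (A \<otimes> Tgt u)) (tenA (Mon M (A \<otimes> Tgt u)) (Id (Val D (A \<otimes> Tgt u)) (rs D (pr1 A (Tgt u)) V)) (rsA D (pr2 A (Tgt u)) g))"
    by (intro monoidal_category.iso_ten[OF Mon_monoidal] rsA_iso[OF _ i] iso_Id_Val) simp_all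
  from univ_post[OF 1, simplified, OF this] show ?thesis
    using ext_right_post[OF t(1) A V _ _ g(1-3), of ?U] g by (simp add: ext_def)
qed

text \<open>A projection formula: if \<open>g\<close> is a base change of \<open>u \<times> 1\<close>, then \<open>g\<^sub>!(s\<^sub>1\<^sup>*V \<otimes> g\<^sup>*s\<^sub>2\<^sup>*Z) \<cong> t\<^sup>*u\<^sub>!V \<otimes> s\<^sub>2\<^sup>*Z\<close>.\<close>

lemma univ_ten_left:
  assumes \<theta>: "univ D u W \<theta>" and Z: "Z \<in> Ob (Val D B)"
    and s: "s \<in> fn S (Src u)" and t: "t \<in> fn S' (Tgt u)" and g: "g \<in> fn S S'" and r: "r \<in> fn S' B"
    and sq: "u \<odot> s = t \<odot> g"
    and bc: "\<And>Y \<eta>. univ D (u \<otimes>\<^sub>F idF B) Y \<eta> \<Longrightarrow> univ D g (rs D \<langle>t, r\<rangle> Y) (rsA D \<langle>s, r \<odot> g\<rangle> \<eta>)"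
  shows "univ D g (ten (Mon M S') (rs D t W) (rs D r Z))
    (Mu M g (rs D t W) (rs D r Z) \<cdot>\<^bsub>Val D S\<^esub> tenA (Mon M S) (rsA D s \<theta>) (Id (Val D S) (rs D (r \<odot> g) Z)))"
proof -
  note [simp] = univD[OF \<theta>] s[unfolded fn_iff] t[unfolded fn_iff] g[unfolded fn_iff] r[unfolded fn_iff] sq Z
  let ?V = "Dom (Val D (Src u)) \<theta>"
  let ?v = "u \<otimes>\<^sub>F idF B" and ?s = "\<langle>s, r \<odot> g\<rangle>" and ?t = "\<langle>t, r\<rangle>"
  let ?P1 = "rs D (pr1 (Tgt u) B) W" and ?P2 = "rs D (pr2 (Tgt u) B) Z"
  let ?Q1 = "rs D (pr1 (Src u) B) ?V" and ?Q2 = "rs D (pr2 (Src u) B) Z"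
  \<comment> \<open>Base change of the external universal arrow; the rest only moves the constraints
    \<open>Mu\<close> to the right places.\<close>
  have "univ D g (rs D ?t (ext D M (Tgt u) B W Z)) (rsA D ?s (ext_left u B W Z \<theta>))"
    by (rule bc[OF univ_ext_left[OF \<theta>]]) simp_all
  then have 1: "univ D g (rs D ?t (ext D M (Tgt u) B W Z)) (rsA D ?s (ext_left u B W Z \<theta>) \<cdot>\<^bsub>Val D S\<^esub> Mu M ?s ?Q1 ?Q2)"
    by (rule univ_pre) (simp_all add: Mu_iso ext_left_def)
  have "rsA D ?s (ext_left u B W Z \<theta>) \<cdot>\<^bsub>Val D S\<^esub> Mu M ?s ?Q1 ?Q2
    = rsA D ?s (Mu M ?v ?P1 ?P2) \<cdot>\<^bsub>Val D S\<^esub>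
      (rsA D ?s (tenA (Mon M (Src u \<otimes> B)) (rsA D (pr1 (Src u) B) \<theta>) (Id (Val D (Src u \<otimes> B)) ?Q2)) \<cdot>\<^bsub>Val D S\<^esub> Mu M ?s ?Q1 ?Q2)"
    by (simp add: ext_left_def)
  also have "rsA D ?s (tenA (Mon M (Src u \<otimes> B)) (rsA D (pr1 (Src u) B) \<theta>) (Id (Val D (Src u \<otimes> B)) ?Q2)) \<cdot>\<^bsub>Val D S\<^esub> Mu M ?s ?Q1 ?Q2
    = Mu M ?s (rs D ?v ?P1) (rs D ?v ?P2) \<cdot>\<^bsub>Val D S\<^esub> tenA (Mon M S) (rsA D s \<theta>) (Id (Val D S) (rs D (r \<odot> g) Z))"
    using Mu_natural[of ?s S "rsA D (pr1 (Src u) B) \<theta>" "Id (Val D (Src u \<otimes> B)) ?Q2" ?Q1 ?Q2] by simp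
  also have "rsA D ?s (Mu M ?v ?P1 ?P2) \<cdot>\<^bsub>Val D S\<^esub> (Mu M ?s (rs D ?v ?P1) (rs D ?v ?P2) \<cdot>\<^bsub>Val D S\<^esub> tenA (Mon M S) (rsA D s \<theta>) (Id (Val D S) (rs D (r \<odot> g) Z)))
     = Mu M (?v \<odot> ?s) ?P1 ?P2 \<cdot>\<^bsub>Val D S\<^esub> tenA (Mon M S) (rsA D s \<theta>) (Id (Val D S) (rs D (r \<odot> g) Z))"
    using Mu_comp[of ?s ?v ?P1 ?P2] by simp
  \<comment> \<open>Going round the square the other way exposes the constraint of
    \<open>?t\<close>, an isomorphism that can be cancelled.\<close>
  also have "?v \<odot> ?s = ?t \<odot> g" by simp
  also have "Mu M (?t \<odot> g) ?P1 ?P2 = rsA D g (Mu M ?t ?P1 ?P2) \<cdot>\<^bsub>Val D S\<^esub> Mu M g (rs D t W) (rs D r Z)"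
    using Mu_comp[of g ?t ?P1 ?P2] by simp
  finally have "rsA D ?s (ext_left u B W Z \<theta>) \<cdot>\<^bsub>Val D S\<^esub> Mu M ?s ?Q1 ?Q2
    = rsA D g (Mu M ?t ?P1 ?P2) \<cdot>\<^bsub>Val D S\<^esub> (Mu M g (rs D t W) (rs D r Z) \<cdot>\<^bsub>Val D S\<^esub> tenA (Mon M S) (rsA D s \<theta>) (Id (Val D S) (rs D (r \<odot> g) Z)))"
    by simp
  with 1 have 2: "univ D g (rs D ?t (ext D M (Tgt u) B W Z))
     (rsA D g (Mu M ?t ?P1 ?P2) \<cdot>\<^bsub>Val D S\<^esub> (Mu M g (rs D t W) (rs D r Z) \<cdot>\<^bsub>Val D S\<^esub> tenA (Mon M S) (rsA D s \<theta>) (Id (Val D S) (rs D (r \<odot> g) Z))))"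
    by (simp only:)
  show ?thesis
    by (rule univ_post_cancel[where g = "Mu M ?t ?P1 ?P2"]) (use 2 in \<open>simp_all add: Mu_iso ext_def\<close>)
qed

text \<open>The projection formula with the Kan extension in the second factor.\<close>

lemma univ_ten_right:
  assumes \<theta>: "univ D u W \<theta>" and Z: "Z \<in> Ob (Val D A)"
    and s: "s \<in> fn S (Src u)" and t: "t \<in> fn S' (Tgt u)" and g: "g \<in> fn S S'" and r: "r \<in> fn S' A"
    and sq: "u \<odot> s = t \<odot> g"
    and bc: "\<And>Y \<eta>. univ D (idF A \<otimes>\<^sub>F u) Y \<eta> \<Longrightarrow> univ D g (rs D \<langle>r, t\<rangle> Y) (rsA D \<langle>r \<odot> g, s\<rangle> \<eta>)"
  shows "univ D g (ten (Mon M S') (rs D r Z) (rs D t W))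
    (Mu M g (rs D r Z) (rs D t W) \<cdot>\<^bsub>Val D S\<^esub> tenA (Mon M S) (Id (Val D S) (rs D (r \<odot> g) Z)) (rsA D s \<theta>))"
proof -
  note [simp] = univD[OF \<theta>] s[unfolded fn_iff] t[unfolded fn_iff] g[unfolded fn_iff] r[unfolded fn_iff] sq Z
  let ?V = "Dom (Val D (Src u)) \<theta>"
  let ?v = "idF A \<otimes>\<^sub>F u" and ?s = "\<langle>r \<odot> g, s\<rangle>" and ?t = "\<langle>r, t\<rangle>"
  let ?P1 = "rs D (pr1 A (Tgt u)) Z" and ?P2 = "rs D (pr2 A (Tgt u)) W"
  let ?Q1 = "rs D (pr1 A (Src u)) Z" and ?Q2 = "rs D (pr2 A (Src u)) ?V"
  let ?T = "tenA (Mon M S) (Id (Val D S) (rs D (r \<odot> g) Z)) (rsA D s \<theta>)"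
  have "univ D g (rs D ?t (ext D M A (Tgt u) Z W)) (rsA D ?s (ext_right A u Z W \<theta>))"
    by (rule bc[OF univ_ext_right[OF \<theta>]]) simp_all
  then have 1: "univ D g (rs D ?t (ext D M A (Tgt u) Z W)) (rsA D ?s (ext_right A u Z W \<theta>) \<cdot>\<^bsub>Val D S\<^esub> Mu M ?s ?Q1 ?Q2)"
    by (rule univ_pre) (simp_all add: Mu_iso ext_right_def)
  have "rsA D ?s (ext_right A u Z W \<theta>) \<cdot>\<^bsub>Val D S\<^esub> Mu M ?s ?Q1 ?Q2
    = rsA D ?s (Mu M ?v ?P1 ?P2) \<cdot>\<^bsub>Val D S\<^esub>
      (rsA D ?s (tenA (Mon M (A \<otimes> Src u)) (Id (Val D (A \<otimes> Src u)) ?Q1) (rsA D (pr2 A (Src u)) \<theta>)) \<cdot>\<^bsub>Val D S\<^esub> Mu M ?s ?Q1 ?Q2)"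
    by (simp add: ext_right_def)
  also have "rsA D ?s (tenA (Mon M (A \<otimes> Src u)) (Id (Val D (A \<otimes> Src u)) ?Q1) (rsA D (pr2 A (Src u)) \<theta>)) \<cdot>\<^bsub>Val D S\<^esub> Mu M ?s ?Q1 ?Q2
    = Mu M ?s (rs D ?v ?P1) (rs D ?v ?P2) \<cdot>\<^bsub>Val D S\<^esub> ?T"
    using Mu_natural[of ?s S "Id (Val D (A \<otimes> Src u)) ?Q1" "rsA D (pr2 A (Src u)) \<theta>" ?Q1 ?Q2] by simp
  also have "rsA D ?s (Mu M ?v ?P1 ?P2) \<cdot>\<^bsub>Val D S\<^esub> (Mu M ?s (rs D ?v ?P1) (rs D ?v ?P2) \<cdot>\<^bsub>Val D S\<^esub> ?T)
     = Mu M (?v \<odot> ?s) ?P1 ?P2 \<cdot>\<^bsub>Val D S\<^esub> ?T"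
    using Mu_comp[of ?s ?v ?P1 ?P2] by simp
  also have "?v \<odot> ?s = ?t \<odot> g" by simp
  also have "Mu M (?t \<odot> g) ?P1 ?P2 = rsA D g (Mu M ?t ?P1 ?P2) \<cdot>\<^bsub>Val D S\<^esub> Mu M g (rs D r Z) (rs D t W)"
    using Mu_comp[of g ?t ?P1 ?P2] by simp
  finally have "rsA D ?s (ext_right A u Z W \<theta>) \<cdot>\<^bsub>Val D S\<^esub> Mu M ?s ?Q1 ?Q2
    = rsA D g (Mu M ?t ?P1 ?P2) \<cdot>\<^bsub>Val D S\<^esub> (Mu M g (rs D r Z) (rs D t W) \<cdot>\<^bsub>Val D S\<^esub> ?T)"
    by simp
  with 1 have 2: "univ D g (rs D ?t (ext D M A (Tgt u) Z W))
     (rsA D g (Mu M ?t ?P1 ?P2) \<cdot>\<^bsub>Val D S\<^esub> (Mu M g (rs D r Z) (rs D t W) \<cdot>\<^bsub>Val D S\<^esub> ?T))"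
    by (simp only:)
  show ?thesis
    by (rule univ_post_cancel[where g = "Mu M ?t ?P1 ?P2"]) (use 2 in \<open>simp_all add: Mu_iso ext_def\<close>)
qed

end

section \<open>The tensor product of the affine line\<close>

lemma reorder_simps [simp]: "Src (reorder A B) = (\<N> \<otimes> \<N>) \<otimes> (A \<otimes> B)" "Tgt (reorder A B) = (\<N> \<otimes> A) \<otimes> (\<N> \<otimes> B)"
  "small_cat A \<Longrightarrow> small_cat B \<Longrightarrow> small_fun (reorder A B)"
  by (simp_all add: reorder_def)

text \<open>Unfolding these leaves only pairings and projections, on which the rules for cartesian
  products normalise.\<close>

lemmas cart = timesF_def diag_def reorder_def

context derivator
begin

lemma fam_times: "small_fun f \<Longrightarrow> small_cat K \<Longrightarrow>
    fam f {(insr K k (Src f), insr K k (Tgt f)) |k. k \<in> Ob K} (f \<otimes>\<^sub>F idF K)"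
proof -
  assume [simp]: "small_fun f" "small_cat K"
  have "{(insr K k (Src f) \<odot> c, insr K k (Tgt f) \<odot> d) |k c d. k \<in> Ob K \<and> (c, d) \<in> {(idF (Src f), idF (Tgt f))}}
    = {(insr K k (Src f), insr K k (Tgt f)) |k. k \<in> Ob K}"
  proof -
    have "insr K k (Src f) \<odot> idF (Src f) = insr K k (Src f)" "insr K k (Tgt f) \<odot> idF (Tgt f) = insr K k (Tgt f)"
      if "k \<in> Ob K" for k using that by simp_all
    then show ?thesis by force
  qed
  then show ?thesis using fam_times_right[OF _ fam_self[of f], of K] by simp
qed

text \<open>A functor of the form \<open>1 \<times> w\<close> sends the copy of \<open>f\<close>
  over \<open>k\<close> to the copy over \<open>w k\<close>, which is all that base change asks
  for.\<close>

lemma univ_times_base_change: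
  assumes \<eta>: "univ D (f \<otimes>\<^sub>F idF K) Y \<eta>" and f: "small_fun f" and w: "w \<in> fn K' K"
  shows "univ D (f \<otimes>\<^sub>F idF K') (rs D (idF (Tgt f) \<otimes>\<^sub>F w) Y) (rsA D (idF (Src f) \<otimes>\<^sub>F w) \<eta>)"
proof (rule univ_base_change[OF fam_times fam_times])
  note [simp] = w[unfolded fn_iff] f
  show "(idF (Src f) \<otimes>\<^sub>F w \<odot> c, idF (Tgt f) \<otimes>\<^sub>F w \<odot> d) \<in> {(insr K k (Src f), insr K k (Tgt f)) |k. k \<in> Ob K}"
    if cd: "(c, d) \<in> {(insr K' k (Src f), insr K' k (Tgt f)) |k. k \<in> Ob K'}" for c d
  proof -
    obtain k where k: "c = insr K' k (Src f)" "d = insr K' k (Tgt f)" "k \<in> Ob K'" using cd by blast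
    have *: "(idF C \<otimes>\<^sub>F w) \<odot> insr K' k C = insr K (FO w k) C" if "small_cat C" for C
      using that k by (auto intro!: sfun_eqI simp: insr_def sfun_simps)
    have "FO w k \<in> Ob K" using k by (simp add: sfun_simps)
    then show ?thesis using k * by auto
  qed
qed (use assms in \<open>simp_all add: fn_iff\<close>)

end

context monoidal_derivator
begin

abbreviation aunit :: "'u scat \<Rightarrow> 'u scat \<Rightarrow> 'o \<Rightarrow> 'o \<Rightarrow> 'a" where
  "aunit A B X Y \<equiv> ladj_unit (Res D (plus_times (A \<otimes> B))) (aext_pre D M A B X Y)"

abbreviation atenA :: "'u scat \<Rightarrow> 'a \<Rightarrow> 'a \<Rightarrow> 'a" where
  "atenA A f g \<equiv> FA (aTen D M A) (f, g)"

definition aMu :: "'u sfun \<Rightarrow> 'o \<Rightarrow> 'o \<Rightarrow> 'a" where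
  "aMu u X Y = rsA D (idF \<N> \<otimes>\<^sub>F diag (Src u)) (aext_mu D M u u X Y)"

lemma aext_pre_ob:
  assumes "small_cat A" "small_cat B" "X \<in> Ob (Val D (\<N> \<otimes> A))" "Y \<in> Ob (Val D (\<N> \<otimes> B))"
  shows "aext_pre D M A B X Y \<in> Ob (Val D ((\<N> \<otimes> \<N>) \<otimes> (A \<otimes> B)))"
  using assms by (simp add: aext_pre_def ext_def)

lemma aunit:
  assumes "small_cat A" "small_cat B" "X \<in> Ob (Val D (\<N> \<otimes> A))" "Y \<in> Ob (Val D (\<N> \<otimes> B))"
  shows "univ D (plus_times (A \<otimes> B)) (aext D M A B X Y) (aunit A B X Y)"
    "Dom (Val D ((\<N> \<otimes> \<N>) \<otimes> (A \<otimes> B))) (aunit A B X Y) = rs D (reorder A B) (ext D M (\<N> \<otimes> A) (\<N> \<otimes> B) X Y)"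
    "aext D M A B X Y \<in> Ob (Val D (\<N> \<otimes> (A \<otimes> B)))"
    "aunit A B X Y \<in> Ar (Val D ((\<N> \<otimes> \<N>) \<otimes> (A \<otimes> B)))"
    "Cod (Val D ((\<N> \<otimes> \<N>) \<otimes> (A \<otimes> B))) (aunit A B X Y) = rs D (plus_times (A \<otimes> B)) (aext D M A B X Y)"
proof -
  show u: "univ D (plus_times (A \<otimes> B)) (aext D M A B X Y) (aunit A B X Y)"
    "Dom (Val D ((\<N> \<otimes> \<N>) \<otimes> (A \<otimes> B))) (aunit A B X Y) = rs D (reorder A B) (ext D M (\<N> \<otimes> A) (\<N> \<otimes> B) X Y)"
    "aext D M A B X Y \<in> Ob (Val D (\<N> \<otimes> (A \<otimes> B)))"
    using univ_lan[of "plus_times (A \<otimes> B)" "aext_pre D M A B X Y"] aext_pre_ob[OF assms] assms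
    by (simp_all add: aext_def) (simp add: aext_pre_def)
  show "aunit A B X Y \<in> Ar (Val D ((\<N> \<otimes> \<N>) \<otimes> (A \<otimes> B)))"
    "Cod (Val D ((\<N> \<otimes> \<N>) \<otimes> (A \<otimes> B))) (aunit A B X Y) = rs D (plus_times (A \<otimes> B)) (aext D M A B X Y)"
    using univD[OF u(1)] by simp_all
qed

lemma aTen_ob: "X \<in> Ob (Val D (\<N> \<otimes> A)) \<Longrightarrow> Y \<in> Ob (Val D (\<N> \<otimes> A)) \<Longrightarrow>
    aten D M A X Y = rs D (idF \<N> \<otimes>\<^sub>F diag A) (aext D M A A X Y)"
  and aTen_arr: "f \<in> Ar (Val D (\<N> \<otimes> A)) \<Longrightarrow> g \<in> Ar (Val D (\<N> \<otimes> A)) \<Longrightarrow>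
    atenA A f g = rsA D (idF \<N> \<otimes>\<^sub>F diag A) (aextA D M A A f g)"
  by (simp_all add: aTen_def)

lemma aten_ob [simp]:
  "small_cat A \<Longrightarrow> X \<in> Ob (Val D (\<N> \<otimes> A)) \<Longrightarrow> Y \<in> Ob (Val D (\<N> \<otimes> A)) \<Longrightarrow> aten D M A X Y \<in> Ob (Val D (\<N> \<otimes> A))"
  by (simp add: aTen_ob aunit)

lemma p1_reorder [simp]:
  assumes "small_cat A"
  shows "pr1 (\<N> \<otimes> A) (\<N> \<otimes> A) \<odot> (reorder A A \<odot> (idF (\<N> \<otimes> \<N>) \<otimes>\<^sub>F diag A)) = p1 A"
    "pr2 (\<N> \<otimes> A) (\<N> \<otimes> A) \<odot> (reorder A A \<odot> (idF (\<N> \<otimes> \<N>) \<otimes>\<^sub>F diag A)) = p2 A"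
  using assms by (simp_all add: cart)

lemma bil_simps [simp]:
  assumes "small_cat A" "X \<in> Ob (Val D (\<N> \<otimes> A))" "Y \<in> Ob (Val D (\<N> \<otimes> A))"
  shows "bil D M A X Y \<in> Ar (Val D ((\<N> \<otimes> \<N>) \<otimes> A))"
    "Dom (Val D ((\<N> \<otimes> \<N>) \<otimes> A)) (bil D M A X Y) = ten (Mon M ((\<N> \<otimes> \<N>) \<otimes> A)) (rs D (p1 A) X) (rs D (p2 A) Y)"
    "Cod (Val D ((\<N> \<otimes> \<N>) \<otimes> A)) (bil D M A X Y) = rs D (plus_times A) (aten D M A X Y)"
  using assms aunit[of A A X Y]
  by (simp_all add: bil_def Let_def ext_def aTen_ob cart)

text \<open>Base change along the diagonal preserves the universal arrow of the chosen Kan extension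
  along addition, and the other factor of \<open>bil\<close> is an invertible constraint.\<close>

lemma univ_bil:
  assumes A: "small_cat A" and XY: "X \<in> Ob (Val D (\<N> \<otimes> A))" "Y \<in> Ob (Val D (\<N> \<otimes> A))"
  shows "univ D (plus_times A) (aten D M A X Y) (bil D M A X Y)"
proof -
  have "univ D (plus_times A) (rs D (idF \<N> \<otimes>\<^sub>F diag A) (aext D M A A X Y)) (rsA D (idF (\<N> \<otimes> \<N>) \<otimes>\<^sub>F diag A) (aunit A A X Y))"
    using univ_times_base_change[OF aunit(1)[OF A A XY], of "diag A" A] A by (simp add: fn_iff)
  then have "univ D (plus_times A) (aten D M A X Y) (rsA D (idF (\<N> \<otimes> \<N>) \<otimes>\<^sub>F diag A) (aunit A A X Y) \<cdot>\<^bsub>Val D ((\<N> \<otimes> \<N>) \<otimes> A)\<^esub>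
         Mu M (reorder A A \<odot> (idF (\<N> \<otimes> \<N>) \<otimes>\<^sub>F diag A))
           (rs D (pr1 (\<N> \<otimes> A) (\<N> \<otimes> A)) X) (rs D (pr2 (\<N> \<otimes> A) (\<N> \<otimes> A)) Y))"
    unfolding aTen_ob[OF XY]
    by (rule univ_pre) (use A XY aunit[OF A A XY] in \<open>simp_all add: Mu_iso ext_def\<close>)
  then show ?thesis by (simp add: bil_def Let_def)
qed

text \<open>The last clause is naturality of the unit; by universality it determines the action on
  morphisms.\<close>

lemma aextA:
  assumes [simp]: "small_cat A" "small_cat B" "f \<in> Ar (Val D (\<N> \<otimes> A))" "g \<in> Ar (Val D (\<N> \<otimes> B))"
    and [simp]: "Dom (Val D (\<N> \<otimes> A)) f = X" "Dom (Val D (\<N> \<otimes> B)) g = Y"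
      "Cod (Val D (\<N> \<otimes> A)) f = X'" "Cod (Val D (\<N> \<otimes> B)) g = Y'"
  shows "aextA D M A B f g \<in> Ar (Val D (\<N> \<otimes> (A \<otimes> B)))"
    "Dom (Val D (\<N> \<otimes> (A \<otimes> B))) (aextA D M A B f g) = aext D M A B X Y"
    "Cod (Val D (\<N> \<otimes> (A \<otimes> B))) (aextA D M A B f g) = aext D M A B X' Y'"
    "rsA D (plus_times (A \<otimes> B)) (aextA D M A B f g) \<cdot>\<^bsub>Val D ((\<N> \<otimes> \<N>) \<otimes> (A \<otimes> B))\<^esub> aunit A B X Y
      = aunit A B X' Y' \<cdot>\<^bsub>Val D ((\<N> \<otimes> \<N>) \<otimes> (A \<otimes> B))\<^esub> rsA D (reorder A B) (extA D M (\<N> \<otimes> A) (\<N> \<otimes> B) f g)"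
proof -
  let ?h = "rsA D (reorder A B) (extA D M (\<N> \<otimes> A) (\<N> \<otimes> B) f g)"
  have h: "?h \<in> Ar (Val D ((\<N> \<otimes> \<N>) \<otimes> (A \<otimes> B)))" "Dom (Val D ((\<N> \<otimes> \<N>) \<otimes> (A \<otimes> B))) ?h = aext_pre D M A B X Y"
    "Cod (Val D ((\<N> \<otimes> \<N>) \<otimes> (A \<otimes> B))) ?h = aext_pre D M A B X' Y'"
    by (simp_all add: extA_def aext_pre_def ext_def)
  show "aextA D M A B f g \<in> Ar (Val D (\<N> \<otimes> (A \<otimes> B)))"
    "Dom (Val D (\<N> \<otimes> (A \<otimes> B))) (aextA D M A B f g) = aext D M A B X Y"
    "Cod (Val D (\<N> \<otimes> (A \<otimes> B))) (aextA D M A B f g) = aext D M A B X' Y'"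
    "rsA D (plus_times (A \<otimes> B)) (aextA D M A B f g) \<cdot>\<^bsub>Val D ((\<N> \<otimes> \<N>) \<otimes> (A \<otimes> B))\<^esub> aunit A B X Y
      = aunit A B X' Y' \<cdot>\<^bsub>Val D ((\<N> \<otimes> \<N>) \<otimes> (A \<otimes> B))\<^esub> ?h"
    using ladj_arr[of "plus_times (A \<otimes> B)" ?h] h by (simp_all add: aextA_def aext_def)
qed

lemma atenA:
  assumes [simp]: "small_cat A" "f \<in> Ar (Val D (\<N> \<otimes> A))" "g \<in> Ar (Val D (\<N> \<otimes> A))"
  shows "atenA A f g \<in> Ar (Val D (\<N> \<otimes> A))"
    "Dom (Val D (\<N> \<otimes> A)) (atenA A f g) = aten D M A (Dom (Val D (\<N> \<otimes> A)) f) (Dom (Val D (\<N> \<otimes> A)) g)"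
    "Cod (Val D (\<N> \<otimes> A)) (atenA A f g) = aten D M A (Cod (Val D (\<N> \<otimes> A)) f) (Cod (Val D (\<N> \<otimes> A)) g)"
  using aextA[of A A f g] by (simp_all add: aTen_arr aTen_ob)

declare atenA [simp]

text \<open>Naturality of the unit and of the constraint \<open>Mu\<close>, restricted to the
  diagonal.\<close>

lemma bil_natural:
  assumes A [simp]: "small_cat A" and fg: "f \<in> Ar (Val D (\<N> \<otimes> A))" "g \<in> Ar (Val D (\<N> \<otimes> A))"
    and XY: "Dom (Val D (\<N> \<otimes> A)) f = X" "Dom (Val D (\<N> \<otimes> A)) g = Y"
      "Cod (Val D (\<N> \<otimes> A)) f = X'" "Cod (Val D (\<N> \<otimes> A)) g = Y'"
  shows "rsA D (plus_times A) (atenA A f g) \<cdot>\<^bsub>Val D ((\<N> \<otimes> \<N>) \<otimes> A)\<^esub> bil D M A X Y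
    = bil D M A X' Y' \<cdot>\<^bsub>Val D ((\<N> \<otimes> \<N>) \<otimes> A)\<^esub> tenA (Mon M ((\<N> \<otimes> \<N>) \<otimes> A)) (rsA D (p1 A) f) (rsA D (p2 A) g)"
proof -
  let ?C = "Val D ((\<N> \<otimes> \<N>) \<otimes> A)"
  let ?d = "idF (\<N> \<otimes> \<N>) \<otimes>\<^sub>F diag A" and ?r = "reorder A A"
  let ?f = "rsA D (pr1 (\<N> \<otimes> A) (\<N> \<otimes> A)) f" and ?g = "rsA D (pr2 (\<N> \<otimes> A) (\<N> \<otimes> A)) g"
  have [simp]: "X \<in> Ob (Val D (\<N> \<otimes> A))" "Y \<in> Ob (Val D (\<N> \<otimes> A))" "X' \<in> Ob (Val D (\<N> \<otimes> A))" "Y' \<in> Ob (Val D (\<N> \<otimes> A))"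
    using fg XY by auto
  note [simp] = fg XY
  let ?m = "\<lambda>X Y. Mu M (?r \<odot> ?d) (rs D (pr1 (\<N> \<otimes> A) (\<N> \<otimes> A)) X) (rs D (pr2 (\<N> \<otimes> A) (\<N> \<otimes> A)) Y)"
  note a = aextA[OF A A fg XY]
  note un = aunit[of A A X Y, simplified] aunit[of A A X' Y', simplified]
  note [simp] = a(1-3) un(2-5,7-10)
  have "rsA D (plus_times A) (atenA A f g) \<cdot>\<^bsub>?C\<^esub> bil D M A X Y
    = rsA D ?d (rsA D (plus_times (A \<otimes> A)) (aextA D M A A f g) \<cdot>\<^bsub>Val D ((\<N> \<otimes> \<N>) \<otimes> (A \<otimes> A))\<^esub> aunit A A X Y) \<cdot>\<^bsub>?C\<^esub> ?m X Y"
    by (simp add: bil_def Let_def aTen_arr ext_def)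
  also have "\<dots> = rsA D ?d (aunit A A X' Y') \<cdot>\<^bsub>?C\<^esub> (rsA D (?r \<odot> ?d) (tenA (Mon M ((\<N> \<otimes> A) \<otimes> (\<N> \<otimes> A))) ?f ?g) \<cdot>\<^bsub>?C\<^esub> ?m X Y)"
    unfolding a(4) by (simp add: extA_def ext_def)
  also have "rsA D (?r \<odot> ?d) (tenA (Mon M ((\<N> \<otimes> A) \<otimes> (\<N> \<otimes> A))) ?f ?g) \<cdot>\<^bsub>?C\<^esub> ?m X Y
    = ?m X' Y' \<cdot>\<^bsub>?C\<^esub> tenA (Mon M ((\<N> \<otimes> \<N>) \<otimes> A)) (rsA D (?r \<odot> ?d) ?f) (rsA D (?r \<odot> ?d) ?g)"
    using Mu_natural[of "?r \<odot> ?d" "(\<N> \<otimes> \<N>) \<otimes> A" ?f ?g] by simp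
  also have "rsA D (?r \<odot> ?d) ?f = rsA D (p1 A) f" by simp
  also have "rsA D (?r \<odot> ?d) ?g = rsA D (p2 A) g" by simp
  finally show ?thesis
    by (simp add: bil_def Let_def ext_def)
qed

text \<open>The last equation characterises the constraint, because \<open>bil\<close> is universal;
  in the coherence proofs it replaces the definition as a Beck--Chevalley transpose.\<close>

lemma aMu:
  assumes u: "u \<in> fn A B" and XY [simp]: "X \<in> Ob (Val D (\<N> \<otimes> B))" "Y \<in> Ob (Val D (\<N> \<otimes> B))"
  shows "aMu u X Y \<in> Ar (Val D (\<N> \<otimes> A))"
    "Dom (Val D (\<N> \<otimes> A)) (aMu u X Y) = aten D M A (rs D (idF \<N> \<otimes>\<^sub>F u) X) (rs D (idF \<N> \<otimes>\<^sub>F u) Y)"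
    "Cod (Val D (\<N> \<otimes> A)) (aMu u X Y) = rs D (idF \<N> \<otimes>\<^sub>F u) (aten D M B X Y)"
    "rsA D (plus_times A) (aMu u X Y) \<cdot>\<^bsub>Val D ((\<N> \<otimes> \<N>) \<otimes> A)\<^esub> bil D M A (rs D (idF \<N> \<otimes>\<^sub>F u) X) (rs D (idF \<N> \<otimes>\<^sub>F u) Y)
      = rsA D (idF (\<N> \<otimes> \<N>) \<otimes>\<^sub>F u) (bil D M B X Y) \<cdot>\<^bsub>Val D ((\<N> \<otimes> \<N>) \<otimes> A)\<^esub>
          Mu M (idF (\<N> \<otimes> \<N>) \<otimes>\<^sub>F u) (rs D (p1 B) X) (rs D (p2 B) Y)"
proof -
  note [simp] = u[unfolded fn_iff]
  let ?u = "idF \<N> \<otimes>\<^sub>F u" and ?w = "idF (\<N> \<otimes> \<N>) \<otimes>\<^sub>F (u \<otimes>\<^sub>F u)" and ?w' = "idF \<N> \<otimes>\<^sub>F (u \<otimes>\<^sub>F u)"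
  let ?d = "\<lambda>A. idF (\<N> \<otimes> \<N>) \<otimes>\<^sub>F diag A" and ?r = "\<lambda>A. reorder A A" and ?C = "Val D ((\<N> \<otimes> \<N>) \<otimes> A)"
  let ?X = "rs D ?u X" and ?Y = "rs D ?u Y"
  let ?C2 = "Val D ((\<N> \<otimes> \<N>) \<otimes> (A \<otimes> A))"
  let ?P1 = "rs D (pr1 (\<N> \<otimes> B) (\<N> \<otimes> B)) X" and ?P2 = "rs D (pr2 (\<N> \<otimes> B) (\<N> \<otimes> B)) Y"
  have [simp]: "?X \<in> Ob (Val D (\<N> \<otimes> A))" "?Y \<in> Ob (Val D (\<N> \<otimes> A))" by simp_all
  note un = aunit[of A A ?X ?Y] aunit[of B B X Y]
  note [simp] = un(2-5,7-10)
  let ?h = "rsA D ?w (aunit B B X Y) \<cdot>\<^bsub>?C2\<^esub> rsA D (?r A) (ext_mu D M ?u ?u X Y)"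
  have e: "ext_mu D M ?u ?u X Y = Mu M (?u \<otimes>\<^sub>F ?u) ?P1 ?P2"
    by (simp add: ext_mu_def)
  have e' [simp]: "ext_mu D M ?u ?u X Y \<in> Ar (Val D ((\<N> \<otimes> A) \<otimes> (\<N> \<otimes> A)))"
    "Dom (Val D ((\<N> \<otimes> A) \<otimes> (\<N> \<otimes> A))) (ext_mu D M ?u ?u X Y) = ext D M (\<N> \<otimes> A) (\<N> \<otimes> A) ?X ?Y"
    "Cod (Val D ((\<N> \<otimes> A) \<otimes> (\<N> \<otimes> A))) (ext_mu D M ?u ?u X Y) = rs D (?u \<otimes>\<^sub>F ?u) (ext D M (\<N> \<otimes> B) (\<N> \<otimes> B) X Y)"
    unfolding e by (simp_all add: ext_def)
  have eo [simp]: "ext D M (\<N> \<otimes> B) (\<N> \<otimes> B) X Y \<in> Ob (Val D ((\<N> \<otimes> B) \<otimes> (\<N> \<otimes> B)))" by (simp add: ext_def)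
  \<comment> \<open>Restriction along \<open>u\<close>, reordering, addition and the diagonal
    commute strictly as functors, so no comparison isomorphism intervenes.\<close>
  have rw: "(?u \<otimes>\<^sub>F ?u) \<odot> ?r A = ?r B \<odot> ?w" by (simp add: cart)
  have rd: "(?u \<otimes>\<^sub>F ?u) \<odot> (?r A \<odot> ?d A) = ?r B \<odot> (idF (\<N> \<otimes> \<N>) \<otimes>\<^sub>F ((u \<otimes>\<^sub>F u) \<odot> diag A))"
    by (simp add: cart)
  have pw: "?w' \<odot> plus_times (A \<otimes> A) = plus_times (B \<otimes> B) \<odot> ?w" by (simp add: cart)
  have dw: "?w \<odot> ?d A = ?d B \<odot> (idF (\<N> \<otimes> \<N>) \<otimes>\<^sub>F u)" by (simp add: cart)
  have dp: "(idF \<N> \<otimes>\<^sub>F diag A) \<odot> plus_times A = plus_times (A \<otimes> A) \<odot> ?d A" by (simp add: cart)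
  have h [simp]: "?h \<in> Ar ?C2" "Dom ?C2 ?h = rs D (?r A) (ext D M (\<N> \<otimes> A) (\<N> \<otimes> A) ?X ?Y)" "Cod ?C2 ?h = rs D (plus_times (A \<otimes> A)) (rs D ?w' (aext D M B B X Y))"
    by (simp_all add: rw pw)
  \<comment> \<open>The Beck--Chevalley map is by definition the transpose of \<open>?h\<close>; its
    defining equation \<open>l4\<close> says what it does to the unit.\<close>
  have amu: "aext_mu D M u u X Y = ltransp (Res D (plus_times (A \<otimes> A))) (rs D ?w' (aext D M B B X Y)) ?h"
    by (simp add: aext_mu_def Let_def)
  have "Dom ?C2 ?h = aext_pre D M A A ?X ?Y" using h(2) by (simp only: aext_pre_def[of D M A A])
  note l0 = ltransp[of "plus_times (A \<otimes> A)" ?h, unfolded timesF_simps plus_simps idF_simps, OF _ h(1,3) this, folded amu aext_def]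
  have l [simp]: "aext_mu D M u u X Y \<in> Ar (Val D (\<N> \<otimes> (A \<otimes> A)))"
    "Dom (Val D (\<N> \<otimes> (A \<otimes> A))) (aext_mu D M u u X Y) = aext D M A A ?X ?Y"
    "Cod (Val D (\<N> \<otimes> (A \<otimes> A))) (aext_mu D M u u X Y) = rs D ?w' (aext D M B B X Y)"
    and l4: "rsA D (plus_times (A \<otimes> A)) (aext_mu D M u u X Y) \<cdot>\<^bsub>?C2\<^esub> aunit A A ?X ?Y = ?h"
    by (rule l0; simp)+
  show "aMu u X Y \<in> Ar (Val D (\<N> \<otimes> A))"
    "Dom (Val D (\<N> \<otimes> A)) (aMu u X Y) = aten D M A ?X ?Y"
    "Cod (Val D (\<N> \<otimes> A)) (aMu u X Y) = rs D ?u (aten D M B X Y)"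
    by (simp_all add: aMu_def aTen_ob cart)
  have "rsA D (plus_times A) (aMu u X Y) \<cdot>\<^bsub>?C\<^esub> bil D M A ?X ?Y
    = rsA D (?d A) (rsA D (plus_times (A \<otimes> A)) (aext_mu D M u u X Y) \<cdot>\<^bsub>?C2\<^esub> aunit A A ?X ?Y)
       \<cdot>\<^bsub>?C\<^esub> Mu M (?r A \<odot> ?d A) (rs D (pr1 (\<N> \<otimes> A) (\<N> \<otimes> A)) ?X) (rs D (pr2 (\<N> \<otimes> A) (\<N> \<otimes> A)) ?Y)"
    by (simp add: bil_def Let_def aMu_def dp ext_def)
  also have "\<dots> = rsA D (?w \<odot> ?d A) (aunit B B X Y) \<cdot>\<^bsub>?C\<^esub> (rsA D (?r A \<odot> ?d A) (Mu M (?u \<otimes>\<^sub>F ?u) ?P1 ?P2) \<cdot>\<^bsub>?C\<^esub>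
       Mu M (?r A \<odot> ?d A) (rs D (?u \<otimes>\<^sub>F ?u) ?P1) (rs D (?u \<otimes>\<^sub>F ?u) ?P2))"
    unfolding l4 unfolding e by (simp add: rw rd ext_def)
  also have "rsA D (?r A \<odot> ?d A) (Mu M (?u \<otimes>\<^sub>F ?u) ?P1 ?P2) \<cdot>\<^bsub>?C\<^esub>
       Mu M (?r A \<odot> ?d A) (rs D (?u \<otimes>\<^sub>F ?u) ?P1) (rs D (?u \<otimes>\<^sub>F ?u) ?P2) = Mu M ((?u \<otimes>\<^sub>F ?u) \<odot> (?r A \<odot> ?d A)) ?P1 ?P2"
    using Mu_comp[of "?r A \<odot> ?d A" "?u \<otimes>\<^sub>F ?u" ?P1 ?P2] by simp
  also have "(?u \<otimes>\<^sub>F ?u) \<odot> (?r A \<odot> ?d A) = (?r B \<odot> ?d B) \<odot> (idF (\<N> \<otimes> \<N>) \<otimes>\<^sub>F u)" by (simp add: cart)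
  also have "Mu M ((?r B \<odot> ?d B) \<odot> (idF (\<N> \<otimes> \<N>) \<otimes>\<^sub>F u)) ?P1 ?P2 = rsA D (idF (\<N> \<otimes> \<N>) \<otimes>\<^sub>F u) (Mu M (?r B \<odot> ?d B) ?P1 ?P2)
      \<cdot>\<^bsub>?C\<^esub> Mu M (idF (\<N> \<otimes> \<N>) \<otimes>\<^sub>F u) (rs D (?r B \<odot> ?d B) ?P1) (rs D (?r B \<odot> ?d B) ?P2)"
    using Mu_comp[of "idF (\<N> \<otimes> \<N>) \<otimes>\<^sub>F u" "?r B \<odot> ?d B" ?P1 ?P2] by simp
  also have "rs D (?r B \<odot> ?d B) ?P1 = rs D (p1 B) X" by simp
  also have "rs D (?r B \<odot> ?d B) ?P2 = rs D (p2 B) Y" by simp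
  finally show "rsA D (plus_times A) (aMu u X Y) \<cdot>\<^bsub>?C\<^esub> bil D M A ?X ?Y
      = rsA D (idF (\<N> \<otimes> \<N>) \<otimes>\<^sub>F u) (bil D M B X Y) \<cdot>\<^bsub>?C\<^esub> Mu M (idF (\<N> \<otimes> \<N>) \<otimes>\<^sub>F u) (rs D (p1 B) X) (rs D (p2 B) Y)"
    unfolding dw by (simp add: bil_def Let_def ext_def)
qed

end

section \<open>Multiplication at generalized elements\<close>

abbreviation padd :: "'u::universe sfun \<Rightarrow> 'u sfun \<Rightarrow> 'u sfun" (infixr "\<oplus>" 62) where
  "k \<oplus> m \<equiv> plus \<odot> \<langle>k, m\<rangle>"

abbreviation zer :: "'u::universe scat \<Rightarrow> 'u sfun" where
  "zer K \<equiv> incl \<odot> bang K"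

context monoidal_prederivator
begin

lemma Mu_comp':
  "\<lbrakk>small_fun u; small_fun v; Src v = Tgt u; Src u = K; X \<in> Ob (Val D (Tgt v)); Y \<in> Ob (Val D (Tgt v))\<rbrakk>
    \<Longrightarrow> rsA D u (Mu M v X Y) \<cdot>\<^bsub>Val D K\<^esub> Mu M u (rs D v X) (rs D v Y) = Mu M (v \<odot> u) X Y"
  using Mu_comp by simp

lemma Mu0_rules [simp]:
  assumes "small_fun u" "Src u = K"
  shows "Mu0 M u \<in> Ar (Val D K)" "Dom (Val D K) (Mu0 M u) = Unt (Mon M K)"
    "Cod (Val D K) (Mu0 M u) = rs D u (Unt (Mon M (Tgt u)))"
  using strong_monoidal_functor.iota_hom[OF Res_strong_monoidal, of u] assms
  by (auto simp: Res_Src Res_Tgt hom_iff)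

lemma Mu0_iso: "small_fun u \<Longrightarrow> Src u = K \<Longrightarrow> iso (Val D K) (Mu0 M u)"
  using strong_monoidal_functor.iota_iso[OF Res_strong_monoidal, of u] by (simp add: Res_Src Res_Tgt)

lemma Asc_natural':
  assumes "small_cat K" "f \<in> Ar (Val D K)" "g \<in> Ar (Val D K)" "h \<in> Ar (Val D K)"
    "Dom (Val D K) f = X" "Dom (Val D K) g = Y" "Dom (Val D K) h = Z"
    "Cod (Val D K) f = X'" "Cod (Val D K) g = Y'" "Cod (Val D K) h = Z'"
  shows "Asc (Mon M K) X' Y' Z' \<cdot>\<^bsub>Val D K\<^esub> tenA (Mon M K) (tenA (Mon M K) f g) h
    = tenA (Mon M K) f (tenA (Mon M K) g h) \<cdot>\<^bsub>Val D K\<^esub> Asc (Mon M K) X Y Z"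
  using monoidal_category.Asc_natural[OF Mon_monoidal[OF assms(1)], of f X X' g Y Y' h Z Z'] assms
  by (simp add: hom_iff)

lemma Mu_Asc:
  assumes "small_fun u" "Src u = K" "X \<in> Ob (Val D (Tgt u))" "Y \<in> Ob (Val D (Tgt u))" "Z \<in> Ob (Val D (Tgt u))"
  shows "rsA D u (Asc (Mon M (Tgt u)) X Y Z) \<cdot>\<^bsub>Val D K\<^esub>
      (Mu M u (ten (Mon M (Tgt u)) X Y) Z \<cdot>\<^bsub>Val D K\<^esub> tenA (Mon M K) (Mu M u X Y) (Id (Val D K) (rs D u Z)))
    = Mu M u X (ten (Mon M (Tgt u)) Y Z) \<cdot>\<^bsub>Val D K\<^esub> (tenA (Mon M K) (Id (Val D K) (rs D u X)) (Mu M u Y Z)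
        \<cdot>\<^bsub>Val D K\<^esub> Asc (Mon M K) (rs D u X) (rs D u Y) (rs D u Z))"
  using strong_monoidal_functor.mu_assoc[OF Res_strong_monoidal, of u X Y Z] assms by (simp add: Res_Src Res_Tgt)

lemma Mu_Lun_Run:
  assumes "small_fun u" "Src u = K" "X \<in> Ob (Val D (Tgt u))"
  shows "rsA D u (Lun (Mon M (Tgt u)) X) \<cdot>\<^bsub>Val D K\<^esub>
      (Mu M u (Unt (Mon M (Tgt u))) X \<cdot>\<^bsub>Val D K\<^esub> tenA (Mon M K) (Mu0 M u) (Id (Val D K) (rs D u X)))
      = Lun (Mon M K) (rs D u X)"
    "rsA D u (Run (Mon M (Tgt u)) X) \<cdot>\<^bsub>Val D K\<^esub>
      (Mu M u X (Unt (Mon M (Tgt u))) \<cdot>\<^bsub>Val D K\<^esub> tenA (Mon M K) (Id (Val D K) (rs D u X)) (Mu0 M u))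
      = Run (Mon M K) (rs D u X)"
  using strong_monoidal_functor.mu_Lun[OF Res_strong_monoidal, of u X]
    strong_monoidal_functor.mu_Run[OF Res_strong_monoidal, of u X] assms by (simp_all add: Res_Src Res_Tgt)

end

context monoidal_derivator
begin

text \<open>For \<open>k, m : K \<rightarrow> \<nat>\<close> and \<open>t : K \<rightarrow> A\<close>, think of \<open>\<langle>k, t\<rangle>\<^sup>*X\<close> as the part of \<open>X\<close> at the generalized element
  \<open>k\<close>; then \<open>bet\<close> is the multiplication \<open>X\<^sub>k \<otimes> Y\<^sub>m \<rightarrow> (X \<otimes> Y)\<^bsub>k + m\<^esub>\<close> in the single category \<open>\<bbbD>(K)\<close>.\<close>

definition bet :: "'u sfun \<Rightarrow> 'u sfun \<Rightarrow> 'u sfun \<Rightarrow> 'o \<Rightarrow> 'o \<Rightarrow> 'a" where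
  "bet k m t X Y = rsA D \<langle>\<langle>k, m\<rangle>, t\<rangle> (bil D M (Tgt t) X Y) \<cdot>\<^bsub>Val D (Src t)\<^esub>
     Mu M \<langle>\<langle>k, m\<rangle>, t\<rangle> (rs D (p1 (Tgt t)) X) (rs D (p2 (Tgt t)) Y)"

lemma bet_simps [simp]:
  assumes "small_fun k" "small_fun m" "small_fun t" "Src k = K" "Src m = K" "Src t = K" "Tgt k = \<N>" "Tgt m = \<N>"
    "X \<in> Ob (Val D (\<N> \<otimes> Tgt t))" "Y \<in> Ob (Val D (\<N> \<otimes> Tgt t))"
  shows "bet k m t X Y \<in> Ar (Val D K)"
    "Dom (Val D K) (bet k m t X Y) = ten (Mon M K) (rs D \<langle>k, t\<rangle> X) (rs D \<langle>m, t\<rangle> Y)"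
    "Cod (Val D K) (bet k m t X Y) = rs D \<langle>k \<oplus> m, t\<rangle> (aten D M (Tgt t) X Y)"
  using assms small_fun_cat(1)[OF assms(3)] by (simp_all add: bet_def)

text \<open>Multiplication is stable under change of the stage \<open>K\<close>, up to the
  constraint of \<open>h\<close>; hence it is known from its value at generic elements.\<close>

lemma bet_restrict:
  assumes "k \<in> fn K \<N>" "m \<in> fn K \<N>" "t \<in> fn K A" "h \<in> fn K' K"
    "X \<in> Ob (Val D (\<N> \<otimes> A))" "Y \<in> Ob (Val D (\<N> \<otimes> A))"
  shows "rsA D h (bet k m t X Y) \<cdot>\<^bsub>Val D K'\<^esub> Mu M h (rs D \<langle>k, t\<rangle> X) (rs D \<langle>m, t\<rangle> Y)
    = bet (k \<odot> h) (m \<odot> h) (t \<odot> h) X Y"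
proof -
  note [simp] = assms[unfolded fn_iff]
  have "rsA D h (bet k m t X Y) \<cdot>\<^bsub>Val D K'\<^esub> Mu M h (rs D \<langle>k, t\<rangle> X) (rs D \<langle>m, t\<rangle> Y)
    = rsA D (\<langle>\<langle>k, m\<rangle>, t\<rangle> \<odot> h) (bil D M A X Y) \<cdot>\<^bsub>Val D K'\<^esub>
      (rsA D h (Mu M \<langle>\<langle>k, m\<rangle>, t\<rangle> (rs D (p1 A) X) (rs D (p2 A) Y)) \<cdot>\<^bsub>Val D K'\<^esub>
        Mu M h (rs D \<langle>\<langle>k, m\<rangle>, t\<rangle> (rs D (p1 A) X)) (rs D \<langle>\<langle>k, m\<rangle>, t\<rangle> (rs D (p2 A) Y)))"
    by (simp add: bet_def)
  also have "\<dots> = bet (k \<odot> h) (m \<odot> h) (t \<odot> h) X Y"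
    by (subst Mu_comp') (simp_all add: bet_def)
  finally show ?thesis .
qed

lemma bet_natural:
  assumes "k \<in> fn K \<N>" "m \<in> fn K \<N>" "t \<in> fn K A" "f \<in> Ar (Val D (\<N> \<otimes> A))" "g \<in> Ar (Val D (\<N> \<otimes> A))"
    "Dom (Val D (\<N> \<otimes> A)) f = X" "Dom (Val D (\<N> \<otimes> A)) g = Y"
      "Cod (Val D (\<N> \<otimes> A)) f = X'" "Cod (Val D (\<N> \<otimes> A)) g = Y'"
  shows "rsA D \<langle>k \<oplus> m, t\<rangle> (atenA A f g) \<cdot>\<^bsub>Val D K\<^esub> bet k m t X Y
    = bet k m t X' Y' \<cdot>\<^bsub>Val D K\<^esub> tenA (Mon M K) (rsA D \<langle>k, t\<rangle> f) (rsA D \<langle>m, t\<rangle> g)"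
proof -
  have "small_cat A" using assms(3) by (simp add: fn_iff)
  then have [simp]: "X \<in> Ob (Val D (\<N> \<otimes> A))" "Y \<in> Ob (Val D (\<N> \<otimes> A))" "X' \<in> Ob (Val D (\<N> \<otimes> A))" "Y' \<in> Ob (Val D (\<N> \<otimes> A))"
    using assms(4-9) by auto
  note [simp] = assms[unfolded fn_iff]
  let ?c = "\<langle>\<langle>k, m\<rangle>, t\<rangle>"
  have "rsA D \<langle>k \<oplus> m, t\<rangle> (atenA A f g) \<cdot>\<^bsub>Val D K\<^esub> bet k m t X Y
    = rsA D ?c (rsA D (plus_times A) (atenA A f g) \<cdot>\<^bsub>Val D ((\<N> \<otimes> \<N>) \<otimes> A)\<^esub> bil D M A X Y)
        \<cdot>\<^bsub>Val D K\<^esub> Mu M ?c (rs D (p1 A) X) (rs D (p2 A) Y)"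
    by (simp add: bet_def)
  also have "\<dots> = rsA D ?c (bil D M A X' Y') \<cdot>\<^bsub>Val D K\<^esub> (rsA D ?c (tenA (Mon M ((\<N> \<otimes> \<N>) \<otimes> A)) (rsA D (p1 A) f) (rsA D (p2 A) g))
        \<cdot>\<^bsub>Val D K\<^esub> Mu M ?c (rs D (p1 A) X) (rs D (p2 A) Y))"
    by (subst bil_natural[OF _ assms(4-9)]) simp_all
  also have "rsA D ?c (tenA (Mon M ((\<N> \<otimes> \<N>) \<otimes> A)) (rsA D (p1 A) f) (rsA D (p2 A) g))
        \<cdot>\<^bsub>Val D K\<^esub> Mu M ?c (rs D (p1 A) X) (rs D (p2 A) Y)
     = Mu M ?c (rs D (p1 A) X') (rs D (p2 A) Y') \<cdot>\<^bsub>Val D K\<^esub> tenA (Mon M K) (rsA D \<langle>k, t\<rangle> f) (rsA D \<langle>m, t\<rangle> g)"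
    using Mu_natural[of ?c K "rsA D (p1 A) f" "rsA D (p2 A) g"] by simp
  finally show ?thesis by (simp add: bet_def)
qed

text \<open>Restriction along \<open>u\<close> changes only \<open>t\<close>, the elements
  \<open>k\<close> and \<open>m\<close> being untouched. As \<open>bet\<close> is universal at
  generic elements, this pins down \<open>aMu\<close>.\<close>

lemma bet_Mu:
  assumes "k \<in> fn K \<N>" "m \<in> fn K \<N>" "t \<in> fn K A" "u \<in> fn A B" "X \<in> Ob (Val D (\<N> \<otimes> B))" "Y \<in> Ob (Val D (\<N> \<otimes> B))"
  shows "rsA D \<langle>k \<oplus> m, t\<rangle> (aMu u X Y) \<cdot>\<^bsub>Val D K\<^esub> bet k m t (rs D (idF \<N> \<otimes>\<^sub>F u) X) (rs D (idF \<N> \<otimes>\<^sub>F u) Y)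
    = bet k m (u \<odot> t) X Y"
proof -
  note [simp] = assms[unfolded fn_iff] aMu(1-3)[OF assms(4-6)]
  let ?c = "\<langle>\<langle>k, m\<rangle>, t\<rangle>" and ?v = "idF (\<N> \<otimes> \<N>) \<otimes>\<^sub>F u" and ?X = "rs D (idF \<N> \<otimes>\<^sub>F u) X" and ?Y = "rs D (idF \<N> \<otimes>\<^sub>F u) Y"
  have "rsA D \<langle>k \<oplus> m, t\<rangle> (aMu u X Y) \<cdot>\<^bsub>Val D K\<^esub> bet k m t ?X ?Y
    = rsA D ?c (rsA D (plus_times A) (aMu u X Y) \<cdot>\<^bsub>Val D ((\<N> \<otimes> \<N>) \<otimes> A)\<^esub> bil D M A ?X ?Y)
        \<cdot>\<^bsub>Val D K\<^esub> Mu M ?c (rs D (p1 A) ?X) (rs D (p2 A) ?Y)"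
    by (simp add: bet_def)
  also have "\<dots> = rsA D (?v \<odot> ?c) (bil D M B X Y) \<cdot>\<^bsub>Val D K\<^esub> (rsA D ?c (Mu M ?v (rs D (p1 B) X) (rs D (p2 B) Y))
        \<cdot>\<^bsub>Val D K\<^esub> Mu M ?c (rs D ?v (rs D (p1 B) X)) (rs D ?v (rs D (p2 B) Y)))"
    by (subst aMu(4)[OF assms(4-6)]) simp
  also have "\<dots> = bet k m (u \<odot> t) X Y"
    by (subst Mu_comp') (simp_all add: bet_def)
  finally show ?thesis .
qed

text \<open>At the two projections to \<open>\<N>\<close> and the one to \<open>A\<close> the
  pairing is the identity functor, so these are the generic elements.\<close>

lemma bet_generic:
  assumes "small_cat A" "X \<in> Ob (Val D (\<N> \<otimes> A))" "Y \<in> Ob (Val D (\<N> \<otimes> A))"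
  shows "bet (pr1 \<N> \<N> \<odot> pr1 (\<N> \<otimes> \<N>) A) (pr2 \<N> \<N> \<odot> pr1 (\<N> \<otimes> \<N>) A) (pr2 (\<N> \<otimes> \<N>) A) X Y = bil D M A X Y"
  using assms by (simp add: bet_def Mu_id)

text \<open>The two trilinear maps \<open>(X\<^sub>k \<otimes> Y\<^sub>l) \<otimes> Z\<^sub>m \<rightarrow> ((X \<otimes> Y) \<otimes> Z)\<^bsub>k + l + m\<^esub>\<close> and \<open>X\<^sub>k \<otimes> (Y\<^sub>l \<otimes> Z\<^sub>m) \<rightarrow> (X \<otimes> (Y \<otimes> Z))\<^bsub>k + l + m\<^esub>\<close>.\<close>

definition gamL :: "'u sfun \<Rightarrow> 'u sfun \<Rightarrow> 'u sfun \<Rightarrow> 'u sfun \<Rightarrow> 'o \<Rightarrow> 'o \<Rightarrow> 'o \<Rightarrow> 'a" where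
  "gamL k l m t X Y Z = bet (k \<oplus> l) m t (aten D M (Tgt t) X Y) Z \<cdot>\<^bsub>Val D (Src t)\<^esub>
     tenA (Mon M (Src t)) (bet k l t X Y) (Id (Val D (Src t)) (rs D \<langle>m, t\<rangle> Z))"

definition gamR :: "'u sfun \<Rightarrow> 'u sfun \<Rightarrow> 'u sfun \<Rightarrow> 'u sfun \<Rightarrow> 'o \<Rightarrow> 'o \<Rightarrow> 'o \<Rightarrow> 'a" where
  "gamR k l m t X Y Z = bet k (l \<oplus> m) t X (aten D M (Tgt t) Y Z) \<cdot>\<^bsub>Val D (Src t)\<^esub>
     tenA (Mon M (Src t)) (Id (Val D (Src t)) (rs D \<langle>k, t\<rangle> X)) (bet l m t Y Z)"

lemma gam_simps [simp]:
  assumes "small_fun k" "small_fun l" "small_fun m" "small_fun t" "Src k = K" "Src l = K" "Src m = K" "Src t = K"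
    "Tgt k = \<N>" "Tgt l = \<N>" "Tgt m = \<N>"
    "X \<in> Ob (Val D (\<N> \<otimes> Tgt t))" "Y \<in> Ob (Val D (\<N> \<otimes> Tgt t))" "Z \<in> Ob (Val D (\<N> \<otimes> Tgt t))"
  shows "gamL k l m t X Y Z \<in> Ar (Val D K)"
    "Dom (Val D K) (gamL k l m t X Y Z) = ten (Mon M K) (ten (Mon M K) (rs D \<langle>k, t\<rangle> X) (rs D \<langle>l, t\<rangle> Y)) (rs D \<langle>m, t\<rangle> Z)"
    "Cod (Val D K) (gamL k l m t X Y Z) = rs D \<langle>k \<oplus> l \<oplus> m, t\<rangle> (aten D M (Tgt t) (aten D M (Tgt t) X Y) Z)"
    "gamR k l m t X Y Z \<in> Ar (Val D K)"
    "Dom (Val D K) (gamR k l m t X Y Z) = ten (Mon M K) (rs D \<langle>k, t\<rangle> X) (ten (Mon M K) (rs D \<langle>l, t\<rangle> Y) (rs D \<langle>m, t\<rangle> Z))"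
    "Cod (Val D K) (gamR k l m t X Y Z) = rs D \<langle>k \<oplus> l \<oplus> m, t\<rangle> (aten D M (Tgt t) X (aten D M (Tgt t) Y Z))"
  using assms small_fun_cat(1)[OF assms(4)] by (simp_all add: gamL_def gamR_def)

text \<open>Two uses of \<open>bet_restrict\<close>; naturality of the constraint of
  \<open>h\<close> moves the inner multiplication past the outer constraint.\<close>

lemma gamL_restrict:
  assumes "k \<in> fn K \<N>" "l \<in> fn K \<N>" "m \<in> fn K \<N>" "t \<in> fn K A" "h \<in> fn K' K"
    "X \<in> Ob (Val D (\<N> \<otimes> A))" "Y \<in> Ob (Val D (\<N> \<otimes> A))" "Z \<in> Ob (Val D (\<N> \<otimes> A))"
  shows "rsA D h (gamL k l m t X Y Z) \<cdot>\<^bsub>Val D K'\<^esub>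
      (Mu M h (ten (Mon M K) (rs D \<langle>k, t\<rangle> X) (rs D \<langle>l, t\<rangle> Y)) (rs D \<langle>m, t\<rangle> Z) \<cdot>\<^bsub>Val D K'\<^esub>
       tenA (Mon M K') (Mu M h (rs D \<langle>k, t\<rangle> X) (rs D \<langle>l, t\<rangle> Y)) (Id (Val D K') (rs D \<langle>m \<odot> h, t \<odot> h\<rangle> Z)))
    = gamL (k \<odot> h) (l \<odot> h) (m \<odot> h) (t \<odot> h) X Y Z"
proof -
  note [simp] = assms[unfolded fn_iff]
  let ?W = "aten D M A X Y" and ?I = "Id (Val D K) (rs D \<langle>m, t\<rangle> Z)" and ?I' = "Id (Val D K') (rs D \<langle>m \<odot> h, t \<odot> h\<rangle> Z)"
  let ?Mu = "Mu M h (rs D \<langle>k, t\<rangle> X) (rs D \<langle>l, t\<rangle> Y)"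
  have "rsA D h (gamL k l m t X Y Z) \<cdot>\<^bsub>Val D K'\<^esub>
      (Mu M h (ten (Mon M K) (rs D \<langle>k, t\<rangle> X) (rs D \<langle>l, t\<rangle> Y)) (rs D \<langle>m, t\<rangle> Z) \<cdot>\<^bsub>Val D K'\<^esub> tenA (Mon M K') ?Mu ?I')
    = rsA D h (bet (k \<oplus> l) m t ?W Z) \<cdot>\<^bsub>Val D K'\<^esub> ((rsA D h (tenA (Mon M K) (bet k l t X Y) ?I) \<cdot>\<^bsub>Val D K'\<^esub>
        Mu M h (ten (Mon M K) (rs D \<langle>k, t\<rangle> X) (rs D \<langle>l, t\<rangle> Y)) (rs D \<langle>m, t\<rangle> Z)) \<cdot>\<^bsub>Val D K'\<^esub> tenA (Mon M K') ?Mu ?I')"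
    by (simp add: gamL_def)
  also have "rsA D h (tenA (Mon M K) (bet k l t X Y) ?I) \<cdot>\<^bsub>Val D K'\<^esub>
        Mu M h (ten (Mon M K) (rs D \<langle>k, t\<rangle> X) (rs D \<langle>l, t\<rangle> Y)) (rs D \<langle>m, t\<rangle> Z)
     = Mu M h (rs D \<langle>k \<oplus> l, t\<rangle> ?W) (rs D \<langle>m, t\<rangle> Z) \<cdot>\<^bsub>Val D K'\<^esub> tenA (Mon M K') (rsA D h (bet k l t X Y)) ?I'"
    using Mu_natural[of h K' "bet k l t X Y" ?I] by simp
  also have "rsA D h (bet (k \<oplus> l) m t ?W Z) \<cdot>\<^bsub>Val D K'\<^esub> ((Mu M h (rs D \<langle>k \<oplus> l, t\<rangle> ?W) (rs D \<langle>m, t\<rangle> Z) \<cdot>\<^bsub>Val D K'\<^esub>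
       tenA (Mon M K') (rsA D h (bet k l t X Y)) ?I') \<cdot>\<^bsub>Val D K'\<^esub> tenA (Mon M K') ?Mu ?I')
     = (rsA D h (bet (k \<oplus> l) m t ?W Z) \<cdot>\<^bsub>Val D K'\<^esub> Mu M h (rs D \<langle>k \<oplus> l, t\<rangle> ?W) (rs D \<langle>m, t\<rangle> Z)) \<cdot>\<^bsub>Val D K'\<^esub>
       tenA (Mon M K') (rsA D h (bet k l t X Y) \<cdot>\<^bsub>Val D K'\<^esub> ?Mu) ?I'"
    by (simp add: tenA_merge)
  also have "rsA D h (bet k l t X Y) \<cdot>\<^bsub>Val D K'\<^esub> ?Mu = bet (k \<odot> h) (l \<odot> h) (t \<odot> h) X Y"
    by (rule bet_restrict[where K = K and A = A]) (simp_all add: fn_iff)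
  also have "rsA D h (bet (k \<oplus> l) m t ?W Z) \<cdot>\<^bsub>Val D K'\<^esub> Mu M h (rs D \<langle>k \<oplus> l, t\<rangle> ?W) (rs D \<langle>m, t\<rangle> Z)
      = bet ((k \<oplus> l) \<odot> h) (m \<odot> h) (t \<odot> h) ?W Z"
    by (rule bet_restrict[where K = K and A = A]) (simp_all add: fn_iff)
  finally show ?thesis by (simp add: gamL_def)
qed

lemma gamR_restrict:
  assumes "k \<in> fn K \<N>" "l \<in> fn K \<N>" "m \<in> fn K \<N>" "t \<in> fn K A" "h \<in> fn K' K"
    "X \<in> Ob (Val D (\<N> \<otimes> A))" "Y \<in> Ob (Val D (\<N> \<otimes> A))" "Z \<in> Ob (Val D (\<N> \<otimes> A))"
  shows "rsA D h (gamR k l m t X Y Z) \<cdot>\<^bsub>Val D K'\<^esub>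
      (Mu M h (rs D \<langle>k, t\<rangle> X) (ten (Mon M K) (rs D \<langle>l, t\<rangle> Y) (rs D \<langle>m, t\<rangle> Z)) \<cdot>\<^bsub>Val D K'\<^esub>
       tenA (Mon M K') (Id (Val D K') (rs D \<langle>k \<odot> h, t \<odot> h\<rangle> X)) (Mu M h (rs D \<langle>l, t\<rangle> Y) (rs D \<langle>m, t\<rangle> Z)))
    = gamR (k \<odot> h) (l \<odot> h) (m \<odot> h) (t \<odot> h) X Y Z"
proof -
  note [simp] = assms[unfolded fn_iff]
  let ?W = "aten D M A Y Z" and ?I = "Id (Val D K) (rs D \<langle>k, t\<rangle> X)" and ?I' = "Id (Val D K') (rs D \<langle>k \<odot> h, t \<odot> h\<rangle> X)"
  let ?Mu = "Mu M h (rs D \<langle>l, t\<rangle> Y) (rs D \<langle>m, t\<rangle> Z)"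
  have "rsA D h (gamR k l m t X Y Z) \<cdot>\<^bsub>Val D K'\<^esub>
      (Mu M h (rs D \<langle>k, t\<rangle> X) (ten (Mon M K) (rs D \<langle>l, t\<rangle> Y) (rs D \<langle>m, t\<rangle> Z)) \<cdot>\<^bsub>Val D K'\<^esub> tenA (Mon M K') ?I' ?Mu)
    = rsA D h (bet k (l \<oplus> m) t X ?W) \<cdot>\<^bsub>Val D K'\<^esub> ((rsA D h (tenA (Mon M K) ?I (bet l m t Y Z)) \<cdot>\<^bsub>Val D K'\<^esub>
        Mu M h (rs D \<langle>k, t\<rangle> X) (ten (Mon M K) (rs D \<langle>l, t\<rangle> Y) (rs D \<langle>m, t\<rangle> Z))) \<cdot>\<^bsub>Val D K'\<^esub> tenA (Mon M K') ?I' ?Mu)"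
    by (simp add: gamR_def)
  also have "rsA D h (tenA (Mon M K) ?I (bet l m t Y Z)) \<cdot>\<^bsub>Val D K'\<^esub>
        Mu M h (rs D \<langle>k, t\<rangle> X) (ten (Mon M K) (rs D \<langle>l, t\<rangle> Y) (rs D \<langle>m, t\<rangle> Z))
     = Mu M h (rs D \<langle>k, t\<rangle> X) (rs D \<langle>l \<oplus> m, t\<rangle> ?W) \<cdot>\<^bsub>Val D K'\<^esub> tenA (Mon M K') ?I' (rsA D h (bet l m t Y Z))"
    using Mu_natural[of h K' ?I "bet l m t Y Z"] by simp
  also have "rsA D h (bet k (l \<oplus> m) t X ?W) \<cdot>\<^bsub>Val D K'\<^esub> ((Mu M h (rs D \<langle>k, t\<rangle> X) (rs D \<langle>l \<oplus> m, t\<rangle> ?W) \<cdot>\<^bsub>Val D K'\<^esub>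
       tenA (Mon M K') ?I' (rsA D h (bet l m t Y Z))) \<cdot>\<^bsub>Val D K'\<^esub> tenA (Mon M K') ?I' ?Mu)
     = (rsA D h (bet k (l \<oplus> m) t X ?W) \<cdot>\<^bsub>Val D K'\<^esub> Mu M h (rs D \<langle>k, t\<rangle> X) (rs D \<langle>l \<oplus> m, t\<rangle> ?W)) \<cdot>\<^bsub>Val D K'\<^esub>
       tenA (Mon M K') ?I' (rsA D h (bet l m t Y Z) \<cdot>\<^bsub>Val D K'\<^esub> ?Mu)"
    by (simp add: tenA_merge)
  also have "rsA D h (bet l m t Y Z) \<cdot>\<^bsub>Val D K'\<^esub> ?Mu = bet (l \<odot> h) (m \<odot> h) (t \<odot> h) Y Z"
    by (rule bet_restrict[where K = K and A = A]) (simp_all add: fn_iff)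
  also have "rsA D h (bet k (l \<oplus> m) t X ?W) \<cdot>\<^bsub>Val D K'\<^esub> Mu M h (rs D \<langle>k, t\<rangle> X) (rs D \<langle>l \<oplus> m, t\<rangle> ?W)
      = bet (k \<odot> h) ((l \<oplus> m) \<odot> h) (t \<odot> h) X ?W"
    by (rule bet_restrict[where K = K and A = A]) (simp_all add: fn_iff)
  finally show ?thesis by (simp add: gamR_def)
qed

text \<open>The inductive step for iterated products. \<open>P\<close> collects the degrees of the
  factors already multiplied, \<open>f\<close> is their sum and \<open>\<theta>\<close> their
  universal product; the projection formula followed by universality of \<open>bil\<close> adds one
  more factor \<open>Z\<close>. It is applied with \<open>P\<close> the square and the cube of
  \<open>\<N>\<close>.\<close>

lemma univ_param_left:
  assumes f: "f \<in> fn P \<N>" and A: "small_cat A" and \<theta>: "univ D (f \<otimes>\<^sub>F idF A) W \<theta>" and Z: "Z \<in> Ob (Val D (\<N> \<otimes> A))"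
  defines "k \<equiv> f \<odot> (pr1 P \<N> \<odot> pr1 (P \<otimes> \<N>) A)" and "m \<equiv> pr2 P \<N> \<odot> pr1 (P \<otimes> \<N>) A" and "t \<equiv> pr2 (P \<otimes> \<N>) A"
  shows "univ D \<langle>k \<oplus> m, t\<rangle> (aten D M A W Z)
     (bet k m t W Z \<cdot>\<^bsub>Val D ((P \<otimes> \<N>) \<otimes> A)\<^esub>
        tenA (Mon M ((P \<otimes> \<N>) \<otimes> A)) (rsA D (pr1 P \<N> \<otimes>\<^sub>F idF A) \<theta>) (Id (Val D ((P \<otimes> \<N>) \<otimes> A)) (rs D \<langle>m, t\<rangle> Z)))"
proof -
  note [simp] = f[unfolded fn_iff] A Z
  note [simp] = univD[OF \<theta>, simplified]
  let ?K = "(P \<otimes> \<N>) \<otimes> A" and ?g = "(f \<otimes>\<^sub>F idF \<N>) \<otimes>\<^sub>F idF A" and ?s = "pr1 P \<N> \<otimes>\<^sub>F idF A"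
  have kmt: "\<langle>\<langle>k, m\<rangle>, t\<rangle> = ?g" by (simp add: k_def m_def t_def cart)
  have km: "k \<in> fn ?K \<N>" "m \<in> fn ?K \<N>" "t \<in> fn ?K A" by (simp_all add: fn_iff k_def m_def t_def)
  have sum: "\<langle>k \<oplus> m, t\<rangle> = plus_times A \<odot> ?g"
    using km unfolding fn_iff by (simp flip: kmt)
  have p2g: "p2 A \<odot> ?g = \<langle>m, t\<rangle>" by (simp add: m_def t_def cart)
  \<comment> \<open>Both functors are \<open>f\<close> times an identity up to rebracketing, and the
    copy of \<open>f\<close> over \<open>a\<close> goes to the copy with parameters \<open>a\<close>
    and \<open>(0, a)\<close>, where \<open>0\<close> is the only object of
    \<open>\<N>\<close>.\<close>
  have bc: "univ D ?g (rs D \<langle>p1 A, p2 A\<rangle> Y) (rsA D \<langle>?s, p2 A \<odot> ?g\<rangle> \<eta>)"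
    if \<eta>: "univ D ((f \<otimes>\<^sub>F idF A) \<otimes>\<^sub>F idF (\<N> \<otimes> A)) Y \<eta>" for Y \<eta>
  proof (rule univ_base_change[OF fam_times_right[OF _ fam_times] fam_times_right[OF _ fam_times] _ _ _ _ \<eta>])
    fix c d
    assume "(c, d) \<in> {(insr A l (Src (f \<otimes>\<^sub>F idF \<N>)) \<odot> c, insr A l (Tgt (f \<otimes>\<^sub>F idF \<N>)) \<odot> d) |l c d. l \<in> Ob A \<and>
      (c, d) \<in> {(insr \<N> k (Src f), insr \<N> k (Tgt f)) |k. k \<in> Ob \<N>}}"
    then obtain a where a: "a \<in> Ob A" "c = insr A a (P \<otimes> \<N>) \<odot> insr \<N> (unat 0) P"
      "d = insr A a (\<N> \<otimes> \<N>) \<odot> insr \<N> (unat 0) \<N>" by auto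
    have "\<langle>?s, p2 A \<odot> ?g\<rangle> \<odot> c = insr (\<N> \<otimes> A) (upair (unat 0) a) (P \<otimes> A) \<odot> insr A a P"
      unfolding a using a(1) by (intro sfun_eqI) (simp_all add: insr_def sfun_simps)
    moreover have "\<langle>p1 A, p2 A\<rangle> \<odot> d = insr (\<N> \<otimes> A) (upair (unat 0) a) (\<N> \<otimes> A) \<odot> insr A a \<N>"
      unfolding a using a(1) by (intro sfun_eqI) (simp_all add: insr_def sfun_simps)
    ultimately show "(\<langle>?s, p2 A \<odot> ?g\<rangle> \<odot> c, \<langle>p1 A, p2 A\<rangle> \<odot> d) \<in> {(insr (\<N> \<otimes> A) l (Src (f \<otimes>\<^sub>F idF A)) \<odot> c, insr (\<N> \<otimes> A) l (Tgt (f \<otimes>\<^sub>F idF A)) \<odot> d) |l c d.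
      l \<in> Ob (\<N> \<otimes> A) \<and> (c, d) \<in> {(insr A k (Src f), insr A k (Tgt f)) |k. k \<in> Ob A}}"
      using a(1) by auto
  qed (simp_all add: fn_iff cart)
  have 1: "univ D ?g (ten (Mon M ((\<N> \<otimes> \<N>) \<otimes> A)) (rs D (p1 A) W) (rs D (p2 A) Z))
    (Mu M ?g (rs D (p1 A) W) (rs D (p2 A) Z) \<cdot>\<^bsub>Val D ?K\<^esub>
      tenA (Mon M ?K) (rsA D ?s \<theta>) (Id (Val D ?K) (rs D (p2 A \<odot> ?g) Z)))"
    by (rule univ_ten_left[OF \<theta> Z, where s = ?s and t = "p1 A" and r = "p2 A"])
       (use bc in \<open>simp_all add: fn_iff\<close>)
  have "univ D (plus_times A \<odot> ?g) (aten D M A W Z) (rsA D ?g (bil D M A W Z) \<cdot>\<^bsub>Val D (Src ?g)\<^esub>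
     (Mu M ?g (rs D (p1 A) W) (rs D (p2 A) Z) \<cdot>\<^bsub>Val D ?K\<^esub>
      tenA (Mon M ?K) (rsA D ?s \<theta>) (Id (Val D ?K) (rs D (p2 A \<odot> ?g) Z))))"
    by (rule univ_comp[OF 1 univ_bil]) simp_all
  moreover have "Tgt t = A" "Src t = ?K" by (simp_all add: t_def)
  ultimately show ?thesis
    unfolding sum bet_def kmt p2g[symmetric] by simp
qed

text \<open>The same step with the new factor on the left, as the bracketing
  \<open>X \<otimes> (Y \<otimes> Z)\<close> requires.\<close>

lemma univ_param_right:
  assumes f: "f \<in> fn P \<N>" and A: "small_cat A" and \<theta>: "univ D (f \<otimes>\<^sub>F idF A) W \<theta>" and Z: "Z \<in> Ob (Val D (\<N> \<otimes> A))"
  defines "k \<equiv> pr1 \<N> P \<odot> pr1 (\<N> \<otimes> P) A" and "m \<equiv> f \<odot> (pr2 \<N> P \<odot> pr1 (\<N> \<otimes> P) A)" and "t \<equiv> pr2 (\<N> \<otimes> P) A"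
  shows "univ D \<langle>k \<oplus> m, t\<rangle> (aten D M A Z W)
     (bet k m t Z W \<cdot>\<^bsub>Val D ((\<N> \<otimes> P) \<otimes> A)\<^esub>
        tenA (Mon M ((\<N> \<otimes> P) \<otimes> A)) (Id (Val D ((\<N> \<otimes> P) \<otimes> A)) (rs D \<langle>k, t\<rangle> Z)) (rsA D (pr2 \<N> P \<otimes>\<^sub>F idF A) \<theta>))"
proof -
  note [simp] = f[unfolded fn_iff] A Z
  note [simp] = univD[OF \<theta>, simplified]
  let ?K = "(\<N> \<otimes> P) \<otimes> A" and ?g = "(idF \<N> \<otimes>\<^sub>F f) \<otimes>\<^sub>F idF A" and ?s = "pr2 \<N> P \<otimes>\<^sub>F idF A"
  have kmt: "\<langle>\<langle>k, m\<rangle>, t\<rangle> = ?g" by (simp add: k_def m_def t_def cart)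
  have km: "k \<in> fn ?K \<N>" "m \<in> fn ?K \<N>" "t \<in> fn ?K A" by (simp_all add: fn_iff k_def m_def t_def)
  have sum: "\<langle>k \<oplus> m, t\<rangle> = plus_times A \<odot> ?g"
    using km unfolding fn_iff by (simp flip: kmt)
  have p1g: "p1 A \<odot> ?g = \<langle>k, t\<rangle>" by (simp add: k_def t_def cart)
  have bc: "univ D ?g (rs D \<langle>p1 A, p2 A\<rangle> Y) (rsA D \<langle>p1 A \<odot> ?g, ?s\<rangle> \<eta>)"
    if \<eta>: "univ D (idF (\<N> \<otimes> A) \<otimes>\<^sub>F (f \<otimes>\<^sub>F idF A)) Y \<eta>" for Y \<eta>
  proof (rule univ_base_change[OF fam_times_left[OF _ fam_times] fam_times_right[OF _ fam_times_left[OF _ fam_self]] _ _ _ _ \<eta>])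
    fix c d
    assume "(c, d) \<in> {(insr A l (Src (idF \<N> \<otimes>\<^sub>F f)) \<odot> c, insr A l (Tgt (idF \<N> \<otimes>\<^sub>F f)) \<odot> d) |l c d. l \<in> Ob A \<and>
      (c, d) \<in> {(ins \<N> l (Src f) \<odot> c, ins \<N> l (Tgt f) \<odot> d) |l c d. l \<in> Ob \<N> \<and> (c, d) \<in> {(idF (Src f), idF (Tgt f))}}}"
    then obtain a where a: "a \<in> Ob A" "c = insr A a (\<N> \<otimes> P) \<odot> ins \<N> (unat 0) P"
      "d = insr A a (\<N> \<otimes> \<N>) \<odot> ins \<N> (unat 0) \<N>" by auto
    have "\<langle>p1 A \<odot> ?g, ?s\<rangle> \<odot> c = ins (\<N> \<otimes> A) (upair (unat 0) a) (P \<otimes> A) \<odot> insr A a P"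
      unfolding a using a(1) by (intro sfun_eqI) (simp_all add: insr_def sfun_simps)
    moreover have "\<langle>p1 A, p2 A\<rangle> \<odot> d = ins (\<N> \<otimes> A) (upair (unat 0) a) (\<N> \<otimes> A) \<odot> insr A a \<N>"
      unfolding a using a(1) by (intro sfun_eqI) (simp_all add: insr_def sfun_simps)
    ultimately show "(\<langle>p1 A \<odot> ?g, ?s\<rangle> \<odot> c, \<langle>p1 A, p2 A\<rangle> \<odot> d) \<in> {(ins (\<N> \<otimes> A) l (Src (f \<otimes>\<^sub>F idF A)) \<odot> c, ins (\<N> \<otimes> A) l (Tgt (f \<otimes>\<^sub>F idF A)) \<odot> d) |l c d.
      l \<in> Ob (\<N> \<otimes> A) \<and> (c, d) \<in> {(insr A k (Src f), insr A k (Tgt f)) |k. k \<in> Ob A}}"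
      using a(1) by auto
  qed (simp_all add: fn_iff cart)
  have 1: "univ D ?g (ten (Mon M ((\<N> \<otimes> \<N>) \<otimes> A)) (rs D (p1 A) Z) (rs D (p2 A) W))
    (Mu M ?g (rs D (p1 A) Z) (rs D (p2 A) W) \<cdot>\<^bsub>Val D ?K\<^esub>
      tenA (Mon M ?K) (Id (Val D ?K) (rs D (p1 A \<odot> ?g) Z)) (rsA D ?s \<theta>))"
    by (rule univ_ten_right[OF \<theta> Z, where s = ?s and t = "p2 A" and r = "p1 A"])
       (use bc in \<open>simp_all add: fn_iff\<close>)
  have "univ D (plus_times A \<odot> ?g) (aten D M A Z W) (rsA D ?g (bil D M A Z W) \<cdot>\<^bsub>Val D (Src ?g)\<^esub>
     (Mu M ?g (rs D (p1 A) Z) (rs D (p2 A) W) \<cdot>\<^bsub>Val D ?K\<^esub>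
      tenA (Mon M ?K) (Id (Val D ?K) (rs D (p1 A \<odot> ?g) Z)) (rsA D ?s \<theta>)))"
    by (rule univ_comp[OF 1 univ_bil]) simp_all
  moreover have "Tgt t = A" "Src t = ?K" by (simp_all add: t_def)
  ultimately show ?thesis
    unfolding sum bet_def kmt p1g[symmetric] by simp
qed

end

section \<open>The associator\<close>

abbreviation (input) tri :: "'u::universe scat \<Rightarrow> 'u scat" where "tri A \<equiv> ((\<N> \<otimes> \<N>) \<otimes> \<N>) \<otimes> A"

text \<open>The generic elements for three factors. Being constants rather than abbreviations, they
  stay atomic when sums and pairings are normalised.\<close>

definition e1 :: "'u::universe scat \<Rightarrow> 'u sfun" where "e1 A = pr1 \<N> \<N> \<odot> (pr1 (\<N> \<otimes> \<N>) \<N> \<odot> pr1 ((\<N> \<otimes> \<N>) \<otimes> \<N>) A)"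
definition e2 :: "'u::universe scat \<Rightarrow> 'u sfun" where "e2 A = pr2 \<N> \<N> \<odot> (pr1 (\<N> \<otimes> \<N>) \<N> \<odot> pr1 ((\<N> \<otimes> \<N>) \<otimes> \<N>) A)"
definition e3 :: "'u::universe scat \<Rightarrow> 'u sfun" where "e3 A = pr2 (\<N> \<otimes> \<N>) \<N> \<odot> pr1 ((\<N> \<otimes> \<N>) \<otimes> \<N>) A"
abbreviation (input) et :: "'u::universe scat \<Rightarrow> 'u sfun" where "et A \<equiv> pr2 ((\<N> \<otimes> \<N>) \<otimes> \<N>) A"

lemma e_simps [simp]:
  assumes "small_cat A"
  shows "small_fun (e1 A)" "small_fun (e2 A)" "small_fun (e3 A)"
    "Src (e1 A) = tri A" "Src (e2 A) = tri A" "Src (e3 A) = tri A" "Tgt (e1 A) = \<N>" "Tgt (e2 A) = \<N>" "Tgt (e3 A) = \<N>"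
  using assms by (simp_all add: e1_def e2_def e3_def)

text \<open>Every triple of elements arises from the generic one by restriction along its own
  pairing.\<close>

lemma e_at [simp]:
  assumes "k \<in> fn K \<N>" "l \<in> fn K \<N>" "m \<in> fn K \<N>" "t \<in> fn K A"
  shows "e1 A \<odot> \<langle>\<langle>\<langle>k, l\<rangle>, m\<rangle>, t\<rangle> = k" "e2 A \<odot> \<langle>\<langle>\<langle>k, l\<rangle>, m\<rangle>, t\<rangle> = l" "e3 A \<odot> \<langle>\<langle>\<langle>k, l\<rangle>, m\<rangle>, t\<rangle> = m"
  using assms by (simp_all add: e1_def e2_def e3_def fn_iff)

context monoidal_derivator
begin

lemma iso_tenA: "iso (Val D K) f \<Longrightarrow> iso (Val D K) g \<Longrightarrow> small_cat K \<Longrightarrow> iso (Val D K) (tenA (Mon M K) f g)"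
  by (rule monoidal_category.iso_ten[OF Mon_monoidal])

lemma iso_comp_Val: "iso (Val D K) f \<Longrightarrow> iso (Val D K) g \<Longrightarrow> Dom (Val D K) g = Cod (Val D K) f \<Longrightarrow> small_cat K
    \<Longrightarrow> iso (Val D K) (g \<cdot>\<^bsub>Val D K\<^esub> f)"
  by (rule category.iso_comp) simp_all

text \<open>\<open>univ_param_left\<close> applied to \<open>bil A X Y\<close>; the resulting arrow
  differs from \<open>gamL\<close> by the invertible constraint of \<open>q12 A\<close>.\<close>

lemma univ_gamL:
  assumes [simp]: "small_cat A" "X \<in> Ob (Val D (\<N> \<otimes> A))" "Y \<in> Ob (Val D (\<N> \<otimes> A))" "Z \<in> Ob (Val D (\<N> \<otimes> A))"
  shows "univ D \<langle>e1 A \<oplus> e2 A \<oplus> e3 A, et A\<rangle> (aten D M A (aten D M A X Y) Z) (gamL (e1 A) (e2 A) (e3 A) (et A) X Y Z)"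
proof -
  let ?W = "aten D M A X Y" and ?K = "tri A"
  let ?I = "Id (Val D ?K) (rs D \<langle>e3 A, et A\<rangle> Z)"
  let ?mu = "Mu M (q12 A) (rs D (p1 A) X) (rs D (p2 A) Y)"
  have k: "plus \<odot> (pr1 (\<N> \<otimes> \<N>) \<N> \<odot> pr1 ((\<N> \<otimes> \<N>) \<otimes> \<N>) A) = e1 A \<oplus> e2 A"
    by (simp add: e1_def e2_def)
  have q: "q12 A = \<langle>\<langle>e1 A, e2 A\<rangle>, et A\<rangle>" by (simp add: e1_def e2_def cart)
  have p12: "p1 A \<odot> q12 A = \<langle>e1 A, et A\<rangle>" "p2 A \<odot> q12 A = \<langle>e2 A, et A\<rangle>"
    "plus_times A \<odot> q12 A = \<langle>e1 A \<oplus> e2 A, et A\<rangle>" by (simp_all add: q)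
  have "univ D \<langle>(e1 A \<oplus> e2 A) \<oplus> e3 A, et A\<rangle> (aten D M A ?W Z)
     (bet (e1 A \<oplus> e2 A) (e3 A) (et A) ?W Z \<cdot>\<^bsub>Val D ?K\<^esub> tenA (Mon M ?K) (rsA D (q12 A) (bil D M A X Y)) ?I)"
    using univ_param_left[OF _ assms(1) univ_bil[OF assms(1-3)] assms(4), of "\<N> \<otimes> \<N>"]
    by (simp only: k e3_def[symmetric]) (simp add: fn_iff)
  moreover have "iso (Val D ?K) (tenA (Mon M ?K) ?mu ?I)"
    by (intro iso_tenA iso_Id_Val Mu_iso) simp_all
  ultimately have "univ D \<langle>(e1 A \<oplus> e2 A) \<oplus> e3 A, et A\<rangle> (aten D M A ?W Z)
    ((bet (e1 A \<oplus> e2 A) (e3 A) (et A) ?W Z \<cdot>\<^bsub>Val D ?K\<^esub> tenA (Mon M ?K) (rsA D (q12 A) (bil D M A X Y)) ?I)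
      \<cdot>\<^bsub>Val D ?K\<^esub> tenA (Mon M ?K) ?mu ?I)" by (rule univ_pre) (simp_all add: p12)
  moreover have "bet (e1 A) (e2 A) (et A) X Y = rsA D (q12 A) (bil D M A X Y) \<cdot>\<^bsub>Val D ?K\<^esub> ?mu"
    by (simp add: bet_def q)
  ultimately show ?thesis by (simp add: gamL_def tenA_merge p12)
qed

text \<open>\<open>univ_param_right\<close> works over
  \<open>\<N> \<otimes> (\<N> \<otimes> \<N>)\<close>, so the result has to be carried to the
  bracketing of the generic triple along an isomorphism of categories.\<close>

lemma univ_gamR:
  assumes [simp]: "small_cat A" "X \<in> Ob (Val D (\<N> \<otimes> A))" "Y \<in> Ob (Val D (\<N> \<otimes> A))" "Z \<in> Ob (Val D (\<N> \<otimes> A))"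
  shows "univ D \<langle>e1 A \<oplus> e2 A \<oplus> e3 A, et A\<rangle> (aten D M A X (aten D M A Y Z)) (gamR (e1 A) (e2 A) (e3 A) (et A) X Y Z)"
proof -
  let ?W = "aten D M A Y Z" and ?K = "(\<N> \<otimes> (\<N> \<otimes> \<N>)) \<otimes> A"
  define k where "k = pr1 \<N> (\<N> \<otimes> \<N>) \<odot> pr1 (\<N> \<otimes> (\<N> \<otimes> \<N>)) A"
  define l where "l = pr1 \<N> \<N> \<odot> (pr2 \<N> (\<N> \<otimes> \<N>) \<odot> pr1 (\<N> \<otimes> (\<N> \<otimes> \<N>)) A)"
  define m where "m = pr2 \<N> \<N> \<odot> (pr2 \<N> (\<N> \<otimes> \<N>) \<odot> pr1 (\<N> \<otimes> (\<N> \<otimes> \<N>)) A)"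
  define t where "t = pr2 (\<N> \<otimes> (\<N> \<otimes> \<N>)) A"
  have [simp]: "small_fun k" "Src k = ?K" "Tgt k = \<N>" "small_fun l" "Src l = ?K" "Tgt l = \<N>"
    "small_fun m" "Src m = ?K" "Tgt m = \<N>" "small_fun t" "Src t = ?K" "Tgt t = A"
    by (simp_all add: k_def l_def m_def t_def)
  let ?I = "Id (Val D ?K) (rs D \<langle>k, t\<rangle> X)"
  let ?s = "pr2 \<N> (\<N> \<otimes> \<N>) \<otimes>\<^sub>F idF A"
  let ?mu = "Mu M ?s (rs D (p1 A) Y) (rs D (p2 A) Z)"
  have lm: "plus \<odot> (pr2 \<N> (\<N> \<otimes> \<N>) \<odot> pr1 (\<N> \<otimes> (\<N> \<otimes> \<N>)) A) = l \<oplus> m"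
    by (simp add: l_def m_def)
  have s: "?s = \<langle>\<langle>l, m\<rangle>, t\<rangle>" by (simp add: l_def m_def t_def cart)
  have ps: "p1 A \<odot> ?s = \<langle>l, t\<rangle>" "p2 A \<odot> ?s = \<langle>m, t\<rangle>"
    "plus_times A \<odot> ?s = \<langle>l \<oplus> m, t\<rangle>" by (simp_all add: s)
  have "univ D \<langle>k \<oplus> (l \<oplus> m), t\<rangle> (aten D M A X ?W)
     (bet k (l \<oplus> m) t X ?W \<cdot>\<^bsub>Val D ?K\<^esub> tenA (Mon M ?K) ?I (rsA D ?s (bil D M A Y Z)))"
    using univ_param_right[OF _ assms(1) univ_bil[OF assms(1,3,4)] assms(2), of "\<N> \<otimes> \<N>"]
    by (simp only: lm k_def[symmetric] t_def[symmetric]) (simp add: fn_iff)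
  moreover have "iso (Val D ?K) (tenA (Mon M ?K) ?I ?mu)"
    by (intro iso_tenA iso_Id_Val Mu_iso) simp_all
  ultimately have "univ D \<langle>k \<oplus> (l \<oplus> m), t\<rangle> (aten D M A X ?W)
    ((bet k (l \<oplus> m) t X ?W \<cdot>\<^bsub>Val D ?K\<^esub> tenA (Mon M ?K) ?I (rsA D ?s (bil D M A Y Z)))
      \<cdot>\<^bsub>Val D ?K\<^esub> tenA (Mon M ?K) ?I ?mu)" by (rule univ_pre) (simp_all add: ps)
  moreover have "bet l m t Y Z = rsA D ?s (bil D M A Y Z) \<cdot>\<^bsub>Val D ?K\<^esub> ?mu"
    by (simp add: bet_def s)
  ultimately have 1: "univ D \<langle>k \<oplus> (l \<oplus> m), t\<rangle> (aten D M A X ?W) (gamR k l m t X Y Z)"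
    by (simp add: gamR_def tenA_merge ps)
  \<comment> \<open>The rebracketing isomorphism and its inverse, written through the generic
    elements of the two sides so that restriction along \<open>a\<close> turns one set into the
    other.\<close>
  define a where "a = \<langle>\<langle>e1 A, \<langle>e2 A, e3 A\<rangle>\<rangle>, et A\<rangle>"
  define b where "b = \<langle>\<langle>\<langle>k, l\<rangle>, m\<rangle>, t\<rangle>"
  have [simp]: "small_fun a" "Src a = tri A" "Tgt a = ?K" "small_fun b" "Src b = ?K" "Tgt b = tri A"
    by (simp_all add: a_def b_def)
  have ka: "k \<odot> a = e1 A" "l \<odot> a = e2 A" "m \<odot> a = e3 A" "t \<odot> a = et A"
    by (simp_all add: a_def k_def l_def m_def t_def)
  have ab: "a \<odot> b = idF ?K" "b \<odot> a = idF (tri A)"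
    by (simp_all add: a_def b_def k_def l_def m_def t_def e1_def e2_def e3_def)
  let ?V = "ten (Mon M ?K) (rs D \<langle>k, t\<rangle> X) (ten (Mon M ?K) (rs D \<langle>l, t\<rangle> Y) (rs D \<langle>m, t\<rangle> Z))"
  have "univ D a ?V (Id (Val D (tri A)) (rs D a ?V))"
    by (rule univ_isoF[OF _ _ ab(2,1)]) simp_all
  from univ_comp[OF this 1]
  have 2: "univ D (\<langle>k \<oplus> (l \<oplus> m), t\<rangle> \<odot> a) (aten D M A X ?W) (rsA D a (gamR k l m t X Y Z))"
    by simp
  have "univ D (\<langle>k \<oplus> (l \<oplus> m), t\<rangle> \<odot> a) (aten D M A X ?W) (rsA D a (gamR k l m t X Y Z) \<cdot>\<^bsub>Val D (tri A)\<^esub>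
     (Mu M a (rs D \<langle>k, t\<rangle> X) (ten (Mon M ?K) (rs D \<langle>l, t\<rangle> Y) (rs D \<langle>m, t\<rangle> Z)) \<cdot>\<^bsub>Val D (tri A)\<^esub>
      tenA (Mon M (tri A)) (Id (Val D (tri A)) (rs D \<langle>k \<odot> a, t \<odot> a\<rangle> X)) (Mu M a (rs D \<langle>l, t\<rangle> Y) (rs D \<langle>m, t\<rangle> Z))))"
    by (rule univ_pre[OF 2 iso_comp_Val[OF iso_tenA[OF iso_Id_Val Mu_iso] Mu_iso]]) (simp_all add: ka)
  then show ?thesis
    by (subst (asm) gamR_restrict[where A = A and K = ?K]) (simp_all add: ka fn_iff)
qed

text \<open>Identifies the maps in the definition of the associator with the two bracketings at the
  generic triple.\<close>

lemma tri_gam: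
  assumes [simp]: "small_cat A" "X \<in> Ob (Val D (\<N> \<otimes> A))" "Y \<in> Ob (Val D (\<N> \<otimes> A))" "Z \<in> Ob (Val D (\<N> \<otimes> A))"
  shows "tri_left D M A X Y Z = gamL (e1 A) (e2 A) (e3 A) (et A) X Y Z"
    "tri_right D M A X Y Z = gamR (e1 A) (e2 A) (e3 A) (et A) X Y Z"
    "q1 A = \<langle>e1 A, et A\<rangle>" "q2 A = \<langle>e2 A, et A\<rangle>" "q3 A = \<langle>e3 A, et A\<rangle>"
    "plus_times A \<odot> r1 A = \<langle>e1 A \<oplus> e2 A \<oplus> e3 A, et A\<rangle>"
proof -
  have q12: "q12 A = \<langle>\<langle>e1 A, e2 A\<rangle>, et A\<rangle>" by (simp add: e1_def e2_def cart)
  have q23: "q23 A = \<langle>\<langle>e2 A, e3 A\<rangle>, et A\<rangle>" by (simp add: e2_def e3_def cart)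
  have r1: "r1 A = \<langle>\<langle>e1 A \<oplus> e2 A, e3 A\<rangle>, et A\<rangle>" by (simp add: e1_def e2_def e3_def cart)
  have r2: "r2 A = \<langle>\<langle>e1 A, e2 A \<oplus> e3 A\<rangle>, et A\<rangle>" by (simp add: e1_def e2_def e3_def cart)
  show q: "q1 A = \<langle>e1 A, et A\<rangle>" "q2 A = \<langle>e2 A, et A\<rangle>" "q3 A = \<langle>e3 A, et A\<rangle>" by (simp_all add: q12 q23)
  show "plus_times A \<odot> r1 A = \<langle>e1 A \<oplus> e2 A \<oplus> e3 A, et A\<rangle>" by (simp add: r1)
  show "tri_left D M A X Y Z = gamL (e1 A) (e2 A) (e3 A) (et A) X Y Z"
    unfolding tri_left_def Let_def q r1 q12 gamL_def by (simp add: bet_def)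
  show "tri_right D M A X Y Z = gamR (e1 A) (e2 A) (e3 A) (et A) X Y Z"
    unfolding tri_right_def Let_def q r2 q23 gamR_def by (simp add: bet_def)
qed

abbreviation aA :: "'u scat \<Rightarrow> 'o \<Rightarrow> 'o \<Rightarrow> 'o \<Rightarrow> 'a" where
  "aA \<equiv> aAsc D M"

text \<open>Universality of \<open>gamL\<close> yields exactly one arrow with the required square,
  so the definite description denotes it. Since \<open>gamR\<close> after the associator of
  \<open>D\<close> is universal as well, that arrow compares two universal arrows and is
  invertible.\<close>

lemma aAsc_generic:
  assumes A [simp]: "small_cat A" and XYZ [simp]: "X \<in> Ob (Val D (\<N> \<otimes> A))" "Y \<in> Ob (Val D (\<N> \<otimes> A))" "Z \<in> Ob (Val D (\<N> \<otimes> A))"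
  shows "aA A X Y Z \<in> Ar (Val D (\<N> \<otimes> A))" "Dom (Val D (\<N> \<otimes> A)) (aA A X Y Z) = aten D M A (aten D M A X Y) Z"
    "Cod (Val D (\<N> \<otimes> A)) (aA A X Y Z) = aten D M A X (aten D M A Y Z)"
    "rsA D \<langle>e1 A \<oplus> e2 A \<oplus> e3 A, et A\<rangle> (aA A X Y Z) \<cdot>\<^bsub>Val D (tri A)\<^esub> gamL (e1 A) (e2 A) (e3 A) (et A) X Y Z
      = gamR (e1 A) (e2 A) (e3 A) (et A) X Y Z \<cdot>\<^bsub>Val D (tri A)\<^esub>
        Asc (Mon M (tri A)) (rs D \<langle>e1 A, et A\<rangle> X) (rs D \<langle>e2 A, et A\<rangle> Y) (rs D \<langle>e3 A, et A\<rangle> Z)"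
    "iso (Val D (\<N> \<otimes> A)) (aA A X Y Z)"
proof -
  let ?C = "Val D (\<N> \<otimes> A)" and ?s = "\<langle>e1 A \<oplus> e2 A \<oplus> e3 A, et A\<rangle>"
  let ?a = "Asc (Mon M (tri A)) (rs D \<langle>e1 A, et A\<rangle> X) (rs D \<langle>e2 A, et A\<rangle> Y) (rs D \<langle>e3 A, et A\<rangle> Z)"
  let ?L = "gamL (e1 A) (e2 A) (e3 A) (et A) X Y Z" and ?R = "gamR (e1 A) (e2 A) (e3 A) (et A) X Y Z"
  note uL = univ_gamL[OF A XYZ] and uR = univ_gamR[OF A XYZ]
  define P where "P a \<longleftrightarrow> a \<in> hom ?C (aten D M A (aten D M A X Y) Z) (aten D M A X (aten D M A Y Z)) \<and>
    rsA D ?s a \<cdot>\<^bsub>Val D (tri A)\<^esub> ?L = ?R \<cdot>\<^bsub>Val D (tri A)\<^esub> ?a" for a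
  have eq: "aA A X Y Z = (THE a. P a)"
    unfolding aAsc_def P_def using tri_gam[OF A XYZ] by simp
  obtain a where a: "a \<in> Ar ?C" "Dom ?C a = aten D M A (aten D M A X Y) Z" "Cod ?C a = aten D M A X (aten D M A Y Z)"
    "rsA D ?s a \<cdot>\<^bsub>Val D (tri A)\<^esub> ?L = ?R \<cdot>\<^bsub>Val D (tri A)\<^esub> ?a"
    using univ_ex[OF uL, of "?R \<cdot>\<^bsub>Val D (tri A)\<^esub> ?a" "aten D M A X (aten D M A Y Z)"] by auto
  have "P a" using a by (simp add: P_def hom_iff)
  moreover have "b = a" if "P b" for b
    using that univ_unique[OF uL, of b a] a by (simp add: P_def hom_iff)
  ultimately have "(THE a. P a) = a" by (rule the_equality)
  then have [simp]: "aA A X Y Z = a" using eq by simp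
  show "aA A X Y Z \<in> Ar ?C" "Dom ?C (aA A X Y Z) = aten D M A (aten D M A X Y) Z"
    "Cod ?C (aA A X Y Z) = aten D M A X (aten D M A Y Z)"
    "rsA D ?s (aA A X Y Z) \<cdot>\<^bsub>Val D (tri A)\<^esub> ?L = ?R \<cdot>\<^bsub>Val D (tri A)\<^esub> ?a"
    using a by simp_all
  have "iso (Val D (tri A)) ?a" by (rule monoidal_category.Asc_iso[OF Mon_monoidal]) simp_all
  then have "univ D ?s (aten D M A X (aten D M A Y Z)) (?R \<cdot>\<^bsub>Val D (tri A)\<^esub> ?a)"
    by (rule univ_pre[OF uR]) simp_all
  then have "univ D ?s (aten D M A X (aten D M A Y Z)) (rsA D ?s a \<cdot>\<^bsub>Val D (tri A)\<^esub> ?L)" unfolding a(4) .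
  then show "iso ?C (aA A X Y Z)"
    using univ_post_iff[OF uL, of a] a by simp
qed

declare aAsc_generic(1-3) [simp]

text \<open>Restrict the generic square along the functor classifying \<open>(k, l, m, t)\<close>;
  the constraints are absorbed because \<open>Mu\<close> is compatible with the associators of
  \<open>D\<close>.\<close>

lemma aAsc_at:
  assumes "k \<in> fn K \<N>" "l \<in> fn K \<N>" "m \<in> fn K \<N>" "t \<in> fn K A"
    "X \<in> Ob (Val D (\<N> \<otimes> A))" "Y \<in> Ob (Val D (\<N> \<otimes> A))" "Z \<in> Ob (Val D (\<N> \<otimes> A))"
  shows "rsA D \<langle>k \<oplus> l \<oplus> m, t\<rangle> (aA A X Y Z) \<cdot>\<^bsub>Val D K\<^esub> gamL k l m t X Y Z
    = gamR k l m t X Y Z \<cdot>\<^bsub>Val D K\<^esub> Asc (Mon M K) (rs D \<langle>k, t\<rangle> X) (rs D \<langle>l, t\<rangle> Y) (rs D \<langle>m, t\<rangle> Z)"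
proof -
  note [simp] = assms[unfolded fn_iff]
  define h where "h = \<langle>\<langle>\<langle>k, l\<rangle>, m\<rangle>, t\<rangle>"
  have h [simp]: "small_fun h" "Src h = K" "Tgt h = tri A" by (simp_all add: h_def)
  have e [simp]: "e1 A \<odot> h = k" "e2 A \<odot> h = l" "e3 A \<odot> h = m" "et A \<odot> h = t"
    unfolding h_def using e_at[OF assms(1-4)] by simp_all
  let ?x = "rs D \<langle>e1 A, et A\<rangle> X" and ?y = "rs D \<langle>e2 A, et A\<rangle> Y" and ?z = "rs D \<langle>e3 A, et A\<rangle> Z"
  let ?T = "Mon M (tri A)" and ?s = "\<langle>e1 A \<oplus> e2 A \<oplus> e3 A, et A\<rangle>"
  let ?mL = "Mu M h (ten ?T ?x ?y) ?z \<cdot>\<^bsub>Val D K\<^esub> tenA (Mon M K) (Mu M h ?x ?y) (Id (Val D K) (rs D \<langle>m, t\<rangle> Z))"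
  have "rsA D h (gamL (e1 A) (e2 A) (e3 A) (et A) X Y Z) \<cdot>\<^bsub>Val D K\<^esub> ?mL = gamL k l m t X Y Z"
    using gamL_restrict[of "e1 A" "tri A" "e2 A" "e3 A" "et A" A h K X Y Z] by (simp add: fn_iff)
  then have "rsA D \<langle>k \<oplus> l \<oplus> m, t\<rangle> (aA A X Y Z) \<cdot>\<^bsub>Val D K\<^esub> gamL k l m t X Y Z
    = rsA D h (rsA D ?s (aA A X Y Z) \<cdot>\<^bsub>Val D (tri A)\<^esub> gamL (e1 A) (e2 A) (e3 A) (et A) X Y Z) \<cdot>\<^bsub>Val D K\<^esub> ?mL"
    by (simp flip: \<open>_ = gamL k l m t X Y Z\<close>)
  also have "\<dots> = rsA D h (gamR (e1 A) (e2 A) (e3 A) (et A) X Y Z) \<cdot>\<^bsub>Val D K\<^esub> (rsA D h (Asc ?T ?x ?y ?z) \<cdot>\<^bsub>Val D K\<^esub> ?mL)"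
    by (subst aAsc_generic(4)) simp_all
  also have "rsA D h (Asc ?T ?x ?y ?z) \<cdot>\<^bsub>Val D K\<^esub> ?mL
     = Mu M h ?x (ten ?T ?y ?z) \<cdot>\<^bsub>Val D K\<^esub> (tenA (Mon M K) (Id (Val D K) (rs D \<langle>k, t\<rangle> X)) (Mu M h ?y ?z)
        \<cdot>\<^bsub>Val D K\<^esub> Asc (Mon M K) (rs D \<langle>k, t\<rangle> X) (rs D \<langle>l, t\<rangle> Y) (rs D \<langle>m, t\<rangle> Z))"
    using Mu_Asc[of h K ?x ?y ?z] by simp
  also have "rsA D h (gamR (e1 A) (e2 A) (e3 A) (et A) X Y Z) \<cdot>\<^bsub>Val D K\<^esub> \<dots>
     = (rsA D h (gamR (e1 A) (e2 A) (e3 A) (et A) X Y Z) \<cdot>\<^bsub>Val D K\<^esub> (Mu M h ?x (ten ?T ?y ?z) \<cdot>\<^bsub>Val D K\<^esub>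
        tenA (Mon M K) (Id (Val D K) (rs D \<langle>k, t\<rangle> X)) (Mu M h ?y ?z))) \<cdot>\<^bsub>Val D K\<^esub>
        Asc (Mon M K) (rs D \<langle>k, t\<rangle> X) (rs D \<langle>l, t\<rangle> Y) (rs D \<langle>m, t\<rangle> Z)" by simp
  also have "rsA D h (gamR (e1 A) (e2 A) (e3 A) (et A) X Y Z) \<cdot>\<^bsub>Val D K\<^esub> (Mu M h ?x (ten ?T ?y ?z) \<cdot>\<^bsub>Val D K\<^esub>
        tenA (Mon M K) (Id (Val D K) (rs D \<langle>k, t\<rangle> X)) (Mu M h ?y ?z)) = gamR k l m t X Y Z"
    using gamR_restrict[of "e1 A" "tri A" "e2 A" "e3 A" "et A" A h K X Y Z] by (simp add: fn_iff)
  finally show ?thesis .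
qed

text \<open>The fourfold multiplication into
  \<open>((W \<otimes> X) \<otimes> Y) \<otimes> Z\<close>, the test arrow for the pentagon.\<close>

definition quad :: "'u sfun \<Rightarrow> 'u sfun \<Rightarrow> 'u sfun \<Rightarrow> 'u sfun \<Rightarrow> 'u sfun \<Rightarrow> 'o \<Rightarrow> 'o \<Rightarrow> 'o \<Rightarrow> 'o \<Rightarrow> 'a" where
  "quad j k l m t W X Y Z = bet (j \<oplus> k \<oplus> l) m t (aten D M (Tgt t) (aten D M (Tgt t) W X) Y) Z \<cdot>\<^bsub>Val D (Src t)\<^esub>
     tenA (Mon M (Src t)) (gamL j k l t W X Y) (Id (Val D (Src t)) (rs D \<langle>m, t\<rangle> Z))"

text \<open>One more inductive step from \<open>gamL\<close>. The stage and its elements are only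
  asserted to exist, since the pentagon is tested through universality alone.\<close>

lemma univ_quad:
  assumes [simp]: "small_cat A" "W \<in> Ob (Val D (\<N> \<otimes> A))" "X \<in> Ob (Val D (\<N> \<otimes> A))" "Y \<in> Ob (Val D (\<N> \<otimes> A))" "Z \<in> Ob (Val D (\<N> \<otimes> A))"
  obtains K j k l m t where "j \<in> fn K \<N>" "k \<in> fn K \<N>" "l \<in> fn K \<N>" "m \<in> fn K \<N>" "t \<in> fn K A"
    "univ D \<langle>j \<oplus> k \<oplus> l \<oplus> m, t\<rangle> (aten D M A (aten D M A (aten D M A W X) Y) Z) (quad j k l m t W X Y Z)"
proof -
  let ?P = "(\<N> \<otimes> \<N>) \<otimes> \<N>"
  let ?K = "(?P \<otimes> \<N>) \<otimes> A"
  define f :: "'u sfun" where "f = (pr1 \<N> \<N> \<odot> pr1 (\<N> \<otimes> \<N>) \<N>) \<oplus> (pr2 \<N> \<N> \<odot> pr1 (\<N> \<otimes> \<N>) \<N>) \<oplus> pr2 (\<N> \<otimes> \<N>) \<N>"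
  define s :: "'u sfun" where "s = pr1 ?P \<N> \<otimes>\<^sub>F idF A"
  have f: "f \<in> fn ?P \<N>" by (simp add: f_def fn_iff)
  have s [simp]: "small_fun s" "Src s = ?K" "Tgt s = tri A" by (simp_all add: s_def)
  define j k l m t where "j = e1 A \<odot> s" "k = e2 A \<odot> s" "l = e3 A \<odot> s" "m = pr2 ?P \<N> \<odot> pr1 (?P \<otimes> \<N>) A" "t = pr2 (?P \<otimes> \<N>) A"
  note d = this
  have ts: "et A \<odot> s = t" by (simp add: s_def d)
  have F [simp]: "small_fun j" "Src j = ?K" "Tgt j = \<N>" "small_fun k" "Src k = ?K" "Tgt k = \<N>" "small_fun l" "Src l = ?K" "Tgt l = \<N>"
    "small_fun m" "Src m = ?K" "Tgt m = \<N>" "small_fun t" "Src t = ?K" "Tgt t = A" by (simp_all add: d)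
  have fA: "f \<otimes>\<^sub>F idF A = \<langle>e1 A \<oplus> e2 A \<oplus> e3 A, et A\<rangle>" by (simp add: f_def e1_def e2_def e3_def cart)
  have fs: "f \<odot> (pr1 ?P \<N> \<odot> pr1 (?P \<otimes> \<N>) A) = j \<oplus> k \<oplus> l" by (simp add: f_def d e1_def e2_def e3_def s_def)
  let ?V = "aten D M A (aten D M A W X) Y" and ?g = "gamL (e1 A) (e2 A) (e3 A) (et A) W X Y"
  let ?I = "Id (Val D ?K) (rs D \<langle>m, t\<rangle> Z)"
  let ?x = "rs D \<langle>e1 A, et A\<rangle> W" and ?y = "rs D \<langle>e2 A, et A\<rangle> X" and ?z = "rs D \<langle>e3 A, et A\<rangle> Y"
  let ?mL = "Mu M s (ten (Mon M (tri A)) ?x ?y) ?z \<cdot>\<^bsub>Val D ?K\<^esub> tenA (Mon M ?K) (Mu M s ?x ?y) (Id (Val D ?K) (rs D \<langle>l, t\<rangle> Y))"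
  have "univ D (f \<otimes>\<^sub>F idF A) ?V ?g" unfolding fA by (rule univ_gamL) simp_all
  from univ_param_left[OF f assms(1) this assms(5)]
  have 1: "univ D \<langle>(j \<oplus> k \<oplus> l) \<oplus> m, t\<rangle> (aten D M A ?V Z)
     (bet (j \<oplus> k \<oplus> l) m t ?V Z \<cdot>\<^bsub>Val D ?K\<^esub> tenA (Mon M ?K) (rsA D s ?g) ?I)"
    unfolding fs s_def[symmetric] d(4,5)[symmetric] .
  have "iso (Val D ?K) (tenA (Mon M ?K) ?mL ?I)"
    by (intro iso_tenA iso_Id_Val iso_comp_Val Mu_iso) (simp_all add: d(1-3)[symmetric] ts)
  from univ_pre[OF 1 this]
  have "univ D \<langle>(j \<oplus> k \<oplus> l) \<oplus> m, t\<rangle> (aten D M A ?V Z)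
     ((bet (j \<oplus> k \<oplus> l) m t ?V Z \<cdot>\<^bsub>Val D ?K\<^esub> tenA (Mon M ?K) (rsA D s ?g) ?I) \<cdot>\<^bsub>Val D ?K\<^esub> tenA (Mon M ?K) ?mL ?I)"
    by (simp add: d(1-3)[symmetric] ts)
  also have "(bet (j \<oplus> k \<oplus> l) m t ?V Z \<cdot>\<^bsub>Val D ?K\<^esub> tenA (Mon M ?K) (rsA D s ?g) ?I) \<cdot>\<^bsub>Val D ?K\<^esub> tenA (Mon M ?K) ?mL ?I
    = bet (j \<oplus> k \<oplus> l) m t ?V Z \<cdot>\<^bsub>Val D ?K\<^esub> tenA (Mon M ?K) (rsA D s ?g \<cdot>\<^bsub>Val D ?K\<^esub> ?mL) ?I"
    by (simp add: d(1-3)[symmetric] ts tenA_merge)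
  also have "rsA D s ?g \<cdot>\<^bsub>Val D ?K\<^esub> ?mL = gamL j k l t W X Y"
    using gamL_restrict[of "e1 A" "tri A" "e2 A" "e3 A" "et A" A s ?K W X Y] by (simp add: fn_iff d(1-3)[symmetric] ts)
  finally have "univ D \<langle>j \<oplus> k \<oplus> l \<oplus> m, t\<rangle> (aten D M A ?V Z) (quad j k l m t W X Y Z)"
    by (simp add: quad_def)
  then show thesis using that[of j ?K k l m t] by (simp add: fn_iff)
qed

end

section \<open>The unitors\<close>

lemma bang_pairF [simp]:
  assumes "small_cat A"
  shows "\<langle>bang (\<e> \<otimes> A), pr2 \<e> A\<rangle> = idF (\<e> \<otimes> A)" "\<langle>pr1 A \<e>, bang (A \<otimes> \<e>)\<rangle> = idF (A \<otimes> \<e>)"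
  using assms by (auto intro!: sfun_eqI)

context monoidal_derivator
begin

abbreviation I :: 'o where "I \<equiv> lan D incl (Unt (Mon M \<e>))"

lemma I_ob [simp]: "I \<in> Ob (Val D \<N>)"
  using univ_lan(3)[of incl "Unt (Mon M \<e>)"] by simp

lemma univ_I: "univ D incl I (ladj_unit (Res D incl) (Unt (Mon M \<e>)))"
  and I_unit [simp]: "ladj_unit (Res D incl) (Unt (Mon M \<e>)) \<in> Ar (Val D \<e>)"
    "Dom (Val D \<e>) (ladj_unit (Res D incl) (Unt (Mon M \<e>))) = Unt (Mon M \<e>)"
    "Cod (Val D \<e>) (ladj_unit (Res D incl) (Unt (Mon M \<e>))) = rs D incl I"
proof -
  show "univ D incl I (ladj_unit (Res D incl) (Unt (Mon M \<e>)))"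
    and "Dom (Val D \<e>) (ladj_unit (Res D incl) (Unt (Mon M \<e>))) = Unt (Mon M \<e>)"
    using univ_lan(1,2)[of incl "Unt (Mon M \<e>)"] by simp_all
  from univD[OF this(1)] show "ladj_unit (Res D incl) (Unt (Mon M \<e>)) \<in> Ar (Val D \<e>)"
    "Cod (Val D \<e>) (ladj_unit (Res D incl) (Unt (Mon M \<e>))) = rs D incl I" by simp_all
qed

abbreviation aU :: "'u scat \<Rightarrow> 'o" where "aU \<equiv> aUnt D M"

lemma aU_ob [simp]: "small_cat A \<Longrightarrow> aU A \<in> Ob (Val D (\<N> \<otimes> A))"
  by (simp add: aUnt_def)

text \<open>The unit is pulled back from \<open>\<N>\<close>, so its restriction sees only the
  degree \<open>k\<close>.\<close>

lemma aU_at [simp]: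
  "small_fun k \<Longrightarrow> small_fun t \<Longrightarrow> Src k = Src t \<Longrightarrow> Tgt k = \<N> \<Longrightarrow> Tgt t = A \<Longrightarrow> small_cat A \<Longrightarrow>
    rs D \<langle>k, t\<rangle> (aU A) = rs D k I"
  by (simp add: aUnt_def)

text \<open>The unit element \<open>1 \<rightarrow> I\<^sub>0\<close> at stage \<open>K\<close>,
  where \<open>I\<^sub>0\<close> is the part of \<open>I\<close> in degree zero.\<close>

definition ups :: "'u scat \<Rightarrow> 'a" where
  "ups K = rsA D (bang K) (ladj_unit (Res D incl) (Unt (Mon M \<e>))) \<cdot>\<^bsub>Val D K\<^esub> Mu0 M (bang K)"

lemma ups [simp]:
  assumes "small_cat K"
  shows "ups K \<in> Ar (Val D K)" "Dom (Val D K) (ups K) = Unt (Mon M K)" "Cod (Val D K) (ups K) = rs D (zer K) I"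
  using assms by (simp_all add: ups_def)

lemma ups_restrict:
  assumes "h \<in> fn K' K"
  shows "rsA D h (ups K) \<cdot>\<^bsub>Val D K'\<^esub> Mu0 M h = ups K'"
proof -
  note [simp] = assms[unfolded fn_iff]
  have "rsA D h (Mu0 M (bang K)) \<cdot>\<^bsub>Val D K'\<^esub> Mu0 M h = Mu0 M (bang K')"
    using Mu0_comp[of h "bang K"] by simp
  then show ?thesis by (simp add: ups_def)
qed

text \<open>Multiplication by the unit element, \<open>1 \<otimes> X\<^sub>n \<rightarrow> I\<^sub>0
  \<otimes> X\<^sub>n \<rightarrow> (I \<otimes> X)\<^sub>n\<close>; the last index is
  \<open>0 + n\<close>, equal to \<open>n\<close> on the nose.\<close>

definition lam :: "'u sfun \<Rightarrow> 'u sfun \<Rightarrow> 'o \<Rightarrow> 'a" where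
  "lam n t X = bet (zer (Src t)) n t (aU (Tgt t)) X \<cdot>\<^bsub>Val D (Src t)\<^esub>
     tenA (Mon M (Src t)) (ups (Src t)) (Id (Val D (Src t)) (rs D \<langle>n, t\<rangle> X))"

definition rho :: "'u sfun \<Rightarrow> 'u sfun \<Rightarrow> 'o \<Rightarrow> 'a" where
  "rho n t X = bet n (zer (Src t)) t X (aU (Tgt t)) \<cdot>\<^bsub>Val D (Src t)\<^esub>
     tenA (Mon M (Src t)) (Id (Val D (Src t)) (rs D \<langle>n, t\<rangle> X)) (ups (Src t))"

lemma lam_rho [simp]:
  assumes "small_fun n" "small_fun t" "Src n = K" "Src t = K" "Tgt n = \<N>" "X \<in> Ob (Val D (\<N> \<otimes> Tgt t))"
  shows "lam n t X \<in> Ar (Val D K)" "Dom (Val D K) (lam n t X) = ten (Mon M K) (Unt (Mon M K)) (rs D \<langle>n, t\<rangle> X)"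
    "Cod (Val D K) (lam n t X) = rs D \<langle>n, t\<rangle> (aten D M (Tgt t) (aU (Tgt t)) X)"
    "rho n t X \<in> Ar (Val D K)" "Dom (Val D K) (rho n t X) = ten (Mon M K) (rs D \<langle>n, t\<rangle> X) (Unt (Mon M K))"
    "Cod (Val D K) (rho n t X) = rs D \<langle>n, t\<rangle> (aten D M (Tgt t) X (aU (Tgt t)))"
  using assms small_fun_cat[OF assms(2)] by (simp_all add: lam_def rho_def)

text \<open>As for \<open>gamL_restrict\<close>, with the unit constraint \<open>Mu0\<close> in
  place of that of the inner product.\<close>

lemma lam_restrict:
  assumes "n \<in> fn K \<N>" "t \<in> fn K A" "h \<in> fn K' K" "X \<in> Ob (Val D (\<N> \<otimes> A))"
  shows "rsA D h (lam n t X) \<cdot>\<^bsub>Val D K'\<^esub> (Mu M h (Unt (Mon M K)) (rs D \<langle>n, t\<rangle> X) \<cdot>\<^bsub>Val D K'\<^esub>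
      tenA (Mon M K') (Mu0 M h) (Id (Val D K') (rs D \<langle>n \<odot> h, t \<odot> h\<rangle> X))) = lam (n \<odot> h) (t \<odot> h) X"
proof -
  note [simp] = assms[unfolded fn_iff]
  let ?I = "Id (Val D K) (rs D \<langle>n, t\<rangle> X)" and ?I' = "Id (Val D K') (rs D \<langle>n \<odot> h, t \<odot> h\<rangle> X)"
  have "rsA D h (lam n t X) \<cdot>\<^bsub>Val D K'\<^esub> (Mu M h (Unt (Mon M K)) (rs D \<langle>n, t\<rangle> X) \<cdot>\<^bsub>Val D K'\<^esub> tenA (Mon M K') (Mu0 M h) ?I')
    = rsA D h (bet (zer K) n t (aU A) X) \<cdot>\<^bsub>Val D K'\<^esub> ((rsA D h (tenA (Mon M K) (ups K) ?I) \<cdot>\<^bsub>Val D K'\<^esub>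
       Mu M h (Unt (Mon M K)) (rs D \<langle>n, t\<rangle> X)) \<cdot>\<^bsub>Val D K'\<^esub> tenA (Mon M K') (Mu0 M h) ?I')"
    by (simp add: lam_def)
  also have "rsA D h (tenA (Mon M K) (ups K) ?I) \<cdot>\<^bsub>Val D K'\<^esub> Mu M h (Unt (Mon M K)) (rs D \<langle>n, t\<rangle> X)
     = Mu M h (rs D (zer K) I) (rs D \<langle>n, t\<rangle> X) \<cdot>\<^bsub>Val D K'\<^esub> tenA (Mon M K') (rsA D h (ups K)) ?I'"
    using Mu_natural[of h K' "ups K" ?I] by simp
  also have "rsA D h (bet (zer K) n t (aU A) X) \<cdot>\<^bsub>Val D K'\<^esub> ((Mu M h (rs D (zer K) I) (rs D \<langle>n, t\<rangle> X) \<cdot>\<^bsub>Val D K'\<^esub>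
       tenA (Mon M K') (rsA D h (ups K)) ?I') \<cdot>\<^bsub>Val D K'\<^esub> tenA (Mon M K') (Mu0 M h) ?I')
    = (rsA D h (bet (zer K) n t (aU A) X) \<cdot>\<^bsub>Val D K'\<^esub> Mu M h (rs D \<langle>zer K, t\<rangle> (aU A)) (rs D \<langle>n, t\<rangle> X)) \<cdot>\<^bsub>Val D K'\<^esub>
       tenA (Mon M K') (rsA D h (ups K) \<cdot>\<^bsub>Val D K'\<^esub> Mu0 M h) ?I'"
    by (simp add: tenA_merge)
  also have "rsA D h (ups K) \<cdot>\<^bsub>Val D K'\<^esub> Mu0 M h = ups K'" by (rule ups_restrict) fact
  also have "rsA D h (bet (zer K) n t (aU A) X) \<cdot>\<^bsub>Val D K'\<^esub> Mu M h (rs D \<langle>zer K, t\<rangle> (aU A)) (rs D \<langle>n, t\<rangle> X)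
     = bet (zer K \<odot> h) (n \<odot> h) (t \<odot> h) (aU A) X"
    by (rule bet_restrict[where K = K and A = A]) (simp_all add: fn_iff)
  finally show ?thesis by (simp add: lam_def)
qed

lemma rho_restrict:
  assumes "n \<in> fn K \<N>" "t \<in> fn K A" "h \<in> fn K' K" "X \<in> Ob (Val D (\<N> \<otimes> A))"
  shows "rsA D h (rho n t X) \<cdot>\<^bsub>Val D K'\<^esub> (Mu M h (rs D \<langle>n, t\<rangle> X) (Unt (Mon M K)) \<cdot>\<^bsub>Val D K'\<^esub>
      tenA (Mon M K') (Id (Val D K') (rs D \<langle>n \<odot> h, t \<odot> h\<rangle> X)) (Mu0 M h)) = rho (n \<odot> h) (t \<odot> h) X"
proof -
  note [simp] = assms[unfolded fn_iff]
  let ?I = "Id (Val D K) (rs D \<langle>n, t\<rangle> X)" and ?I' = "Id (Val D K') (rs D \<langle>n \<odot> h, t \<odot> h\<rangle> X)"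
  have "rsA D h (rho n t X) \<cdot>\<^bsub>Val D K'\<^esub> (Mu M h (rs D \<langle>n, t\<rangle> X) (Unt (Mon M K)) \<cdot>\<^bsub>Val D K'\<^esub> tenA (Mon M K') ?I' (Mu0 M h))
    = rsA D h (bet n (zer K) t X (aU A)) \<cdot>\<^bsub>Val D K'\<^esub> ((rsA D h (tenA (Mon M K) ?I (ups K)) \<cdot>\<^bsub>Val D K'\<^esub>
       Mu M h (rs D \<langle>n, t\<rangle> X) (Unt (Mon M K))) \<cdot>\<^bsub>Val D K'\<^esub> tenA (Mon M K') ?I' (Mu0 M h))"
    by (simp add: rho_def)
  also have "rsA D h (tenA (Mon M K) ?I (ups K)) \<cdot>\<^bsub>Val D K'\<^esub> Mu M h (rs D \<langle>n, t\<rangle> X) (Unt (Mon M K))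
     = Mu M h (rs D \<langle>n, t\<rangle> X) (rs D (zer K) I) \<cdot>\<^bsub>Val D K'\<^esub> tenA (Mon M K') ?I' (rsA D h (ups K))"
    using Mu_natural[of h K' ?I "ups K"] by simp
  also have "rsA D h (bet n (zer K) t X (aU A)) \<cdot>\<^bsub>Val D K'\<^esub> ((Mu M h (rs D \<langle>n, t\<rangle> X) (rs D (zer K) I) \<cdot>\<^bsub>Val D K'\<^esub>
       tenA (Mon M K') ?I' (rsA D h (ups K))) \<cdot>\<^bsub>Val D K'\<^esub> tenA (Mon M K') ?I' (Mu0 M h))
    = (rsA D h (bet n (zer K) t X (aU A)) \<cdot>\<^bsub>Val D K'\<^esub> Mu M h (rs D \<langle>n, t\<rangle> X) (rs D \<langle>zer K, t\<rangle> (aU A))) \<cdot>\<^bsub>Val D K'\<^esub>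
       tenA (Mon M K') ?I' (rsA D h (ups K) \<cdot>\<^bsub>Val D K'\<^esub> Mu0 M h)"
    by (simp add: tenA_merge)
  also have "rsA D h (ups K) \<cdot>\<^bsub>Val D K'\<^esub> Mu0 M h = ups K'" by (rule ups_restrict) fact
  also have "rsA D h (bet n (zer K) t X (aU A)) \<cdot>\<^bsub>Val D K'\<^esub> Mu M h (rs D \<langle>n, t\<rangle> X) (rs D \<langle>zer K, t\<rangle> (aU A))
     = bet (n \<odot> h) (zer K \<odot> h) (t \<odot> h) X (aU A)"
    by (rule bet_restrict[where K = K and A = A]) (simp_all add: fn_iff)
  finally show ?thesis by (simp add: rho_def)
qed

text \<open>The arrow defining \<open>I\<close> is universal along \<open>incl\<close>, so by the
  projection formula its product with \<open>X\<close> is universal along the functor that inserts a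
  zero. Followed by addition that functor is the identity, and universality along an identity means
  invertibility.\<close>

lemma iso_lam:
  assumes A [simp]: "small_cat A" and X [simp]: "X \<in> Ob (Val D (\<N> \<otimes> A))"
  shows "iso (Val D (\<N> \<otimes> A)) (lam (pr1 \<N> A) (pr2 \<N> A) X)"
proof -
  let ?K = "\<N> \<otimes> A" and ?u = "ladj_unit (Res D incl) (Unt (Mon M \<e>))" and ?g = "zero_left A"
  let ?t = "pr1 \<N> \<N> \<odot> pr1 (\<N> \<otimes> \<N>) A"
  have g: "?g = \<langle>\<langle>zer ?K, pr1 \<N> A\<rangle>, pr2 \<N> A\<rangle>" by (simp add: cart)
  have p: "p1 A \<odot> ?g = \<langle>zer ?K, pr2 \<N> A\<rangle>" "p2 A \<odot> ?g = idF ?K" "plus_times A \<odot> ?g = idF ?K" by (simp_all add: g)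
  \<comment> \<open>Up to identifying \<open>\<e> \<otimes> ?K\<close> with \<open>?K\<close> and a
    rebracketing, inserting a zero is \<open>incl \<otimes>\<^sub>F idF ?K\<close> itself, so base
    change is conjugation by isomorphisms.\<close>
  have bc: "univ D ?g (rs D \<langle>?t, p2 A\<rangle> Y) (rsA D \<langle>bang ?K, p2 A \<odot> ?g\<rangle> \<eta>)"
    if \<eta>: "univ D (incl \<otimes>\<^sub>F idF ?K) Y \<eta>" for Y \<eta>
    by (rule univ_iso_square[OF \<eta>, where a' = "pr2 \<e> ?K" and
          b' = "\<langle>\<langle>pr1 \<N> ?K, pr1 \<N> A \<odot> pr2 \<N> ?K\<rangle>, pr2 \<N> A \<odot> pr2 \<N> ?K\<rangle>"])
       (simp_all add: p)
  have 1: "univ D ?g (ten (Mon M ((\<N> \<otimes> \<N>) \<otimes> A)) (rs D ?t I) (rs D (p2 A) X))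
    (Mu M ?g (rs D ?t I) (rs D (p2 A) X) \<cdot>\<^bsub>Val D ?K\<^esub>
      tenA (Mon M ?K) (rsA D (bang ?K) ?u) (Id (Val D ?K) (rs D (p2 A \<odot> ?g) X)))"
    by (rule univ_ten_left[OF univ_I X, where s = "bang ?K" and t = ?t and r = "p2 A"])
       (use bc in \<open>simp_all add: fn_iff\<close>)
  have tI: "rs D ?t I = rs D (p1 A) (aU A)" by (simp add: aUnt_def)
  have "univ D (plus_times A \<odot> ?g) (aten D M A (aU A) X) (rsA D ?g (bil D M A (aU A) X) \<cdot>\<^bsub>Val D (Src ?g)\<^esub>
     (Mu M ?g (rs D (p1 A) (aU A)) (rs D (p2 A) X) \<cdot>\<^bsub>Val D ?K\<^esub>
      tenA (Mon M ?K) (rsA D (bang ?K) ?u) (Id (Val D ?K) (rs D (p2 A \<odot> ?g) X))))"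
    by (rule univ_comp[OF 1[unfolded tI] univ_bil]) simp_all
  then have "univ D (idF ?K) (aten D M A (aU A) X)
     (bet (zer ?K) (pr1 \<N> A) (pr2 \<N> A) (aU A) X \<cdot>\<^bsub>Val D ?K\<^esub> tenA (Mon M ?K) (rsA D (bang ?K) ?u) (Id (Val D ?K) X))"
    unfolding p(2,3) by (simp add: bet_def g)
  then have "iso (Val D ?K) (bet (zer ?K) (pr1 \<N> A) (pr2 \<N> A) (aU A) X \<cdot>\<^bsub>Val D ?K\<^esub> tenA (Mon M ?K) (rsA D (bang ?K) ?u) (Id (Val D ?K) X))"
    by (simp add: univ_idF_iff)
  note 2 = this
  have "iso (Val D ?K) ((bet (zer ?K) (pr1 \<N> A) (pr2 \<N> A) (aU A) X \<cdot>\<^bsub>Val D ?K\<^esub> tenA (Mon M ?K) (rsA D (bang ?K) ?u) (Id (Val D ?K) X))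
     \<cdot>\<^bsub>Val D ?K\<^esub> tenA (Mon M ?K) (Mu0 M (bang ?K)) (Id (Val D ?K) X))"
    by (rule iso_comp_Val[OF iso_tenA[OF Mu0_iso iso_Id_Val] 2]) simp_all
  then show ?thesis by (simp add: lam_def ups_def tenA_merge)
qed

text \<open>The same argument with the zero inserted on the right.\<close>

lemma iso_rho:
  assumes A [simp]: "small_cat A" and X [simp]: "X \<in> Ob (Val D (\<N> \<otimes> A))"
  shows "iso (Val D (\<N> \<otimes> A)) (rho (pr1 \<N> A) (pr2 \<N> A) X)"
proof -
  let ?K = "\<N> \<otimes> A" and ?u = "ladj_unit (Res D incl) (Unt (Mon M \<e>))" and ?g = "zero_right A"
  let ?t = "pr2 \<N> \<N> \<odot> pr1 (\<N> \<otimes> \<N>) A"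
  have g: "?g = \<langle>\<langle>pr1 \<N> A, zer ?K\<rangle>, pr2 \<N> A\<rangle>" by (simp add: cart)
  have p: "p2 A \<odot> ?g = \<langle>zer ?K, pr2 \<N> A\<rangle>" "p1 A \<odot> ?g = idF ?K" "plus_times A \<odot> ?g = idF ?K" by (simp_all add: g)
  have bc: "univ D ?g (rs D \<langle>p1 A, ?t\<rangle> Y) (rsA D \<langle>p1 A \<odot> ?g, bang ?K\<rangle> \<eta>)"
    if \<eta>: "univ D (idF ?K \<otimes>\<^sub>F incl) Y \<eta>" for Y \<eta>
    by (rule univ_iso_square[OF \<eta>, where a' = "pr1 ?K \<e>" and
          b' = "\<langle>\<langle>pr1 \<N> A \<odot> pr1 ?K \<N>, pr2 ?K \<N>\<rangle>, pr2 \<N> A \<odot> pr1 ?K \<N>\<rangle>"])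
       (simp_all add: p)
  have 1: "univ D ?g (ten (Mon M ((\<N> \<otimes> \<N>) \<otimes> A)) (rs D (p1 A) X) (rs D ?t I))
    (Mu M ?g (rs D (p1 A) X) (rs D ?t I) \<cdot>\<^bsub>Val D ?K\<^esub>
      tenA (Mon M ?K) (Id (Val D ?K) (rs D (p1 A \<odot> ?g) X)) (rsA D (bang ?K) ?u))"
    by (rule univ_ten_right[OF univ_I X, where s = "bang ?K" and t = ?t and r = "p1 A"])
       (use bc in \<open>simp_all add: fn_iff\<close>)
  have tI: "rs D ?t I = rs D (p2 A) (aU A)" by (simp add: aUnt_def)
  have "univ D (plus_times A \<odot> ?g) (aten D M A X (aU A)) (rsA D ?g (bil D M A X (aU A)) \<cdot>\<^bsub>Val D (Src ?g)\<^esub>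
     (Mu M ?g (rs D (p1 A) X) (rs D (p2 A) (aU A)) \<cdot>\<^bsub>Val D ?K\<^esub>
      tenA (Mon M ?K) (Id (Val D ?K) (rs D (p1 A \<odot> ?g) X)) (rsA D (bang ?K) ?u)))"
    by (rule univ_comp[OF 1[unfolded tI] univ_bil]) simp_all
  then have "univ D (idF ?K) (aten D M A X (aU A))
     (bet (pr1 \<N> A) (zer ?K) (pr2 \<N> A) X (aU A) \<cdot>\<^bsub>Val D ?K\<^esub> tenA (Mon M ?K) (Id (Val D ?K) X) (rsA D (bang ?K) ?u))"
    unfolding p(2,3) by (simp add: bet_def g)
  then have "iso (Val D ?K) (bet (pr1 \<N> A) (zer ?K) (pr2 \<N> A) X (aU A) \<cdot>\<^bsub>Val D ?K\<^esub> tenA (Mon M ?K) (Id (Val D ?K) X) (rsA D (bang ?K) ?u))"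
    by (simp add: univ_idF_iff)
  note 2 = this
  have "iso (Val D ?K) ((bet (pr1 \<N> A) (zer ?K) (pr2 \<N> A) X (aU A) \<cdot>\<^bsub>Val D ?K\<^esub> tenA (Mon M ?K) (Id (Val D ?K) X) (rsA D (bang ?K) ?u))
     \<cdot>\<^bsub>Val D ?K\<^esub> tenA (Mon M ?K) (Id (Val D ?K) X) (Mu0 M (bang ?K)))"
    by (rule iso_comp_Val[OF iso_tenA[OF iso_Id_Val Mu0_iso] 2]) simp_all
  then show ?thesis by (simp add: rho_def ups_def tenA_merge)
qed

text \<open>The description denotes \<open>q\<close> composed with the inverse of
  \<open>p\<close>.\<close>

lemma the_left_factor:
  assumes "category C" "iso C p" "q \<in> Ar C" "Dom C q = Dom C p" "Cod C p = x" "Cod C q = y"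
  shows "\<exists>f. (THE f. f \<in> hom C x y \<and> f \<cdot>\<^bsub>C\<^esub> p = q) = f \<and> f \<in> hom C x y \<and> f \<cdot>\<^bsub>C\<^esub> p = q"
proof -
  interpret category C by fact
  have p: "p \<in> Ar C" using assms(2) by (rule iso_arr)
  obtain h where h: "h \<in> Ar C" "Dom C h = x" "Cod C h = Dom C p" "h \<cdot>\<^bsub>C\<^esub> p = Id C (Dom C p)"
    using isoE[OF assms(2)] unfolding assms(5) .
  have "q \<cdot>\<^bsub>C\<^esub> h \<in> hom C x y \<and> (q \<cdot>\<^bsub>C\<^esub> h) \<cdot>\<^bsub>C\<^esub> p = q"
    using h p assms by (simp add: hom_iff comp_arr comp_assoc comp_Id)
  moreover have "f = g" if "f \<in> hom C x y \<and> f \<cdot>\<^bsub>C\<^esub> p = q" "g \<in> hom C x y \<and> g \<cdot>\<^bsub>C\<^esub> p = q" for f g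
    using iso_cancel_right[OF assms(2), of f g] that assms(5) by (simp add: hom_iff)
  ultimately have "\<exists>!f. f \<in> hom C x y \<and> f \<cdot>\<^bsub>C\<^esub> p = q" by blast
  from theI'[OF this] show ?thesis by blast
qed

lemma aLun_generic:
  assumes A [simp]: "small_cat A" and X [simp]: "X \<in> Ob (Val D (\<N> \<otimes> A))"
  shows "aLun D M A X \<in> Ar (Val D (\<N> \<otimes> A))" "Dom (Val D (\<N> \<otimes> A)) (aLun D M A X) = aten D M A (aU A) X"
    "Cod (Val D (\<N> \<otimes> A)) (aLun D M A X) = X"
    "aLun D M A X \<cdot>\<^bsub>Val D (\<N> \<otimes> A)\<^esub> lam (pr1 \<N> A) (pr2 \<N> A) X = Lun (Mon M (\<N> \<otimes> A)) X"
    "iso (Val D (\<N> \<otimes> A)) (aLun D M A X)"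
proof -
  let ?K = "\<N> \<otimes> A"
  have g: "zero_left A = \<langle>\<langle>zer ?K, pr1 \<N> A\<rangle>, pr2 \<N> A\<rangle>" by (simp add: cart)
  have "rsA D (zero_left A) (bil D M A (aU A) X) \<cdot>\<^bsub>Val D ?K\<^esub> (Mu M (zero_left A) (rs D (p1 A) (aU A)) (rs D (p2 A) X)
      \<cdot>\<^bsub>Val D ?K\<^esub> tenA (Mon M ?K) (unit_map D M A) (Id (Val D ?K) X)) = lam (pr1 \<N> A) (pr2 \<N> A) X"
    unfolding g unit_map_def ups_def[symmetric] lam_def bet_def by simp
  then have eq: "aLun D M A X = (THE f. f \<in> hom (Val D ?K) (aten D M A (aU A) X) X \<and>
      f \<cdot>\<^bsub>Val D ?K\<^esub> lam (pr1 \<N> A) (pr2 \<N> A) X = Lun (Mon M ?K) X)"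
    by (simp add: aLun_def Let_def)
  have "aLun D M A X \<in> hom (Val D ?K) (aten D M A (aU A) X) X \<and> aLun D M A X \<cdot>\<^bsub>Val D ?K\<^esub> lam (pr1 \<N> A) (pr2 \<N> A) X = Lun (Mon M ?K) X"
    using the_left_factor[OF _ iso_lam[OF A X], of "Lun (Mon M ?K) X" "aten D M A (aU A) X" X, folded eq] by auto
  then show l: "aLun D M A X \<in> Ar (Val D ?K)" "Dom (Val D ?K) (aLun D M A X) = aten D M A (aU A) X"
    "Cod (Val D ?K) (aLun D M A X) = X"
    "aLun D M A X \<cdot>\<^bsub>Val D ?K\<^esub> lam (pr1 \<N> A) (pr2 \<N> A) X = Lun (Mon M ?K) X"
    by (simp_all add: hom_iff)
  have "iso (Val D ?K) (Lun (Mon M ?K) X)" by (rule monoidal_category.Lun_iso[OF Mon_monoidal]) simp_all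
  then have i: "iso (Val D ?K) (aLun D M A X \<cdot>\<^bsub>Val D ?K\<^esub> lam (pr1 \<N> A) (pr2 \<N> A) X)" unfolding l(4) .
  show "iso (Val D ?K) (aLun D M A X)"
    by (rule category.iso_cancel_comp_left[OF _ i iso_lam[OF A X]]) (use l(1-3) in simp_all)
qed

lemma aRun_generic:
  assumes A [simp]: "small_cat A" and X [simp]: "X \<in> Ob (Val D (\<N> \<otimes> A))"
  shows "aRun D M A X \<in> Ar (Val D (\<N> \<otimes> A))" "Dom (Val D (\<N> \<otimes> A)) (aRun D M A X) = aten D M A X (aU A)"
    "Cod (Val D (\<N> \<otimes> A)) (aRun D M A X) = X"
    "aRun D M A X \<cdot>\<^bsub>Val D (\<N> \<otimes> A)\<^esub> rho (pr1 \<N> A) (pr2 \<N> A) X = Run (Mon M (\<N> \<otimes> A)) X"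
    "iso (Val D (\<N> \<otimes> A)) (aRun D M A X)"
proof -
  let ?K = "\<N> \<otimes> A"
  have g: "zero_right A = \<langle>\<langle>pr1 \<N> A, zer ?K\<rangle>, pr2 \<N> A\<rangle>" by (simp add: cart)
  have "rsA D (zero_right A) (bil D M A X (aU A)) \<cdot>\<^bsub>Val D ?K\<^esub> (Mu M (zero_right A) (rs D (p1 A) X) (rs D (p2 A) (aU A))
      \<cdot>\<^bsub>Val D ?K\<^esub> tenA (Mon M ?K) (Id (Val D ?K) X) (unit_map D M A)) = rho (pr1 \<N> A) (pr2 \<N> A) X"
    unfolding g unit_map_def ups_def[symmetric] rho_def bet_def by simp
  then have eq: "aRun D M A X = (THE f. f \<in> hom (Val D ?K) (aten D M A X (aU A)) X \<and>
      f \<cdot>\<^bsub>Val D ?K\<^esub> rho (pr1 \<N> A) (pr2 \<N> A) X = Run (Mon M ?K) X)"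
    by (simp add: aRun_def Let_def)
  have "aRun D M A X \<in> hom (Val D ?K) (aten D M A X (aU A)) X \<and> aRun D M A X \<cdot>\<^bsub>Val D ?K\<^esub> rho (pr1 \<N> A) (pr2 \<N> A) X = Run (Mon M ?K) X"
    using the_left_factor[OF _ iso_rho[OF A X], of "Run (Mon M ?K) X" "aten D M A X (aU A)" X, folded eq] by auto
  then show l: "aRun D M A X \<in> Ar (Val D ?K)" "Dom (Val D ?K) (aRun D M A X) = aten D M A X (aU A)"
    "Cod (Val D ?K) (aRun D M A X) = X"
    "aRun D M A X \<cdot>\<^bsub>Val D ?K\<^esub> rho (pr1 \<N> A) (pr2 \<N> A) X = Run (Mon M ?K) X"
    by (simp_all add: hom_iff)
  have "iso (Val D ?K) (Run (Mon M ?K) X)" by (rule monoidal_category.Run_iso[OF Mon_monoidal]) simp_all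
  then have i: "iso (Val D ?K) (aRun D M A X \<cdot>\<^bsub>Val D ?K\<^esub> rho (pr1 \<N> A) (pr2 \<N> A) X)" unfolding l(4) .
  show "iso (Val D ?K) (aRun D M A X)"
    by (rule category.iso_cancel_comp_left[OF _ i iso_rho[OF A X]]) (use l(1-3) in simp_all)
qed

declare aLun_generic(1-3) [simp] aRun_generic(1-3) [simp]

text \<open>The generic equations restricted along \<open>\<langle>n, t\<rangle>\<close>;
  compatibility of \<open>Mu\<close> and \<open>Mu0\<close> with the unitors of \<open>D\<close>
  absorbs the constraints.\<close>

lemma aLun_at:
  assumes "n \<in> fn K \<N>" "t \<in> fn K A" "X \<in> Ob (Val D (\<N> \<otimes> A))"
  shows "rsA D \<langle>n, t\<rangle> (aLun D M A X) \<cdot>\<^bsub>Val D K\<^esub> lam n t X = Lun (Mon M K) (rs D \<langle>n, t\<rangle> X)"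
    "rsA D \<langle>n, t\<rangle> (aRun D M A X) \<cdot>\<^bsub>Val D K\<^esub> rho n t X = Run (Mon M K) (rs D \<langle>n, t\<rangle> X)"
proof -
  note [simp] = assms[unfolded fn_iff]
  let ?h = "\<langle>n, t\<rangle>"
  let ?m = "Mu M ?h (Unt (Mon M (\<N> \<otimes> A))) X \<cdot>\<^bsub>Val D K\<^esub> tenA (Mon M K) (Mu0 M ?h) (Id (Val D K) (rs D ?h X))"
  let ?m' = "Mu M ?h X (Unt (Mon M (\<N> \<otimes> A))) \<cdot>\<^bsub>Val D K\<^esub> tenA (Mon M K) (Id (Val D K) (rs D ?h X)) (Mu0 M ?h)"
  have l: "rsA D ?h (lam (pr1 \<N> A) (pr2 \<N> A) X) \<cdot>\<^bsub>Val D K\<^esub> ?m = lam n t X"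
    using lam_restrict[of "pr1 \<N> A" "\<N> \<otimes> A" "pr2 \<N> A" A ?h K X] by (simp add: fn_iff)
  have "rsA D ?h (aLun D M A X) \<cdot>\<^bsub>Val D K\<^esub> (rsA D ?h (lam (pr1 \<N> A) (pr2 \<N> A) X) \<cdot>\<^bsub>Val D K\<^esub> ?m)
    = rsA D ?h (aLun D M A X \<cdot>\<^bsub>Val D (\<N> \<otimes> A)\<^esub> lam (pr1 \<N> A) (pr2 \<N> A) X) \<cdot>\<^bsub>Val D K\<^esub> ?m" by simp
  also have "\<dots> = Lun (Mon M K) (rs D ?h X)"
    unfolding aLun_generic(4)[OF fn_iff[THEN iffD1, OF assms(2), THEN conjunct2, THEN conjunct2, THEN conjunct2, THEN conjunct2] assms(3)]
    using Mu_Lun_Run(1)[of ?h K X] by simp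
  finally show "rsA D ?h (aLun D M A X) \<cdot>\<^bsub>Val D K\<^esub> lam n t X = Lun (Mon M K) (rs D ?h X)" unfolding l .
  have r: "rsA D ?h (rho (pr1 \<N> A) (pr2 \<N> A) X) \<cdot>\<^bsub>Val D K\<^esub> ?m' = rho n t X"
    using rho_restrict[of "pr1 \<N> A" "\<N> \<otimes> A" "pr2 \<N> A" A ?h K X] by (simp add: fn_iff)
  have "rsA D ?h (aRun D M A X) \<cdot>\<^bsub>Val D K\<^esub> (rsA D ?h (rho (pr1 \<N> A) (pr2 \<N> A) X) \<cdot>\<^bsub>Val D K\<^esub> ?m')
    = rsA D ?h (aRun D M A X \<cdot>\<^bsub>Val D (\<N> \<otimes> A)\<^esub> rho (pr1 \<N> A) (pr2 \<N> A) X) \<cdot>\<^bsub>Val D K\<^esub> ?m'" by simp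
  also have "\<dots> = Run (Mon M K) (rs D ?h X)"
    unfolding aRun_generic(4)[OF fn_iff[THEN iffD1, OF assms(2), THEN conjunct2, THEN conjunct2, THEN conjunct2, THEN conjunct2] assms(3)]
    using Mu_Lun_Run(2)[of ?h K X] by simp
  finally show "rsA D ?h (aRun D M A X) \<cdot>\<^bsub>Val D K\<^esub> rho n t X = Run (Mon M K) (rs D ?h X)" unfolding r .
qed

end

section \<open>Coherence\<close>

text \<open>Lets an equation for \<open>g f\<close> act inside a right-nested composite, where
  \<open>g f\<close> does not occur as a subterm.\<close>

lemma (in category) comp_left:
  "\<lbrakk>g \<cdot>\<^bsub>C\<^esub> f = k; f \<in> Ar C; g \<in> Ar C; h \<in> Ar C; Dom C g = Cod C f; Dom C f = Cod C h\<rbrakk>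
    \<Longrightarrow> g \<cdot>\<^bsub>C\<^esub> (f \<cdot>\<^bsub>C\<^esub> h) = k \<cdot>\<^bsub>C\<^esub> h"
  by (simp add: comp_assoc[symmetric] del: comp_assoc category.comp_assoc)

context monoidal_derivator
begin

lemma bil_unique:
  assumes "small_cat A" "X \<in> Ob (Val D (\<N> \<otimes> A))" "Y \<in> Ob (Val D (\<N> \<otimes> A))"
    "f \<in> Ar (Val D (\<N> \<otimes> A))" "g \<in> Ar (Val D (\<N> \<otimes> A))"
    "Dom (Val D (\<N> \<otimes> A)) f = aten D M A X Y" "Dom (Val D (\<N> \<otimes> A)) g = aten D M A X Y"
    "Cod (Val D (\<N> \<otimes> A)) f = Cod (Val D (\<N> \<otimes> A)) g"
    "rsA D (plus_times A) f \<cdot>\<^bsub>Val D ((\<N> \<otimes> \<N>) \<otimes> A)\<^esub> bil D M A X Y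
      = rsA D (plus_times A) g \<cdot>\<^bsub>Val D ((\<N> \<otimes> \<N>) \<otimes> A)\<^esub> bil D M A X Y"
  shows "f = g"
  by (rule univ_unique[OF univ_bil[OF assms(1-3)]]) (use assms in simp_all)

text \<open>Two arrows out of a product agree if they agree after \<open>bil\<close>; there the
  functor laws are those of the tensor product of \<open>D\<close>.\<close>

lemma cfunctor_aTen:
  assumes A [simp]: "small_cat A"
  shows "cfunctor (aTen D M A)"
proof -
  let ?C = "Val D (\<N> \<otimes> A)" and ?C2 = "Val D ((\<N> \<otimes> \<N>) \<otimes> A)"
  have id: "atenA A (Id ?C X) (Id ?C Y) = Id ?C (aten D M A X Y)"
    if [simp]: "X \<in> Ob ?C" "Y \<in> Ob ?C" for X Y
  proof (rule bil_unique[of A X Y])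
    have "rsA D (plus_times A) (atenA A (Id ?C X) (Id ?C Y)) \<cdot>\<^bsub>?C2\<^esub> bil D M A X Y
      = bil D M A X Y \<cdot>\<^bsub>?C2\<^esub> tenA (Mon M ((\<N> \<otimes> \<N>) \<otimes> A)) (rsA D (p1 A) (Id ?C X)) (rsA D (p2 A) (Id ?C Y))"
      by (rule bil_natural) simp_all
    then show "rsA D (plus_times A) (atenA A (Id ?C X) (Id ?C Y)) \<cdot>\<^bsub>?C2\<^esub> bil D M A X Y
      = rsA D (plus_times A) (Id ?C (aten D M A X Y)) \<cdot>\<^bsub>?C2\<^esub> bil D M A X Y" by simp
  qed simp_all
  have cmp: "atenA A (f' \<cdot>\<^bsub>?C\<^esub> f) (g' \<cdot>\<^bsub>?C\<^esub> g) = atenA A f' g' \<cdot>\<^bsub>?C\<^esub> atenA A f g"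
    if [simp]: "f \<in> Ar ?C" "g \<in> Ar ?C" "f' \<in> Ar ?C" "g' \<in> Ar ?C" "Dom ?C f' = Cod ?C f" "Dom ?C g' = Cod ?C g" for f g f' g'
  proof (rule bil_unique[of A "Dom ?C f" "Dom ?C g"])
    let ?b = "\<lambda>f g. bil D M A (Dom ?C f) (Dom ?C g)" and ?T = "Mon M ((\<N> \<otimes> \<N>) \<otimes> A)"
    have [simp]: "bil D M A (Cod ?C f) (Cod ?C g) \<in> Ar ?C2" by simp
    have 1: "rsA D (plus_times A) (atenA A (f' \<cdot>\<^bsub>?C\<^esub> f) (g' \<cdot>\<^bsub>?C\<^esub> g)) \<cdot>\<^bsub>?C2\<^esub> ?b f g
      = bil D M A (Cod ?C f') (Cod ?C g') \<cdot>\<^bsub>?C2\<^esub> tenA ?T (rsA D (p1 A) (f' \<cdot>\<^bsub>?C\<^esub> f)) (rsA D (p2 A) (g' \<cdot>\<^bsub>?C\<^esub> g))"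
      by (rule bil_natural) simp_all
    have 2: "rsA D (plus_times A) (atenA A f g) \<cdot>\<^bsub>?C2\<^esub> ?b f g
      = bil D M A (Cod ?C f) (Cod ?C g) \<cdot>\<^bsub>?C2\<^esub> tenA ?T (rsA D (p1 A) f) (rsA D (p2 A) g)"
      by (rule bil_natural) simp_all
    have 3: "rsA D (plus_times A) (atenA A f' g') \<cdot>\<^bsub>?C2\<^esub> bil D M A (Cod ?C f) (Cod ?C g)
      = bil D M A (Cod ?C f') (Cod ?C g') \<cdot>\<^bsub>?C2\<^esub> tenA ?T (rsA D (p1 A) f') (rsA D (p2 A) g')"
      by (rule bil_natural) simp_all
    note 4 = category.comp_left[OF _ 3]
    show "rsA D (plus_times A) (atenA A (f' \<cdot>\<^bsub>?C\<^esub> f) (g' \<cdot>\<^bsub>?C\<^esub> g)) \<cdot>\<^bsub>?C2\<^esub> ?b f g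
      = rsA D (plus_times A) (atenA A f' g' \<cdot>\<^bsub>?C\<^esub> atenA A f g) \<cdot>\<^bsub>?C2\<^esub> ?b f g"
      unfolding 1 by (simp add: 2 4 tenA_merge)
  qed simp_all
  show ?thesis unfolding aTen_def
    by (rule cfunctor_mk_fun[OF category_prod_cat])
       (use id cmp in \<open>auto simp: category_simps aTen_def[symmetric] simp flip: aTen_ob aTen_arr\<close>)
qed

lemma atenA_Id [simp]: "\<lbrakk>small_cat A; X \<in> Ob (Val D (\<N> \<otimes> A)); Y \<in> Ob (Val D (\<N> \<otimes> A))\<rbrakk>
    \<Longrightarrow> atenA A (Id (Val D (\<N> \<otimes> A)) X) (Id (Val D (\<N> \<otimes> A)) Y) = Id (Val D (\<N> \<otimes> A)) (aten D M A X Y)"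
  using cfunctor_Id[OF cfunctor_aTen refl, of A "(X, Y)"] by (simp add: aTen_def)

text \<open>Naturality of \<open>bet\<close> for the inner and for the outer multiplication, joined
  by the interchange law.\<close>

lemma gam_natural:
  assumes "k \<in> fn K \<N>" "l \<in> fn K \<N>" "m \<in> fn K \<N>" "t \<in> fn K A"
    "f \<in> Ar (Val D (\<N> \<otimes> A))" "g \<in> Ar (Val D (\<N> \<otimes> A))" "h \<in> Ar (Val D (\<N> \<otimes> A))"
    "Dom (Val D (\<N> \<otimes> A)) f = X" "Dom (Val D (\<N> \<otimes> A)) g = Y" "Dom (Val D (\<N> \<otimes> A)) h = Z"
    "Cod (Val D (\<N> \<otimes> A)) f = X'" "Cod (Val D (\<N> \<otimes> A)) g = Y'" "Cod (Val D (\<N> \<otimes> A)) h = Z'"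
  shows "rsA D \<langle>k \<oplus> l \<oplus> m, t\<rangle> (atenA A (atenA A f g) h) \<cdot>\<^bsub>Val D K\<^esub> gamL k l m t X Y Z
    = gamL k l m t X' Y' Z' \<cdot>\<^bsub>Val D K\<^esub>
      tenA (Mon M K) (tenA (Mon M K) (rsA D \<langle>k, t\<rangle> f) (rsA D \<langle>l, t\<rangle> g)) (rsA D \<langle>m, t\<rangle> h)"
    "rsA D \<langle>k \<oplus> l \<oplus> m, t\<rangle> (atenA A f (atenA A g h)) \<cdot>\<^bsub>Val D K\<^esub> gamR k l m t X Y Z
    = gamR k l m t X' Y' Z' \<cdot>\<^bsub>Val D K\<^esub>
      tenA (Mon M K) (rsA D \<langle>k, t\<rangle> f) (tenA (Mon M K) (rsA D \<langle>l, t\<rangle> g) (rsA D \<langle>m, t\<rangle> h))"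
proof -
  have "small_cat A" using assms(4) by (simp add: fn_iff)
  then have [simp]: "X \<in> Ob (Val D (\<N> \<otimes> A))" "Y \<in> Ob (Val D (\<N> \<otimes> A))" "Z \<in> Ob (Val D (\<N> \<otimes> A))"
    "X' \<in> Ob (Val D (\<N> \<otimes> A))" "Y' \<in> Ob (Val D (\<N> \<otimes> A))" "Z' \<in> Ob (Val D (\<N> \<otimes> A))"
    using assms(5-13) by auto
  note [simp] = assms[unfolded fn_iff]
  have 1: "rsA D \<langle>(k \<oplus> l) \<oplus> m, t\<rangle> (atenA A (atenA A f g) h) \<cdot>\<^bsub>Val D K\<^esub> bet (k \<oplus> l) m t (aten D M A X Y) Z
    = bet (k \<oplus> l) m t (aten D M A X' Y') Z' \<cdot>\<^bsub>Val D K\<^esub> tenA (Mon M K) (rsA D \<langle>k \<oplus> l, t\<rangle> (atenA A f g)) (rsA D \<langle>m, t\<rangle> h)"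
    by (rule bet_natural) (simp_all add: fn_iff)
  have 2: "rsA D \<langle>k \<oplus> l, t\<rangle> (atenA A f g) \<cdot>\<^bsub>Val D K\<^esub> bet k l t X Y
    = bet k l t X' Y' \<cdot>\<^bsub>Val D K\<^esub> tenA (Mon M K) (rsA D \<langle>k, t\<rangle> f) (rsA D \<langle>l, t\<rangle> g)"
    by (rule bet_natural) (simp_all add: fn_iff)
  show "rsA D \<langle>k \<oplus> l \<oplus> m, t\<rangle> (atenA A (atenA A f g) h) \<cdot>\<^bsub>Val D K\<^esub> gamL k l m t X Y Z
    = gamL k l m t X' Y' Z' \<cdot>\<^bsub>Val D K\<^esub>
      tenA (Mon M K) (tenA (Mon M K) (rsA D \<langle>k, t\<rangle> f) (rsA D \<langle>l, t\<rangle> g)) (rsA D \<langle>m, t\<rangle> h)"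
    using category.comp_left[OF _ 1, of "tenA (Mon M K) (bet k l t X Y) (Id (Val D K) (rs D \<langle>m, t\<rangle> Z))"] 2
    by (simp add: gamL_def tenA_merge)
  have 1: "rsA D \<langle>k \<oplus> (l \<oplus> m), t\<rangle> (atenA A f (atenA A g h)) \<cdot>\<^bsub>Val D K\<^esub> bet k (l \<oplus> m) t X (aten D M A Y Z)
    = bet k (l \<oplus> m) t X' (aten D M A Y' Z') \<cdot>\<^bsub>Val D K\<^esub> tenA (Mon M K) (rsA D \<langle>k, t\<rangle> f) (rsA D \<langle>l \<oplus> m, t\<rangle> (atenA A g h))"
    by (rule bet_natural) (simp_all add: fn_iff)
  have 2: "rsA D \<langle>l \<oplus> m, t\<rangle> (atenA A g h) \<cdot>\<^bsub>Val D K\<^esub> bet l m t Y Z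
    = bet l m t Y' Z' \<cdot>\<^bsub>Val D K\<^esub> tenA (Mon M K) (rsA D \<langle>l, t\<rangle> g) (rsA D \<langle>m, t\<rangle> h)"
    by (rule bet_natural) (simp_all add: fn_iff)
  show "rsA D \<langle>k \<oplus> l \<oplus> m, t\<rangle> (atenA A f (atenA A g h)) \<cdot>\<^bsub>Val D K\<^esub> gamR k l m t X Y Z
    = gamR k l m t X' Y' Z' \<cdot>\<^bsub>Val D K\<^esub>
      tenA (Mon M K) (rsA D \<langle>k, t\<rangle> f) (tenA (Mon M K) (rsA D \<langle>l, t\<rangle> g) (rsA D \<langle>m, t\<rangle> h))"
    using category.comp_left[OF _ 1, of "tenA (Mon M K) (Id (Val D K) (rs D \<langle>k, t\<rangle> X)) (bet l m t Y Z)"] 2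
    by (simp add: gamR_def tenA_merge)
qed

text \<open>Tested against the universal \<open>gamL\<close>, where it becomes naturality of the
  associator of \<open>D\<close> over the generic stage.\<close>

lemma aAsc_natural:
  assumes A [simp]: "small_cat A"
    and fgh: "f \<in> Ar (Val D (\<N> \<otimes> A))" "g \<in> Ar (Val D (\<N> \<otimes> A))" "h \<in> Ar (Val D (\<N> \<otimes> A))"
    "Dom (Val D (\<N> \<otimes> A)) f = X" "Dom (Val D (\<N> \<otimes> A)) g = Y" "Dom (Val D (\<N> \<otimes> A)) h = Z"
    "Cod (Val D (\<N> \<otimes> A)) f = X'" "Cod (Val D (\<N> \<otimes> A)) g = Y'" "Cod (Val D (\<N> \<otimes> A)) h = Z'"
  shows "aA A X' Y' Z' \<cdot>\<^bsub>Val D (\<N> \<otimes> A)\<^esub> atenA A (atenA A f g) h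
    = atenA A f (atenA A g h) \<cdot>\<^bsub>Val D (\<N> \<otimes> A)\<^esub> aA A X Y Z"
proof -
  have ob [simp]: "X \<in> Ob (Val D (\<N> \<otimes> A))" "Y \<in> Ob (Val D (\<N> \<otimes> A))" "Z \<in> Ob (Val D (\<N> \<otimes> A))"
    "X' \<in> Ob (Val D (\<N> \<otimes> A))" "Y' \<in> Ob (Val D (\<N> \<otimes> A))" "Z' \<in> Ob (Val D (\<N> \<otimes> A))"
    using fgh by auto
  note [simp] = fgh
  let ?K = "tri A" and ?T = "Mon M (tri A)" and ?s = "\<langle>e1 A \<oplus> e2 A \<oplus> e3 A, et A\<rangle>"
  let ?L = "gamL (e1 A) (e2 A) (e3 A) (et A)" and ?R = "gamR (e1 A) (e2 A) (e3 A) (et A)"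
  let ?f = "rsA D \<langle>e1 A, et A\<rangle> f" and ?g = "rsA D \<langle>e2 A, et A\<rangle> g" and ?h = "rsA D \<langle>e3 A, et A\<rangle> h"
  let ?x = "rs D \<langle>e1 A, et A\<rangle> X" and ?y = "rs D \<langle>e2 A, et A\<rangle> Y" and ?z = "rs D \<langle>e3 A, et A\<rangle> Z"
  let ?x' = "rs D \<langle>e1 A, et A\<rangle> X'" and ?y' = "rs D \<langle>e2 A, et A\<rangle> Y'" and ?z' = "rs D \<langle>e3 A, et A\<rangle> Z'"
  have e: "e1 A \<in> fn ?K \<N>" "e2 A \<in> fn ?K \<N>" "e3 A \<in> fn ?K \<N>" "et A \<in> fn ?K A" by (simp_all add: fn_iff)
  note n = gam_natural[OF e fgh]
  note a = aAsc_generic(4)[OF A ob(4-6)] and b = aAsc_generic(4)[OF A ob(1-3)]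
  have as: "Asc ?T ?x' ?y' ?z' \<cdot>\<^bsub>Val D ?K\<^esub> tenA ?T (tenA ?T ?f ?g) ?h = tenA ?T ?f (tenA ?T ?g ?h) \<cdot>\<^bsub>Val D ?K\<^esub> Asc ?T ?x ?y ?z"
    by (rule Asc_natural') simp_all
  have "rsA D ?s (aA A X' Y' Z' \<cdot>\<^bsub>Val D (\<N> \<otimes> A)\<^esub> atenA A (atenA A f g) h) \<cdot>\<^bsub>Val D ?K\<^esub> ?L X Y Z
    = (rsA D ?s (aA A X' Y' Z') \<cdot>\<^bsub>Val D ?K\<^esub> ?L X' Y' Z') \<cdot>\<^bsub>Val D ?K\<^esub> tenA ?T (tenA ?T ?f ?g) ?h"
    by (simp add: n)
  also have "\<dots> = (?R X' Y' Z' \<cdot>\<^bsub>Val D ?K\<^esub> tenA ?T ?f (tenA ?T ?g ?h)) \<cdot>\<^bsub>Val D ?K\<^esub> Asc ?T ?x ?y ?z"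
    unfolding a by (simp add: as)
  also have "\<dots> = rsA D ?s (atenA A f (atenA A g h)) \<cdot>\<^bsub>Val D ?K\<^esub> (rsA D ?s (aA A X Y Z) \<cdot>\<^bsub>Val D ?K\<^esub> ?L X Y Z)"
    unfolding n(2)[symmetric] b by simp
  finally have eq: "rsA D ?s (aA A X' Y' Z' \<cdot>\<^bsub>Val D (\<N> \<otimes> A)\<^esub> atenA A (atenA A f g) h) \<cdot>\<^bsub>Val D ?K\<^esub> ?L X Y Z
    = rsA D ?s (atenA A f (atenA A g h) \<cdot>\<^bsub>Val D (\<N> \<otimes> A)\<^esub> aA A X Y Z) \<cdot>\<^bsub>Val D ?K\<^esub> ?L X Y Z" by simp
  show ?thesis
    by (rule univ_unique[OF univ_gamL[OF A ob(1-3)]]) (use eq in simp_all)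
qed

lemma lam_natural:
  assumes "n \<in> fn K \<N>" "t \<in> fn K A" "f \<in> Ar (Val D (\<N> \<otimes> A))" "Dom (Val D (\<N> \<otimes> A)) f = X" "Cod (Val D (\<N> \<otimes> A)) f = X'"
  shows "rsA D \<langle>n, t\<rangle> (atenA A (Id (Val D (\<N> \<otimes> A)) (aU A)) f) \<cdot>\<^bsub>Val D K\<^esub> lam n t X
    = lam n t X' \<cdot>\<^bsub>Val D K\<^esub> tenA (Mon M K) (Id (Val D K) (Unt (Mon M K))) (rsA D \<langle>n, t\<rangle> f)"
    "rsA D \<langle>n, t\<rangle> (atenA A f (Id (Val D (\<N> \<otimes> A)) (aU A))) \<cdot>\<^bsub>Val D K\<^esub> rho n t X
    = rho n t X' \<cdot>\<^bsub>Val D K\<^esub> tenA (Mon M K) (rsA D \<langle>n, t\<rangle> f) (Id (Val D K) (Unt (Mon M K)))"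
proof -
  have "small_cat A" using assms(2) by (simp add: fn_iff)
  then have [simp]: "X \<in> Ob (Val D (\<N> \<otimes> A))" "X' \<in> Ob (Val D (\<N> \<otimes> A))" using assms(3-5) by auto
  note [simp] = assms[unfolded fn_iff]
  let ?I = "Id (Val D (\<N> \<otimes> A)) (aU A)"
  have 1: "rsA D \<langle>zer K \<oplus> n, t\<rangle> (atenA A ?I f) \<cdot>\<^bsub>Val D K\<^esub> bet (zer K) n t (aU A) X
    = bet (zer K) n t (aU A) X' \<cdot>\<^bsub>Val D K\<^esub> tenA (Mon M K) (rsA D \<langle>zer K, t\<rangle> ?I) (rsA D \<langle>n, t\<rangle> f)"
    by (rule bet_natural) (simp_all add: fn_iff)
  show "rsA D \<langle>n, t\<rangle> (atenA A ?I f) \<cdot>\<^bsub>Val D K\<^esub> lam n t X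
    = lam n t X' \<cdot>\<^bsub>Val D K\<^esub> tenA (Mon M K) (Id (Val D K) (Unt (Mon M K))) (rsA D \<langle>n, t\<rangle> f)"
    using category.comp_left[OF _ 1, of "tenA (Mon M K) (ups K) (Id (Val D K) (rs D \<langle>n, t\<rangle> X))"]
    by (simp add: lam_def tenA_merge)
  have 2: "rsA D \<langle>n \<oplus> zer K, t\<rangle> (atenA A f ?I) \<cdot>\<^bsub>Val D K\<^esub> bet n (zer K) t X (aU A)
    = bet n (zer K) t X' (aU A) \<cdot>\<^bsub>Val D K\<^esub> tenA (Mon M K) (rsA D \<langle>n, t\<rangle> f) (rsA D \<langle>zer K, t\<rangle> ?I)"
    by (rule bet_natural) (simp_all add: fn_iff)
  show "rsA D \<langle>n, t\<rangle> (atenA A f ?I) \<cdot>\<^bsub>Val D K\<^esub> rho n t X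
    = rho n t X' \<cdot>\<^bsub>Val D K\<^esub> tenA (Mon M K) (rsA D \<langle>n, t\<rangle> f) (Id (Val D K) (Unt (Mon M K)))"
    using category.comp_left[OF _ 2, of "tenA (Mon M K) (Id (Val D K) (rs D \<langle>n, t\<rangle> X)) (ups K)"]
    by (simp add: rho_def tenA_merge)
qed

lemma Lun_natural':
  assumes "small_cat K" "f \<in> Ar (Val D K)" "Dom (Val D K) f = X" "Cod (Val D K) f = X'"
  shows "Lun (Mon M K) X' \<cdot>\<^bsub>Val D K\<^esub> tenA (Mon M K) (Id (Val D K) (Unt (Mon M K))) f = f \<cdot>\<^bsub>Val D K\<^esub> Lun (Mon M K) X"
    "Run (Mon M K) X' \<cdot>\<^bsub>Val D K\<^esub> tenA (Mon M K) f (Id (Val D K) (Unt (Mon M K))) = f \<cdot>\<^bsub>Val D K\<^esub> Run (Mon M K) X"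
  using monoidal_category.Lun_natural[OF Mon_monoidal[OF assms(1)], of f X X']
    monoidal_category.Run_natural[OF Mon_monoidal[OF assms(1)], of f X X'] assms by (simp_all add: hom_iff)

text \<open>Cancelling the isomorphisms \<open>lam\<close> and \<open>rho\<close> leaves naturality
  of the unitors of \<open>D\<close>.\<close>

lemma aLun_natural:
  assumes A [simp]: "small_cat A" and f: "f \<in> Ar (Val D (\<N> \<otimes> A))" "Dom (Val D (\<N> \<otimes> A)) f = X" "Cod (Val D (\<N> \<otimes> A)) f = X'"
  shows "aLun D M A X' \<cdot>\<^bsub>Val D (\<N> \<otimes> A)\<^esub> atenA A (Id (Val D (\<N> \<otimes> A)) (aU A)) f = f \<cdot>\<^bsub>Val D (\<N> \<otimes> A)\<^esub> aLun D M A X"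
    "aRun D M A X' \<cdot>\<^bsub>Val D (\<N> \<otimes> A)\<^esub> atenA A f (Id (Val D (\<N> \<otimes> A)) (aU A)) = f \<cdot>\<^bsub>Val D (\<N> \<otimes> A)\<^esub> aRun D M A X"
proof -
  have ob [simp]: "X \<in> Ob (Val D (\<N> \<otimes> A))" "X' \<in> Ob (Val D (\<N> \<otimes> A))" using f by auto
  note [simp] = f
  let ?K = "\<N> \<otimes> A" and ?T = "Mon M (\<N> \<otimes> A)" and ?n = "pr1 \<N> A" and ?t = "pr2 \<N> A"
  let ?I = "Id (Val D ?K) (aU A)" and ?E = "Id (Val D ?K) (Unt ?T)"
  have f1: "?n \<in> fn ?K \<N>" "?t \<in> fn ?K A" by (simp_all add: fn_iff)
  have n: "atenA A ?I f \<cdot>\<^bsub>Val D ?K\<^esub> lam ?n ?t X = lam ?n ?t X' \<cdot>\<^bsub>Val D ?K\<^esub> tenA ?T ?E f"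
    "atenA A f ?I \<cdot>\<^bsub>Val D ?K\<^esub> rho ?n ?t X = rho ?n ?t X' \<cdot>\<^bsub>Val D ?K\<^esub> tenA ?T f ?E"
    using lam_natural[OF f1 f] by simp_all
  note l = aLun_generic(4)[OF A ob(1)] aLun_generic(4)[OF A ob(2)] and r = aRun_generic(4)[OF A ob(1)] aRun_generic(4)[OF A ob(2)]
  have nat: "Lun ?T X' \<cdot>\<^bsub>Val D ?K\<^esub> tenA ?T ?E f = f \<cdot>\<^bsub>Val D ?K\<^esub> Lun ?T X"
    "Run ?T X' \<cdot>\<^bsub>Val D ?K\<^esub> tenA ?T f ?E = f \<cdot>\<^bsub>Val D ?K\<^esub> Run ?T X"
    by (rule Lun_natural'; simp)+
  have "(aLun D M A X' \<cdot>\<^bsub>Val D ?K\<^esub> atenA A ?I f) \<cdot>\<^bsub>Val D ?K\<^esub> lam ?n ?t X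
    = (aLun D M A X' \<cdot>\<^bsub>Val D ?K\<^esub> lam ?n ?t X') \<cdot>\<^bsub>Val D ?K\<^esub> tenA ?T ?E f" by (simp add: n)
  also have "\<dots> = f \<cdot>\<^bsub>Val D ?K\<^esub> (aLun D M A X \<cdot>\<^bsub>Val D ?K\<^esub> lam ?n ?t X)" unfolding l nat ..
  finally have 1: "(aLun D M A X' \<cdot>\<^bsub>Val D ?K\<^esub> atenA A ?I f) \<cdot>\<^bsub>Val D ?K\<^esub> lam ?n ?t X
    = (f \<cdot>\<^bsub>Val D ?K\<^esub> aLun D M A X) \<cdot>\<^bsub>Val D ?K\<^esub> lam ?n ?t X" by simp
  show "aLun D M A X' \<cdot>\<^bsub>Val D ?K\<^esub> atenA A ?I f = f \<cdot>\<^bsub>Val D ?K\<^esub> aLun D M A X"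
    by (rule category.iso_cancel_right[OF _ iso_lam[OF A ob(1)] _ _ _ _ 1]) simp_all
  have "(aRun D M A X' \<cdot>\<^bsub>Val D ?K\<^esub> atenA A f ?I) \<cdot>\<^bsub>Val D ?K\<^esub> rho ?n ?t X
    = (aRun D M A X' \<cdot>\<^bsub>Val D ?K\<^esub> rho ?n ?t X') \<cdot>\<^bsub>Val D ?K\<^esub> tenA ?T f ?E" by (simp add: n)
  also have "\<dots> = f \<cdot>\<^bsub>Val D ?K\<^esub> (aRun D M A X \<cdot>\<^bsub>Val D ?K\<^esub> rho ?n ?t X)" unfolding r nat ..
  finally have 2: "(aRun D M A X' \<cdot>\<^bsub>Val D ?K\<^esub> atenA A f ?I) \<cdot>\<^bsub>Val D ?K\<^esub> rho ?n ?t X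
    = (f \<cdot>\<^bsub>Val D ?K\<^esub> aRun D M A X) \<cdot>\<^bsub>Val D ?K\<^esub> rho ?n ?t X" by simp
  show "aRun D M A X' \<cdot>\<^bsub>Val D ?K\<^esub> atenA A f ?I = f \<cdot>\<^bsub>Val D ?K\<^esub> aRun D M A X"
    by (rule category.iso_cancel_right[OF _ iso_rho[OF A ob(1)] _ _ _ _ 2]) simp_all
qed

text \<open>After composition with the universal fourfold multiplication, each path becomes
  \<open>?goal\<close> preceded by the corresponding path in the pentagon of the category over
  \<open>K\<close>.\<close>

lemma pentagon_affine:
  assumes A [simp]: "small_cat A" and ob [simp]: "W \<in> Ob (Val D (\<N> \<otimes> A))" "X \<in> Ob (Val D (\<N> \<otimes> A))"
    "Y \<in> Ob (Val D (\<N> \<otimes> A))" "Z \<in> Ob (Val D (\<N> \<otimes> A))"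
  shows "aA A W X (aten D M A Y Z) \<cdot>\<^bsub>Val D (\<N> \<otimes> A)\<^esub> aA A (aten D M A W X) Y Z
    = atenA A (Id (Val D (\<N> \<otimes> A)) W) (aA A X Y Z) \<cdot>\<^bsub>Val D (\<N> \<otimes> A)\<^esub>
      (aA A W (aten D M A X Y) Z \<cdot>\<^bsub>Val D (\<N> \<otimes> A)\<^esub> atenA A (aA A W X Y) (Id (Val D (\<N> \<otimes> A)) Z))"
proof -
  obtain K j k l m t where f: "j \<in> fn K \<N>" "k \<in> fn K \<N>" "l \<in> fn K \<N>" "m \<in> fn K \<N>" "t \<in> fn K A"
    and u: "univ D \<langle>j \<oplus> k \<oplus> l \<oplus> m, t\<rangle> (aten D M A (aten D M A (aten D M A W X) Y) Z) (quad j k l m t W X Y Z)"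
    by (rule univ_quad[OF A ob])
  note [simp] = f[unfolded fn_iff]
  have s: "j \<oplus> k \<in> fn K \<N>" "k \<oplus> l \<in> fn K \<N>" "l \<oplus> m \<in> fn K \<N>" "j \<oplus> k \<oplus> l \<in> fn K \<N>" "k \<oplus> l \<oplus> m \<in> fn K \<N>"
    by (simp_all add: fn_iff)
  let ?C = "Val D K" and ?T = "Mon M K" and ?s = "\<langle>j \<oplus> k \<oplus> l \<oplus> m, t\<rangle>" and ?t = "aten D M A" and ?C' = "Val D (\<N> \<otimes> A)"
  let ?w = "rs D \<langle>j, t\<rangle> W" and ?x = "rs D \<langle>k, t\<rangle> X" and ?y = "rs D \<langle>l, t\<rangle> Y" and ?z = "rs D \<langle>m, t\<rangle> Z"
  let ?q = "quad j k l m t W X Y Z"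
  let ?i = "Id ?C"
  let ?goal = "bet j (k \<oplus> l \<oplus> m) t W (?t X (?t Y Z)) \<cdot>\<^bsub>?C\<^esub> tenA ?T (?i ?w) (gamR k l m t X Y Z)"
  \<comment> \<open>\<open>quad\<close> also factors through \<open>gamL\<close> with the sum
    \<open>j \<oplus> k\<close> as first element, the shape on which the first associator of the
    short path acts.\<close>
  have q1: "?q = gamL (j \<oplus> k) l m t (?t W X) Y Z \<cdot>\<^bsub>?C\<^esub> tenA ?T (tenA ?T (bet j k t W X) (?i ?y)) (?i ?z)"
    by (simp add: quad_def gamL_def tenA_merge)
  note a1 = aAsc_at[OF s(1) f(3-5), of "?t W X" Y Z]
  have n1: "Asc ?T (rs D \<langle>j \<oplus> k, t\<rangle> (?t W X)) ?y ?z \<cdot>\<^bsub>?C\<^esub> tenA ?T (tenA ?T (bet j k t W X) (?i ?y)) (?i ?z)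
    = tenA ?T (bet j k t W X) (tenA ?T (?i ?y) (?i ?z)) \<cdot>\<^bsub>?C\<^esub> Asc ?T (ten ?T ?w ?x) ?y ?z"
    by (rule Asc_natural') simp_all
  \<comment> \<open>Interchange: the products \<open>W X\<close> and \<open>Y Z\<close> may be
    formed in either order. This exposes the shape for the second associator.\<close>
  have g1: "gamR (j \<oplus> k) l m t (?t W X) Y Z \<cdot>\<^bsub>?C\<^esub> tenA ?T (bet j k t W X) (tenA ?T (?i ?y) (?i ?z))
    = gamL j k (l \<oplus> m) t W X (?t Y Z) \<cdot>\<^bsub>?C\<^esub> tenA ?T (?i (ten ?T ?w ?x)) (bet l m t Y Z)"
    by (simp add: gamR_def gamL_def tenA_merge)
  note a2 = aAsc_at[OF f(1,2) s(3) f(5), of W X "?t Y Z"]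
  have n2: "Asc ?T ?w ?x (rs D \<langle>l \<oplus> m, t\<rangle> (?t Y Z)) \<cdot>\<^bsub>?C\<^esub> tenA ?T (tenA ?T (?i ?w) (?i ?x)) (bet l m t Y Z)
    = tenA ?T (?i ?w) (tenA ?T (?i ?x) (bet l m t Y Z)) \<cdot>\<^bsub>?C\<^esub> Asc ?T ?w ?x (ten ?T ?y ?z)"
    by (rule Asc_natural') simp_all
  have g2: "gamR j k (l \<oplus> m) t W X (?t Y Z) \<cdot>\<^bsub>?C\<^esub> tenA ?T (?i ?w) (tenA ?T (?i ?x) (bet l m t Y Z)) = ?goal"
    by (simp add: gamR_def tenA_merge)
  have "rsA D ?s (aA A W X (?t Y Z) \<cdot>\<^bsub>?C'\<^esub> aA A (?t W X) Y Z) \<cdot>\<^bsub>?C\<^esub> ?q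
    = rsA D ?s (aA A W X (?t Y Z)) \<cdot>\<^bsub>?C\<^esub> ((rsA D \<langle>(j \<oplus> k) \<oplus> l \<oplus> m, t\<rangle> (aA A (?t W X) Y Z) \<cdot>\<^bsub>?C\<^esub> gamL (j \<oplus> k) l m t (?t W X) Y Z) \<cdot>\<^bsub>?C\<^esub>
        tenA ?T (tenA ?T (bet j k t W X) (?i ?y)) (?i ?z))"
    unfolding q1 by simp
  also have "\<dots> = rsA D ?s (aA A W X (?t Y Z)) \<cdot>\<^bsub>?C\<^esub> (gamR (j \<oplus> k) l m t (?t W X) Y Z \<cdot>\<^bsub>?C\<^esub> (Asc ?T (rs D \<langle>j \<oplus> k, t\<rangle> (?t W X)) ?y ?z
       \<cdot>\<^bsub>?C\<^esub> tenA ?T (tenA ?T (bet j k t W X) (?i ?y)) (?i ?z)))"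
    by (subst a1) simp_all
  also have "\<dots> = rsA D ?s (aA A W X (?t Y Z)) \<cdot>\<^bsub>?C\<^esub> ((gamR (j \<oplus> k) l m t (?t W X) Y Z \<cdot>\<^bsub>?C\<^esub>
       tenA ?T (bet j k t W X) (tenA ?T (?i ?y) (?i ?z))) \<cdot>\<^bsub>?C\<^esub> Asc ?T (ten ?T ?w ?x) ?y ?z)"
    unfolding n1 by (simp del: ten_rules(5))
  also have "\<dots> = (rsA D ?s (aA A W X (?t Y Z)) \<cdot>\<^bsub>?C\<^esub> gamL j k (l \<oplus> m) t W X (?t Y Z)) \<cdot>\<^bsub>?C\<^esub>
       (tenA ?T (?i (ten ?T ?w ?x)) (bet l m t Y Z) \<cdot>\<^bsub>?C\<^esub> Asc ?T (ten ?T ?w ?x) ?y ?z)"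
    unfolding g1 by simp
  also have "\<dots> = gamR j k (l \<oplus> m) t W X (?t Y Z) \<cdot>\<^bsub>?C\<^esub> ((Asc ?T ?w ?x (rs D \<langle>l \<oplus> m, t\<rangle> (?t Y Z)) \<cdot>\<^bsub>?C\<^esub>
       tenA ?T (tenA ?T (?i ?w) (?i ?x)) (bet l m t Y Z)) \<cdot>\<^bsub>?C\<^esub> Asc ?T (ten ?T ?w ?x) ?y ?z)"
    by (subst a2) simp_all
  also have "\<dots> = (gamR j k (l \<oplus> m) t W X (?t Y Z) \<cdot>\<^bsub>?C\<^esub> tenA ?T (?i ?w) (tenA ?T (?i ?x) (bet l m t Y Z))) \<cdot>\<^bsub>?C\<^esub>
       (Asc ?T ?w ?x (ten ?T ?y ?z) \<cdot>\<^bsub>?C\<^esub> Asc ?T (ten ?T ?w ?x) ?y ?z)"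
    unfolding n2 by simp
  also have "\<dots> = ?goal \<cdot>\<^bsub>?C\<^esub> (Asc ?T ?w ?x (ten ?T ?y ?z) \<cdot>\<^bsub>?C\<^esub> Asc ?T (ten ?T ?w ?x) ?y ?z)"
    unfolding g2 ..
  \<comment> \<open>The pentagon in the category over \<open>K\<close>, the only place where it
    enters.\<close>
  also have "Asc ?T ?w ?x (ten ?T ?y ?z) \<cdot>\<^bsub>?C\<^esub> Asc ?T (ten ?T ?w ?x) ?y ?z
    = tenA ?T (?i ?w) (Asc ?T ?x ?y ?z) \<cdot>\<^bsub>?C\<^esub> (Asc ?T ?w (ten ?T ?x ?y) ?z \<cdot>\<^bsub>?C\<^esub> tenA ?T (Asc ?T ?w ?x ?y) (?i ?z))"
    by (rule monoidal_category.pentagon[OF Mon_monoidal]) simp_all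
  finally have L: "rsA D ?s (aA A W X (?t Y Z) \<cdot>\<^bsub>?C'\<^esub> aA A (?t W X) Y Z) \<cdot>\<^bsub>?C\<^esub> ?q = ?goal \<cdot>\<^bsub>?C\<^esub>
    (tenA ?T (?i ?w) (Asc ?T ?x ?y ?z) \<cdot>\<^bsub>?C\<^esub> (Asc ?T ?w (ten ?T ?x ?y) ?z \<cdot>\<^bsub>?C\<^esub> tenA ?T (Asc ?T ?w ?x ?y) (?i ?z)))" .
  \<comment> \<open>The long path: its three arrows are pushed through the multiplication in turn,
    the outer two by naturality of \<open>bet\<close>, the middle one by
    \<open>aAsc_at\<close>.\<close>
  have b1: "rsA D \<langle>(j \<oplus> k \<oplus> l) \<oplus> m, t\<rangle> (atenA A (aA A W X Y) (Id ?C' Z)) \<cdot>\<^bsub>?C\<^esub> bet (j \<oplus> k \<oplus> l) m t (?t (?t W X) Y) Z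
    = bet (j \<oplus> k \<oplus> l) m t (?t W (?t X Y)) Z \<cdot>\<^bsub>?C\<^esub> tenA ?T (rsA D \<langle>j \<oplus> k \<oplus> l, t\<rangle> (aA A W X Y)) (rsA D \<langle>m, t\<rangle> (Id ?C' Z))"
    by (rule bet_natural) (simp_all add: fn_iff)
  note c1 = aAsc_at[OF f(1-3,5), of W X Y]
  have q2: "bet (j \<oplus> k \<oplus> l) m t (?t W (?t X Y)) Z \<cdot>\<^bsub>?C\<^esub> tenA ?T (gamR j k l t W X Y \<cdot>\<^bsub>?C\<^esub> Asc ?T ?w ?x ?y) (?i ?z)
    = gamL j (k \<oplus> l) m t W (?t X Y) Z \<cdot>\<^bsub>?C\<^esub> (tenA ?T (tenA ?T (?i ?w) (bet k l t X Y)) (?i ?z) \<cdot>\<^bsub>?C\<^esub> tenA ?T (Asc ?T ?w ?x ?y) (?i ?z))"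
    by (simp add: gamR_def gamL_def tenA_merge)
  have c2: "rsA D \<langle>j \<oplus> (k \<oplus> l) \<oplus> m, t\<rangle> (aA A W (?t X Y) Z) \<cdot>\<^bsub>?C\<^esub> gamL j (k \<oplus> l) m t W (?t X Y) Z
    = gamR j (k \<oplus> l) m t W (?t X Y) Z \<cdot>\<^bsub>?C\<^esub> Asc ?T ?w (rs D \<langle>k \<oplus> l, t\<rangle> (?t X Y)) ?z"
    by (rule aAsc_at) (simp_all add: fn_iff)
  have n3: "Asc ?T ?w (rs D \<langle>k \<oplus> l, t\<rangle> (?t X Y)) ?z \<cdot>\<^bsub>?C\<^esub> tenA ?T (tenA ?T (?i ?w) (bet k l t X Y)) (?i ?z)
    = tenA ?T (?i ?w) (tenA ?T (bet k l t X Y) (?i ?z)) \<cdot>\<^bsub>?C\<^esub> Asc ?T ?w (ten ?T ?x ?y) ?z"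
    by (rule Asc_natural') simp_all
  have g3: "gamR j (k \<oplus> l) m t W (?t X Y) Z \<cdot>\<^bsub>?C\<^esub> tenA ?T (?i ?w) (tenA ?T (bet k l t X Y) (?i ?z))
    = bet j (k \<oplus> l \<oplus> m) t W (?t (?t X Y) Z) \<cdot>\<^bsub>?C\<^esub> tenA ?T (?i ?w) (gamL k l m t X Y Z)"
    by (simp add: gamR_def gamL_def tenA_merge)
  have b2: "rsA D \<langle>j \<oplus> (k \<oplus> l \<oplus> m), t\<rangle> (atenA A (Id ?C' W) (aA A X Y Z)) \<cdot>\<^bsub>?C\<^esub> bet j (k \<oplus> l \<oplus> m) t W (?t (?t X Y) Z)
    = bet j (k \<oplus> l \<oplus> m) t W (?t X (?t Y Z)) \<cdot>\<^bsub>?C\<^esub> tenA ?T (rsA D \<langle>j, t\<rangle> (Id ?C' W)) (rsA D \<langle>k \<oplus> l \<oplus> m, t\<rangle> (aA A X Y Z))"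
    by (rule bet_natural) (simp_all add: fn_iff)
  have b2': "rsA D ?s (atenA A (Id ?C' W) (aA A X Y Z)) \<cdot>\<^bsub>?C\<^esub> (bet j (k \<oplus> l \<oplus> m) t W (?t (?t X Y) Z) \<cdot>\<^bsub>?C\<^esub> tenA ?T (?i ?w) (gamL k l m t X Y Z))
    = ?goal \<cdot>\<^bsub>?C\<^esub> tenA ?T (?i ?w) (Asc ?T ?x ?y ?z)"
    using category.comp_left[OF _ b2, of "tenA ?T (?i ?w) (gamL k l m t X Y Z)"]
    by (simp add: tenA_merge aAsc_at[OF f(2-5)])
  have "rsA D ?s (atenA A (aA A W X Y) (Id ?C' Z)) \<cdot>\<^bsub>?C\<^esub> ?q
    = bet (j \<oplus> k \<oplus> l) m t (?t W (?t X Y)) Z \<cdot>\<^bsub>?C\<^esub> tenA ?T (gamR j k l t W X Y \<cdot>\<^bsub>?C\<^esub> Asc ?T ?w ?x ?y) (?i ?z)"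
    using category.comp_left[OF _ b1, of "tenA ?T (gamL j k l t W X Y) (?i ?z)"]
    by (simp add: quad_def tenA_merge c1)
  then have e1: "rsA D ?s (atenA A (aA A W X Y) (Id ?C' Z)) \<cdot>\<^bsub>?C\<^esub> ?q
    = gamL j (k \<oplus> l) m t W (?t X Y) Z \<cdot>\<^bsub>?C\<^esub> (tenA ?T (tenA ?T (?i ?w) (bet k l t X Y)) (?i ?z) \<cdot>\<^bsub>?C\<^esub> tenA ?T (Asc ?T ?w ?x ?y) (?i ?z))"
    unfolding q2 .
  have Q [simp]: "?q \<in> Ar ?C" "Cod ?C ?q = rs D ?s (?t (?t (?t W X) Y) Z)" using univD[OF u] by simp_all
  have "rsA D ?s (atenA A (Id ?C' W) (aA A X Y Z) \<cdot>\<^bsub>?C'\<^esub> (aA A W (?t X Y) Z \<cdot>\<^bsub>?C'\<^esub> atenA A (aA A W X Y) (Id ?C' Z))) \<cdot>\<^bsub>?C\<^esub> ?q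
    = rsA D ?s (atenA A (Id ?C' W) (aA A X Y Z)) \<cdot>\<^bsub>?C\<^esub> (rsA D ?s (aA A W (?t X Y) Z) \<cdot>\<^bsub>?C\<^esub> (rsA D ?s (atenA A (aA A W X Y) (Id ?C' Z)) \<cdot>\<^bsub>?C\<^esub> ?q))"
    by simp
  also have "\<dots> = rsA D ?s (atenA A (Id ?C' W) (aA A X Y Z)) \<cdot>\<^bsub>?C\<^esub> ((rsA D \<langle>j \<oplus> (k \<oplus> l) \<oplus> m, t\<rangle> (aA A W (?t X Y) Z) \<cdot>\<^bsub>?C\<^esub> gamL j (k \<oplus> l) m t W (?t X Y) Z)
      \<cdot>\<^bsub>?C\<^esub> (tenA ?T (tenA ?T (?i ?w) (bet k l t X Y)) (?i ?z) \<cdot>\<^bsub>?C\<^esub> tenA ?T (Asc ?T ?w ?x ?y) (?i ?z)))"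
    unfolding e1 by simp
  also have "\<dots> = rsA D ?s (atenA A (Id ?C' W) (aA A X Y Z)) \<cdot>\<^bsub>?C\<^esub> (gamR j (k \<oplus> l) m t W (?t X Y) Z \<cdot>\<^bsub>?C\<^esub>
      ((Asc ?T ?w (rs D \<langle>k \<oplus> l, t\<rangle> (?t X Y)) ?z \<cdot>\<^bsub>?C\<^esub> tenA ?T (tenA ?T (?i ?w) (bet k l t X Y)) (?i ?z)) \<cdot>\<^bsub>?C\<^esub> tenA ?T (Asc ?T ?w ?x ?y) (?i ?z)))"
    unfolding c2 by simp
  also have "\<dots> = rsA D ?s (atenA A (Id ?C' W) (aA A X Y Z)) \<cdot>\<^bsub>?C\<^esub> ((gamR j (k \<oplus> l) m t W (?t X Y) Z \<cdot>\<^bsub>?C\<^esub>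
      tenA ?T (?i ?w) (tenA ?T (bet k l t X Y) (?i ?z))) \<cdot>\<^bsub>?C\<^esub> (Asc ?T ?w (ten ?T ?x ?y) ?z \<cdot>\<^bsub>?C\<^esub> tenA ?T (Asc ?T ?w ?x ?y) (?i ?z)))"
    unfolding n3 by simp
  also have "\<dots> = (rsA D ?s (atenA A (Id ?C' W) (aA A X Y Z)) \<cdot>\<^bsub>?C\<^esub> (bet j (k \<oplus> l \<oplus> m) t W (?t (?t X Y) Z) \<cdot>\<^bsub>?C\<^esub> tenA ?T (?i ?w) (gamL k l m t X Y Z)))
       \<cdot>\<^bsub>?C\<^esub> (Asc ?T ?w (ten ?T ?x ?y) ?z \<cdot>\<^bsub>?C\<^esub> tenA ?T (Asc ?T ?w ?x ?y) (?i ?z))"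
    unfolding g3 by simp
  also have "\<dots> = ?goal \<cdot>\<^bsub>?C\<^esub> (tenA ?T (?i ?w) (Asc ?T ?x ?y ?z) \<cdot>\<^bsub>?C\<^esub> (Asc ?T ?w (ten ?T ?x ?y) ?z \<cdot>\<^bsub>?C\<^esub> tenA ?T (Asc ?T ?w ?x ?y) (?i ?z)))"
    unfolding b2' by simp
  finally have R: "rsA D ?s (aA A W X (?t Y Z) \<cdot>\<^bsub>?C'\<^esub> aA A (?t W X) Y Z) \<cdot>\<^bsub>?C\<^esub> ?q
    = rsA D ?s (atenA A (Id ?C' W) (aA A X Y Z) \<cdot>\<^bsub>?C'\<^esub> (aA A W (?t X Y) Z \<cdot>\<^bsub>?C'\<^esub> atenA A (aA A W X Y) (Id ?C' Z))) \<cdot>\<^bsub>?C\<^esub> ?q"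
    unfolding L by simp
  show ?thesis by (rule univ_unique[OF u]) (use R in simp_all)
qed

text \<open>Restrictions of isomorphisms and the constraints are isomorphisms, so invertibility
  spreads from the generic element to all others.\<close>

lemma iso_lam_rho_at:
  assumes "n \<in> fn K \<N>" "t \<in> fn K A" "X \<in> Ob (Val D (\<N> \<otimes> A))"
  shows "iso (Val D K) (lam n t X)" "iso (Val D K) (rho n t X)"
proof -
  note [simp] = assms[unfolded fn_iff]
  let ?h = "\<langle>n, t\<rangle>" and ?C = "Val D K" and ?U = "Unt (Mon M (\<N> \<otimes> A))" and ?i = "Id (Val D K) (rs D \<langle>n, t\<rangle> X)"
  have A: "small_cat A" using assms(2) by (simp add: fn_iff)
  have "iso ?C (rsA D ?h (lam (pr1 \<N> A) (pr2 \<N> A) X) \<cdot>\<^bsub>?C\<^esub> (Mu M ?h ?U X \<cdot>\<^bsub>?C\<^esub> tenA (Mon M K) (Mu0 M ?h) ?i))"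
    by (rule iso_comp_Val[OF iso_comp_Val[OF iso_tenA[OF Mu0_iso iso_Id_Val] Mu_iso] rsA_iso[OF _ iso_lam[OF A assms(3)]]])
       simp_all
  moreover have "rsA D ?h (lam (pr1 \<N> A) (pr2 \<N> A) X) \<cdot>\<^bsub>?C\<^esub> (Mu M ?h ?U X \<cdot>\<^bsub>?C\<^esub> tenA (Mon M K) (Mu0 M ?h) ?i) = lam n t X"
    using lam_restrict[of "pr1 \<N> A" "\<N> \<otimes> A" "pr2 \<N> A" A ?h K X] by (simp add: fn_iff)
  ultimately show "iso ?C (lam n t X)" by simp
  have "iso ?C (rsA D ?h (rho (pr1 \<N> A) (pr2 \<N> A) X) \<cdot>\<^bsub>?C\<^esub> (Mu M ?h X ?U \<cdot>\<^bsub>?C\<^esub> tenA (Mon M K) ?i (Mu0 M ?h)))"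
    by (rule iso_comp_Val[OF iso_comp_Val[OF iso_tenA[OF iso_Id_Val Mu0_iso] Mu_iso] rsA_iso[OF _ iso_rho[OF A assms(3)]]])
       simp_all
  moreover have "rsA D ?h (rho (pr1 \<N> A) (pr2 \<N> A) X) \<cdot>\<^bsub>?C\<^esub> (Mu M ?h X ?U \<cdot>\<^bsub>?C\<^esub> tenA (Mon M K) ?i (Mu0 M ?h)) = rho n t X"
    using rho_restrict[of "pr1 \<N> A" "\<N> \<otimes> A" "pr2 \<N> A" A ?h K X] by (simp add: fn_iff)
  ultimately show "iso ?C (rho n t X)" by simp
qed

text \<open>The test arrow \<open>q\<close> inserts the unit element in the middle. It is
  \<open>bil\<close> preceded by \<open>rho \<otimes> 1\<close>, hence universal, and at the same
  time a composite with \<open>gamL\<close> at \<open>(k, 0, m)\<close>, where the associator is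
  known.\<close>

lemma triangle_affine:
  assumes A [simp]: "small_cat A" and ob [simp]: "X \<in> Ob (Val D (\<N> \<otimes> A))" "Y \<in> Ob (Val D (\<N> \<otimes> A))"
  shows "atenA A (Id (Val D (\<N> \<otimes> A)) X) (aLun D M A Y) \<cdot>\<^bsub>Val D (\<N> \<otimes> A)\<^esub> aA A X (aU A) Y
    = atenA A (aRun D M A X) (Id (Val D (\<N> \<otimes> A)) Y)"
proof -
  let ?K = "(\<N> \<otimes> \<N>) \<otimes> A"
  define k m t where "k = pr1 \<N> \<N> \<odot> pr1 (\<N> \<otimes> \<N>) A" and "m = pr2 \<N> \<N> \<odot> pr1 (\<N> \<otimes> \<N>) A" and "t = pr2 (\<N> \<otimes> \<N>) A"
  have f: "k \<in> fn ?K \<N>" "m \<in> fn ?K \<N>" "t \<in> fn ?K A" by (simp_all add: fn_iff k_def m_def t_def)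
  note [simp] = f[unfolded fn_iff]
  have z: "zer ?K \<in> fn ?K \<N>" by (simp add: fn_iff)
  let ?C = "Val D ?K" and ?T = "Mon M ?K" and ?s = "\<langle>k \<oplus> m, t\<rangle>" and ?t = "aten D M A" and ?C' = "Val D (\<N> \<otimes> A)"
  let ?x = "rs D \<langle>k, t\<rangle> X" and ?y = "rs D \<langle>m, t\<rangle> Y" and ?i = "Id ?C" and ?u = "Unt (Mon M ?K)"
  have s: "?s = plus_times A" by (simp add: k_def m_def t_def cart)
  have b: "bet k m t V Y = bil D M A V Y" if "V \<in> Ob ?C'" for V
    using bet_generic[OF A that ob(2)] by (simp add: k_def m_def t_def)
  have u1: "univ D ?s (?t (?t X (aU A)) Y) (bet k m t (?t X (aU A)) Y)"
    unfolding s by (subst b) (simp_all add: univ_bil)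
  have i: "iso ?C (tenA ?T (rho k t X) (?i ?y))"
    by (rule iso_tenA[OF iso_lam_rho_at(2)[OF f(1,3) ob(1)] iso_Id_Val]) simp_all
  define q where "q = bet k m t (?t X (aU A)) Y \<cdot>\<^bsub>?C\<^esub> tenA ?T (rho k t X) (?i ?y)"
  have u: "univ D ?s (?t (?t X (aU A)) Y) q"
    unfolding q_def by (rule univ_pre[OF u1 i]) simp_all
  have q: "q = gamL k (zer ?K) m t X (aU A) Y \<cdot>\<^bsub>?C\<^esub> tenA ?T (tenA ?T (?i ?x) (ups ?K)) (?i ?y)"
    by (simp add: q_def gamL_def rho_def tenA_merge)
  have a: "rsA D ?s (aA A X (aU A) Y) \<cdot>\<^bsub>?C\<^esub> gamL k (zer ?K) m t X (aU A) Y
    = gamR k (zer ?K) m t X (aU A) Y \<cdot>\<^bsub>?C\<^esub> Asc ?T ?x (rs D \<langle>zer ?K, t\<rangle> (aU A)) ?y"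
    using aAsc_at[OF f(1) z f(2,3), of X "aU A" Y] by simp
  have n: "Asc ?T ?x (rs D \<langle>zer ?K, t\<rangle> (aU A)) ?y \<cdot>\<^bsub>?C\<^esub> tenA ?T (tenA ?T (?i ?x) (ups ?K)) (?i ?y)
    = tenA ?T (?i ?x) (tenA ?T (ups ?K) (?i ?y)) \<cdot>\<^bsub>?C\<^esub> Asc ?T ?x ?u ?y"
    by (rule Asc_natural') simp_all
  have g: "gamR k (zer ?K) m t X (aU A) Y \<cdot>\<^bsub>?C\<^esub> tenA ?T (?i ?x) (tenA ?T (ups ?K) (?i ?y))
    = bet k m t X (?t (aU A) Y) \<cdot>\<^bsub>?C\<^esub> tenA ?T (?i ?x) (lam m t Y)"
    by (simp add: gamR_def lam_def tenA_merge)
  have b1: "rsA D ?s (atenA A (Id ?C' X) (aLun D M A Y)) \<cdot>\<^bsub>?C\<^esub> bet k m t X (?t (aU A) Y)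
    = bet k m t X Y \<cdot>\<^bsub>?C\<^esub> tenA ?T (rsA D \<langle>k, t\<rangle> (Id ?C' X)) (rsA D \<langle>m, t\<rangle> (aLun D M A Y))"
    by (rule bet_natural) (simp_all add: fn_iff)
  have l: "rsA D ?s (atenA A (Id ?C' X) (aLun D M A Y)) \<cdot>\<^bsub>?C\<^esub> (bet k m t X (?t (aU A) Y) \<cdot>\<^bsub>?C\<^esub> tenA ?T (?i ?x) (lam m t Y))
    = bet k m t X Y \<cdot>\<^bsub>?C\<^esub> tenA ?T (?i ?x) (Lun ?T ?y)"
    using category.comp_left[OF _ b1, of "tenA ?T (?i ?x) (lam m t Y)"] by (simp add: tenA_merge aLun_at(1)[OF f(2,3) ob(2)])
  have b2: "rsA D ?s (atenA A (aRun D M A X) (Id ?C' Y)) \<cdot>\<^bsub>?C\<^esub> bet k m t (?t X (aU A)) Y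
    = bet k m t X Y \<cdot>\<^bsub>?C\<^esub> tenA ?T (rsA D \<langle>k, t\<rangle> (aRun D M A X)) (rsA D \<langle>m, t\<rangle> (Id ?C' Y))"
    by (rule bet_natural) (simp_all add: fn_iff)
  have r: "rsA D ?s (atenA A (aRun D M A X) (Id ?C' Y)) \<cdot>\<^bsub>?C\<^esub> q = bet k m t X Y \<cdot>\<^bsub>?C\<^esub> tenA ?T (Run ?T ?x) (?i ?y)"
    using category.comp_left[OF _ b2, of "tenA ?T (rho k t X) (?i ?y)"] by (simp add: q_def tenA_merge aLun_at(2)[OF f(1,3) ob(1)])
  have Q [simp]: "q \<in> Ar ?C" "Cod ?C q = rs D ?s (?t (?t X (aU A)) Y)" using univD[OF u] by simp_all
  have "rsA D ?s (atenA A (Id ?C' X) (aLun D M A Y) \<cdot>\<^bsub>?C'\<^esub> aA A X (aU A) Y) \<cdot>\<^bsub>?C\<^esub> q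
    = rsA D ?s (atenA A (Id ?C' X) (aLun D M A Y)) \<cdot>\<^bsub>?C\<^esub> (rsA D ?s (aA A X (aU A) Y) \<cdot>\<^bsub>?C\<^esub> q)" by simp
  also have "rsA D ?s (aA A X (aU A) Y) \<cdot>\<^bsub>?C\<^esub> q = (rsA D ?s (aA A X (aU A) Y) \<cdot>\<^bsub>?C\<^esub> gamL k (zer ?K) m t X (aU A) Y) \<cdot>\<^bsub>?C\<^esub>
      tenA ?T (tenA ?T (?i ?x) (ups ?K)) (?i ?y)" unfolding q by simp
  also have "\<dots> = gamR k (zer ?K) m t X (aU A) Y \<cdot>\<^bsub>?C\<^esub> (Asc ?T ?x (rs D \<langle>zer ?K, t\<rangle> (aU A)) ?y \<cdot>\<^bsub>?C\<^esub>
      tenA ?T (tenA ?T (?i ?x) (ups ?K)) (?i ?y))" unfolding a by simp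
  also have "\<dots> = (gamR k (zer ?K) m t X (aU A) Y \<cdot>\<^bsub>?C\<^esub> tenA ?T (?i ?x) (tenA ?T (ups ?K) (?i ?y))) \<cdot>\<^bsub>?C\<^esub> Asc ?T ?x ?u ?y"
    unfolding n by simp
  also have "rsA D ?s (atenA A (Id ?C' X) (aLun D M A Y)) \<cdot>\<^bsub>?C\<^esub> \<dots>
    = (rsA D ?s (atenA A (Id ?C' X) (aLun D M A Y)) \<cdot>\<^bsub>?C\<^esub> (bet k m t X (?t (aU A) Y) \<cdot>\<^bsub>?C\<^esub> tenA ?T (?i ?x) (lam m t Y))) \<cdot>\<^bsub>?C\<^esub> Asc ?T ?x ?u ?y"
    unfolding g by simp
  also have "\<dots> = bet k m t X Y \<cdot>\<^bsub>?C\<^esub> (tenA ?T (?i ?x) (Lun ?T ?y) \<cdot>\<^bsub>?C\<^esub> Asc ?T ?x ?u ?y)" unfolding l by simp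
  also have "tenA ?T (?i ?x) (Lun ?T ?y) \<cdot>\<^bsub>?C\<^esub> Asc ?T ?x ?u ?y = tenA ?T (Run ?T ?x) (?i ?y)"
    by (rule monoidal_category.triangle[OF Mon_monoidal]) simp_all
  finally have e: "rsA D ?s (atenA A (Id ?C' X) (aLun D M A Y) \<cdot>\<^bsub>?C'\<^esub> aA A X (aU A) Y) \<cdot>\<^bsub>?C\<^esub> q
    = rsA D ?s (atenA A (aRun D M A X) (Id ?C' Y)) \<cdot>\<^bsub>?C\<^esub> q" unfolding r .
  show ?thesis by (rule univ_unique[OF u]) (use e in simp_all)
qed

abbreviation AM :: "('u, 'o, 'a) mpder" where "AM \<equiv> affine_line_monoidal D M"

lemma AM_simps [simp]: "Ten (Mon AM A) = aTen D M A" "Unt (Mon AM A) = aU A" "Asc (Mon AM A) = aA A"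
  "Lun (Mon AM A) = aLun D M A" "Run (Mon AM A) = aRun D M A" "Mu AM u = aMu u"
  "Mu0 AM u = Id (Val D (\<N> \<otimes> Src u)) (aU (Src u))"
  by (simp_all add: affine_line_monoidal_def aMu_def fun_eq_iff)

lemma monoidal_category_affine:
  assumes A [simp]: "small_cat A"
  shows "monoidal_category (Val D (\<N> \<otimes> A)) (Mon AM A)"
proof (intro monoidal_category.intro monoidal_category_axioms.intro)
  show "category (Val D (\<N> \<otimes> A))" by simp
  show "cfunctor (Ten (Mon AM A))" by (simp add: cfunctor_aTen)
  show "Src (Ten (Mon AM A)) = prod_cat (Val D (\<N> \<otimes> A)) (Val D (\<N> \<otimes> A))" "Tgt (Ten (Mon AM A)) = Val D (\<N> \<otimes> A)"
    by (simp_all add: aTen_def)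
qed (simp_all add: hom_iff aAsc_generic(5) aAsc_natural aLun_generic(5) aRun_generic(5) aLun_natural
    pentagon_affine triangle_affine)

end

text \<open>Interchange: \<open>g\<close> acts on the parameter and \<open>\<alpha>\<close> on the
  other factor.\<close>

lemma (in prederivator) cell_timesN_param:
  assumes g: "g \<in> fn L L'" and \<alpha>: "small_nt \<alpha>" "Src (NS \<alpha>) = A" "Tgt (NS \<alpha>) = B" and X: "X \<in> Ob (Val D (L' \<otimes> B))"
  shows "rsA D (g \<otimes>\<^sub>F idF A) (NC (Cell D (timesN L' \<alpha>)) X) = NC (Cell D (timesN L \<alpha>)) (rs D (g \<otimes>\<^sub>F idF B) X)"
proof -
  note [simp] = g[unfolded fn_iff] \<alpha> X small_nt_fun[OF \<alpha>(1)] small_nt_arr[OF \<alpha>(1)]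
  have [simp]: "small_cat A" "small_cat B" using small_fun_cat[of "NS \<alpha>"] by auto
  have "mk_nt (NS (timesN L' \<alpha>) \<odot> (g \<otimes>\<^sub>F idF A)) (NT (timesN L' \<alpha>) \<odot> (g \<otimes>\<^sub>F idF A)) (\<lambda>x. NC (timesN L' \<alpha>) (FO (g \<otimes>\<^sub>F idF A) x))
    = mk_nt ((g \<otimes>\<^sub>F idF B) \<odot> NS (timesN L \<alpha>)) ((g \<otimes>\<^sub>F idF B) \<odot> NT (timesN L \<alpha>)) (\<lambda>x. FA (g \<otimes>\<^sub>F idF B) (NC (timesN L \<alpha>) x))"
    by (intro mk_nt_eqI) (auto simp: sfun_simps)
  then show ?thesis
    using cell_whisker_right[of "timesN L' \<alpha>" "g \<otimes>\<^sub>F idF A" X] cell_whisker_left[of "timesN L \<alpha>" "g \<otimes>\<^sub>F idF B" X] by simp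
qed

section \<open>Restriction functors as strong monoidal functors\<close>

context monoidal_derivator
begin

text \<open>The generic elements are among those tested, and there \<open>bet\<close> is the
  universal arrow \<open>bil\<close>. Testing at all stages is harmless, since the calculation rules
  hold at every stage.\<close>

lemma bet_unique:
  assumes A [simp]: "small_cat A" and ob [simp]: "X \<in> Ob (Val D (\<N> \<otimes> A))" "Y \<in> Ob (Val D (\<N> \<otimes> A))"
    and fg: "f \<in> Ar (Val D (\<N> \<otimes> A))" "g \<in> Ar (Val D (\<N> \<otimes> A))"
    "Dom (Val D (\<N> \<otimes> A)) f = aten D M A X Y" "Dom (Val D (\<N> \<otimes> A)) g = aten D M A X Y"
    "Cod (Val D (\<N> \<otimes> A)) f = Cod (Val D (\<N> \<otimes> A)) g"
    and eq: "\<And>K k m t. \<lbrakk>k \<in> fn K \<N>; m \<in> fn K \<N>; t \<in> fn K A\<rbrakk>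
      \<Longrightarrow> rsA D \<langle>k \<oplus> m, t\<rangle> f \<cdot>\<^bsub>Val D K\<^esub> bet k m t X Y = rsA D \<langle>k \<oplus> m, t\<rangle> g \<cdot>\<^bsub>Val D K\<^esub> bet k m t X Y"
  shows "f = g"
proof -
  let ?k = "pr1 \<N> \<N> \<odot> pr1 (\<N> \<otimes> \<N>) A" and ?m = "pr2 \<N> \<N> \<odot> pr1 (\<N> \<otimes> \<N>) A" and ?t = "pr2 (\<N> \<otimes> \<N>) A"
  have "\<langle>?k \<oplus> ?m, ?t\<rangle> = plus_times A" by (simp add: cart)
  then show ?thesis
    using eq[of ?k "(\<N> \<otimes> \<N>) \<otimes> A" ?m ?t] bet_generic[OF A ob]
    by (intro bil_unique[OF A ob fg]) (simp add: fn_iff)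
qed

lemma gamL_unique:
  assumes A [simp]: "small_cat A" and ob [simp]: "X \<in> Ob (Val D (\<N> \<otimes> A))" "Y \<in> Ob (Val D (\<N> \<otimes> A))" "Z \<in> Ob (Val D (\<N> \<otimes> A))"
    and fg: "f \<in> Ar (Val D (\<N> \<otimes> A))" "g \<in> Ar (Val D (\<N> \<otimes> A))"
    "Dom (Val D (\<N> \<otimes> A)) f = aten D M A (aten D M A X Y) Z" "Dom (Val D (\<N> \<otimes> A)) g = aten D M A (aten D M A X Y) Z"
    "Cod (Val D (\<N> \<otimes> A)) f = Cod (Val D (\<N> \<otimes> A)) g"
    and eq: "\<And>K k l m t. \<lbrakk>k \<in> fn K \<N>; l \<in> fn K \<N>; m \<in> fn K \<N>; t \<in> fn K A\<rbrakk>
      \<Longrightarrow> rsA D \<langle>k \<oplus> l \<oplus> m, t\<rangle> f \<cdot>\<^bsub>Val D K\<^esub> gamL k l m t X Y Z = rsA D \<langle>k \<oplus> l \<oplus> m, t\<rangle> g \<cdot>\<^bsub>Val D K\<^esub> gamL k l m t X Y Z"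
  shows "f = g"
proof (rule univ_unique[OF univ_gamL[OF A ob]])
  show "rsA D \<langle>e1 A \<oplus> e2 A \<oplus> e3 A, et A\<rangle> f \<cdot>\<^bsub>Val D (Src \<langle>e1 A \<oplus> e2 A \<oplus> e3 A, et A\<rangle>)\<^esub> gamL (e1 A) (e2 A) (e3 A) (et A) X Y Z
    = rsA D \<langle>e1 A \<oplus> e2 A \<oplus> e3 A, et A\<rangle> g \<cdot>\<^bsub>Val D (Src \<langle>e1 A \<oplus> e2 A \<oplus> e3 A, et A\<rangle>)\<^esub> gamL (e1 A) (e2 A) (e3 A) (et A) X Y Z"
    using eq[of "e1 A" "tri A" "e2 A" "e3 A" "et A"] by (simp add: fn_iff)
qed (use fg in simp_all)

context
  fixes u :: "'u sfun" and A B :: "'u scat"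
  assumes u: "u \<in> fn A B"
begin

lemma aMu_arr [simp]:
  assumes "X \<in> Ob (Val D (\<N> \<otimes> B))" "Y \<in> Ob (Val D (\<N> \<otimes> B))"
  shows "aMu u X Y \<in> Ar (Val D (\<N> \<otimes> A))"
    "Dom (Val D (\<N> \<otimes> A)) (aMu u X Y) = aten D M A (rs D (idF \<N> \<otimes>\<^sub>F u) X) (rs D (idF \<N> \<otimes>\<^sub>F u) Y)"
    "Cod (Val D (\<N> \<otimes> A)) (aMu u X Y) = rs D (idF \<N> \<otimes>\<^sub>F u) (aten D M B X Y)"
  using aMu(1-3)[OF u assms] by simp_all

text \<open>By its characterisation \<open>aMu\<close> compares two universal arrows:
  \<open>bil\<close> over \<open>A\<close>, and the restriction of \<open>bil\<close> over
  \<open>B\<close>, universal by base change and corrected by a constraint.\<close>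

lemma aMu_iso:
  assumes XY [simp]: "X \<in> Ob (Val D (\<N> \<otimes> B))" "Y \<in> Ob (Val D (\<N> \<otimes> B))"
  shows "iso (Val D (\<N> \<otimes> A)) (aMu u X Y)"
proof -
  note [simp] = u[unfolded fn_iff]
  let ?w = "idF (\<N> \<otimes> \<N>) \<otimes>\<^sub>F u" and ?v = "idF \<N> \<otimes>\<^sub>F u"
  have B: "small_cat B" by simp
  have "univ D (plus_times A) (rs D ?v (aten D M B X Y)) (rsA D ?w (bil D M B X Y))"
    using univ_times_base_change[OF univ_bil[OF B XY], of u A] u by simp
  then have "univ D (plus_times A) (rs D ?v (aten D M B X Y)) (rsA D ?w (bil D M B X Y)
      \<cdot>\<^bsub>Val D ((\<N> \<otimes> \<N>) \<otimes> A)\<^esub> Mu M ?w (rs D (p1 B) X) (rs D (p2 B) Y))"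
    by (rule univ_pre) (simp_all add: Mu_iso)
  note 1 = this[folded aMu(4)[OF u XY]]
  show ?thesis
    using univ_post_iff[OF univ_bil[of A "rs D ?v X" "rs D ?v Y"], of "aMu u X Y" "rs D ?v (aten D M B X Y)"] 1
    by simp
qed

lemma aMu_natural:
  assumes fg: "f \<in> Ar (Val D (\<N> \<otimes> B))" "g \<in> Ar (Val D (\<N> \<otimes> B))"
    "Dom (Val D (\<N> \<otimes> B)) f = X" "Dom (Val D (\<N> \<otimes> B)) g = Y" "Cod (Val D (\<N> \<otimes> B)) f = X'" "Cod (Val D (\<N> \<otimes> B)) g = Y'"
  shows "aMu u X' Y' \<cdot>\<^bsub>Val D (\<N> \<otimes> A)\<^esub> atenA A (rsA D (idF \<N> \<otimes>\<^sub>F u) f) (rsA D (idF \<N> \<otimes>\<^sub>F u) g)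
    = rsA D (idF \<N> \<otimes>\<^sub>F u) (atenA B f g) \<cdot>\<^bsub>Val D (\<N> \<otimes> A)\<^esub> aMu u X Y"
proof -
  note [simp] = u[unfolded fn_iff]
  have ob [simp]: "X \<in> Ob (Val D (\<N> \<otimes> B))" "Y \<in> Ob (Val D (\<N> \<otimes> B))" "X' \<in> Ob (Val D (\<N> \<otimes> B))" "Y' \<in> Ob (Val D (\<N> \<otimes> B))"
    using fg by auto
  note [simp] = fg
  let ?v = "idF \<N> \<otimes>\<^sub>F u"
  show ?thesis
  proof (rule bet_unique[of A "rs D ?v X" "rs D ?v Y"])
    fix K k m t assume km: "k \<in> fn K \<N>" "m \<in> fn K \<N>" "t \<in> fn K A"
    note [simp] = km[unfolded fn_iff]
    let ?s = "\<langle>k \<oplus> m, t\<rangle>" and ?C = "Val D K"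
    have ut: "u \<odot> t \<in> fn K B" by (simp add: fn_iff)
    have "rsA D ?s (aMu u X' Y' \<cdot>\<^bsub>Val D (\<N> \<otimes> A)\<^esub> atenA A (rsA D ?v f) (rsA D ?v g)) \<cdot>\<^bsub>?C\<^esub> bet k m t (rs D ?v X) (rs D ?v Y)
      = rsA D ?s (aMu u X' Y') \<cdot>\<^bsub>?C\<^esub> (rsA D ?s (atenA A (rsA D ?v f) (rsA D ?v g)) \<cdot>\<^bsub>?C\<^esub> bet k m t (rs D ?v X) (rs D ?v Y))" by simp
    also have "rsA D ?s (atenA A (rsA D ?v f) (rsA D ?v g)) \<cdot>\<^bsub>?C\<^esub> bet k m t (rs D ?v X) (rs D ?v Y)
      = bet k m t (rs D ?v X') (rs D ?v Y') \<cdot>\<^bsub>?C\<^esub> tenA (Mon M K) (rsA D \<langle>k, t\<rangle> (rsA D ?v f)) (rsA D \<langle>m, t\<rangle> (rsA D ?v g))"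
      by (rule bet_natural) (simp_all add: fn_iff)
    also have "rsA D ?s (aMu u X' Y') \<cdot>\<^bsub>?C\<^esub> \<dots> = (rsA D ?s (aMu u X' Y') \<cdot>\<^bsub>?C\<^esub> bet k m t (rs D ?v X') (rs D ?v Y')) \<cdot>\<^bsub>?C\<^esub>
       tenA (Mon M K) (rsA D \<langle>k, u \<odot> t\<rangle> f) (rsA D \<langle>m, u \<odot> t\<rangle> g)" by simp
    also have "\<dots> = bet k m (u \<odot> t) X' Y' \<cdot>\<^bsub>?C\<^esub> tenA (Mon M K) (rsA D \<langle>k, u \<odot> t\<rangle> f) (rsA D \<langle>m, u \<odot> t\<rangle> g)"
      unfolding bet_Mu[OF km u ob(3,4)] ..
    also have "\<dots> = rsA D \<langle>k \<oplus> m, u \<odot> t\<rangle> (atenA B f g) \<cdot>\<^bsub>?C\<^esub> (rsA D ?s (aMu u X Y) \<cdot>\<^bsub>?C\<^esub> bet k m t (rs D ?v X) (rs D ?v Y))"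
      unfolding bet_Mu[OF km u ob(1,2)] bet_natural[OF km(1,2) ut fg] ..
    finally show "rsA D ?s (aMu u X' Y' \<cdot>\<^bsub>Val D (\<N> \<otimes> A)\<^esub> atenA A (rsA D ?v f) (rsA D ?v g)) \<cdot>\<^bsub>?C\<^esub> bet k m t (rs D ?v X) (rs D ?v Y)
      = rsA D ?s (rsA D ?v (atenA B f g) \<cdot>\<^bsub>Val D (\<N> \<otimes> A)\<^esub> aMu u X Y) \<cdot>\<^bsub>?C\<^esub> bet k m t (rs D ?v X) (rs D ?v Y)" by simp
  qed simp_all
qed

text \<open>The composites occurring in the associativity law of \<open>aMu\<close> turn the
  threefold multiplications over \<open>A\<close> at \<open>t\<close> into those over
  \<open>B\<close> at \<open>u \<odot> t\<close>.\<close>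

lemma gam_Mu:
  assumes km: "k \<in> fn K \<N>" "l \<in> fn K \<N>" "m \<in> fn K \<N>" "t \<in> fn K A"
    and ob: "X \<in> Ob (Val D (\<N> \<otimes> B))" "Y \<in> Ob (Val D (\<N> \<otimes> B))" "Z \<in> Ob (Val D (\<N> \<otimes> B))"
  shows "rsA D \<langle>k \<oplus> l \<oplus> m, t\<rangle> (aMu u (aten D M B X Y) Z \<cdot>\<^bsub>Val D (\<N> \<otimes> A)\<^esub> atenA A (aMu u X Y) (Id (Val D (\<N> \<otimes> A)) (rs D (idF \<N> \<otimes>\<^sub>F u) Z)))
      \<cdot>\<^bsub>Val D K\<^esub> gamL k l m t (rs D (idF \<N> \<otimes>\<^sub>F u) X) (rs D (idF \<N> \<otimes>\<^sub>F u) Y) (rs D (idF \<N> \<otimes>\<^sub>F u) Z) = gamL k l m (u \<odot> t) X Y Z"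
    "rsA D \<langle>k \<oplus> l \<oplus> m, t\<rangle> (aMu u X (aten D M B Y Z) \<cdot>\<^bsub>Val D (\<N> \<otimes> A)\<^esub> atenA A (Id (Val D (\<N> \<otimes> A)) (rs D (idF \<N> \<otimes>\<^sub>F u) X)) (aMu u Y Z))
      \<cdot>\<^bsub>Val D K\<^esub> gamR k l m t (rs D (idF \<N> \<otimes>\<^sub>F u) X) (rs D (idF \<N> \<otimes>\<^sub>F u) Y) (rs D (idF \<N> \<otimes>\<^sub>F u) Z) = gamR k l m (u \<odot> t) X Y Z"
proof -
  note [simp] = km[unfolded fn_iff] u[unfolded fn_iff] ob
  let ?v = "idF \<N> \<otimes>\<^sub>F u" and ?s = "\<langle>k \<oplus> l \<oplus> m, t\<rangle>" and ?C = "Val D K" and ?C' = "Val D (\<N> \<otimes> A)" and ?t = "aten D M B" and ?T = "Mon M K"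
  let ?X = "rs D ?v X" and ?Y = "rs D ?v Y" and ?Z = "rs D ?v Z"
  let ?ut = "u \<odot> t"
  have s: "k \<oplus> l \<in> fn K \<N>" "l \<oplus> m \<in> fn K \<N>" by (simp_all add: fn_iff)
  have b1: "rsA D \<langle>(k \<oplus> l) \<oplus> m, t\<rangle> (atenA A (aMu u X Y) (Id ?C' ?Z)) \<cdot>\<^bsub>?C\<^esub> bet (k \<oplus> l) m t (aten D M A ?X ?Y) ?Z
    = bet (k \<oplus> l) m t (rs D ?v (?t X Y)) ?Z \<cdot>\<^bsub>?C\<^esub> tenA ?T (rsA D \<langle>k \<oplus> l, t\<rangle> (aMu u X Y)) (rsA D \<langle>m, t\<rangle> (Id ?C' ?Z))"
    by (rule bet_natural) (simp_all add: fn_iff)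
  have c1: "rsA D \<langle>(k \<oplus> l) \<oplus> m, t\<rangle> (aMu u (?t X Y) Z) \<cdot>\<^bsub>?C\<^esub> bet (k \<oplus> l) m t (rs D ?v (?t X Y)) ?Z = bet (k \<oplus> l) m ?ut (?t X Y) Z"
    by (rule bet_Mu[OF s(1) km(3,4) u]) simp_all
  have "rsA D ?s (aMu u (?t X Y) Z \<cdot>\<^bsub>?C'\<^esub> atenA A (aMu u X Y) (Id ?C' ?Z)) \<cdot>\<^bsub>?C\<^esub> gamL k l m t ?X ?Y ?Z
    = rsA D ?s (aMu u (?t X Y) Z) \<cdot>\<^bsub>?C\<^esub> ((rsA D \<langle>(k \<oplus> l) \<oplus> m, t\<rangle> (atenA A (aMu u X Y) (Id ?C' ?Z)) \<cdot>\<^bsub>?C\<^esub> bet (k \<oplus> l) m t (aten D M A ?X ?Y) ?Z)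
      \<cdot>\<^bsub>?C\<^esub> tenA ?T (bet k l t ?X ?Y) (Id ?C (rs D \<langle>m, t\<rangle> ?Z)))" by (simp add: gamL_def)
  also have "\<dots> = (rsA D \<langle>(k \<oplus> l) \<oplus> m, t\<rangle> (aMu u (?t X Y) Z) \<cdot>\<^bsub>?C\<^esub> bet (k \<oplus> l) m t (rs D ?v (?t X Y)) ?Z) \<cdot>\<^bsub>?C\<^esub>
      tenA ?T (rsA D \<langle>k \<oplus> l, t\<rangle> (aMu u X Y) \<cdot>\<^bsub>?C\<^esub> bet k l t ?X ?Y) (Id ?C (rs D \<langle>m, t\<rangle> ?Z))"
    unfolding b1 by (simp add: tenA_merge)
  also have "\<dots> = gamL k l m ?ut X Y Z"
    unfolding c1 bet_Mu[OF km(1,2,4) u ob(1,2)] by (simp add: gamL_def)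
  finally show "rsA D ?s (aMu u (?t X Y) Z \<cdot>\<^bsub>?C'\<^esub> atenA A (aMu u X Y) (Id ?C' ?Z)) \<cdot>\<^bsub>?C\<^esub> gamL k l m t ?X ?Y ?Z = gamL k l m ?ut X Y Z" .
  have b2: "rsA D \<langle>k \<oplus> (l \<oplus> m), t\<rangle> (atenA A (Id ?C' ?X) (aMu u Y Z)) \<cdot>\<^bsub>?C\<^esub> bet k (l \<oplus> m) t ?X (aten D M A ?Y ?Z)
    = bet k (l \<oplus> m) t ?X (rs D ?v (?t Y Z)) \<cdot>\<^bsub>?C\<^esub> tenA ?T (rsA D \<langle>k, t\<rangle> (Id ?C' ?X)) (rsA D \<langle>l \<oplus> m, t\<rangle> (aMu u Y Z))"
    by (rule bet_natural) (simp_all add: fn_iff)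
  have c2: "rsA D \<langle>k \<oplus> (l \<oplus> m), t\<rangle> (aMu u X (?t Y Z)) \<cdot>\<^bsub>?C\<^esub> bet k (l \<oplus> m) t ?X (rs D ?v (?t Y Z)) = bet k (l \<oplus> m) ?ut X (?t Y Z)"
    by (rule bet_Mu[OF km(1) s(2) km(4) u]) simp_all
  have "rsA D ?s (aMu u X (?t Y Z) \<cdot>\<^bsub>?C'\<^esub> atenA A (Id ?C' ?X) (aMu u Y Z)) \<cdot>\<^bsub>?C\<^esub> gamR k l m t ?X ?Y ?Z
    = rsA D ?s (aMu u X (?t Y Z)) \<cdot>\<^bsub>?C\<^esub> ((rsA D \<langle>k \<oplus> (l \<oplus> m), t\<rangle> (atenA A (Id ?C' ?X) (aMu u Y Z)) \<cdot>\<^bsub>?C\<^esub> bet k (l \<oplus> m) t ?X (aten D M A ?Y ?Z))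
      \<cdot>\<^bsub>?C\<^esub> tenA ?T (Id ?C (rs D \<langle>k, t\<rangle> ?X)) (bet l m t ?Y ?Z))" by (simp add: gamR_def)
  also have "\<dots> = (rsA D \<langle>k \<oplus> (l \<oplus> m), t\<rangle> (aMu u X (?t Y Z)) \<cdot>\<^bsub>?C\<^esub> bet k (l \<oplus> m) t ?X (rs D ?v (?t Y Z))) \<cdot>\<^bsub>?C\<^esub>
      tenA ?T (Id ?C (rs D \<langle>k, t\<rangle> ?X)) (rsA D \<langle>l \<oplus> m, t\<rangle> (aMu u Y Z) \<cdot>\<^bsub>?C\<^esub> bet l m t ?Y ?Z)"
    unfolding b2 by (simp add: tenA_merge)
  also have "\<dots> = gamR k l m ?ut X Y Z"
    unfolding c2 bet_Mu[OF km(2,3,4) u ob(2,3)] by (simp add: gamR_def)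
  finally show "rsA D ?s (aMu u X (?t Y Z) \<cdot>\<^bsub>?C'\<^esub> atenA A (Id ?C' ?X) (aMu u Y Z)) \<cdot>\<^bsub>?C\<^esub> gamR k l m t ?X ?Y ?Z = gamR k l m ?ut X Y Z" .
qed

text \<open>After \<open>gamL\<close> both sides become \<open>gamR\<close> at
  \<open>u \<odot> t\<close> preceded by the associator of the stage, by \<open>aAsc_at\<close> over
  \<open>B\<close> and over \<open>A\<close>.\<close>

lemma aMu_Asc:
  assumes ob [simp]: "X \<in> Ob (Val D (\<N> \<otimes> B))" "Y \<in> Ob (Val D (\<N> \<otimes> B))" "Z \<in> Ob (Val D (\<N> \<otimes> B))"
  shows "rsA D (idF \<N> \<otimes>\<^sub>F u) (aA B X Y Z) \<cdot>\<^bsub>Val D (\<N> \<otimes> A)\<^esub>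
      (aMu u (aten D M B X Y) Z \<cdot>\<^bsub>Val D (\<N> \<otimes> A)\<^esub> atenA A (aMu u X Y) (Id (Val D (\<N> \<otimes> A)) (rs D (idF \<N> \<otimes>\<^sub>F u) Z)))
    = aMu u X (aten D M B Y Z) \<cdot>\<^bsub>Val D (\<N> \<otimes> A)\<^esub> (atenA A (Id (Val D (\<N> \<otimes> A)) (rs D (idF \<N> \<otimes>\<^sub>F u) X)) (aMu u Y Z)
      \<cdot>\<^bsub>Val D (\<N> \<otimes> A)\<^esub> aA A (rs D (idF \<N> \<otimes>\<^sub>F u) X) (rs D (idF \<N> \<otimes>\<^sub>F u) Y) (rs D (idF \<N> \<otimes>\<^sub>F u) Z))"
proof -
  note [simp] = u[unfolded fn_iff]
  let ?v = "idF \<N> \<otimes>\<^sub>F u" and ?C' = "Val D (\<N> \<otimes> A)" and ?t = "aten D M B"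
  let ?X = "rs D ?v X" and ?Y = "rs D ?v Y" and ?Z = "rs D ?v Z"
  let ?l = "aMu u (?t X Y) Z \<cdot>\<^bsub>?C'\<^esub> atenA A (aMu u X Y) (Id ?C' ?Z)" and ?r = "aMu u X (?t Y Z) \<cdot>\<^bsub>?C'\<^esub> atenA A (Id ?C' ?X) (aMu u Y Z)"
  have "rsA D ?v (aA B X Y Z) \<cdot>\<^bsub>?C'\<^esub> ?l = ?r \<cdot>\<^bsub>?C'\<^esub> aA A ?X ?Y ?Z"
  proof (rule gamL_unique[of A ?X ?Y ?Z])
    fix K k l m t assume km: "k \<in> fn K \<N>" "l \<in> fn K \<N>" "m \<in> fn K \<N>" "t \<in> fn K A"
    note [simp] = km[unfolded fn_iff]
    let ?s = "\<langle>k \<oplus> l \<oplus> m, t\<rangle>" and ?C = "Val D K" and ?T = "Mon M K"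
    have ut: "u \<odot> t \<in> fn K B" by (simp add: fn_iff)
    note g = gam_Mu[OF km ob]
    have "rsA D ?s (rsA D ?v (aA B X Y Z) \<cdot>\<^bsub>?C'\<^esub> ?l) \<cdot>\<^bsub>?C\<^esub> gamL k l m t ?X ?Y ?Z
      = rsA D \<langle>k \<oplus> l \<oplus> m, u \<odot> t\<rangle> (aA B X Y Z) \<cdot>\<^bsub>?C\<^esub> (rsA D ?s ?l \<cdot>\<^bsub>?C\<^esub> gamL k l m t ?X ?Y ?Z)" by simp
    also have "\<dots> = (rsA D ?s ?r \<cdot>\<^bsub>?C\<^esub> gamR k l m t ?X ?Y ?Z) \<cdot>\<^bsub>?C\<^esub>
        Asc ?T (rs D \<langle>k, u \<odot> t\<rangle> X) (rs D \<langle>l, u \<odot> t\<rangle> Y) (rs D \<langle>m, u \<odot> t\<rangle> Z)"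
      unfolding g aAsc_at[OF km(1-3) ut ob] ..
    also have "\<dots> = rsA D ?s ?r \<cdot>\<^bsub>?C\<^esub> (rsA D ?s (aA A ?X ?Y ?Z) \<cdot>\<^bsub>?C\<^esub> gamL k l m t ?X ?Y ?Z)"
      using aAsc_at[OF km, of ?X ?Y ?Z] by simp
    finally show "rsA D ?s (rsA D ?v (aA B X Y Z) \<cdot>\<^bsub>?C'\<^esub> ?l) \<cdot>\<^bsub>?C\<^esub> gamL k l m t ?X ?Y ?Z
      = rsA D ?s (?r \<cdot>\<^bsub>?C'\<^esub> aA A ?X ?Y ?Z) \<cdot>\<^bsub>?C\<^esub> gamL k l m t ?X ?Y ?Z" by simp
  qed simp_all
  then show ?thesis by simp
qed

text \<open>\<open>aU B\<close> restricts strictly to \<open>aU A\<close>, so the unit constraint is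
  an identity and only \<open>aMu\<close> has to be carried through \<open>lam\<close> and
  \<open>rho\<close>.\<close>

lemma aMu_Lun:
  assumes X [simp]: "X \<in> Ob (Val D (\<N> \<otimes> B))"
  shows "rsA D (idF \<N> \<otimes>\<^sub>F u) (aLun D M B X) \<cdot>\<^bsub>Val D (\<N> \<otimes> A)\<^esub> aMu u (aU B) X = aLun D M A (rs D (idF \<N> \<otimes>\<^sub>F u) X)"
    "rsA D (idF \<N> \<otimes>\<^sub>F u) (aRun D M B X) \<cdot>\<^bsub>Val D (\<N> \<otimes> A)\<^esub> aMu u X (aU B) = aRun D M A (rs D (idF \<N> \<otimes>\<^sub>F u) X)"
proof -
  note [simp] = u[unfolded fn_iff]
  let ?v = "idF \<N> \<otimes>\<^sub>F u" and ?n = "pr1 \<N> A" and ?t = "pr2 \<N> A" and ?K = "\<N> \<otimes> A"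
  have f: "?n \<in> fn ?K \<N>" "?t \<in> fn ?K A" "u \<odot> ?t \<in> fn ?K B" "zer ?K \<in> fn ?K \<N>" by (simp_all add: fn_iff)
  let ?X = "rs D ?v X"
  have A: "small_cat A" and X': "?X \<in> Ob (Val D ?K)" by simp_all
  have nt: "\<langle>?n, u \<odot> ?t\<rangle> = ?v" by (simp add: cart)
  have U [simp]: "rs D ?v (aU B) = aU A" by (simp add: aUnt_def)
  have b1: "aMu u (aU B) X \<cdot>\<^bsub>Val D ?K\<^esub> bet (zer ?K) ?n ?t (aU A) ?X = bet (zer ?K) ?n (u \<odot> ?t) (aU B) X"
    using bet_Mu[OF f(4,1,2) u, of "aU B" X] by simp
  have l: "aMu u (aU B) X \<cdot>\<^bsub>Val D ?K\<^esub> lam ?n ?t ?X = lam ?n (u \<odot> ?t) X"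
    using category.comp_left[OF _ b1, of "tenA (Mon M ?K) (ups ?K) (Id (Val D ?K) ?X)"] by (simp add: lam_def nt)
  have 1: "(rsA D ?v (aLun D M B X) \<cdot>\<^bsub>Val D ?K\<^esub> aMu u (aU B) X) \<cdot>\<^bsub>Val D ?K\<^esub> lam ?n ?t ?X = aLun D M A ?X \<cdot>\<^bsub>Val D ?K\<^esub> lam ?n ?t ?X"
    using aLun_at(1)[OF f(1,3) X] aLun_generic(4)[OF A X'] by (simp add: l nt)
  show "rsA D ?v (aLun D M B X) \<cdot>\<^bsub>Val D ?K\<^esub> aMu u (aU B) X = aLun D M A ?X"
    by (rule category.iso_cancel_right[OF _ iso_lam[OF A X'] _ _ _ _ 1]) simp_all
  have b2: "aMu u X (aU B) \<cdot>\<^bsub>Val D ?K\<^esub> bet ?n (zer ?K) ?t ?X (aU A) = bet ?n (zer ?K) (u \<odot> ?t) X (aU B)"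
    using bet_Mu[OF f(1,4,2) u, of X "aU B"] by simp
  have r: "aMu u X (aU B) \<cdot>\<^bsub>Val D ?K\<^esub> rho ?n ?t ?X = rho ?n (u \<odot> ?t) X"
    using category.comp_left[OF _ b2, of "tenA (Mon M ?K) (Id (Val D ?K) ?X) (ups ?K)"] by (simp add: rho_def nt)
  have 2: "(rsA D ?v (aRun D M B X) \<cdot>\<^bsub>Val D ?K\<^esub> aMu u X (aU B)) \<cdot>\<^bsub>Val D ?K\<^esub> rho ?n ?t ?X = aRun D M A ?X \<cdot>\<^bsub>Val D ?K\<^esub> rho ?n ?t ?X"
    using aLun_at(2)[OF f(1,3) X] aRun_generic(4)[OF A X'] by (simp add: r nt)
  show "rsA D ?v (aRun D M B X) \<cdot>\<^bsub>Val D ?K\<^esub> aMu u X (aU B) = aRun D M A ?X"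
    by (rule category.iso_cancel_right[OF _ iso_rho[OF A X'] _ _ _ _ 2]) simp_all
qed

end

text \<open>Addition and both projections act on the powers of \<open>\<N>\<close> alone and so
  commute with the cells of \<open>\<alpha>\<close>; what remains over
  \<open>\<N> \<otimes> \<N>\<close> is the compatibility of \<open>Mu\<close> with cells.\<close>

lemma aMu_Cell:
  assumes \<alpha>: "small_nt \<alpha>" "NS \<alpha> = u" "NT \<alpha> = v" "Src u = A" "Tgt u = B"
    and XY [simp]: "X \<in> Ob (Val D (\<N> \<otimes> B))" "Y \<in> Ob (Val D (\<N> \<otimes> B))"
  shows "NC (Cell D (timesN \<N> \<alpha>)) (aten D M B X Y) \<cdot>\<^bsub>Val D (\<N> \<otimes> A)\<^esub> aMu u X Y
    = aMu v X Y \<cdot>\<^bsub>Val D (\<N> \<otimes> A)\<^esub> atenA A (NC (Cell D (timesN \<N> \<alpha>)) X) (NC (Cell D (timesN \<N> \<alpha>)) Y)"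
proof -
  note fn = small_nt_fun[OF \<alpha>(1), unfolded \<alpha>(2-5)]
  have [simp]: "small_cat A" "small_cat B" using small_fun_cat[OF fn(1)] \<alpha>(4,5) by auto
  note [simp] = \<alpha> fn
  have u: "u \<in> fn A B" and v: "v \<in> fn A B" by (simp_all add: fn_iff)
  let ?K = "(\<N> \<otimes> \<N>) \<otimes> A" and ?C' = "Val D (\<N> \<otimes> A)" and ?T = "Mon M ((\<N> \<otimes> \<N>) \<otimes> A)" and ?t = "aten D M B"
  let ?C = "Val D ?K"
  let ?c = "\<lambda>X. NC (Cell D (timesN \<N> \<alpha>)) X" and ?d = "\<lambda>X. NC (Cell D (timesN (\<N> \<otimes> \<N>) \<alpha>)) X"
  let ?u = "idF \<N> \<otimes>\<^sub>F u" and ?v = "idF \<N> \<otimes>\<^sub>F v" and ?u2 = "idF (\<N> \<otimes> \<N>) \<otimes>\<^sub>F u" and ?v2 = "idF (\<N> \<otimes> \<N>) \<otimes>\<^sub>F v"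
  have c [simp]: "?c Z \<in> Ar ?C'" "Dom ?C' (?c Z) = rs D ?u Z" "Cod ?C' (?c Z) = rs D ?v Z"
    if "Z \<in> Ob (Val D (\<N> \<otimes> B))" for Z using that cell_arr[of "timesN \<N> \<alpha>" Z] by simp_all
  have d [simp]: "?d Z \<in> Ar ?C" "Dom ?C (?d Z) = rs D ?u2 Z" "Cod ?C (?d Z) = rs D ?v2 Z"
    if "Z \<in> Ob (Val D ((\<N> \<otimes> \<N>) \<otimes> B))" for Z using that cell_arr[of "timesN (\<N> \<otimes> \<N>) \<alpha>" Z] by simp_all
  have w: "rsA D (g \<otimes>\<^sub>F idF A) (?c Z) = ?d (rs D (g \<otimes>\<^sub>F idF B) Z)"
    if "g \<in> fn (\<N> \<otimes> \<N>) \<N>" "Z \<in> Ob (Val D (\<N> \<otimes> B))" for g Z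
    using cell_timesN_param[OF that(1) \<alpha>(1), of A B Z] that by simp
  have ws: "rsA D (plus_times A) (?c Z) = ?d (rs D (plus_times B) Z)" "rsA D (p1 A) (?c Z) = ?d (rs D (p1 B) Z)"
    "rsA D (p2 A) (?c Z) = ?d (rs D (p2 B) Z)" if "Z \<in> Ob (Val D (\<N> \<otimes> B))" for Z
    using that by (simp_all add: w fn_iff)
  let ?x = "rs D (p1 B) X" and ?y = "rs D (p2 B) Y" and ?b = "bil D M B X Y"
  have n: "?d (rs D (plus_times B) (?t X Y)) \<cdot>\<^bsub>?C\<^esub> rsA D ?u2 ?b = rsA D ?v2 ?b \<cdot>\<^bsub>?C\<^esub> ?d (ten (Mon M ((\<N> \<otimes> \<N>) \<otimes> B)) ?x ?y)"
    using cell_natural[of "timesN (\<N> \<otimes> \<N>) \<alpha>" ?b] by simp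
  have m: "?d (ten (Mon M ((\<N> \<otimes> \<N>) \<otimes> B)) ?x ?y) \<cdot>\<^bsub>?C\<^esub> Mu M ?u2 ?x ?y = Mu M ?v2 ?x ?y \<cdot>\<^bsub>?C\<^esub> tenA ?T (?d ?x) (?d ?y)"
    using Mu_Cell[of "timesN (\<N> \<otimes> \<N>) \<alpha>" ?x ?y] by simp
  have b: "rsA D (plus_times A) (atenA A (?c X) (?c Y)) \<cdot>\<^bsub>?C\<^esub> bil D M A (rs D ?u X) (rs D ?u Y)
    = bil D M A (rs D ?v X) (rs D ?v Y) \<cdot>\<^bsub>?C\<^esub> tenA ?T (rsA D (p1 A) (?c X)) (rsA D (p2 A) (?c Y))"
    by (rule bil_natural) simp_all
  note mu = aMu(4)[OF u XY] aMu(4)[OF v XY]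
  note [simp] = aMu_arr[OF u] aMu_arr[OF v]
  have "rsA D (plus_times A) (?c (?t X Y) \<cdot>\<^bsub>?C'\<^esub> aMu u X Y) \<cdot>\<^bsub>?C\<^esub> bil D M A (rs D ?u X) (rs D ?u Y)
    = rsA D (plus_times A) (?c (?t X Y)) \<cdot>\<^bsub>?C\<^esub> (rsA D (plus_times A) (aMu u X Y) \<cdot>\<^bsub>?C\<^esub> bil D M A (rs D ?u X) (rs D ?u Y))"
    by simp
  also have "\<dots> = (?d (rs D (plus_times B) (?t X Y)) \<cdot>\<^bsub>?C\<^esub> rsA D ?u2 ?b) \<cdot>\<^bsub>?C\<^esub> Mu M ?u2 ?x ?y"
    unfolding mu by (simp add: ws)
  also have "\<dots> = rsA D ?v2 ?b \<cdot>\<^bsub>?C\<^esub> (?d (ten (Mon M ((\<N> \<otimes> \<N>) \<otimes> B)) ?x ?y) \<cdot>\<^bsub>?C\<^esub> Mu M ?u2 ?x ?y)"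
    unfolding n by simp
  also have "\<dots> = (rsA D ?v2 ?b \<cdot>\<^bsub>?C\<^esub> Mu M ?v2 ?x ?y) \<cdot>\<^bsub>?C\<^esub> tenA ?T (rsA D (p1 A) (?c X)) (rsA D (p2 A) (?c Y))"
    unfolding m by (simp add: ws)
  also have "\<dots> = rsA D (plus_times A) (aMu v X Y) \<cdot>\<^bsub>?C\<^esub> (rsA D (plus_times A) (atenA A (?c X) (?c Y)) \<cdot>\<^bsub>?C\<^esub> bil D M A (rs D ?u X) (rs D ?u Y))"
    unfolding mu(2)[symmetric] b by simp
  finally have e: "rsA D (plus_times A) (?c (?t X Y) \<cdot>\<^bsub>?C'\<^esub> aMu u X Y) \<cdot>\<^bsub>?C\<^esub> bil D M A (rs D ?u X) (rs D ?u Y)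
    = rsA D (plus_times A) (aMu v X Y \<cdot>\<^bsub>?C'\<^esub> atenA A (?c X) (?c Y)) \<cdot>\<^bsub>?C\<^esub> bil D M A (rs D ?u X) (rs D ?u Y)" by simp
  show ?thesis by (rule bil_unique[of A "rs D ?u X" "rs D ?u Y"]) (use e in simp_all)
qed

text \<open>By \<open>bet_Mu\<close> both sides turn the multiplication at \<open>t\<close> into the
  one at \<open>v \<odot> (u \<odot> t)\<close>.\<close>

lemma aMu_comp:
  assumes u: "u \<in> fn A B" and v: "v \<in> fn B C" and XY [simp]: "X \<in> Ob (Val D (\<N> \<otimes> C))" "Y \<in> Ob (Val D (\<N> \<otimes> C))"
  shows "aMu (v \<odot> u) X Y = rsA D (idF \<N> \<otimes>\<^sub>F u) (aMu v X Y) \<cdot>\<^bsub>Val D (\<N> \<otimes> A)\<^esub>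
    aMu u (rs D (idF \<N> \<otimes>\<^sub>F v) X) (rs D (idF \<N> \<otimes>\<^sub>F v) Y)"
proof -
  note [simp] = u[unfolded fn_iff] v[unfolded fn_iff]
  have vu: "v \<odot> u \<in> fn A C" by (simp add: fn_iff)
  note [simp] = aMu_arr[OF u] aMu_arr[OF v] aMu_arr[OF vu]
  let ?u = "idF \<N> \<otimes>\<^sub>F u" and ?v = "idF \<N> \<otimes>\<^sub>F v" and ?w = "idF \<N> \<otimes>\<^sub>F (v \<odot> u)"
  show ?thesis
  proof (rule bet_unique[of A "rs D ?w X" "rs D ?w Y"])
    fix K k m t assume km: "k \<in> fn K \<N>" "m \<in> fn K \<N>" "t \<in> fn K A"
    note [simp] = km[unfolded fn_iff]
    have ut: "u \<odot> t \<in> fn K B" by (simp add: fn_iff)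
    have 1: "rsA D \<langle>k \<oplus> m, t\<rangle> (aMu u (rs D ?v X) (rs D ?v Y)) \<cdot>\<^bsub>Val D K\<^esub> bet k m t (rs D ?w X) (rs D ?w Y)
      = bet k m (u \<odot> t) (rs D ?v X) (rs D ?v Y)"
      using bet_Mu[OF km u, of "rs D ?v X" "rs D ?v Y"] by simp
    show "rsA D \<langle>k \<oplus> m, t\<rangle> (aMu (v \<odot> u) X Y) \<cdot>\<^bsub>Val D K\<^esub> bet k m t (rs D ?w X) (rs D ?w Y)
      = rsA D \<langle>k \<oplus> m, t\<rangle> (rsA D ?u (aMu v X Y) \<cdot>\<^bsub>Val D (\<N> \<otimes> A)\<^esub> aMu u (rs D ?v X) (rs D ?v Y))
        \<cdot>\<^bsub>Val D K\<^esub> bet k m t (rs D ?w X) (rs D ?w Y)"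
      using bet_Mu[OF km(1,2) ut v XY] bet_Mu[OF km vu XY] by (simp add: 1)
  qed simp_all
qed

lemma aMu_id:
  assumes A [simp]: "small_cat A" and XY [simp]: "X \<in> Ob (Val D (\<N> \<otimes> A))" "Y \<in> Ob (Val D (\<N> \<otimes> A))"
  shows "aMu (idF A) X Y = Id (Val D (\<N> \<otimes> A)) (aten D M A X Y)"
proof -
  have i: "idF A \<in> fn A A" by (simp add: fn_iff)
  note [simp] = aMu_arr[OF i]
  show ?thesis
  proof (rule bet_unique[of A X Y])
    fix K k m t assume km: "k \<in> fn K \<N>" "m \<in> fn K \<N>" "t \<in> fn K A"
    note [simp] = km[unfolded fn_iff]
    show "rsA D \<langle>k \<oplus> m, t\<rangle> (aMu (idF A) X Y) \<cdot>\<^bsub>Val D K\<^esub> bet k m t X Y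
      = rsA D \<langle>k \<oplus> m, t\<rangle> (Id (Val D (\<N> \<otimes> A)) (aten D M A X Y)) \<cdot>\<^bsub>Val D K\<^esub> bet k m t X Y"
      using bet_Mu[OF km i XY] by simp
  qed simp_all
qed

lemma strong_monoidal_affine:
  assumes u: "u \<in> fn A B"
  shows "strong_monoidal_functor (Res D (idF \<N> \<otimes>\<^sub>F u)) (Mon AM B) (Mon AM A) (aMu u) (Id (Val D (\<N> \<otimes> A)) (aU A))"
proof -
  note [simp] = u[unfolded fn_iff] aMu_arr[OF u]
  have [simp]: "rs D (idF \<N> \<otimes>\<^sub>F u) (aU B) = aU A" by (simp add: aUnt_def)
  have s [simp]: "Src (Res D (idF \<N> \<otimes>\<^sub>F u)) = Val D (\<N> \<otimes> B)" "Tgt (Res D (idF \<N> \<otimes>\<^sub>F u)) = Val D (\<N> \<otimes> A)"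
    by (simp_all add: Res_Src Res_Tgt)
  show ?thesis
  proof (intro strong_monoidal_functor.intro strong_monoidal_functor_axioms.intro)
    show "cfunctor (Res D (idF \<N> \<otimes>\<^sub>F u))" by (simp add: Res_functor)
    show "monoidal_category (Src (Res D (idF \<N> \<otimes>\<^sub>F u))) (Mon AM B)"
      "monoidal_category (Tgt (Res D (idF \<N> \<otimes>\<^sub>F u))) (Mon AM A)" by (simp_all add: monoidal_category_affine)
  qed (simp_all add: hom_iff aMu_iso[OF u] aMu_natural[OF u] iso_Id_Val aMu_Asc[OF u] aMu_Lun[OF u])
qed

lemma monoidal_prederivator_affine: "monoidal_prederivator (affine_line D) AM"
proof -
  interpret S: prederivator "affine_line D"
    unfolding affine_line_def by (rule prederivator_shift[OF prederivator_axioms]) simp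
  note [simp] = affine_line_def
  show ?thesis
  proof (intro monoidal_prederivator.intro monoidal_prederivator_axioms.intro S.prederivator_axioms, goal_cases)
    case (1 A) then show ?case by (simp add: monoidal_category_affine)
  next
    case (2 u) then show ?case using strong_monoidal_affine[of u "Src u" "Tgt u"] by (simp add: fn_iff)
  next
    case (3 A X Y) then show ?case by (simp add: aMu_id)
  next
    case (4 A) then show ?case by simp
  next
    case (5 u v X Y) then show ?case by (simp add: aMu_comp[of u "Src u" "Tgt u" v "Tgt v"] fn_iff)
  next
    case (6 u v) then show ?case by (simp add: aUnt_def)
  next
    case (7 \<alpha> X Y) then show ?case using aMu_Cell[OF 7(1) refl refl refl refl] small_nt_fun[OF 7(1)] by simp
  next
    \<comment> \<open>The unit is restricted along the projection to \<open>\<N>\<close>, under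
      which \<open>timesN \<N> \<alpha>\<close> becomes an identity, so its cell at the unit is an
      identity.\<close>
    case (8 \<alpha>)
    note [simp] = 8 small_nt_fun[OF 8] small_nt_arr[OF 8]
    let ?A = "Src (NS \<alpha>)" and ?B = "Tgt (NS \<alpha>)"
    have [simp]: "small_cat ?A" "small_cat ?B" using small_fun_cat[of "NS \<alpha>"] by auto
    have "mk_nt (pr1 \<N> ?B \<odot> NS (timesN \<N> \<alpha>)) (pr1 \<N> ?B \<odot> NT (timesN \<N> \<alpha>)) (\<lambda>x. FA (pr1 \<N> ?B) (NC (timesN \<N> \<alpha>) x))
      = mk_nt (pr1 \<N> ?A) (pr1 \<N> ?A) (\<lambda>x. Id \<N> (FO (pr1 \<N> ?A) x))"
      by (intro mk_nt_eqI) (auto simp: sfun_simps)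
    then have "NC (Cell D (timesN \<N> \<alpha>)) (aU ?B) = Id (Val D (\<N> \<otimes> ?A)) (rs D (pr1 \<N> ?A) I)"
      using cell_whisker_left[of "timesN \<N> \<alpha>" "pr1 \<N> ?B" I] by (simp add: aUnt_def cell_eq_Id)
    then show ?case by (simp add: aUnt_def)
  qed
qed

end

section \<open>The external product and its right adjoints\<close>

definition sigma :: "'u::universe scat \<Rightarrow> 'u scat \<Rightarrow> 'u sfun" where
  "sigma A B = \<langle>(pr1 \<N> A \<odot> pr1 (\<N> \<otimes> A) (\<N> \<otimes> B)) \<oplus> (pr1 \<N> B \<odot> pr2 (\<N> \<otimes> A) (\<N> \<otimes> B)),
     pr2 \<N> A \<otimes>\<^sub>F pr2 \<N> B\<rangle>"

lemma sigma_simps [simp]: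
  assumes "small_cat A" "small_cat B"
  shows "small_fun (sigma A B)" "Src (sigma A B) = (\<N> \<otimes> A) \<otimes> (\<N> \<otimes> B)" "Tgt (sigma A B) = \<N> \<otimes> (A \<otimes> B)"
  using assms by (simp_all add: sigma_def)

lemma sigma_natural:
  assumes "u \<in> fn A A'" "v \<in> fn B B'"
  shows "sigma A' B' \<odot> ((idF \<N> \<otimes>\<^sub>F u) \<otimes>\<^sub>F (idF \<N> \<otimes>\<^sub>F v)) = (idF \<N> \<otimes>\<^sub>F (u \<otimes>\<^sub>F v)) \<odot> sigma A B"
proof -
  note [simp] = assms[unfolded fn_iff]
  show ?thesis by (simp add: sigma_def cart)
qed

context monoidal_derivator
begin

abbreviation AD :: "('u, 'o, 'a) pder" where "AD \<equiv> affine_line D"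

lemma AD_simps [simp]: "Val AD A = Val D (\<N> \<otimes> A)" "Res AD u = Res D (idF \<N> \<otimes>\<^sub>F u)"
  by (simp_all add: affine_line_def)

text \<open>The external product derived from the internal one is \<open>aten\<close> of two objects
  pulled back to \<open>A \<otimes> B\<close>, not literally the \<open>aext\<close> that
  \<open>aten\<close> was built from. Its universal arrow is therefore assembled anew, as the
  multiplication at the two projections to \<open>\<N>\<close>.\<close>

definition ebil :: "'u scat \<Rightarrow> 'u scat \<Rightarrow> 'o \<Rightarrow> 'o \<Rightarrow> 'a" where
  "ebil A B X Y = bet (pr1 \<N> A \<odot> pr1 (\<N> \<otimes> A) (\<N> \<otimes> B)) (pr1 \<N> B \<odot> pr2 (\<N> \<otimes> A) (\<N> \<otimes> B)) (pr2 \<N> A \<otimes>\<^sub>F pr2 \<N> B)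
     (rs D (idF \<N> \<otimes>\<^sub>F pr1 A B) X) (rs D (idF \<N> \<otimes>\<^sub>F pr2 A B) Y)"

lemma pairF_ext [simp]:
  assumes "small_cat A" "small_cat B"
  shows "(idF \<N> \<otimes>\<^sub>F pr1 A B) \<odot> \<langle>pr1 \<N> A \<odot> pr1 (\<N> \<otimes> A) (\<N> \<otimes> B), pr2 \<N> A \<otimes>\<^sub>F pr2 \<N> B\<rangle> = pr1 (\<N> \<otimes> A) (\<N> \<otimes> B)"
    "(idF \<N> \<otimes>\<^sub>F pr2 A B) \<odot> \<langle>pr1 \<N> B \<odot> pr2 (\<N> \<otimes> A) (\<N> \<otimes> B), pr2 \<N> A \<otimes>\<^sub>F pr2 \<N> B\<rangle> = pr2 (\<N> \<otimes> A) (\<N> \<otimes> B)"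
  using assms by (simp_all add: cart)

lemma ext_affine_ob [simp]:
  assumes "small_cat A" "small_cat B" "X \<in> Ob (Val D (\<N> \<otimes> A))" "Y \<in> Ob (Val D (\<N> \<otimes> B))"
  shows "ext AD AM A B X Y \<in> Ob (Val D (\<N> \<otimes> (A \<otimes> B)))"
  using assms by (simp add: ext_def)

lemma ebil_simps [simp]:
  assumes "small_cat A" "small_cat B" "X \<in> Ob (Val D (\<N> \<otimes> A))" "Y \<in> Ob (Val D (\<N> \<otimes> B))"
  shows "ebil A B X Y \<in> Ar (Val D ((\<N> \<otimes> A) \<otimes> (\<N> \<otimes> B)))"
    "Dom (Val D ((\<N> \<otimes> A) \<otimes> (\<N> \<otimes> B))) (ebil A B X Y) = ext D M (\<N> \<otimes> A) (\<N> \<otimes> B) X Y"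
    "Cod (Val D ((\<N> \<otimes> A) \<otimes> (\<N> \<otimes> B))) (ebil A B X Y) = rs D (sigma A B) (ext AD AM A B X Y)"
  using assms pairF_ext[OF assms(1,2)] by (simp_all add: ebil_def ext_def sigma_def)

text \<open>\<open>bil\<close> over \<open>A \<otimes> B\<close>, carried along the isomorphism that
  undoes \<open>reorder A B\<close> and corrected by a constraint.\<close>

lemma univ_ebil:
  assumes [simp]: "small_cat A" "small_cat B" "X \<in> Ob (Val D (\<N> \<otimes> A))" "Y \<in> Ob (Val D (\<N> \<otimes> B))"
  shows "univ D (sigma A B) (ext AD AM A B X Y) (ebil A B X Y)"
proof -
  let ?AB = "A \<otimes> B" and ?K = "(\<N> \<otimes> A) \<otimes> (\<N> \<otimes> B)" and ?L = "(\<N> \<otimes> \<N>) \<otimes> (A \<otimes> B)"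
  let ?X = "rs D (idF \<N> \<otimes>\<^sub>F pr1 A B) X" and ?Y = "rs D (idF \<N> \<otimes>\<^sub>F pr2 A B) Y"
  define c where "c = \<langle>\<langle>pr1 \<N> A \<odot> pr1 (\<N> \<otimes> A) (\<N> \<otimes> B), pr1 \<N> B \<odot> pr2 (\<N> \<otimes> A) (\<N> \<otimes> B)\<rangle>, pr2 \<N> A \<otimes>\<^sub>F pr2 \<N> B\<rangle>"
  have [simp]: "small_fun c" "Src c = ?K" "Tgt c = ?L" by (simp_all add: c_def)
  have i: "reorder A B \<odot> c = idF ?K" "c \<odot> reorder A B = idF ?L" by (simp_all add: c_def cart)
  have pc: "plus_times ?AB \<odot> c = sigma A B" by (simp add: c_def sigma_def)
  let ?V = "ten (Mon M ?L) (rs D (p1 ?AB) ?X) (rs D (p2 ?AB) ?Y)"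
  have "univ D c ?V (Id (Val D ?K) (rs D c ?V))"
    by (rule univ_isoF[OF _ _ i]) simp_all
  from univ_comp[OF this univ_bil[of ?AB ?X ?Y]]
  have "univ D (sigma A B) (aten D M ?AB ?X ?Y) (rsA D c (bil D M ?AB ?X ?Y))" by (simp add: pc)
  then have "univ D (sigma A B) (aten D M ?AB ?X ?Y) (rsA D c (bil D M ?AB ?X ?Y) \<cdot>\<^bsub>Val D ?K\<^esub> Mu M c (rs D (p1 ?AB) ?X) (rs D (p2 ?AB) ?Y))"
    by (rule univ_pre) (simp_all add: Mu_iso)
  then show ?thesis by (simp add: ebil_def bet_def c_def ext_def)
qed

lemma extA_affine [simp]:
  assumes "small_cat A" "small_cat B" "f \<in> Ar (Val D (\<N> \<otimes> A))" "g \<in> Ar (Val D (\<N> \<otimes> B))"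
    "Dom (Val D (\<N> \<otimes> A)) f = X" "Dom (Val D (\<N> \<otimes> B)) g = Y" "Cod (Val D (\<N> \<otimes> A)) f = X'" "Cod (Val D (\<N> \<otimes> B)) g = Y'"
  shows "extA AD AM A B f g \<in> Ar (Val D (\<N> \<otimes> (A \<otimes> B)))"
    "Dom (Val D (\<N> \<otimes> (A \<otimes> B))) (extA AD AM A B f g) = ext AD AM A B X Y"
    "Cod (Val D (\<N> \<otimes> (A \<otimes> B))) (extA AD AM A B f g) = ext AD AM A B X' Y'"
  using assms by (simp_all add: extA_def ext_def)

lemma ebil_natural:
  assumes A: "small_cat A" "small_cat B" and f: "f \<in> Ar (Val D (\<N> \<otimes> A))" "g \<in> Ar (Val D (\<N> \<otimes> B))"
    "Dom (Val D (\<N> \<otimes> A)) f = X" "Dom (Val D (\<N> \<otimes> B)) g = Y" "Cod (Val D (\<N> \<otimes> A)) f = X'" "Cod (Val D (\<N> \<otimes> B)) g = Y'"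
  shows "rsA D (sigma A B) (extA AD AM A B f g) \<cdot>\<^bsub>Val D ((\<N> \<otimes> A) \<otimes> (\<N> \<otimes> B))\<^esub> ebil A B X Y
    = ebil A B X' Y' \<cdot>\<^bsub>Val D ((\<N> \<otimes> A) \<otimes> (\<N> \<otimes> B))\<^esub> extA D M (\<N> \<otimes> A) (\<N> \<otimes> B) f g"
proof -
  note [simp] = A f pairF_ext[OF A]
  show ?thesis unfolding ebil_def sigma_def extA_def AM_simps AD_simps
    by (subst bet_natural[where A = "A \<otimes> B"]) (simp_all add: fn_iff)
qed

lemma ext_mu_affine [simp]:
  assumes "u \<in> fn A A'" "v \<in> fn B B'" and XY: "X \<in> Ob (Val D (\<N> \<otimes> A'))" "Y \<in> Ob (Val D (\<N> \<otimes> B'))"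
  shows "ext_mu AD AM u v X Y \<in> Ar (Val D (\<N> \<otimes> (A \<otimes> B)))"
    "Dom (Val D (\<N> \<otimes> (A \<otimes> B))) (ext_mu AD AM u v X Y) = ext AD AM A B (rs D (idF \<N> \<otimes>\<^sub>F u) X) (rs D (idF \<N> \<otimes>\<^sub>F v) Y)"
    "Cod (Val D (\<N> \<otimes> (A \<otimes> B))) (ext_mu AD AM u v X Y) = rs D (idF \<N> \<otimes>\<^sub>F (u \<otimes>\<^sub>F v)) (ext AD AM A' B' X Y)"
proof -
  note [simp] = assms[unfolded fn_iff]
  have "u \<otimes>\<^sub>F v \<in> fn (A \<otimes> B) (A' \<otimes> B')" by (simp add: fn_iff)
  note [simp] = aMu_arr[OF this]
  show "ext_mu AD AM u v X Y \<in> Ar (Val D (\<N> \<otimes> (A \<otimes> B)))"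
    "Dom (Val D (\<N> \<otimes> (A \<otimes> B))) (ext_mu AD AM u v X Y) = ext AD AM A B (rs D (idF \<N> \<otimes>\<^sub>F u) X) (rs D (idF \<N> \<otimes>\<^sub>F v) Y)"
    "Cod (Val D (\<N> \<otimes> (A \<otimes> B))) (ext_mu AD AM u v X Y) = rs D (idF \<N> \<otimes>\<^sub>F (u \<otimes>\<^sub>F v)) (ext AD AM A' B' X Y)"
    by (simp_all add: ext_mu_def ext_def)
qed

text \<open>Both sides are one multiplication, with \<open>t\<close> followed by
  \<open>u \<otimes>\<^sub>F v\<close>: the first by \<open>bet_Mu\<close>, the second by
  \<open>bet_restrict\<close>.\<close>

lemma ebil_Mu:
  assumes u: "u \<in> fn A A'" "v \<in> fn B B'" and XY: "X \<in> Ob (Val D (\<N> \<otimes> A'))" "Y \<in> Ob (Val D (\<N> \<otimes> B'))"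
  shows "rsA D (sigma A B) (ext_mu AD AM u v X Y) \<cdot>\<^bsub>Val D ((\<N> \<otimes> A) \<otimes> (\<N> \<otimes> B))\<^esub>
      ebil A B (rs D (idF \<N> \<otimes>\<^sub>F u) X) (rs D (idF \<N> \<otimes>\<^sub>F v) Y)
    = rsA D ((idF \<N> \<otimes>\<^sub>F u) \<otimes>\<^sub>F (idF \<N> \<otimes>\<^sub>F v)) (ebil A' B' X Y) \<cdot>\<^bsub>Val D ((\<N> \<otimes> A) \<otimes> (\<N> \<otimes> B))\<^esub>
      ext_mu D M (idF \<N> \<otimes>\<^sub>F u) (idF \<N> \<otimes>\<^sub>F v) X Y"
proof -
  note [simp] = assms[unfolded fn_iff]
  let ?K = "(\<N> \<otimes> A) \<otimes> (\<N> \<otimes> B)" and ?K' = "(\<N> \<otimes> A') \<otimes> (\<N> \<otimes> B')" and ?h = "(idF \<N> \<otimes>\<^sub>F u) \<otimes>\<^sub>F (idF \<N> \<otimes>\<^sub>F v)"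
  have uv: "u \<otimes>\<^sub>F v \<in> fn (A \<otimes> B) (A' \<otimes> B')" by (simp add: fn_iff)
  define k m t where "k = pr1 \<N> A \<odot> pr1 (\<N> \<otimes> A) (\<N> \<otimes> B)" and "m = pr1 \<N> B \<odot> pr2 (\<N> \<otimes> A) (\<N> \<otimes> B)" and "t = pr2 \<N> A \<otimes>\<^sub>F pr2 \<N> B"
  define k' m' t' where "k' = pr1 \<N> A' \<odot> pr1 (\<N> \<otimes> A') (\<N> \<otimes> B')" and "m' = pr1 \<N> B' \<odot> pr2 (\<N> \<otimes> A') (\<N> \<otimes> B')" and "t' = pr2 \<N> A' \<otimes>\<^sub>F pr2 \<N> B'"
  have f: "k \<in> fn ?K \<N>" "m \<in> fn ?K \<N>" "t \<in> fn ?K (A \<otimes> B)" "k' \<in> fn ?K' \<N>" "m' \<in> fn ?K' \<N>" "t' \<in> fn ?K' (A' \<otimes> B')" "?h \<in> fn ?K ?K'"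
    by (simp_all add: fn_iff k_def m_def t_def k'_def m'_def t'_def)
  have e: "k' \<odot> ?h = k" "m' \<odot> ?h = m" "t' \<odot> ?h = (u \<otimes>\<^sub>F v) \<odot> t"
    by (simp_all add: k_def m_def t_def k'_def m'_def t'_def cart)
  let ?X = "rs D (idF \<N> \<otimes>\<^sub>F pr1 A' B') X" and ?Y = "rs D (idF \<N> \<otimes>\<^sub>F pr2 A' B') Y"
  have 1: "rsA D \<langle>k \<oplus> m, t\<rangle> (aMu (u \<otimes>\<^sub>F v) ?X ?Y) \<cdot>\<^bsub>Val D ?K\<^esub> bet k m t (rs D (idF \<N> \<otimes>\<^sub>F (u \<otimes>\<^sub>F v)) ?X) (rs D (idF \<N> \<otimes>\<^sub>F (u \<otimes>\<^sub>F v)) ?Y)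
    = bet k m ((u \<otimes>\<^sub>F v) \<odot> t) ?X ?Y"
    by (rule bet_Mu[OF f(1-3) uv]) simp_all
  have 2: "rsA D ?h (bet k' m' t' ?X ?Y) \<cdot>\<^bsub>Val D ?K\<^esub> Mu M ?h (rs D \<langle>k', t'\<rangle> ?X) (rs D \<langle>m', t'\<rangle> ?Y) = bet k m ((u \<otimes>\<^sub>F v) \<odot> t) ?X ?Y"
    unfolding e[symmetric] by (rule bet_restrict[OF f(4-7)]) simp_all
  have r: "rs D \<langle>k', t'\<rangle> ?X = rs D (pr1 (\<N> \<otimes> A') (\<N> \<otimes> B')) X" "rs D \<langle>m', t'\<rangle> ?Y = rs D (pr2 (\<N> \<otimes> A') (\<N> \<otimes> B')) Y"
    unfolding k'_def m'_def t'_def using pairF_ext[of A' B'] by simp_all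
  have q: "rs D (idF \<N> \<otimes>\<^sub>F (u \<otimes>\<^sub>F v)) ?X = rs D (idF \<N> \<otimes>\<^sub>F pr1 A B) (rs D (idF \<N> \<otimes>\<^sub>F u) X)"
    "rs D (idF \<N> \<otimes>\<^sub>F (u \<otimes>\<^sub>F v)) ?Y = rs D (idF \<N> \<otimes>\<^sub>F pr2 A B) (rs D (idF \<N> \<otimes>\<^sub>F v) Y)" by simp_all
  have "ext_mu D M (idF \<N> \<otimes>\<^sub>F u) (idF \<N> \<otimes>\<^sub>F v) X Y = Mu M ?h (rs D \<langle>k', t'\<rangle> ?X) (rs D \<langle>m', t'\<rangle> ?Y)"
    unfolding r by (simp add: ext_mu_def)
  moreover have "ext_mu AD AM u v X Y = aMu (u \<otimes>\<^sub>F v) ?X ?Y" by (simp add: ext_mu_def)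
  moreover have "ebil A' B' X Y = bet k' m' t' ?X ?Y" "sigma A B = \<langle>k \<oplus> m, t\<rangle>"
    "ebil A B (rs D (idF \<N> \<otimes>\<^sub>F u) X) (rs D (idF \<N> \<otimes>\<^sub>F v) Y) = bet k m t (rs D (idF \<N> \<otimes>\<^sub>F (u \<otimes>\<^sub>F v)) ?X) (rs D (idF \<N> \<otimes>\<^sub>F (u \<otimes>\<^sub>F v)) ?Y)"
    unfolding q by (simp_all add: ebil_def sigma_def k_def m_def t_def k'_def m'_def t'_def)
  ultimately show ?thesis using 1 2 by simp
qed

text \<open>Composed with the universal \<open>ebil\<close>, the arrow \<open>?k1\<close> becomes
  the cocontinuity arrow of \<open>D\<close> for \<open>?u\<close> followed by \<open>ebil\<close>,
  which is universal. Cancelling \<open>ebil\<close> leaves \<open>?k1\<close> universal;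
  \<open>?k2\<close> is treated alike.\<close>

lemma cocont_affine:
  assumes A: "small_cat A" and u: "small_fun u" and XY: "X \<in> Ob (Val D (\<N> \<otimes> Src u))" "Y \<in> Ob (Val D (\<N> \<otimes> A))"
  shows "iso (Val D (\<N> \<otimes> (Tgt u \<otimes> A))) (cocont_left AD AM u A X Y)"
    "iso (Val D (\<N> \<otimes> (A \<otimes> Tgt u))) (cocont_right AD AM A u Y X)"
proof -
  note [simp] = A u XY
  let ?S = "Src u" and ?T = "Tgt u" and ?u = "idF \<N> \<otimes>\<^sub>F u"
  have f: "u \<in> fn ?S ?T" "idF A \<in> fn A A" by (simp_all add: fn_iff)
  let ?L = "lan D ?u X" and ?U = "ladj_unit (Res D ?u) X"
  have l: "univ D ?u ?L ?U" "Dom (Val D (\<N> \<otimes> ?S)) ?U = X" "?L \<in> Ob (Val D (\<N> \<otimes> ?T))"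
    using univ_lan[of ?u X] by simp_all
  note [simp] = l(2,3) univD[OF l(1), simplified]
  note [simp] = ext_mu_affine[OF f] ext_mu_affine[OF f(2,1)]
  have e: "rsA D (sigma ?S A) (extA AD AM ?S A ?U (Id (Val D (\<N> \<otimes> A)) Y)) \<cdot>\<^bsub>Val D ((\<N> \<otimes> ?S) \<otimes> (\<N> \<otimes> A))\<^esub> ebil ?S A X Y
    = ebil ?S A (rs D ?u ?L) Y \<cdot>\<^bsub>Val D ((\<N> \<otimes> ?S) \<otimes> (\<N> \<otimes> A))\<^esub> extA D M (\<N> \<otimes> ?S) (\<N> \<otimes> A) ?U (Id (Val D (\<N> \<otimes> A)) Y)"
    "rsA D (sigma A ?S) (extA AD AM A ?S (Id (Val D (\<N> \<otimes> A)) Y) ?U) \<cdot>\<^bsub>Val D ((\<N> \<otimes> A) \<otimes> (\<N> \<otimes> ?S))\<^esub> ebil A ?S Y X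
    = ebil A ?S Y (rs D ?u ?L) \<cdot>\<^bsub>Val D ((\<N> \<otimes> A) \<otimes> (\<N> \<otimes> ?S))\<^esub> extA D M (\<N> \<otimes> A) (\<N> \<otimes> ?S) (Id (Val D (\<N> \<otimes> A)) Y) ?U"
    by (rule ebil_natural; simp)+
  have ext1: "extA D M (\<N> \<otimes> ?S) (\<N> \<otimes> A) ?U (Id (Val D (\<N> \<otimes> A)) Y) \<in> Ar (Val D ((\<N> \<otimes> ?S) \<otimes> (\<N> \<otimes> A)))"
    "Dom (Val D ((\<N> \<otimes> ?S) \<otimes> (\<N> \<otimes> A))) (extA D M (\<N> \<otimes> ?S) (\<N> \<otimes> A) ?U (Id (Val D (\<N> \<otimes> A)) Y)) = ext D M (\<N> \<otimes> ?S) (\<N> \<otimes> A) X Y"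
    "Cod (Val D ((\<N> \<otimes> ?S) \<otimes> (\<N> \<otimes> A))) (extA D M (\<N> \<otimes> ?S) (\<N> \<otimes> A) ?U (Id (Val D (\<N> \<otimes> A)) Y)) = ext D M (\<N> \<otimes> ?S) (\<N> \<otimes> A) (rs D ?u ?L) Y"
    "extA D M (\<N> \<otimes> A) (\<N> \<otimes> ?S) (Id (Val D (\<N> \<otimes> A)) Y) ?U \<in> Ar (Val D ((\<N> \<otimes> A) \<otimes> (\<N> \<otimes> ?S)))"
    "Dom (Val D ((\<N> \<otimes> A) \<otimes> (\<N> \<otimes> ?S))) (extA D M (\<N> \<otimes> A) (\<N> \<otimes> ?S) (Id (Val D (\<N> \<otimes> A)) Y) ?U) = ext D M (\<N> \<otimes> A) (\<N> \<otimes> ?S) Y X"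
    "Cod (Val D ((\<N> \<otimes> A) \<otimes> (\<N> \<otimes> ?S))) (extA D M (\<N> \<otimes> A) (\<N> \<otimes> ?S) (Id (Val D (\<N> \<otimes> A)) Y) ?U) = ext D M (\<N> \<otimes> A) (\<N> \<otimes> ?S) Y (rs D ?u ?L)"
    by (simp_all add: extA_def ext_def)
  have mu1: "ext_mu D M ?u (idF (\<N> \<otimes> A)) ?L Y \<in> Ar (Val D ((\<N> \<otimes> ?S) \<otimes> (\<N> \<otimes> A)))"
    "Dom (Val D ((\<N> \<otimes> ?S) \<otimes> (\<N> \<otimes> A))) (ext_mu D M ?u (idF (\<N> \<otimes> A)) ?L Y) = ext D M (\<N> \<otimes> ?S) (\<N> \<otimes> A) (rs D ?u ?L) Y"
    "Cod (Val D ((\<N> \<otimes> ?S) \<otimes> (\<N> \<otimes> A))) (ext_mu D M ?u (idF (\<N> \<otimes> A)) ?L Y) = rs D (?u \<otimes>\<^sub>F idF (\<N> \<otimes> A)) (ext D M (\<N> \<otimes> ?T) (\<N> \<otimes> A) ?L Y)"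
    "ext_mu D M (idF (\<N> \<otimes> A)) ?u Y ?L \<in> Ar (Val D ((\<N> \<otimes> A) \<otimes> (\<N> \<otimes> ?S)))"
    "Dom (Val D ((\<N> \<otimes> A) \<otimes> (\<N> \<otimes> ?S))) (ext_mu D M (idF (\<N> \<otimes> A)) ?u Y ?L) = ext D M (\<N> \<otimes> A) (\<N> \<otimes> ?S) Y (rs D ?u ?L)"
    "Cod (Val D ((\<N> \<otimes> A) \<otimes> (\<N> \<otimes> ?S))) (ext_mu D M (idF (\<N> \<otimes> A)) ?u Y ?L) = rs D (idF (\<N> \<otimes> A) \<otimes>\<^sub>F ?u) (ext D M (\<N> \<otimes> A) (\<N> \<otimes> ?T) Y ?L)"
    by (simp_all add: ext_mu_def ext_def)
  have m1: "rsA D (sigma ?S A) (ext_mu AD AM u (idF A) ?L Y) \<cdot>\<^bsub>Val D ((\<N> \<otimes> ?S) \<otimes> (\<N> \<otimes> A))\<^esub> ebil ?S A (rs D ?u ?L) Y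
    = rsA D (?u \<otimes>\<^sub>F idF (\<N> \<otimes> A)) (ebil ?T A ?L Y) \<cdot>\<^bsub>Val D ((\<N> \<otimes> ?S) \<otimes> (\<N> \<otimes> A))\<^esub> ext_mu D M ?u (idF (\<N> \<otimes> A)) ?L Y"
    using ebil_Mu[OF f, of ?L Y] by simp
  have m2: "rsA D (sigma A ?S) (ext_mu AD AM (idF A) u Y ?L) \<cdot>\<^bsub>Val D ((\<N> \<otimes> A) \<otimes> (\<N> \<otimes> ?S))\<^esub> ebil A ?S Y (rs D ?u ?L)
    = rsA D (idF (\<N> \<otimes> A) \<otimes>\<^sub>F ?u) (ebil A ?T Y ?L) \<cdot>\<^bsub>Val D ((\<N> \<otimes> A) \<otimes> (\<N> \<otimes> ?S))\<^esub> ext_mu D M (idF (\<N> \<otimes> A)) ?u Y ?L"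
    using ebil_Mu[OF f(2,1), of Y ?L] by simp
  \<comment> \<open>Extending along \<open>?u\<close> and then adding degrees is strictly the same
    as adding degrees first.\<close>
  have s1: "sigma ?T A \<odot> (?u \<otimes>\<^sub>F idF (\<N> \<otimes> A)) = (idF \<N> \<otimes>\<^sub>F (u \<otimes>\<^sub>F idF A)) \<odot> sigma ?S A"
    using sigma_natural[OF f] by simp
  have s2: "sigma A ?T \<odot> (idF (\<N> \<otimes> A) \<otimes>\<^sub>F ?u) = (idF \<N> \<otimes>\<^sub>F (idF A \<otimes>\<^sub>F u)) \<odot> sigma A ?S"
    using sigma_natural[OF f(2,1)] by simp
  let ?k1 = "ext_mu AD AM u (idF A) ?L Y \<cdot>\<^bsub>Val D (\<N> \<otimes> (?S \<otimes> A))\<^esub> extA AD AM ?S A ?U (Id (Val D (\<N> \<otimes> A)) Y)"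
  let ?k2 = "ext_mu AD AM (idF A) u Y ?L \<cdot>\<^bsub>Val D (\<N> \<otimes> (A \<otimes> ?S))\<^esub> extA AD AM A ?S (Id (Val D (\<N> \<otimes> A)) Y) ?U"
  let ?w1 = "idF \<N> \<otimes>\<^sub>F (u \<otimes>\<^sub>F idF A)" and ?w2 = "idF \<N> \<otimes>\<^sub>F (idF A \<otimes>\<^sub>F u)"
  note [simp] = ext1 mu1
  let ?C1 = "Val D ((\<N> \<otimes> ?S) \<otimes> (\<N> \<otimes> A))" and ?C2 = "Val D ((\<N> \<otimes> A) \<otimes> (\<N> \<otimes> ?S))"
  have x1: "ext_left ?u (\<N> \<otimes> A) ?L Y ?U = ext_mu D M ?u (idF (\<N> \<otimes> A)) ?L Y \<cdot>\<^bsub>?C1\<^esub> extA D M (\<N> \<otimes> ?S) (\<N> \<otimes> A) ?U (Id (Val D (\<N> \<otimes> A)) Y)"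
    by (simp add: ext_left_def ext_mu_def extA_def)
  have x2: "ext_right (\<N> \<otimes> A) ?u Y ?L ?U = ext_mu D M (idF (\<N> \<otimes> A)) ?u Y ?L \<cdot>\<^bsub>?C2\<^esub> extA D M (\<N> \<otimes> A) (\<N> \<otimes> ?S) (Id (Val D (\<N> \<otimes> A)) Y) ?U"
    by (simp add: ext_right_def ext_mu_def extA_def)
  have k1: "rsA D (sigma ?S A) ?k1 \<cdot>\<^bsub>?C1\<^esub> ebil ?S A X Y
    = rsA D (?u \<otimes>\<^sub>F idF (\<N> \<otimes> A)) (ebil ?T A ?L Y) \<cdot>\<^bsub>?C1\<^esub> ext_left ?u (\<N> \<otimes> A) ?L Y ?U"
    using category.comp_left[OF _ m1, of "extA D M (\<N> \<otimes> ?S) (\<N> \<otimes> A) ?U (Id (Val D (\<N> \<otimes> A)) Y)"]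
    by (simp add: x1 e s1)
  have k2: "rsA D (sigma A ?S) ?k2 \<cdot>\<^bsub>?C2\<^esub> ebil A ?S Y X
    = rsA D (idF (\<N> \<otimes> A) \<otimes>\<^sub>F ?u) (ebil A ?T Y ?L) \<cdot>\<^bsub>?C2\<^esub> ext_right (\<N> \<otimes> A) ?u Y ?L ?U"
    using category.comp_left[OF _ m2, of "extA D M (\<N> \<otimes> A) (\<N> \<otimes> ?S) (Id (Val D (\<N> \<otimes> A)) Y) ?U"]
    by (simp add: x2 e s2)
  have "univ D (sigma ?T A \<odot> (?u \<otimes>\<^sub>F idF (\<N> \<otimes> A))) (ext AD AM ?T A ?L Y)
    (rsA D (?u \<otimes>\<^sub>F idF (\<N> \<otimes> A)) (ebil ?T A ?L Y) \<cdot>\<^bsub>Val D (Src (?u \<otimes>\<^sub>F idF (\<N> \<otimes> A)))\<^esub> ext_left ?u (\<N> \<otimes> A) ?L Y ?U)"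
    by (rule univ_comp[OF univ_ext_left[OF l(1)] univ_ebil]) simp_all
  then have "univ D (?w1 \<odot> sigma ?S A) (ext AD AM ?T A ?L Y) (rsA D (sigma ?S A) ?k1 \<cdot>\<^bsub>Val D (Src (sigma ?S A))\<^esub> ebil ?S A X Y)"
    using k1 by (simp only: s1) simp
  note c1 = this
  have "univ D ?w1 (ext AD AM ?T A ?L Y) ?k1"
    by (rule univ_cancel[OF univ_ebil c1]) simp_all
  moreover have "cocont_left AD AM u A X Y = ltransp (Res D ?w1) (ext AD AM ?T A ?L Y) ?k1"
    by (simp add: cocont_left_def)
  ultimately show "iso (Val D (\<N> \<otimes> (Tgt u \<otimes> A))) (cocont_left AD AM u A X Y)"
    using ltransp_iso_iff[of ?w1 ?k1 "ext AD AM ?T A ?L Y"] by simp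
  have "univ D (sigma A ?T \<odot> (idF (\<N> \<otimes> A) \<otimes>\<^sub>F ?u)) (ext AD AM A ?T Y ?L)
    (rsA D (idF (\<N> \<otimes> A) \<otimes>\<^sub>F ?u) (ebil A ?T Y ?L) \<cdot>\<^bsub>Val D (Src (idF (\<N> \<otimes> A) \<otimes>\<^sub>F ?u))\<^esub> ext_right (\<N> \<otimes> A) ?u Y ?L ?U)"
    by (rule univ_comp[OF univ_ext_right[OF l(1)] univ_ebil]) simp_all
  then have "univ D (?w2 \<odot> sigma A ?S) (ext AD AM A ?T Y ?L) (rsA D (sigma A ?S) ?k2 \<cdot>\<^bsub>Val D (Src (sigma A ?S))\<^esub> ebil A ?S Y X)"
    using k2 by (simp only: s2) simp
  note c2 = this
  have "univ D ?w2 (ext AD AM A ?T Y ?L) ?k2"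
    by (rule univ_cancel[OF univ_ebil c2]) simp_all
  moreover have "cocont_right AD AM A u Y X = ltransp (Res D ?w2) (ext AD AM A ?T Y ?L) ?k2"
    by (simp add: cocont_right_def)
  ultimately show "iso (Val D (\<N> \<otimes> (A \<otimes> Tgt u))) (cocont_right AD AM A u Y X)"
    using ltransp_iso_iff[of ?w2 ?k2 "ext AD AM A ?T Y ?L"] by simp
qed

lemma monoidal_derivator_affine: "monoidal_derivator AD AM"
proof (intro monoidal_derivator.intro monoidal_derivator_axioms.intro)
  show "derivator AD" unfolding affine_line_def by (rule derivator_shift) simp
  show "monoidal_prederivator AD AM" by (rule monoidal_prederivator_affine)
qed (simp_all add: cocont_affine)

end

section \<open>Internal homs and their mates\<close>

lemma (in prederivator) univ_bij:
  assumes "univ D u Y \<eta>" "Z \<in> Ob (Val D (Tgt u))" "Dom (Val D (Src u)) \<eta> = X"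
  shows "bij_betw (\<lambda>h. rsA D u h \<cdot>\<^bsub>Val D (Src u)\<^esub> \<eta>) (hom (Val D (Tgt u)) Y Z) (hom (Val D (Src u)) X (rs D u Z))"
  unfolding bij_betw_def
proof (intro conjI subset_antisym subsetI)
  note [simp] = univD[OF assms(1)] assms(2,3)
  show "inj_on (\<lambda>h. rsA D u h \<cdot>\<^bsub>Val D (Src u)\<^esub> \<eta>) (hom (Val D (Tgt u)) Y Z)"
    by (rule inj_onI, rule univ_unique[OF assms(1)]) (simp_all add: hom_iff)
  show "f \<in> hom (Val D (Src u)) X (rs D u Z)" if "f \<in> (\<lambda>h. rsA D u h \<cdot>\<^bsub>Val D (Src u)\<^esub> \<eta>) ` hom (Val D (Tgt u)) Y Z" for f
    using that by (auto simp: hom_iff)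
  fix f assume f: "f \<in> hom (Val D (Src u)) X (rs D u Z)"
  then obtain g where "g \<in> Ar (Val D (Tgt u))" "Dom (Val D (Tgt u)) g = Y" "Cod (Val D (Tgt u)) g = Z"
    "rsA D u g \<cdot>\<^bsub>Val D (Src u)\<^esub> \<eta> = f"
    using univ_ex[OF assms(1), of f Z] by (auto simp: hom_iff)
  then show "f \<in> (\<lambda>h. rsA D u h \<cdot>\<^bsub>Val D (Src u)\<^esub> \<eta>) ` hom (Val D (Tgt u)) Y Z"
    by (intro image_eqI[of _ _ g]) (simp_all add: hom_iff)
qed

text \<open>Closedness only asserts existence; with the homs and bijections as parameters, the new
  ones can be defined from them.\<close>

locale closed_pair = monoidal_derivator D M + closed_two_variable_adjunction D M rhd lhd \<phi> \<psi>
  for D :: "('u::universe, 'o, 'a) pder" and M and rhd and lhd and \<phi> and \<psi>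
begin

definition arhd :: "'u scat \<Rightarrow> 'u scat \<Rightarrow> ('o \<times> 'o, 'a \<times> 'a, 'o, 'a) ftor" where
  "arhd A B = mk_fun (prod_cat (op_cat (Val D (\<N> \<otimes> B))) (Val D (\<N> \<otimes> (A \<otimes> B)))) (Val D (\<N> \<otimes> A))
     (\<lambda>(Y, Z). FO (rhd (\<N> \<otimes> A) (\<N> \<otimes> B)) (Y, rs D (sigma A B) Z))
     (\<lambda>(y, z). FA (rhd (\<N> \<otimes> A) (\<N> \<otimes> B)) (y, rsA D (sigma A B) z))"

definition alhd :: "'u scat \<Rightarrow> 'u scat \<Rightarrow> ('o \<times> 'o, 'a \<times> 'a, 'o, 'a) ftor" where
  "alhd A B = mk_fun (prod_cat (Val D (\<N> \<otimes> (A \<otimes> B))) (op_cat (Val D (\<N> \<otimes> A)))) (Val D (\<N> \<otimes> B))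
     (\<lambda>(Z, X). FO (lhd (\<N> \<otimes> A) (\<N> \<otimes> B)) (rs D (sigma A B) Z, X))
     (\<lambda>(z, x). FA (lhd (\<N> \<otimes> A) (\<N> \<otimes> B)) (rsA D (sigma A B) z, x))"

text \<open>Transposition along the universal arrow \<open>ebil\<close>, from maps out of the affine
  product to maps \<open>X \<star> Y \<rightarrow> \<sigma>\<^sup>*Z\<close> over
  \<open>D\<close>.\<close>

definition tau :: "'u scat \<Rightarrow> 'u scat \<Rightarrow> 'o \<Rightarrow> 'o \<Rightarrow> 'a \<Rightarrow> 'a" where
  "tau A B X Y h = rsA D (sigma A B) h \<cdot>\<^bsub>Val D ((\<N> \<otimes> A) \<otimes> (\<N> \<otimes> B))\<^esub> ebil A B X Y"

definition aphi :: "'u scat \<Rightarrow> 'u scat \<Rightarrow> 'o \<Rightarrow> 'o \<Rightarrow> 'o \<Rightarrow> 'a \<Rightarrow> 'a" where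
  "aphi A B X Y Z h = \<phi> (\<N> \<otimes> A) (\<N> \<otimes> B) X Y (rs D (sigma A B) Z) (tau A B X Y h)"

definition apsi :: "'u scat \<Rightarrow> 'u scat \<Rightarrow> 'o \<Rightarrow> 'o \<Rightarrow> 'o \<Rightarrow> 'a \<Rightarrow> 'a" where
  "apsi A B X Y Z h = \<psi> (\<N> \<otimes> A) (\<N> \<otimes> B) X Y (rs D (sigma A B) Z) (tau A B X Y h)"

lemma tau_bij:
  assumes "small_cat A" "small_cat B" "X \<in> Ob (Val D (\<N> \<otimes> A))" "Y \<in> Ob (Val D (\<N> \<otimes> B))" "Z \<in> Ob (Val D (\<N> \<otimes> (A \<otimes> B)))"
  shows "bij_betw (tau A B X Y) (hom (Val D (\<N> \<otimes> (A \<otimes> B))) (ext AD AM A B X Y) Z)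
    (hom (Val D ((\<N> \<otimes> A) \<otimes> (\<N> \<otimes> B))) (ext D M (\<N> \<otimes> A) (\<N> \<otimes> B) X Y) (rs D (sigma A B) Z))"
  using univ_bij[OF univ_ebil[OF assms(1-4)], of Z] assms by (simp add: tau_def[abs_def])

text \<open>Naturality of \<open>ebil\<close> in both variables; the second clause is the typing
  that \<open>phi_natural\<close> and \<open>psi_natural\<close> ask for.\<close>

lemma tau_natural:
  assumes "small_cat A" "small_cat B" "x \<in> hom (Val D (\<N> \<otimes> A)) X' X" "y \<in> hom (Val D (\<N> \<otimes> B)) Y' Y"
    "z \<in> hom (Val D (\<N> \<otimes> (A \<otimes> B))) Z Z'" "h \<in> hom (Val D (\<N> \<otimes> (A \<otimes> B))) (ext AD AM A B X Y) Z"
  shows "tau A B X' Y' (z \<cdot>\<^bsub>Val D (\<N> \<otimes> (A \<otimes> B))\<^esub> (h \<cdot>\<^bsub>Val D (\<N> \<otimes> (A \<otimes> B))\<^esub> extA AD AM A B x y))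
    = rsA D (sigma A B) z \<cdot>\<^bsub>Val D ((\<N> \<otimes> A) \<otimes> (\<N> \<otimes> B))\<^esub> (tau A B X Y h \<cdot>\<^bsub>Val D ((\<N> \<otimes> A) \<otimes> (\<N> \<otimes> B))\<^esub> extA D M (\<N> \<otimes> A) (\<N> \<otimes> B) x y)"
    "tau A B X Y h \<in> hom (Val D ((\<N> \<otimes> A) \<otimes> (\<N> \<otimes> B))) (ext D M (\<N> \<otimes> A) (\<N> \<otimes> B) X Y) (rs D (sigma A B) Z)"
proof -
  note [simp] = assms(1,2)
  have ob [simp]: "X \<in> Ob (Val D (\<N> \<otimes> A))" "Y \<in> Ob (Val D (\<N> \<otimes> B))" "X' \<in> Ob (Val D (\<N> \<otimes> A))" "Y' \<in> Ob (Val D (\<N> \<otimes> B))"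
    using assms(3,4) by (auto simp: hom_iff)
  note [simp] = assms(3-)[unfolded hom_iff]
  have n: "rsA D (sigma A B) (extA AD AM A B x y) \<cdot>\<^bsub>Val D ((\<N> \<otimes> A) \<otimes> (\<N> \<otimes> B))\<^esub> ebil A B X' Y'
    = ebil A B X Y \<cdot>\<^bsub>Val D ((\<N> \<otimes> A) \<otimes> (\<N> \<otimes> B))\<^esub> extA D M (\<N> \<otimes> A) (\<N> \<otimes> B) x y"
    by (rule ebil_natural) simp_all
  have [simp]: "extA D M (\<N> \<otimes> A) (\<N> \<otimes> B) x y \<in> Ar (Val D ((\<N> \<otimes> A) \<otimes> (\<N> \<otimes> B)))"
    "Cod (Val D ((\<N> \<otimes> A) \<otimes> (\<N> \<otimes> B))) (extA D M (\<N> \<otimes> A) (\<N> \<otimes> B) x y) = ext D M (\<N> \<otimes> A) (\<N> \<otimes> B) X Y"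
    by (simp_all add: extA_def ext_def)
  show "tau A B X' Y' (z \<cdot>\<^bsub>Val D (\<N> \<otimes> (A \<otimes> B))\<^esub> (h \<cdot>\<^bsub>Val D (\<N> \<otimes> (A \<otimes> B))\<^esub> extA AD AM A B x y))
    = rsA D (sigma A B) z \<cdot>\<^bsub>Val D ((\<N> \<otimes> A) \<otimes> (\<N> \<otimes> B))\<^esub> (tau A B X Y h \<cdot>\<^bsub>Val D ((\<N> \<otimes> A) \<otimes> (\<N> \<otimes> B))\<^esub> extA D M (\<N> \<otimes> A) (\<N> \<otimes> B) x y)"
    by (simp add: tau_def n)
  show "tau A B X Y h \<in> hom (Val D ((\<N> \<otimes> A) \<otimes> (\<N> \<otimes> B))) (ext D M (\<N> \<otimes> A) (\<N> \<otimes> B) X Y) (rs D (sigma A B) Z)"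
    by (simp add: tau_def hom_iff)
qed

lemma arhd_FO: "Y \<in> Ob (Val D (\<N> \<otimes> B)) \<Longrightarrow> Z \<in> Ob (Val D (\<N> \<otimes> (A \<otimes> B))) \<Longrightarrow>
    FO (arhd A B) (Y, Z) = FO (rhd (\<N> \<otimes> A) (\<N> \<otimes> B)) (Y, rs D (sigma A B) Z)"
  and alhd_FO: "X \<in> Ob (Val D (\<N> \<otimes> A)) \<Longrightarrow> Z \<in> Ob (Val D (\<N> \<otimes> (A \<otimes> B))) \<Longrightarrow>
    FO (alhd A B) (Z, X) = FO (lhd (\<N> \<otimes> A) (\<N> \<otimes> B)) (rs D (sigma A B) Z, X)"
  by (simp_all add: arhd_def alhd_def)

lemma rhd_lhd_ob [simp]:
  assumes "small_cat A" "small_cat B"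
  shows "Y \<in> Ob (Val D B) \<Longrightarrow> Z \<in> Ob (Val D (A \<otimes> B)) \<Longrightarrow> FO (rhd A B) (Y, Z) \<in> Ob (Val D A)"
    "X \<in> Ob (Val D A) \<Longrightarrow> Z \<in> Ob (Val D (A \<otimes> B)) \<Longrightarrow> FO (lhd A B) (Z, X) \<in> Ob (Val D B)"
  using cfunctor_ob[OF rhd_functor[OF assms] rhd_Tgt[OF assms], of "(Y, Z)"]
    cfunctor_ob[OF lhd_functor[OF assms] lhd_Tgt[OF assms], of "(Z, X)"] assms
  by (simp_all add: rhd_Src lhd_Src)

lemma category_op_cat: "category C \<Longrightarrow> category (op_cat C)"
  by (rule category.intro)
     (auto simp: hom_iff op_cat_def category_simps category.Dom_ext category.Cod_ext category.Id_ext intro: category.Cmp_ext)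

lemma cfunctor_arhd:
  assumes A [simp]: "small_cat A" "small_cat B"
  shows "cfunctor (arhd A B)" "cfunctor (alhd A B)"
proof -
  let ?K = "(\<N> \<otimes> A) \<otimes> (\<N> \<otimes> B)"
  let ?R = "rhd (\<N> \<otimes> A) (\<N> \<otimes> B)" and ?L = "lhd (\<N> \<otimes> A) (\<N> \<otimes> B)"
  have R: "cfunctor ?R" "Src ?R = prod_cat (op_cat (Val D (\<N> \<otimes> B))) (Val D ?K)" "Tgt ?R = Val D (\<N> \<otimes> A)"
    by (simp_all add: rhd_functor rhd_Src rhd_Tgt)
  have L: "cfunctor ?L" "Src ?L = prod_cat (Val D ?K) (op_cat (Val D (\<N> \<otimes> A)))" "Tgt ?L = Val D (\<N> \<otimes> B)"
    by (simp_all add: lhd_functor lhd_Src lhd_Tgt)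
  have RI: "FA ?R (Id (Val D (\<N> \<otimes> B)) Y, Id (Val D ?K) Z) = Id (Val D (\<N> \<otimes> A)) (FO ?R (Y, Z))"
    if "Y \<in> Ob (Val D (\<N> \<otimes> B))" "Z \<in> Ob (Val D ?K)" for Y Z
    using cfunctor_Id[OF R(1) refl, of "(Y, Z)"] that by (simp add: R)
  have LI: "FA ?L (Id (Val D ?K) Z, Id (Val D (\<N> \<otimes> A)) X) = Id (Val D (\<N> \<otimes> B)) (FO ?L (Z, X))"
    if "X \<in> Ob (Val D (\<N> \<otimes> A))" "Z \<in> Ob (Val D ?K)" for X Z
    using cfunctor_Id[OF L(1) refl, of "(Z, X)"] that by (simp add: L)
  have RA: "FA ?R (y, z) \<in> Ar (Val D (\<N> \<otimes> A))" "Dom (Val D (\<N> \<otimes> A)) (FA ?R (y, z)) = FO ?R (Cod (Val D (\<N> \<otimes> B)) y, Dom (Val D ?K) z)"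
    "Cod (Val D (\<N> \<otimes> A)) (FA ?R (y, z)) = FO ?R (Dom (Val D (\<N> \<otimes> B)) y, Cod (Val D ?K) z)"
    if "y \<in> Ar (Val D (\<N> \<otimes> B))" "z \<in> Ar (Val D ?K)" for y z
    using cfunctor_arr[OF R(1), of "(y, z)"] that by (simp_all add: R)
  have LA: "FA ?L (z, x) \<in> Ar (Val D (\<N> \<otimes> B))" "Dom (Val D (\<N> \<otimes> B)) (FA ?L (z, x)) = FO ?L (Dom (Val D ?K) z, Cod (Val D (\<N> \<otimes> A)) x)"
    "Cod (Val D (\<N> \<otimes> B)) (FA ?L (z, x)) = FO ?L (Cod (Val D ?K) z, Dom (Val D (\<N> \<otimes> A)) x)"
    if "x \<in> Ar (Val D (\<N> \<otimes> A))" "z \<in> Ar (Val D ?K)" for x z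
    using cfunctor_arr[OF L(1), of "(z, x)"] that by (simp_all add: L)
  have RC: "FA ?R (y \<cdot>\<^bsub>Val D (\<N> \<otimes> B)\<^esub> y', z' \<cdot>\<^bsub>Val D ?K\<^esub> z) = FA ?R (y', z') \<cdot>\<^bsub>Val D (\<N> \<otimes> A)\<^esub> FA ?R (y, z)"
    if "y \<in> Ar (Val D (\<N> \<otimes> B))" "z \<in> Ar (Val D ?K)" "y' \<in> Ar (Val D (\<N> \<otimes> B))" "z' \<in> Ar (Val D ?K)"
      "Dom (Val D (\<N> \<otimes> B)) y = Cod (Val D (\<N> \<otimes> B)) y'" "Dom (Val D ?K) z' = Cod (Val D ?K) z" for y z y' z'
    using cfunctor_comp[OF R(1) refl, of "(y, z)" "(y', z')"] that by (simp add: R)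
  have LC: "FA ?L (z' \<cdot>\<^bsub>Val D ?K\<^esub> z, x \<cdot>\<^bsub>Val D (\<N> \<otimes> A)\<^esub> x') = FA ?L (z', x') \<cdot>\<^bsub>Val D (\<N> \<otimes> B)\<^esub> FA ?L (z, x)"
    if "x \<in> Ar (Val D (\<N> \<otimes> A))" "z \<in> Ar (Val D ?K)" "x' \<in> Ar (Val D (\<N> \<otimes> A))" "z' \<in> Ar (Val D ?K)"
      "Dom (Val D (\<N> \<otimes> A)) x = Cod (Val D (\<N> \<otimes> A)) x'" "Dom (Val D ?K) z' = Cod (Val D ?K) z" for x z x' z'
    using cfunctor_comp[OF L(1) refl, of "(z, x)" "(z', x')"] that by (simp add: L)
  show "cfunctor (arhd A B)" unfolding arhd_def
    by (rule cfunctor_mk_fun[OF category_prod_cat[OF category_op_cat]]) (auto simp: RI RA RC)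
  show "cfunctor (alhd A B)" unfolding alhd_def
    by (rule cfunctor_mk_fun[OF category_prod_cat[OF _ category_op_cat]]) (auto simp: LI LA LC)
qed

lemma two_variable_adjunction_affine: "two_variable_adjunction AD AM arhd alhd aphi apsi"
proof (rule two_variable_adjunction.intro, goal_cases)
  case (7 A B X Y Z)
  then show ?case
    using bij_betw_trans[OF tau_bij[of A B X Y Z] phi_bij[of "\<N> \<otimes> A" "\<N> \<otimes> B" X Y "rs D (sigma A B) Z"]]
    by (simp add: arhd_FO aphi_def[abs_def] comp_def)
next
  case (8 A B x X' X y Y' Y z Z Z' h)
  note h = 8[unfolded AD_simps]
  note [simp] = h(1,2)
  have "rsA D (sigma A B) z \<in> hom (Val D ((\<N> \<otimes> A) \<otimes> (\<N> \<otimes> B))) (rs D (sigma A B) Z) (rs D (sigma A B) Z')"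
    using h(5) by (simp add: hom_iff)
  from phi_natural[OF _ _ h(3,4) this tau_natural(2)[OF h]] show ?case
    using h(4,5) by (simp add: aphi_def tau_natural(1)[OF h] arhd_def hom_iff)
next
  case (9 A B X Y Z)
  then show ?case
    using bij_betw_trans[OF tau_bij[of A B X Y Z] psi_bij[of "\<N> \<otimes> A" "\<N> \<otimes> B" X Y "rs D (sigma A B) Z"]]
    by (simp add: alhd_FO apsi_def[abs_def] comp_def)
next
  case (10 A B x X' X y Y' Y z Z Z' h)
  note h = 10[unfolded AD_simps]
  note [simp] = h(1,2)
  have "rsA D (sigma A B) z \<in> hom (Val D ((\<N> \<otimes> A) \<otimes> (\<N> \<otimes> B))) (rs D (sigma A B) Z) (rs D (sigma A B) Z')"
    using h(5) by (simp add: hom_iff)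
  from psi_natural[OF _ _ h(3,4) this tau_natural(2)[OF h]] show ?case
    using h(3,5) by (simp add: apsi_def tau_natural(1)[OF h] alhd_def hom_iff)
qed (simp_all add: cfunctor_arhd, simp_all add: arhd_def alhd_def)

text \<open>Transposition commutes with restriction, because \<open>sigma\<close> is strictly
  natural and \<open>ebil\<close> respects the constraints. The arrow defining an affine mate is
  thus carried to the one defining a mate in \<open>D\<close>.\<close>

lemma tau_Mu:
  assumes u: "u \<in> fn A A'" "v \<in> fn B B'" and XY: "X \<in> Ob (Val D (\<N> \<otimes> A'))" "Y \<in> Ob (Val D (\<N> \<otimes> B'))"
    and e: "e \<in> hom (Val D (\<N> \<otimes> (A' \<otimes> B'))) (ext AD AM A' B' X Y) Z"
  shows "tau A B (rs D (idF \<N> \<otimes>\<^sub>F u) X) (rs D (idF \<N> \<otimes>\<^sub>F v) Y)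
      (rsA D (idF \<N> \<otimes>\<^sub>F (u \<otimes>\<^sub>F v)) e \<cdot>\<^bsub>Val D (\<N> \<otimes> (A \<otimes> B))\<^esub> ext_mu AD AM u v X Y)
    = rsA D ((idF \<N> \<otimes>\<^sub>F u) \<otimes>\<^sub>F (idF \<N> \<otimes>\<^sub>F v)) (tau A' B' X Y e) \<cdot>\<^bsub>Val D ((\<N> \<otimes> A) \<otimes> (\<N> \<otimes> B))\<^esub>
      ext_mu D M (idF \<N> \<otimes>\<^sub>F u) (idF \<N> \<otimes>\<^sub>F v) X Y"
proof -
  note [simp] = u[unfolded fn_iff] XY e[unfolded hom_iff] ext_mu_affine[OF u XY]
  let ?h = "(idF \<N> \<otimes>\<^sub>F u) \<otimes>\<^sub>F (idF \<N> \<otimes>\<^sub>F v)" and ?C = "Val D ((\<N> \<otimes> A) \<otimes> (\<N> \<otimes> B))"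
  have [simp]: "ext_mu D M (idF \<N> \<otimes>\<^sub>F u) (idF \<N> \<otimes>\<^sub>F v) X Y \<in> Ar ?C"
    "Cod ?C (ext_mu D M (idF \<N> \<otimes>\<^sub>F u) (idF \<N> \<otimes>\<^sub>F v) X Y) = rs D ?h (ext D M (\<N> \<otimes> A') (\<N> \<otimes> B') X Y)"
    by (simp_all add: ext_mu_def ext_def)
  show ?thesis by (simp add: tau_def ebil_Mu[OF u XY] sigma_natural[OF u])
qed

lemma closed_two_variable_adjunction_affine: "closed_two_variable_adjunction AD AM arhd alhd aphi apsi"
proof -
  interpret A: two_variable_adjunction AD AM arhd alhd aphi apsi by (rule two_variable_adjunction_affine)
  show ?thesis
  proof (unfold_locales, goal_cases)
    case (1 u B Y Z)
    note [simp] = 1[unfolded AD_simps]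
    let ?u = "idF \<N> \<otimes>\<^sub>F u" and ?S = "sigma (Tgt u) B" and ?A = "\<N> \<otimes> Tgt u" and ?B = "\<N> \<otimes> B"
    let ?h = "?u \<otimes>\<^sub>F idF ?B" and ?w = "idF \<N> \<otimes>\<^sub>F (u \<otimes>\<^sub>F idF B)"
    let ?W = "FO (rhd ?A ?B) (Y, rs D ?S Z)"
    have f: "u \<in> fn (Src u) (Tgt u)" "idF B \<in> fn B B" by (simp_all add: fn_iff)
    have W [simp]: "FO (arhd (Tgt u) B) (Y, Z) = ?W" "?W \<in> Ob (Val D ?A)" by (simp_all add: arhd_FO)
    define e where "e = A.ev_rhd (Tgt u) B Y Z"
    note ab = A.phi_bij[of "Tgt u" B ?W Y Z, simplified]
    have Id: "Id (Val D ?A) ?W \<in> hom (Val D ?A) ?W ?W" by (simp add: hom_iff)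
    have e: "e \<in> hom (Val D (\<N> \<otimes> (Tgt u \<otimes> B))) (ext AD AM (Tgt u) B ?W Y) Z" "aphi (Tgt u) B ?W Y Z e = Id (Val D ?A) ?W"
      using Id bij_betw_imp_surj_on[OF ab]
      by (simp_all add: e_def A.ev_rhd_def Let_def inv_into_into f_inv_into_f)
    have b: "bij_betw (\<phi> ?A ?B ?W Y (rs D ?S Z)) (hom (Val D (?A \<otimes> ?B)) (ext D M ?A ?B ?W Y) (rs D ?S Z)) (hom (Val D ?A) ?W ?W)"
      by (rule phi_bij) simp_all
    have t: "tau (Tgt u) B ?W Y e \<in> hom (Val D (?A \<otimes> ?B)) (ext D M ?A ?B ?W Y) (rs D ?S Z)"
      using bij_betwE[OF tau_bij[of "Tgt u" B ?W Y Z]] e(1) by simp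
    \<comment> \<open>An evaluation is the arrow that the hom bijection sends to an identity; since
      \<open>aphi\<close> is \<open>\<phi>\<close> after \<open>tau\<close>, the evaluation of
      \<open>D\<close> is the transpose of the affine one.\<close>
    have ev: "ev_rhd ?A ?B Y (rs D ?S Z) = tau (Tgt u) B ?W Y e"
      using inv_into_f_f[OF bij_betw_imp_inj_on[OF b] t] e(2) by (simp add: ev_rhd_def Let_def aphi_def)
    have s: "sigma (Tgt u) B \<odot> ?h = ?w \<odot> sigma (Src u) B" using sigma_natural[OF f] by simp
    have "tau (Src u) B (rs D ?u ?W) Y (rsA D ?w e \<cdot>\<^bsub>Val D (\<N> \<otimes> (Src u \<otimes> B))\<^esub> ext_mu AD AM u (idF B) ?W Y)
      = rsA D ?h (tau (Tgt u) B ?W Y e) \<cdot>\<^bsub>Val D ((\<N> \<otimes> Src u) \<otimes> ?B)\<^esub> ext_mu D M ?u (idF ?B) ?W Y"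
      using tau_Mu[OF f, of ?W Y e Z] e(1) by simp
    \<comment> \<open>An equality of arrows, not just an isomorphism between them, so invertibility
      is inherited from \<open>D\<close> directly.\<close>
    then have "A.mate_rhd u B Y Z = mate_rhd ?u ?B Y (rs D ?S Z)"
      by (simp add: A.mate_rhd_def mate_rhd_def Let_def aphi_def e_def[symmetric] ev s)
    then show ?case using mate_rhd_iso[of ?u ?B Y "rs D ?S Z"] by simp
  next
    case (2 B u X Z)
    note [simp] = 2[unfolded AD_simps]
    let ?u = "idF \<N> \<otimes>\<^sub>F u" and ?S = "sigma B (Tgt u)" and ?A = "\<N> \<otimes> Tgt u" and ?B = "\<N> \<otimes> B"
    let ?h = "idF ?B \<otimes>\<^sub>F ?u" and ?w = "idF \<N> \<otimes>\<^sub>F (idF B \<otimes>\<^sub>F u)"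
    let ?W = "FO (lhd ?B ?A) (rs D ?S Z, X)"
    have f: "idF B \<in> fn B B" "u \<in> fn (Src u) (Tgt u)" by (simp_all add: fn_iff)
    have W [simp]: "FO (alhd B (Tgt u)) (Z, X) = ?W" "?W \<in> Ob (Val D ?A)" by (simp_all add: alhd_FO)
    define e where "e = A.ev_lhd B (Tgt u) Z X"
    note ab = A.psi_bij[of B "Tgt u" X ?W Z, simplified]
    have Id: "Id (Val D ?A) ?W \<in> hom (Val D ?A) ?W ?W" by (simp add: hom_iff)
    have e: "e \<in> hom (Val D (\<N> \<otimes> (B \<otimes> Tgt u))) (ext AD AM B (Tgt u) X ?W) Z" "apsi B (Tgt u) X ?W Z e = Id (Val D ?A) ?W"
      using Id bij_betw_imp_surj_on[OF ab]
      by (simp_all add: e_def A.ev_lhd_def Let_def inv_into_into f_inv_into_f)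
    have b: "bij_betw (\<psi> ?B ?A X ?W (rs D ?S Z)) (hom (Val D (?B \<otimes> ?A)) (ext D M ?B ?A X ?W) (rs D ?S Z)) (hom (Val D ?A) ?W ?W)"
      by (rule psi_bij) simp_all
    have t: "tau B (Tgt u) X ?W e \<in> hom (Val D (?B \<otimes> ?A)) (ext D M ?B ?A X ?W) (rs D ?S Z)"
      using bij_betwE[OF tau_bij[of B "Tgt u" X ?W Z]] e(1) by simp
    have ev: "ev_lhd ?B ?A (rs D ?S Z) X = tau B (Tgt u) X ?W e"
      using inv_into_f_f[OF bij_betw_imp_inj_on[OF b] t] e(2) by (simp add: ev_lhd_def Let_def apsi_def)
    have s: "sigma B (Tgt u) \<odot> ?h = ?w \<odot> sigma B (Src u)" using sigma_natural[OF f] by simp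
    have "tau B (Src u) X (rs D ?u ?W) (rsA D ?w e \<cdot>\<^bsub>Val D (\<N> \<otimes> (B \<otimes> Src u))\<^esub> ext_mu AD AM (idF B) u X ?W)
      = rsA D ?h (tau B (Tgt u) X ?W e) \<cdot>\<^bsub>Val D (?B \<otimes> (\<N> \<otimes> Src u))\<^esub> ext_mu D M (idF ?B) ?u X ?W"
      using tau_Mu[OF f, of X ?W e Z] e(1) by simp
    then have "A.mate_lhd B u Z X = mate_lhd ?B ?u (rs D ?S Z) X"
      by (simp add: A.mate_lhd_def mate_lhd_def Let_def apsi_def e_def[symmetric] ev s)
    then show ?case using mate_lhd_iso[of ?B ?u X "rs D ?S Z"] by simp
  qed
qed

end

theorem theorem6p1:
  fixes D :: "('u::universe, 'o, 'a) pder" and M :: "('u, 'o, 'a) mpder"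
  assumes "closed_monoidal_derivator D M"
  shows "closed_monoidal_derivator (affine_line D) (affine_line_monoidal D M)"
proof -
  interpret closed_monoidal_derivator D M by fact
  obtain rhd lhd \<phi> \<psi> where "closed_two_variable_adjunction D M rhd lhd \<phi> \<psi>" using closed by blast
  then interpret closed_pair D M rhd lhd \<phi> \<psi> by (intro closed_pair.intro monoidal_derivator_axioms)
  show ?thesis
    by (intro closed_monoidal_derivator.intro closed_monoidal_derivator_axioms.intro monoidal_derivator_affine exI)
       (rule closed_two_variable_adjunction_affine)
qed

end
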